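(* $(1+\varepsilon)$-Approximate Min-Plus Product can be solved in time $\tilde{\mathcal{O}}(n^{\frac{\omega+3}{2}}\varepsilon^{-1})$.
   Context: $\mathbb{R}_+=\{a\in\mathbb{R}:a\ge1\}\cup\{\infty\}$. Given $A,B\in\mathbb{R}_+^{n\times n}$, the Min-Plus Product is $C[i,j]=\min_{k\in[n]}(A[i,k]+B[k,j])$; a $(1+\varepsilon)$-approximation is a matrix $\tilde C$ with $C[i,j]\le\tilde C[i,j]\le(1+\varepsilon)C[i,j]$ for all $i,j$. Input numbers are in floating-point representation with unit-cost arithmetic; time counts arithmetic operations and is independent of the largest input value $W$. $\tilde{\mathcal{O}}$ hides polylogarithmic factors in $n$ and $1/\varepsilon$, never $\log W$. $\omega$ is the matrix multiplication exponent; $0<\varepsilon<1/10$. *)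

theory Defs
  imports Complex_Main "HOL-Library.Extended_Real"
begin

section \<open>The exponent of matrix multiplication\<close>

text \<open>
  Division-free straight-line programs over the rationals. The value list starts with the inputs;
  every instruction costs one unit and appends one value. A reference to a position that does not
  exist reads \<open>0\<close>.
\<close>

datatype instr = Scalar rat | Add nat nat | Sub nat nat | Mul nat nat

definition fetch :: "rat list \<Rightarrow> nat \<Rightarrow> rat" where
  "fetch vs i = (if i < length vs then vs ! i else 0)"

fun step :: "instr \<Rightarrow> rat list \<Rightarrow> rat list" where
  "step (Scalar q) vs = vs @ [q]"
| "step (Add i j) vs = vs @ [fetch vs i + fetch vs j]"
| "step (Sub i j) vs = vs @ [fetch vs i - fetch vs j]"
| "step (Mul i j) vs = vs @ [fetch vs i * fetch vs j]"

definition row_major :: "nat \<Rightarrow> (nat \<Rightarrow> nat \<Rightarrow> 'a) \<Rightarrow> 'a list" where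
  "row_major n A = map (\<lambda>l. A (l div n) (l mod n)) [0..<n * n]"

definition mat_prod :: "nat \<Rightarrow> (nat \<Rightarrow> nat \<Rightarrow> 'a::comm_ring_1) \<Rightarrow> (nat \<Rightarrow> nat \<Rightarrow> 'a) \<Rightarrow> nat \<Rightarrow> nat \<Rightarrow> 'a" where
  "mat_prod n A B i j = (\<Sum>k<n. A i k * B k j)"

definition slp_multiplies :: "nat \<Rightarrow> instr list \<Rightarrow> (nat \<Rightarrow> nat \<Rightarrow> nat) \<Rightarrow> bool" where
  "slp_multiplies n prog out \<longleftrightarrow>
     (\<forall>A B. \<forall>i<n. \<forall>j<n.
        fetch (fold step prog (row_major n A @ row_major n B)) (out i j) = mat_prod n A B i j)"

definition matmul_exponent :: real ("\<omega>") where
  "\<omega> = Inf {\<tau>. \<exists>K. \<forall>n\<ge>1. \<exists>prog out.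
              slp_multiplies n prog out \<and> real (length prog) \<le> K * real n powr \<tau>}"

section \<open>A random access machine with words and floating-point numbers\<close>

text \<open>
  The memory consists of arrays, named by natural numbers, of integer words and of numbers.
  Words have bounded magnitude. The result of an arithmetic operation on numbers is rounded by an
  arbitrary function of bounded relative error and has to stay in a bounded range of magnitudes.
  Unbounded words, exact real arithmetic or an unbounded exponent range would allow a whole matrix
  row to be packed into a single cell. Comparisons, loads and stores are exact. Numbers cannot be
  converted to words. There is no initialisation of memory.
\<close>

record machine =
  wmax :: real
  rnd :: "real \<Rightarrow> real"
  nmin :: real
  nmax :: real

record state =
  wmem :: "nat \<Rightarrow> int \<Rightarrow> int"
  nmem :: "nat \<Rightarrow> int \<Rightarrow> ereal"

datatype arith = Plus | Minus | Times | Divide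

datatype wexp = WConst int | WLoad nat wexp | WArith arith wexp wexp | WMod wexp wexp

datatype nexp = NWord wexp | NInfinity | NLoad nat wexp | NArith arith nexp nexp

datatype bexp = WLess wexp wexp | NLess nexp nexp | Neg bexp | Conj bexp bexp

datatype com =
    Skip
  | WStore nat wexp wexp
  | NStore nat wexp nexp
  | Seq com com
  | Cond bexp com com
  | While bexp com

definition word :: "machine \<Rightarrow> int \<Rightarrow> int option" where
  "word m v = (if real_of_int \<bar>v\<bar> \<le> wmax m then Some v else None)"

definition number :: "machine \<Rightarrow> ereal \<Rightarrow> ereal option" where
  "number m x =
     (if \<bar>x\<bar> = \<infinity> then Some x
      else let r = rnd m (real_of_ereal x) in
        if r = 0 \<or> nmin m \<le> \<bar>r\<bar> \<and> \<bar>r\<bar> \<le> nmax m then Some (ereal r) else None)"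

definition lift2 :: "('a \<Rightarrow> 'b \<Rightarrow> 'c) \<Rightarrow> 'a option \<Rightarrow> 'b option \<Rightarrow> 'c option" where
  "lift2 f x y = Option.bind x (\<lambda>a. Option.bind y (\<lambda>b. Some (f a b)))"

fun word_op :: "arith \<Rightarrow> int \<Rightarrow> int \<Rightarrow> int" where
  "word_op Plus x y = x + y"
| "word_op Minus x y = x - y"
| "word_op Times x y = x * y"
| "word_op Divide x y = x div y"

fun number_op :: "arith \<Rightarrow> ereal \<Rightarrow> ereal \<Rightarrow> ereal" where
  "number_op Plus x y = x + y"
| "number_op Minus x y = x - y"
| "number_op Times x y = x * y"
| "number_op Divide x y = x / y"

fun weval :: "machine \<Rightarrow> state \<Rightarrow> wexp \<Rightarrow> int option" where
  "weval m s (WConst v) = word m v"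
| "weval m s (WLoad a e) = map_option (wmem s a) (weval m s e)"
| "weval m s (WArith f d e) = Option.bind (lift2 (word_op f) (weval m s d) (weval m s e)) (word m)"
| "weval m s (WMod d e) = Option.bind (lift2 (mod) (weval m s d) (weval m s e)) (word m)"

fun neval :: "machine \<Rightarrow> state \<Rightarrow> nexp \<Rightarrow> ereal option" where
  "neval m s (NWord e) = Option.bind (weval m s e) (\<lambda>v. number m (ereal (real_of_int v)))"
| "neval m s NInfinity = Some \<infinity>"
| "neval m s (NLoad a e) = map_option (nmem s a) (weval m s e)"
| "neval m s (NArith f d e) =
     Option.bind (lift2 (number_op f) (neval m s d) (neval m s e)) (number m)"

fun beval :: "machine \<Rightarrow> state \<Rightarrow> bexp \<Rightarrow> bool option" where
  "beval m s (WLess d e) = lift2 (<) (weval m s d) (weval m s e)"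
| "beval m s (NLess d e) = lift2 (<) (neval m s d) (neval m s e)"
| "beval m s (Neg b) = map_option Not (beval m s b)"
| "beval m s (Conj b c) = lift2 (\<and>) (beval m s b) (beval m s c)"

fun wcost :: "wexp \<Rightarrow> nat" where
  "wcost (WConst v) = 1"
| "wcost (WLoad a e) = 1 + wcost e"
| "wcost (WArith f d e) = 1 + wcost d + wcost e"
| "wcost (WMod d e) = 1 + wcost d + wcost e"

fun ncost :: "nexp \<Rightarrow> nat" where
  "ncost (NWord e) = 1 + wcost e"
| "ncost NInfinity = 1"
| "ncost (NLoad a e) = 1 + wcost e"
| "ncost (NArith f d e) = 1 + ncost d + ncost e"

fun bcost :: "bexp \<Rightarrow> nat" where
  "bcost (WLess d e) = 1 + wcost d + wcost e"
| "bcost (NLess d e) = 1 + ncost d + ncost e"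
| "bcost (Neg b) = 1 + bcost b"
| "bcost (Conj b c) = 1 + bcost b + bcost c"

text \<open>
  \<open>exec m p s t s'\<close>: on machine \<open>m\<close>, program \<open>p\<close> leads from state \<open>s\<close> to state \<open>s'\<close> at cost \<open>t\<close>.
  A program that leaves the word or number range of the machine has no execution.
\<close>

inductive exec :: "machine \<Rightarrow> com \<Rightarrow> state \<Rightarrow> nat \<Rightarrow> state \<Rightarrow> bool" for m where
  Skip: "exec m Skip s 1 s"
| WStore: "weval m s i = Some x \<Longrightarrow> weval m s e = Some v \<Longrightarrow>
    exec m (WStore a i e) s (1 + wcost i + wcost e)
      (s\<lparr>wmem := (wmem s)(a := (wmem s a)(x := v))\<rparr>)"
| NStore: "weval m s i = Some x \<Longrightarrow> neval m s e = Some v \<Longrightarrow>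
    exec m (NStore a i e) s (1 + wcost i + ncost e)
      (s\<lparr>nmem := (nmem s)(a := (nmem s a)(x := v))\<rparr>)"
| Seq: "exec m p s t s' \<Longrightarrow> exec m q s' t' s'' \<Longrightarrow> exec m (Seq p q) s (t + t') s''"
| CondTrue: "beval m s b = Some True \<Longrightarrow> exec m p s t s' \<Longrightarrow>
    exec m (Cond b p q) s (1 + bcost b + t) s'"
| CondFalse: "beval m s b = Some False \<Longrightarrow> exec m q s t s' \<Longrightarrow>
    exec m (Cond b p q) s (1 + bcost b + t) s'"
| WhileTrue: "beval m s b = Some True \<Longrightarrow> exec m p s t s' \<Longrightarrow> exec m (While b p) s' t' s'' \<Longrightarrow>
    exec m (While b p) s (1 + bcost b + t + t') s''"
| WhileFalse: "beval m s b = Some False \<Longrightarrow> exec m (While b p) s (1 + bcost b) s"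

text \<open>
  \<open>supports m X W\<close>: words hold integers up to \<open>X\<close> in magnitude, the unit roundoff is at most
  \<open>1 / X\<close>, and magnitudes from \<open>1 / X\<close> to \<open>X * W\<close> are representable. With \<open>X\<close> a fixed power
  of \<open>n / \<epsilon>\<close> this amounts to words and mantissas of \<open>O(log n + log (1 / \<epsilon>))\<close> bits.
\<close>

definition supports :: "machine \<Rightarrow> real \<Rightarrow> real \<Rightarrow> bool" where
  "supports m X W \<longleftrightarrow>
     X \<le> wmax m \<and> (\<forall>r. \<bar>rnd m r - r\<bar> \<le> \<bar>r\<bar> / X) \<and> nmin m \<le> 1 / X \<and> X * W \<le> nmax m"

definition holds_matrix :: "nat \<Rightarrow> (int \<Rightarrow> 'a) \<Rightarrow> (nat \<Rightarrow> nat \<Rightarrow> 'a) \<Rightarrow> bool" where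
  "holds_matrix n a A \<longleftrightarrow> (\<forall>i<n. \<forall>j<n. a (int (i * n + j)) = A i j)"

section \<open>Approximate Min-Plus Product\<close>

definition R_plus :: "ereal set" where
  "R_plus = {ereal a | a. a \<ge> 1} \<union> {\<infinity>}"

definition min_plus :: "nat \<Rightarrow> (nat \<Rightarrow> nat \<Rightarrow> ereal) \<Rightarrow> (nat \<Rightarrow> nat \<Rightarrow> ereal) \<Rightarrow> nat \<Rightarrow> nat \<Rightarrow> ereal" where
  "min_plus n A B i j = (MIN k\<in>{..<n}. A i k + B k j)"

definition approximates :: "nat \<Rightarrow> real \<Rightarrow> (nat \<Rightarrow> nat \<Rightarrow> ereal) \<Rightarrow> (nat \<Rightarrow> nat \<Rightarrow> ereal) \<Rightarrow> bool" where
  "approximates n \<epsilon> C C' \<longleftrightarrow> (\<forall>i<n. \<forall>j<n. C i j \<le> C' i j \<and> C' i j \<le> ereal (1 + \<epsilon>) * C i j)"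

definition max_finite_entry :: "nat \<Rightarrow> (nat \<Rightarrow> nat \<Rightarrow> ereal) \<Rightarrow> (nat \<Rightarrow> nat \<Rightarrow> ereal) \<Rightarrow> real" where
  "max_finite_entry n A B =
     Max (insert 1 {r. \<exists>i<n. \<exists>j<n. A i j = ereal r \<or> B i j = ereal r})"

text \<open>
  Input: \<open>n\<close> in word array 0, \<open>\<epsilon>\<close> in number array 0, the matrices row by row in number arrays 1
  and 2. Output: number array 3.
\<close>

definition solves_approx_min_plus :: "com \<Rightarrow> (nat \<Rightarrow> real \<Rightarrow> real) \<Rightarrow> bool" where
  "solves_approx_min_plus p T \<longleftrightarrow>
     (\<exists>c::nat. \<forall>n \<epsilon> A B m s.
        n \<ge> 1 \<longrightarrow> 0 < \<epsilon> \<longrightarrow> \<epsilon> < 1 / 10 \<longrightarrow>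
        (\<forall>i<n. \<forall>j<n. A i j \<in> R_plus \<and> B i j \<in> R_plus) \<longrightarrow>
        supports m ((real n / \<epsilon>) ^ c) (max_finite_entry n A B) \<longrightarrow>
        wmem s 0 0 = int n \<longrightarrow> nmem s 0 0 = ereal \<epsilon> \<longrightarrow>
        holds_matrix n (nmem s 1) A \<longrightarrow> holds_matrix n (nmem s 2) B \<longrightarrow>
        (\<exists>t s' C. exec m p s t s' \<and> real t \<le> T n \<epsilon> \<and>
           holds_matrix n (nmem s' 3) C \<and> approximates n \<epsilon> (min_plus n A B) C))"

definition soft_O :: "(nat \<Rightarrow> real \<Rightarrow> real) \<Rightarrow> (nat \<Rightarrow> real \<Rightarrow> real) set" where
  "soft_O f = {T. \<exists>K. \<exists>k::nat. \<forall>n \<epsilon>. n \<ge> 1 \<longrightarrow> 0 < \<epsilon> \<longrightarrow> \<epsilon> < 1 / 10 \<longrightarrow>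
                 T n \<epsilon> \<le> K * f n \<epsilon> * ln (real n / \<epsilon>) ^ k}"

definition approx_min_plus_in_soft_O :: "(nat \<Rightarrow> real \<Rightarrow> real) \<Rightarrow> bool" where
  "approx_min_plus_in_soft_O f \<longleftrightarrow> (\<exists>p. \<exists>T\<in>soft_O f. solves_approx_min_plus p T)"

section \<open>Matrix multiplication on the machine\<close>

text \<open>
  Product of integer matrices with entries of \<open>O(log n)\<close> bits on machines with words of
  \<open>O(log n)\<close> bits, in time \<open>n powr \<tau>\<close> up to polylogarithmic factors. Input: \<open>n\<close> in word array 0,
  the matrices in word arrays 1 and 2. Output: word array 3.
\<close>

definition matmul_in_soft_O :: "real \<Rightarrow> bool" where
  "matmul_in_soft_O \<tau> \<longleftrightarrow>
     (\<forall>d::nat. \<exists>p. \<exists>c::nat. \<exists>K. \<exists>k::nat. \<forall>n A B m s.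
        n \<ge> 1 \<longrightarrow>
        (\<forall>i<n. \<forall>j<n. \<bar>A i j\<bar> \<le> int n ^ d \<and> \<bar>B i j\<bar> \<le> int n ^ d) \<longrightarrow>
        supports m (real (n + 1) ^ c) 1 \<longrightarrow>
        wmem s 0 0 = int n \<longrightarrow>
        holds_matrix n (wmem s 1) A \<longrightarrow> holds_matrix n (wmem s 2) B \<longrightarrow>
        (\<exists>t s'. exec m p s t s' \<and> real t \<le> K * real n powr \<tau> * (1 + ln (real n)) ^ k \<and>
           holds_matrix n (wmem s' 3) (mat_prod n A B)))"

end

theory Submission imports Defs "HOL-Computational_Algebra.Polynomial" begin

text \<open>
  For \<open>x + y = N\<close> one has \<open>a + b \<le> N max (a / x) (b / y)\<close>, with near equality for a suitable \<open>x\<close>. Hence with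
  \<open>N\<close> of order \<open>1 / \<epsilon>\<close> the minimum of the \<open>N - 1\<close> min-max products of \<open>A / x\<close> and \<open>B / (N - x)\<close>, multiplied
  by \<open>N\<close>, approximates the min-plus product, and rounding is harmless because min-max products only compare.

  A min-max product depends on the ranks of the \<open>2 n\<^sup>2\<close> entries only. The ranks are cut into groups of \<open>n \<sigma>\<close>
  consecutive ones; inside a group, the entries of a row are cut into pieces of at most \<open>\<sigma>\<close> entries and those of a
  column into chunks of at most \<open>\<sigma>\<close> entries. One Boolean product per group finds, for every pair of rows, the first
  piece containing a candidate; this piece is scanned, and the candidates inside the chunk of an entry are compared
  directly. With a Boolean product in time \<open>T\<close> the total is \<open>n\<^sup>2 \<sigma> + (n / \<sigma>) T\<close>, so the best \<open>\<sigma>\<close> gives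
  \<open>sqrt (n\<^sup>3 T)\<close>. As \<open>T\<close> is unknown to the program, \<open>\<sigma>\<close> is doubled until the products fit into the budget
  \<open>n\<^sup>2 \<sigma>\<close>, which is enforced by counting their cost.

  For exponents above \<open>\<omega>\<close> the Boolean product is obtained from a straight-line program for a constant size \<open>d\<close>:
  its part that is linear in each of the two inputs is a bilinear algorithm, whose tensor powers are evaluated with
  Yates' algorithm on integers.
\<close>

section \<open>Straight-line programs as bilinear algorithms\<close>

text \<open>The two factors are treated as one table of 2 n rows of length n: the rows of A, then
  the columns of B. A candidate for an ordered pair (u, v) of rows is an entry of u whose neighbour
  in the same column of v has smaller rank. Every inner index is a candidate for exactly one of (u,
  v) and (v, u), so two accumulators per unordered pair, each a minimum of entries of its first row,
  give the min-max product as their minimum. A group of n \<sigma> ranks falls into at most 3 n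
  pieces and 2 n chunks, so square matrices of size 4 n suffice for its Boolean product.

  The machine shapes the rest. Rounding is an arbitrary function of small relative error, so the
  result is multiplied by N + 1 instead of N to stay above the exact value. Numbers cannot be turned
  into words, so N is found by counting. Words are bounded integers, so the bilinear algorithm is
  made integral by a common denominator D, and D^h is divided out at the end. The exponent \<omega>
  is an infimum and constants grow to their h-th power under tensor powers; d is therefore chosen so
  large that the constant disappears in the slack \<delta>.\<close>

abbreviation slp_run :: "nat \<Rightarrow> instr list \<Rightarrow> (nat \<Rightarrow> nat \<Rightarrow> rat) \<Rightarrow> (nat \<Rightarrow> nat \<Rightarrow> rat) \<Rightarrow> rat list" where
  "slp_run n p A B \<equiv> fold step p (row_major n A @ row_major n B)"

lemma length_row_major [simp]: "length (row_major n A) = n * n"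
  by (simp add: row_major_def)

lemma length_step [simp]: "length (step i vs) = Suc (length vs)"
  by (cases i) auto

lemma length_slp: "length (fold step p vs) = length vs + length p"
  by (induction p arbitrary: vs) auto

lemma fetch_append: "fetch (vs @ [x]) i = (if i = length vs then x else fetch vs i)"
  by (auto simp: fetch_def nth_append)

lemma fetch_append2: "fetch (vs @ [x, y]) i = (if i = Suc (length vs) then y else if i = length vs then x else fetch vs i)"
  using fetch_append[of "vs @ [x]" y i] by (simp add: fetch_append)

lemma fetch_prefix: "i < length vs \<Longrightarrow> fetch (fold step p vs) i = fetch vs i"
proof (induction p arbitrary: vs)
  case (Cons a p)
  have "fetch (step a vs) i = fetch vs i" using Cons.prems by (cases a) (auto simp: fetch_append)
  then show ?case using Cons by simp
qed simp

lemma fetch_input: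
  "z < n * n \<Longrightarrow> fetch (row_major n A @ row_major n B) z = A (z div n) (z mod n)"
  "z < n * n \<Longrightarrow> fetch (row_major n A @ row_major n B) (n * n + z) = B (z div n) (z mod n)"
  by (auto simp: fetch_def nth_append row_major_def)

text \<open>Each of the n^2 outputs needs an instruction of its own: an output can be neither a
  missing position nor an input nor shared with another output, and three kinds of test inputs
  exclude these cases. This is the source of the lower bound 2 for \<omega>.\<close>

lemma slp_length_ge:
  assumes n: "1 \<le> n" and slp: "slp_multiplies n p out"
  shows "n * n \<le> length p"
proof -
  have val: "fetch (slp_run n p A B) (out i j) = mat_prod n A B i j" if "i < n" "j < n" for A B i j
    using slp that unfolding slp_multiplies_def by blast
  have rng: "out i j < 2 * (n * n) + length p" if ij: "i < n" "j < n" for i j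
  proof (rule ccontr)
    assume "\<not> ?thesis"
    then have "fetch (slp_run n p (\<lambda>_ _. 1) (\<lambda>_ _. 1)) (out i j) = 0" by (simp add: fetch_def length_slp)
    then show False using val[OF ij, of "\<lambda>_ _. 1" "\<lambda>_ _. 1"] n by (simp add: mat_prod_def)
  qed
  have inp: "\<not> out i j < 2 * (n * n)" if ij: "i < n" "j < n" for i j
  proof
    assume o: "out i j < 2 * (n * n)"
    \<comment> \<open>With all entries 2 every input position reads 2, while every entry of the
      product is 4 n.\<close>
    let ?A = "\<lambda>_ _. 2 :: rat"
    have "fetch (row_major n ?A @ row_major n ?A) (out i j) = 2"
    proof (cases "out i j < n * n")
      case True then show ?thesis by (simp add: fetch_input)
    next
      case False
      then have "out i j = n * n + (out i j - n * n)" "out i j - n * n < n * n" using o by auto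
      then show ?thesis using fetch_input(2)[of "out i j - n * n" n ?A ?A] by simp
    qed
    then have "mat_prod n ?A ?A i j = 2" using val[OF ij, of ?A ?A] fetch_prefix[of "out i j" "row_major n ?A @ row_major n ?A" p] o by simp
    then have "rat_of_nat n * 4 = 2" by (simp add: mat_prod_def)
    moreover have "1 \<le> rat_of_nat n" using n by simp
    ultimately show False by linarith
  qed
  have "inj_on (\<lambda>(i, j). out i j - 2 * (n * n)) ({..<n} \<times> {..<n})"
  proof (rule inj_onI, clarify)
    fix i j i' j' assume a: "i < n" "j < n" "i' < n" "j' < n" "out i j - 2 * (n * n) = out i' j' - 2 * (n * n)"
    then have o: "out i j = out i' j'" using inp[of i j] inp[of i' j'] by auto
    \<comment> \<open>Row i of ones times column j of ones: only the entry (i, j) of the product is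
      nonzero.\<close>
    let ?A = "\<lambda>x k. if x = i then 1 else 0 :: rat" and ?B = "\<lambda>k y. if y = j then 1 else 0 :: rat"
    have "mat_prod n ?A ?B i j = mat_prod n ?A ?B i' j'" using val[of i j ?A ?B] val[of i' j' ?A ?B] a o by simp
    then show "i = i' \<and> j = j'" using n by (auto simp: mat_prod_def split: if_splits)
  qed
  moreover have "out i j - 2 * (n * n) < length p" if "i < n" "j < n" for i j
    using rng[OF that] inp[OF that] by linarith
  then have "(\<lambda>(i, j). out i j - 2 * (n * n)) ` ({..<n} \<times> {..<n}) \<subseteq> {..<length p}" by auto
  ultimately have "card ({..<n} \<times> {..<n}) \<le> card {..<length p}" by (intro card_inj_on_le) auto
  then show ?thesis by (simp add: card_cartesian_product)
qed

section \<open>The naive program\<close>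

definition slp_val :: "nat \<Rightarrow> instr list \<Rightarrow> nat \<Rightarrow> ((nat \<Rightarrow> nat \<Rightarrow> rat) \<Rightarrow> (nat \<Rightarrow> nat \<Rightarrow> rat) \<Rightarrow> rat) \<Rightarrow> bool" where
  "slp_val n p x f \<longleftrightarrow> x < 2 * (n * n) + length p \<and> (\<forall>A B. fetch (slp_run n p A B) x = f A B)"

text \<open>The range condition in \<open>slp_val\<close> makes this true: an existing position
  keeps its value when instructions are appended.\<close>

lemma slp_val_append: "slp_val n p x f \<Longrightarrow> slp_val n (p @ e) x f"
  unfolding slp_val_def by (auto simp: fetch_prefix length_slp)

lemma slp_dot:
  assumes ij: "i < n" "j < n" and m: "m \<le> n"
  shows "\<exists>e x. length e = 2 * m + 1 \<and> slp_val n (p @ e) x (\<lambda>A B. \<Sum>k<m. A i k * B k j)"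
  using m
proof (induction m)
  case 0
  have "slp_val n (p @ [Scalar 0]) (2 * (n * n) + length p) (\<lambda>A B. 0)"
    by (simp add: slp_val_def fetch_append length_slp)
  then show ?case by (intro exI[of _ "[Scalar 0]"]) auto
next
  case (Suc m)
  then obtain e x where e: "length e = 2 * m + 1" "slp_val n (p @ e) x (\<lambda>A B. \<Sum>k<m. A i k * B k j)" by auto
  let ?N = "2 * (n * n) + length (p @ e)"
  let ?a = "i * n + m" and ?b = "n * n + (m * n + j)"
  \<comment> \<open>\<open>?N\<close> is the position that the new product gets; the addition reads
    it together with the previous partial sum at \<open>x\<close>.\<close>
  let ?e = "e @ [Mul ?a ?b, Add x ?N]"
  have mn: "m < n" using Suc by simp
  have lt: "i * n + m < n * n" "m * n + j < n * n"
  proof -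
    have "Suc i * n \<le> n * n" "Suc m * n \<le> n * n" using ij mn by (intro mult_right_mono; simp)+
    then show "i * n + m < n * n" "m * n + j < n * n" using ij mn by auto
  qed
  have fa: "fetch (slp_run n (p @ e) A B) ?a = A i m" "fetch (slp_run n (p @ e) A B) ?b = B m j" for A B
    using lt fetch_prefix[of ?a "row_major n A @ row_major n B" "p @ e"] fetch_prefix[of ?b "row_major n A @ row_major n B" "p @ e"]
      fetch_input(1)[OF lt(1), of A B] fetch_input(2)[OF lt(2), of A B] ij mn by auto
  have "slp_val n (p @ ?e) (Suc ?N) (\<lambda>A B. \<Sum>k<Suc m. A i k * B k j)"
    using e(2) fa unfolding slp_val_def by (auto simp: fetch_append fetch_append2 length_slp)
  then show ?case using e(1) by (intro exI[of _ ?e] exI[of _ "Suc ?N"]) auto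
qed

lemma slp_dots:
  "\<forall>(i, j)\<in>set ps. i < n \<and> j < n \<Longrightarrow>
   \<exists>e out. length e = length ps * (2 * n + 1) \<and> (\<forall>(i, j)\<in>set ps. slp_val n (p @ e) (out i j) (\<lambda>A B. \<Sum>k<n. A i k * B k j))"
proof (induction ps arbitrary: p)
  case (Cons ij ps)
  obtain i j where ij: "ij = (i, j)" by (cases ij)
  obtain e x where e: "length e = 2 * n + 1" "slp_val n (p @ e) x (\<lambda>A B. \<Sum>k<n. A i k * B k j)"
    using slp_dot[of i n j n p] Cons.prems ij by auto
  obtain e' out where e': "length e' = length ps * (2 * n + 1)" "\<forall>(i, j)\<in>set ps. slp_val n ((p @ e) @ e') (out i j) (\<lambda>A B. \<Sum>k<n. A i k * B k j)"
    using Cons.IH[of "p @ e"] Cons.prems by auto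
  let ?out = "\<lambda>i' j'. if (i', j') = (i, j) then x else out i' j'"
  have "\<forall>(i', j')\<in>set (ij # ps). slp_val n (p @ e @ e') (?out i' j') (\<lambda>A B. \<Sum>k<n. A i' k * B k j')"
    using e'(2) slp_val_append[OF e(2), of e'] ij by auto
  then show ?case using e(1) e'(1) by (intro exI[of _ "e @ e'"] exI[of _ ?out]) auto
qed simp

text \<open>Makes the set under the infimum nonempty, without which \<open>Inf\<close> would carry
  no information, and leads to \<omega> \<le> 3.\<close>

lemma slp_naive: "\<exists>p out. slp_multiplies n p out \<and> length p = n * n * (2 * n + 1)"
proof -
  let ?ps = "List.product [0..<n] [0..<n]"
  obtain e out where e: "length e = length ?ps * (2 * n + 1)" "\<forall>(i, j)\<in>set ?ps. slp_val n ([] @ e) (out i j) (\<lambda>A B. \<Sum>k<n. A i k * B k j)"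
    using slp_dots[of ?ps n "[]"] by auto
  then have "slp_multiplies n e out" unfolding slp_multiplies_def slp_val_def mat_prod_def by auto
  then show ?thesis using e(1) by auto
qed

section \<open>Bounds for the exponent\<close>

definition exponents :: "real set" where
  "exponents = {\<tau>. \<exists>K. \<forall>n\<ge>1. \<exists>prog out. slp_multiplies n prog out \<and> real (length prog) \<le> K * real n powr \<tau>}"

lemma omega_exponents: "\<omega> = Inf exponents"
  unfolding matmul_exponent_def exponents_def ..

lemma three_exponent: "3 \<in> exponents"
proof -
  have "\<exists>prog out. slp_multiplies n prog out \<and> real (length prog) \<le> 3 * real n powr 3" if "1 \<le> n" for n
  proof -
    obtain p out where p: "slp_multiplies n p out" "length p = n * n * (2 * n + 1)" using slp_naive by blast
    have "n * n * (2 * n + 1) \<le> n * n * (3 * n)" using that by (intro mult_left_mono) auto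
    also have "\<dots> = 3 * n ^ 3" by (simp add: power3_eq_cube)
    finally have "real (length p) \<le> real (3 * n ^ 3)" using p(2) by (simp only: of_nat_le_iff)
    also have "\<dots> = 3 * real n powr 3" using that by (simp add: powr_numeral)
    finally show ?thesis using p(1) by blast
  qed
  then show ?thesis unfolding exponents_def by blast
qed

text \<open>The n^2 instructions forced by \<open>slp_length_ge\<close> contradict a bound K
  n^\<tau> with \<tau> < 2 as soon as n^(2 - \<tau>) exceeds K.\<close>

lemma exponents_ge_2: "\<tau> \<in> exponents \<Longrightarrow> 2 \<le> \<tau>"
proof (rule ccontr)
  assume "\<tau> \<in> exponents" and lt: "\<not> 2 \<le> \<tau>"
  then obtain K where K: "\<And>n. 1 \<le> n \<Longrightarrow> \<exists>prog out. slp_multiplies n prog out \<and> real (length prog) \<le> K * real n powr \<tau>"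
    unfolding exponents_def by blast
  define a where "a = 2 - \<tau>"
  have a: "0 < a" using lt unfolding a_def by simp
  \<comment> \<open>Larger than K and positive, so that its root makes sense and n can be taken past
    it.\<close>
  define M where "M = max K 1 + 1"
  define n where "n = nat \<lceil>M powr (1 / a)\<rceil> + 1"
  have n: "1 \<le> n" "M powr (1 / a) \<le> real n" unfolding n_def by linarith+
  obtain p out where p: "slp_multiplies n p out" "real (length p) \<le> K * real n powr \<tau>" using K[OF n(1)] by blast
  have "real n powr 2 = real (n * n)" using n by (simp add: powr_numeral power2_eq_square)
  also have "\<dots> \<le> real (length p)" using slp_length_ge[OF n(1) p(1)] by (simp only: of_nat_le_iff)
  also have "\<dots> \<le> K * real n powr \<tau>" by (rule p(2))
  finally have "real n powr (a + \<tau>) \<le> K * real n powr \<tau>" unfolding a_def by simp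
  then have "real n powr a \<le> K" using n(1) by (simp add: powr_add)
  moreover have "M = (M powr (1 / a)) powr a" using a unfolding M_def by (simp add: powr_powr)
  moreover have "(M powr (1 / a)) powr a \<le> real n powr a" using n(2) a by (intro powr_mono2) auto
  ultimately have "M \<le> K" by linarith
  then show False unfolding M_def by (simp add: max_def split: if_splits)
qed

text \<open>The lower bound makes d^2 at most d^(\<omega> + \<delta>), so the number of products can
  be raised to d^2; the upper bound gives \<omega> \<le> (\<omega> + 3) / 2, so that a single matrix
  product is within the target time.\<close>

lemma omega_bounds: "2 \<le> \<omega>" "\<omega> \<le> 3"
proof -
  show "2 \<le> \<omega>" unfolding omega_exponents using three_exponent exponents_ge_2 by (intro cInf_greatest) auto
  show "\<omega> \<le> 3" unfolding omega_exponents using three_exponent exponents_ge_2 by (intro cInf_lower bdd_belowI) auto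
qed

lemma exponent_near_omega: "0 < \<delta> \<Longrightarrow> \<exists>\<tau>\<in>exponents. \<tau> < \<omega> + \<delta>"
  unfolding omega_exponents using three_exponent by (intro cInf_lessD) auto

section \<open>The bilinear part of a straight-line program\<close>

lemma coeff_mult_1: "coeff (p * q) 1 = coeff p 0 * coeff q 1 + coeff p 1 * coeff q (0::nat)"
  by (simp add: coeff_mult)

text \<open>The outer variable of P is t and the inner one is s, so
  \<open>coeff (coeff P i) j\<close> belongs to t^i s^j.\<close>

abbreviation eval2 :: "rat \<Rightarrow> rat \<Rightarrow> rat poly poly \<Rightarrow> rat" where
  "eval2 s t P \<equiv> poly (poly P [:t:]) s"

text \<open>A nonzero polynomial has finitely many roots. This is used twice: over the rationals for
  the inner variable, then over the rational polynomials, where the constants already form an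
  infinite set.\<close>

lemma eval2_eq:
  assumes "\<And>s t. eval2 s t P = eval2 s t Q"
  shows "P = Q"
proof (rule ccontr)
  assume "P \<noteq> Q"
  have "poly (P - Q) [:t:] = 0" for t
  proof -
    have "poly (poly P [:t:]) = poly (poly Q [:t:])" using assms by auto
    then show ?thesis by (simp add: poly_eq_poly_eq_iff)
  qed
  then have "range (\<lambda>t. [:t:]) \<subseteq> {x. poly (P - Q) x = 0}" by auto
  moreover have "finite {x. poly (P - Q) x = 0}" using \<open>P \<noteq> Q\<close> by (intro poly_roots_finite) simp
  moreover have "infinite (range (\<lambda>t::rat. [:t:]))"
    using finite_imageD[of "\<lambda>t::rat. [:t:]" UNIV] infinite_UNIV_char_0[where 'a = rat] by (auto simp: inj_on_def)
  ultimately show False using finite_subset by blast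
qed

abbreviation lin :: "nat \<Rightarrow> (nat \<Rightarrow> rat) \<Rightarrow> (nat \<Rightarrow> nat \<Rightarrow> rat) \<Rightarrow> rat" where
  "lin n u A \<equiv> \<Sum>z<n * n. u z * A (z div n) (z mod n)"

text \<open>Scaling the inputs to \<open>s A\<close> and \<open>t B\<close>, every value of the program is a polynomial in \<open>s\<close> and \<open>t\<close>; its
  coefficients of \<open>1\<close>, \<open>s\<close>, \<open>t\<close> and \<open>s t\<close> are a constant, a linear form in \<open>A\<close>, a linear form in
  \<open>B\<close> and a combination of two products of linear forms per instruction.\<close>

lemma slp_coefficients:
  "\<exists>u v c a b w. \<forall>A B. \<exists>P. \<forall>x.
     (\<forall>s t. fetch (slp_run n p (\<lambda>i j. s * A i j) (\<lambda>i j. t * B i j)) x = eval2 s t (P x)) \<and>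
     coeff (coeff (P x) 0) 0 = c x \<and> coeff (coeff (P x) 0) 1 = lin n (a x) A \<and> coeff (coeff (P x) 1) 0 = lin n (b x) B \<and>
     coeff (coeff (P x) 1) 1 = (\<Sum>l<2 * length p. w x l * (lin n (u l) A * lin n (v l) B))"
proof (induction p rule: rev_induct)
  case Nil
  define a :: "nat \<Rightarrow> nat \<Rightarrow> rat" where "a x z = (if x = z then 1 else 0)" for x z
  define b :: "nat \<Rightarrow> nat \<Rightarrow> rat" where "b x z = (if x = n * n + z then 1 else 0)" for x z
  have la: "lin n (a x) A = (if x < n * n then A (x div n) (x mod n) else 0)" for x A
    unfolding a_def by (simp add: if_distrib[of "\<lambda>y. y * _"] cong: if_cong)
  have lb: "lin n (b x) B = (if n * n \<le> x \<and> x < 2 * (n * n) then B ((x - n * n) div n) ((x - n * n) mod n) else 0)" for x B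
  proof (cases "n * n \<le> x \<and> x < 2 * (n * n)")
    case True
    then have "b x z = (if z = x - n * n then 1 else 0)" for z unfolding b_def by auto
    then show ?thesis using True by (simp add: if_distrib[of "\<lambda>y. y * _"] cong: if_cong) linarith
  next
    case False
    then show ?thesis unfolding b_def by (auto intro!: sum.neutral)
  qed
  have "\<forall>A B. \<exists>P. \<forall>x.
     (\<forall>s t. fetch (slp_run n [] (\<lambda>i j. s * A i j) (\<lambda>i j. t * B i j)) x = eval2 s t (P x)) \<and>
     coeff (coeff (P x) 0) 0 = 0 \<and> coeff (coeff (P x) 0) 1 = lin n (a x) A \<and> coeff (coeff (P x) 1) 0 = lin n (b x) B \<and>
     coeff (coeff (P x) 1) 1 = 0"
  proof (intro allI)
    fix A B :: "nat \<Rightarrow> nat \<Rightarrow> rat"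
    define P :: "nat \<Rightarrow> rat poly poly" where "P x = (if x < n * n then [:[:0, A (x div n) (x mod n):]:]
       else if x < 2 * (n * n) then [:0, [:B ((x - n * n) div n) ((x - n * n) mod n):]:] else 0)" for x
    have "(\<forall>s t. fetch (slp_run n [] (\<lambda>i j. s * A i j) (\<lambda>i j. t * B i j)) x = eval2 s t (P x)) \<and>
     coeff (coeff (P x) 0) 0 = 0 \<and> coeff (coeff (P x) 0) 1 = lin n (a x) A \<and> coeff (coeff (P x) 1) 0 = lin n (b x) B \<and>
     coeff (coeff (P x) 1) 1 = 0" for x
    proof -
      consider "x < n * n" | "n * n \<le> x" "x < 2 * (n * n)" | "2 * (n * n) \<le> x" by linarith
      then show ?thesis
      proof cases
        case 1
        then show ?thesis unfolding la lb P_def by (simp add: fetch_input)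
      next
        case 2
        then have "x = n * n + (x - n * n)" "x - n * n < n * n" by auto
        then have "fetch (row_major n (\<lambda>i j. s * A i j) @ row_major n (\<lambda>i j. t * B i j)) x = t * B ((x - n * n) div n) ((x - n * n) mod n)" for s t
          using fetch_input(2)[of "x - n * n" n "\<lambda>i j. s * A i j" "\<lambda>i j. t * B i j"] by simp
        then show ?thesis using 2 unfolding la lb P_def by simp
      next
        case 3
        then show ?thesis unfolding la lb P_def by (simp add: fetch_def)
      qed
    qed
    then show "\<exists>P. \<forall>x. (\<forall>s t. fetch (slp_run n [] (\<lambda>i j. s * A i j) (\<lambda>i j. t * B i j)) x = eval2 s t (P x)) \<and>
     coeff (coeff (P x) 0) 0 = 0 \<and> coeff (coeff (P x) 0) 1 = lin n (a x) A \<and> coeff (coeff (P x) 1) 0 = lin n (b x) B \<and>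
     coeff (coeff (P x) 1) 1 = 0" by blast
  qed
  then show ?case
    by (intro exI[of _ "\<lambda>_ _. 0"] exI[of _ "\<lambda>_. 0"] exI[of _ a] exI[of _ b]) simp
next
  case (snoc ins p)
  then obtain u v c a b w where IH: "\<And>A B. \<exists>P. \<forall>x.
     (\<forall>s t. fetch (slp_run n p (\<lambda>i j. s * A i j) (\<lambda>i j. t * B i j)) x = eval2 s t (P x)) \<and>
     coeff (coeff (P x) 0) 0 = c x \<and> coeff (coeff (P x) 0) 1 = lin n (a x) A \<and> coeff (coeff (P x) 1) 0 = lin n (b x) B \<and>
     coeff (coeff (P x) 1) 1 = (\<Sum>l<2 * length p. w x l * (lin n (u l) A * lin n (v l) B))"
    by blast
  \<comment> \<open>\<open>?N\<close> is the position of the value of the last instruction;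
    \<open>?L\<close> and \<open>Suc ?L\<close> number the two products reserved for it. All earlier
    positions keep their coefficients.\<close>
  let ?L = "2 * length p" and ?N = "n * n + n * n + length p"
  obtain i j where ij: "case ins of Scalar _ \<Rightarrow> True | Add i' j' \<Rightarrow> i = i' \<and> j = j' | Sub i' j' \<Rightarrow> i = i' \<and> j = j' | Mul i' j' \<Rightarrow> i = i' \<and> j = j'"
    by (cases ins) auto
  \<comment> \<open>With q_i for the coefficient of s t in value i, a product of values i and j has
    the coefficient c_i q_j + c_j q_i + a_i b_j + a_j b_i. The last two terms are the new products;
    the other instructions give both of them weight 0.\<close>
  define u' where "u' = u(?L := a i, Suc ?L := a j)"
  define v' where "v' = v(?L := b j, Suc ?L := b i)"
  define cN where "cN = (case ins of Scalar k \<Rightarrow> k | Add _ _ \<Rightarrow> c i + c j | Sub _ _ \<Rightarrow> c i - c j | Mul _ _ \<Rightarrow> c i * c j)"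
  define aN where "aN = (\<lambda>z. case ins of Scalar k \<Rightarrow> 0 | Add _ _ \<Rightarrow> a i z + a j z | Sub _ _ \<Rightarrow> a i z - a j z | Mul _ _ \<Rightarrow> c i * a j z + c j * a i z)"
  define bN where "bN = (\<lambda>z. case ins of Scalar k \<Rightarrow> 0 | Add _ _ \<Rightarrow> b i z + b j z | Sub _ _ \<Rightarrow> b i z - b j z | Mul _ _ \<Rightarrow> c i * b j z + c j * b i z)"
  define wN where "wN = (\<lambda>l. case ins of Scalar k \<Rightarrow> 0 | Add _ _ \<Rightarrow> (if l < ?L then w i l + w j l else 0)
     | Sub _ _ \<Rightarrow> (if l < ?L then w i l - w j l else 0) | Mul _ _ \<Rightarrow> (if l < ?L then c i * w j l + c j * w i l else 1))"
  define w' where "w' = (\<lambda>x l. if x = ?N then wN l else if l < ?L then w x l else 0)"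
  have "\<exists>P. \<forall>x.
     (\<forall>s t. fetch (slp_run n (p @ [ins]) (\<lambda>i j. s * A i j) (\<lambda>i j. t * B i j)) x = eval2 s t (P x)) \<and>
     coeff (coeff (P x) 0) 0 = (c(?N := cN)) x \<and> coeff (coeff (P x) 0) 1 = lin n ((a(?N := aN)) x) A \<and> coeff (coeff (P x) 1) 0 = lin n ((b(?N := bN)) x) B \<and>
     coeff (coeff (P x) 1) 1 = (\<Sum>l<2 * length (p @ [ins]). w' x l * (lin n (u' l) A * lin n (v' l) B))" for A B
  proof -
    obtain P where P: "\<And>x s t. fetch (slp_run n p (\<lambda>i j. s * A i j) (\<lambda>i j. t * B i j)) x = eval2 s t (P x)"
     "\<And>x. coeff (coeff (P x) 0) 0 = c x" "\<And>x. coeff (coeff (P x) 0) 1 = lin n (a x) A" "\<And>x. coeff (coeff (P x) 1) 0 = lin n (b x) B"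
     "\<And>x. coeff (coeff (P x) 1) 1 = (\<Sum>l<2 * length p. w x l * (lin n (u l) A * lin n (v l) B))"
      using IH[of A B] by blast
    define PN where "PN = (case ins of Scalar k \<Rightarrow> [:[:k:]:] | Add _ _ \<Rightarrow> P i + P j | Sub _ _ \<Rightarrow> P i - P j | Mul _ _ \<Rightarrow> P i * P j)"
    define P' where "P' = P(?N := PN)"
    let ?T = "\<lambda>l. lin n (u l) A * lin n (v l) B" and ?T' = "\<lambda>l. lin n (u' l) A * lin n (v' l) B"
    have T: "?T' l = ?T l" if "l < ?L" for l using that unfolding u'_def v'_def by simp
    have split: "(\<Sum>l<2 * length (p @ [ins]). f l * ?T' l) = (\<Sum>l<?L. f l * ?T l) + (f ?L * (lin n (a i) A * lin n (b j) B) + f (Suc ?L) * (lin n (a j) A * lin n (b i) B))" for f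
    proof -
      have "(\<Sum>l<2 * length (p @ [ins]). f l * ?T' l) = (\<Sum>l<?L. f l * ?T' l) + f ?L * ?T' ?L + f (Suc ?L) * ?T' (Suc ?L)" by simp
      also have "(\<Sum>l<?L. f l * ?T' l) = (\<Sum>l<?L. f l * ?T l)" by (intro sum.cong refl) (simp only: T lessThan_iff)
      finally show ?thesis unfolding u'_def v'_def by simp
    qed
    have ev: "fetch (slp_run n (p @ [ins]) (\<lambda>i j. s * A i j) (\<lambda>i j. t * B i j)) x = eval2 s t (P' x)" for s t x
      using ij unfolding P'_def PN_def by (cases ins) (auto simp: fetch_append length_slp P(1))
    have N: "coeff (coeff PN 0) 0 = cN" "coeff (coeff PN 0) 1 = lin n aN A" "coeff (coeff PN 1) 0 = lin n bN B"
      using ij unfolding PN_def cN_def aN_def bN_def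
      by (cases ins; simp add: P(2-4)[unfolded One_nat_def] coeff_mult_0 coeff_mult_1[unfolded One_nat_def] sum.distrib sum_subtractf sum_distrib_left algebra_simps)+
    have N1: "coeff (coeff PN 1) 1 = (\<Sum>l<2 * length (p @ [ins]). wN l * ?T' l)"
      unfolding split using ij unfolding PN_def wN_def
      by (cases ins; simp add: P(2-5)[unfolded One_nat_def] coeff_mult_0 coeff_mult_1[unfolded One_nat_def] sum.distrib sum_subtractf sum_distrib_left algebra_simps)
    have O: "(\<Sum>l<2 * length (p @ [ins]). w' x l * ?T' l) = (\<Sum>l<?L. w x l * ?T l)" if "x \<noteq> ?N" for x
      unfolding split using that unfolding w'_def by (auto intro!: sum.cong)
    have O1: "(\<Sum>l<2 * length (p @ [ins]). w' ?N l * ?T' l) = (\<Sum>l<2 * length (p @ [ins]). wN l * ?T' l)" unfolding w'_def by simp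
    have "coeff (coeff (P' x) 0) 0 = (c(?N := cN)) x \<and> coeff (coeff (P' x) 0) 1 = lin n ((a(?N := aN)) x) A \<and> coeff (coeff (P' x) 1) 0 = lin n ((b(?N := bN)) x) B \<and>
     coeff (coeff (P' x) 1) 1 = (\<Sum>l<2 * length (p @ [ins]). w' x l * ?T' l)" for x
    proof (cases "x = ?N")
      case True
      then show ?thesis using N N1 O1 unfolding P'_def by simp
    next
      case False
      then show ?thesis using P(2-5) O[OF False] unfolding P'_def by simp
    qed
    then show ?thesis using ev by blast
  qed
  then show ?case by blast
qed

text \<open>On inputs scaled by s and t an output is s t times the entry of the product. As a
  polynomial it has no other coefficient, and the coefficient of s t is a combination of products of
  a linear form in A with a linear form in B.\<close>

lemma slp_bilinear:
  assumes slp: "slp_multiplies n p out"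
  shows "\<exists>u v w. \<forall>A B. \<forall>i<n. \<forall>j<n. mat_prod n A B i j = (\<Sum>l<2 * length p. w (i * n + j) l * (lin n (u l) A * lin n (v l) B))"
proof -
  obtain u v c a b w where H: "\<And>A B. \<exists>P. \<forall>x.
     (\<forall>s t. fetch (slp_run n p (\<lambda>i j. s * A i j) (\<lambda>i j. t * B i j)) x = eval2 s t (P x)) \<and>
     coeff (coeff (P x) 0) 0 = c x \<and> coeff (coeff (P x) 0) 1 = lin n (a x) A \<and> coeff (coeff (P x) 1) 0 = lin n (b x) B \<and>
     coeff (coeff (P x) 1) 1 = (\<Sum>l<2 * length p. w x l * (lin n (u l) A * lin n (v l) B))"
    using slp_coefficients[where n = n and p = p] by blast
  \<comment> \<open>The weights are indexed by i n + j in the statement, so the output position has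
    to be recovered from this number.\<close>
  have main: "mat_prod n A B i j = (\<Sum>l<2 * length p. w (out ((i * n + j) div n) ((i * n + j) mod n)) l * (lin n (u l) A * lin n (v l) B))"
    if ij: "i < n" "j < n" for A B i j
  proof -
    obtain P where P: "\<And>x s t. fetch (slp_run n p (\<lambda>i j. s * A i j) (\<lambda>i j. t * B i j)) x = eval2 s t (P x)"
     "\<And>x. coeff (coeff (P x) 1) 1 = (\<Sum>l<2 * length p. w x l * (lin n (u l) A * lin n (v l) B))"
      using H[of A B] by blast
    have "eval2 s t (P (out i j)) = eval2 s t [:0, [:0, mat_prod n A B i j:]:]" for s t
    proof -
      have "eval2 s t (P (out i j)) = mat_prod n (\<lambda>i j. s * A i j) (\<lambda>i j. t * B i j) i j"
        using slp ij unfolding P(1)[symmetric] slp_multiplies_def by blast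
      also have "\<dots> = s * t * mat_prod n A B i j" unfolding mat_prod_def by (simp add: sum_distrib_left algebra_simps)
      finally show ?thesis by simp
    qed
    then have "P (out i j) = [:0, [:0, mat_prod n A B i j:]:]" by (rule eval2_eq)
    then have "mat_prod n A B i j = coeff (coeff (P (out i j)) 1) 1" by simp
    moreover have "(i * n + j) div n = i" "(i * n + j) mod n = j" using ij by auto
    ultimately show ?thesis unfolding P(2) by simp
  qed
  show ?thesis by (rule exI[of _ u], rule exI[of _ v], rule exI[of _ "\<lambda>z. w (out (z div n) (z mod n))"], intro allI impI) (rule main)
qed

section \<open>Integer coefficients\<close>

lemma common_denominator: "finite S \<Longrightarrow> \<exists>D>0. \<forall>x\<in>S. \<exists>k. rat_of_int D * x = rat_of_int k"
proof (induction S rule: finite_induct)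
  case empty
  then show ?case by (intro exI[of _ 1]) simp
next
  case (insert x S)
  then obtain D where D: "0 < D" "\<forall>y\<in>S. \<exists>k. rat_of_int D * y = rat_of_int k" by blast
  obtain a b where ab: "x = rat_of_int a / rat_of_int b" "0 < b" by (metis Fract_of_int_quotient Rat_cases)
  have "\<exists>k. rat_of_int (D * b) * y = rat_of_int k" if "y \<in> insert x S" for y
  proof (cases "y = x")
    case True
    then have "rat_of_int (D * b) * y = rat_of_int (D * a)" using ab by simp
    then show ?thesis by (rule exI)
  next
    case False
    then have "y \<in> S" using that by simp
    then obtain k where "rat_of_int D * y = rat_of_int k" using D(2) by blast
    moreover have "rat_of_int (D * b) * y = (rat_of_int D * y) * rat_of_int b" by (simp only: of_int_mult ac_simps)
    ultimately have "rat_of_int (D * b) * y = rat_of_int (k * b)" by simp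
    then show ?thesis by (rule exI)
  qed
  then show ?case using D(1) ab(2) by (intro exI[of _ "D * b"]) auto
qed

lemma integral_table:
  fixes f :: "nat \<Rightarrow> nat \<Rightarrow> rat"
  shows "\<exists>D>0. \<exists>g. \<forall>x<a. \<forall>y<b. rat_of_int D * f x y = rat_of_int (g x y)"
proof -
  have "finite ((\<lambda>(x, y). f x y) ` ({..<a} \<times> {..<b}))" by simp
  from common_denominator[OF this] obtain D where D: "0 < D" "\<forall>x<a. \<forall>y<b. \<exists>k. rat_of_int D * f x y = rat_of_int k" by auto
  then show ?thesis by (intro exI[of _ D] conjI exI[of _ "\<lambda>x y. SOME k. rat_of_int D * f x y = rat_of_int k"]) (auto intro: someI_ex)
qed

text \<open>Words are integers. Each of the three coefficient tables is scaled by a common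
  denominator of its own, and the price is one factor D in the result.\<close>

lemma slp_integer_bilinear:
  assumes slp: "slp_multiplies d p out"
  shows "\<exists>\<alpha> \<beta> \<gamma> D. 0 < D \<and> (\<forall>A B :: nat \<Rightarrow> nat \<Rightarrow> int. \<forall>i<d. \<forall>j<d.
      (\<Sum>l<2 * length p. \<gamma> (i * d + j) l * ((\<Sum>z<d * d. \<alpha> l z * A (z div d) (z mod d)) * (\<Sum>z<d * d. \<beta> l z * B (z div d) (z mod d)))) =
      D * mat_prod d A B i j)"
proof -
  let ?r = "2 * length p"
  obtain u v w where H: "\<And>A B i j. i < d \<Longrightarrow> j < d \<Longrightarrow> mat_prod d A B i j = (\<Sum>l<?r. w (i * d + j) l * (lin d (u l) A * lin d (v l) B))"
    using slp_bilinear[OF slp] by blast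
  obtain D1 \<alpha> where D1: "0 < D1" "\<forall>x<?r. \<forall>y<d * d. rat_of_int D1 * u x y = rat_of_int (\<alpha> x y)" using integral_table by blast
  obtain D2 \<beta> where D2: "0 < D2" "\<forall>x<?r. \<forall>y<d * d. rat_of_int D2 * v x y = rat_of_int (\<beta> x y)" using integral_table by blast
  obtain D3 \<gamma> where D3: "0 < D3" "\<forall>x<d * d. \<forall>y<?r. rat_of_int D3 * w x y = rat_of_int (\<gamma> x y)" using integral_table by blast
  have "(\<Sum>l<?r. \<gamma> (i * d + j) l * ((\<Sum>z<d * d. \<alpha> l z * A (z div d) (z mod d)) * (\<Sum>z<d * d. \<beta> l z * B (z div d) (z mod d)))) =
      (D1 * D2 * D3) * mat_prod d A B i j" if ij: "i < d" "j < d" for A B :: "nat \<Rightarrow> nat \<Rightarrow> int" and i j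
  proof -
    have "Suc i * d \<le> d * d" using ij by (intro mult_right_mono) auto
    then have ijd: "i * d + j < d * d" using ij by simp
    let ?A = "\<lambda>i j. rat_of_int (A i j)" and ?B = "\<lambda>i j. rat_of_int (B i j)"
    have a: "rat_of_int (\<Sum>z<d * d. \<alpha> l z * A (z div d) (z mod d)) = rat_of_int D1 * lin d (u l) ?A" if "l < ?r" for l
    proof -
      have "rat_of_int (\<Sum>z<d * d. \<alpha> l z * A (z div d) (z mod d)) = (\<Sum>z<d * d. rat_of_int (\<alpha> l z) * ?A (z div d) (z mod d))" by simp
      also have "\<dots> = (\<Sum>z<d * d. rat_of_int D1 * u l z * ?A (z div d) (z mod d))" using D1(2) that by (intro sum.cong) auto
      finally show ?thesis by (simp add: sum_distrib_left mult.assoc)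
    qed
    have b: "rat_of_int (\<Sum>z<d * d. \<beta> l z * B (z div d) (z mod d)) = rat_of_int D2 * lin d (v l) ?B" if "l < ?r" for l
    proof -
      have "rat_of_int (\<Sum>z<d * d. \<beta> l z * B (z div d) (z mod d)) = (\<Sum>z<d * d. rat_of_int (\<beta> l z) * ?B (z div d) (z mod d))" by simp
      also have "\<dots> = (\<Sum>z<d * d. rat_of_int D2 * v l z * ?B (z div d) (z mod d))" using D2(2) that by (intro sum.cong) auto
      finally show ?thesis by (simp add: sum_distrib_left mult.assoc)
    qed
    have "rat_of_int (\<Sum>l<?r. \<gamma> (i * d + j) l * ((\<Sum>z<d * d. \<alpha> l z * A (z div d) (z mod d)) * (\<Sum>z<d * d. \<beta> l z * B (z div d) (z mod d)))) =
      (\<Sum>l<?r. (rat_of_int D3 * w (i * d + j) l) * ((rat_of_int D1 * lin d (u l) ?A) * (rat_of_int D2 * lin d (v l) ?B)))"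
    proof -
      have "rat_of_int (\<Sum>l<?r. \<gamma> (i * d + j) l * ((\<Sum>z<d * d. \<alpha> l z * A (z div d) (z mod d)) * (\<Sum>z<d * d. \<beta> l z * B (z div d) (z mod d)))) =
       (\<Sum>l<?r. rat_of_int (\<gamma> (i * d + j) l) * (rat_of_int (\<Sum>z<d * d. \<alpha> l z * A (z div d) (z mod d)) * rat_of_int (\<Sum>z<d * d. \<beta> l z * B (z div d) (z mod d))))"
        unfolding of_int_sum[of _ "{..<?r}"] of_int_mult ..
      also have "\<dots> = (\<Sum>l<?r. (rat_of_int D3 * w (i * d + j) l) * ((rat_of_int D1 * lin d (u l) ?A) * (rat_of_int D2 * lin d (v l) ?B)))"
      proof (rule sum.cong[OF refl])
        fix l assume "l \<in> {..<?r}"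
        then have l: "l < ?r" by simp
        have g: "rat_of_int (\<gamma> (i * d + j) l) = rat_of_int D3 * w (i * d + j) l" using D3(2) ijd l by simp
        show "rat_of_int (\<gamma> (i * d + j) l) * (rat_of_int (\<Sum>z<d * d. \<alpha> l z * A (z div d) (z mod d)) * rat_of_int (\<Sum>z<d * d. \<beta> l z * B (z div d) (z mod d))) =
          (rat_of_int D3 * w (i * d + j) l) * ((rat_of_int D1 * lin d (u l) ?A) * (rat_of_int D2 * lin d (v l) ?B))"
          unfolding g a[OF l] b[OF l] ..
      qed
      finally show ?thesis .
    qed
    also have "\<dots> = rat_of_int (D1 * D2 * D3) * (\<Sum>l<?r. w (i * d + j) l * (lin d (u l) ?A * lin d (v l) ?B))"
      unfolding sum_distrib_left[of "rat_of_int (D1 * D2 * D3)"] by (rule sum.cong[OF refl]) (simp only: of_int_mult ac_simps)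
    also have "(\<Sum>l<?r. w (i * d + j) l * (lin d (u l) ?A * lin d (v l) ?B)) = mat_prod d ?A ?B i j" by (rule H[OF ij, symmetric])
    also have "rat_of_int (D1 * D2 * D3) * mat_prod d ?A ?B i j = rat_of_int (D1 * D2 * D3 * mat_prod d A B i j)"
      by (simp only: mat_prod_def of_int_mult of_int_sum)
    finally show ?thesis by (simp only: of_int_eq_iff)
  qed
  then show ?thesis using D1(1) D2(1) D3(1)
    by (intro exI[of _ \<alpha>] exI[of _ \<beta>] exI[of _ \<gamma>] exI[of _ "D1 * D2 * D3"]) auto
qed

section \<open>Weakest preconditions with running times\<close>

definition wupd :: "nat \<Rightarrow> int \<Rightarrow> int \<Rightarrow> state \<Rightarrow> state" where
  "wupd a x v s = s\<lparr>wmem := (wmem s)(a := (wmem s a)(x := v))\<rparr>"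

definition nupd :: "nat \<Rightarrow> int \<Rightarrow> ereal \<Rightarrow> state \<Rightarrow> state" where
  "nupd a x v s = s\<lparr>nmem := (nmem s)(a := (nmem s a)(x := v))\<rparr>"

lemma upd_simps [simp]:
  "wmem (wupd a x v s) b = (if b = a then (wmem s a)(x := v) else wmem s b)"
  "nmem (wupd a x v s) b = nmem s b"
  "nmem (nupd a x y s) b = (if b = a then (nmem s a)(x := y) else nmem s b)"
  "wmem (nupd a x y s) b = wmem s b"
  by (auto simp: wupd_def nupd_def)

lemma lift2_Some [simp]: "lift2 f (Some a) (Some b) = Some (f a b)"
  by (simp add: lift2_def)

text \<open>The existential quantifier makes this total correctness: a program that leaves the range
  of the machine has no execution, so every such statement also proves the absence of overflow. The
  running time is an argument of the postcondition.\<close>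

definition wp :: "machine \<Rightarrow> com \<Rightarrow> (nat \<Rightarrow> state \<Rightarrow> bool) \<Rightarrow> state \<Rightarrow> bool" where
  "wp m p Q s \<longleftrightarrow> (\<exists>t s'. exec m p s t s' \<and> Q t s')"

inductive_cases SkipE: "exec m Skip s t s'"
inductive_cases WStoreE: "exec m (WStore a i e) s t s'"
inductive_cases NStoreE: "exec m (NStore a i e) s t s'"
inductive_cases SeqE: "exec m (Seq p q) s t s'"
inductive_cases CondE: "exec m (Cond b p q) s t s'"
inductive_cases WhileE: "exec m (While b p) s t s'"

lemma wp_Skip [simp]: "wp m Skip Q s \<longleftrightarrow> Q 1 s"
  unfolding wp_def by (metis SkipE exec.Skip)

lemma wp_WStore [simp]:
  "wp m (WStore a i e) Q s \<longleftrightarrow>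
     (\<exists>x v. weval m s i = Some x \<and> weval m s e = Some v \<and> Q (1 + wcost i + wcost e) (wupd a x v s))"
  (is "?l \<longleftrightarrow> ?r")
proof
  assume ?l then show ?r unfolding wp_def wupd_def by (auto elim!: WStoreE)
next
  assume ?r then show ?l unfolding wp_def wupd_def using exec.WStore by meson
qed

lemma wp_NStore [simp]:
  "wp m (NStore a i e) Q s \<longleftrightarrow>
     (\<exists>x v. weval m s i = Some x \<and> neval m s e = Some v \<and> Q (1 + wcost i + ncost e) (nupd a x v s))"
  (is "?l \<longleftrightarrow> ?r")
proof
  assume ?l then show ?r unfolding wp_def nupd_def by (auto elim!: NStoreE)
next
  assume ?r then show ?l unfolding wp_def nupd_def using exec.NStore by meson
qed

lemma wp_Seq [simp]:
  "wp m (Seq p q) Q s \<longleftrightarrow> wp m p (\<lambda>t s'. wp m q (\<lambda>t' s''. Q (t + t') s'') s') s"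
  (is "?l \<longleftrightarrow> ?r")
proof
  assume ?l then show ?r unfolding wp_def by (auto elim!: SeqE)
next
  assume ?r then show ?l unfolding wp_def using exec.Seq by meson
qed

lemma wp_Cond [simp]:
  "wp m (Cond b p q) Q s \<longleftrightarrow> beval m s b \<noteq> None \<and>
     (beval m s b = Some True \<longrightarrow> wp m p (\<lambda>t s'. Q (1 + bcost b + t) s') s) \<and>
     (beval m s b = Some False \<longrightarrow> wp m q (\<lambda>t s'. Q (1 + bcost b + t) s') s)"
  (is "?l \<longleftrightarrow> ?r")
proof
  assume ?l then show ?r unfolding wp_def by (auto elim!: CondE)
next
  assume ?r
  then consider "beval m s b = Some True" | "beval m s b = Some False" by (cases "beval m s b") auto
  then show ?l
  proof cases
    case 1
    with \<open>?r\<close> show ?thesis unfolding wp_def using exec.CondTrue[OF 1] by blast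
  next
    case 2
    with \<open>?r\<close> show ?thesis unfolding wp_def using exec.CondFalse[OF 2] by blast
  qed
qed

lemma wp_mono: "wp m p Q s \<Longrightarrow> (\<And>t s'. Q t s' \<Longrightarrow> Q' t s') \<Longrightarrow> wp m p Q' s"
  unfolding wp_def by blast

fun wmods :: "com \<Rightarrow> nat set" where
  "wmods Skip = {}"
| "wmods (WStore a i e) = {a}"
| "wmods (NStore a i e) = {}"
| "wmods (Seq p q) = wmods p \<union> wmods q"
| "wmods (Cond b p q) = wmods p \<union> wmods q"
| "wmods (While b p) = wmods p"

fun nmods :: "com \<Rightarrow> nat set" where
  "nmods Skip = {}"
| "nmods (WStore a i e) = {}"
| "nmods (NStore a i e) = {a}"
| "nmods (Seq p q) = nmods p \<union> nmods q"
| "nmods (Cond b p q) = nmods p \<union> nmods q"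
| "nmods (While b p) = nmods p"

lemma exec_frame:
  "exec m p s t s' \<Longrightarrow> (\<forall>a. a \<notin> wmods p \<longrightarrow> wmem s' a = wmem s a) \<and> (\<forall>a. a \<notin> nmods p \<longrightarrow> nmem s' a = nmem s a)"
  by (induction rule: exec.induct) auto

text \<open>Adds to a specification that arrays never written keep their contents, so that
  specifications need to mention only what changes. The unit of framing is a whole array.\<close>

lemma wp_frame:
  assumes "wp m p Q s"
    and "\<And>t s'. Q t s' \<Longrightarrow> (\<And>a. a \<notin> wmods p \<Longrightarrow> wmem s' a = wmem s a) \<Longrightarrow>
           (\<And>a. a \<notin> nmods p \<Longrightarrow> nmem s' a = nmem s a) \<Longrightarrow> Q' t s'"
  shows "wp m p Q' s"
  using assms unfolding wp_def by (meson exec_frame)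

text \<open>k counts finished iterations and J bounds their number, which gives termination; c
  bounds the cost of each iteration separately. Whatever the body does not write may be used in
  every step without being part of the invariant.\<close>

lemma wp_While:
  assumes init: "I 0 s"
    and step: "\<And>k s'. I k s' \<Longrightarrow> k \<le> J \<Longrightarrow>
        (\<And>a. a \<notin> wmods body \<Longrightarrow> wmem s' a = wmem s a) \<Longrightarrow>
        (\<And>a. a \<notin> nmods body \<Longrightarrow> nmem s' a = nmem s a) \<Longrightarrow>
        \<exists>v. beval m s' b = Some v \<and>
          (v \<longrightarrow> k < J \<and> wp m body (\<lambda>t s''. t \<le> c k \<and> I (Suc k) s'') s') \<and>
          (\<not> v \<longrightarrow> (\<forall>t. t \<le> (\<Sum>j<k. c j) + (k + 1) * (1 + bcost b) \<longrightarrow> Q t s'))"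
  shows "wp m (While b body) Q s"
proof -
  let ?fr = "\<lambda>s'. (\<forall>a. a \<notin> wmods body \<longrightarrow> wmem s' a = wmem s a) \<and> (\<forall>a. a \<notin> nmods body \<longrightarrow> nmem s' a = nmem s a)"
  \<comment> \<open>Generalised over the time T already spent, because Q speaks about the total
    time.\<close>
  have "wp m (While b body) (\<lambda>t. Q (T + t)) s'"
    if "I k s'" "k \<le> J" "?fr s'" "T \<le> (\<Sum>j<k. c j) + k * (1 + bcost b)" for k s' T
    using that
  proof (induction "J - k" arbitrary: k s' T rule: less_induct)
    case less
    from step[OF less.prems(1,2)] less.prems(3) obtain v where v: "beval m s' b = Some v"
      "v \<Longrightarrow> k < J \<and> wp m body (\<lambda>t s''. t \<le> c k \<and> I (Suc k) s'') s'"
      "\<not> v \<Longrightarrow> (\<forall>t. t \<le> (\<Sum>j<k. c j) + (k + 1) * (1 + bcost b) \<longrightarrow> Q t s')"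
      by blast
    show ?case
    proof (cases v)
      case True
      with v obtain t1 s1 where 1: "k < J" "exec m body s' t1 s1" "t1 \<le> c k" "I (Suc k) s1"
        unfolding wp_def by blast
      have fr1: "?fr s1" using exec_frame[OF 1(2)] less.prems(3) by simp
      have "wp m (While b body) (\<lambda>t. Q (T + (1 + bcost b + t1) + t)) s1"
        by (rule less.hyps[of "Suc k"]) (use 1 fr1 less.prems(4) in simp_all)
      then obtain t2 s2 where 2: "exec m (While b body) s1 t2 s2" "Q (T + (1 + bcost b + t1) + t2) s2"
        unfolding wp_def by blast
      have "exec m (While b body) s' (1 + bcost b + t1 + t2) s2"
        using exec.WhileTrue[OF _ 1(2) 2(1)] True v(1) by simp
      then show ?thesis using 2(2) unfolding wp_def by (metis add.assoc)
    next
      case False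
      then have "Q (T + (1 + bcost b)) s'" using v(3) less.prems(4) by (simp add: algebra_simps)
      then show ?thesis using False v(1) unfolding wp_def by (metis exec.WhileFalse)
    qed
  qed
  from this[of 0 s 0] init show ?thesis by simp
qed

section \<open>Counted loops\<close>

abbreviation Var :: "nat \<Rightarrow> wexp" where "Var v \<equiv> WLoad v (WConst 0)"
abbreviation Assign :: "nat \<Rightarrow> wexp \<Rightarrow> com" where "Assign v e \<equiv> WStore v (WConst 0) e"
abbreviation "Padd \<equiv> WArith Plus"
abbreviation "Psub \<equiv> WArith Minus"
abbreviation "Pmul \<equiv> WArith Times"
abbreviation "Pdiv \<equiv> WArith Divide"

definition For :: "nat \<Rightarrow> wexp \<Rightarrow> com \<Rightarrow> com" where
  "For i e body = Seq (Assign i (WConst 0))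
     (While (WLess (Var i) e) (Seq body (Assign i (Padd (Var i) (WConst 1)))))"

lemma mods_For [simp]:
  "wmods (For i e p) = insert i (wmods p)" "nmods (For i e p) = nmods p"
  by (auto simp: For_def)

text \<open>The bound e is evaluated anew before every iteration, hence its value is required in all
  states of the loop. The invariant for k + 1 is stated after the increment of the counter, and 20
  is a generous allowance for test and increment.\<close>

lemma wp_For:
  assumes e: "\<And>k s'. k \<le> N \<Longrightarrow> I k s' \<Longrightarrow> wmem s' i 0 = int k \<Longrightarrow>
        (\<And>a. a \<noteq> i \<Longrightarrow> a \<notin> wmods body \<Longrightarrow> wmem s' a = wmem s a) \<Longrightarrow> weval m s' e = Some (int N)"
    and N: "real N + 1 \<le> wmax m"
    and init: "I 0 (wupd i 0 0 s)"
    and body: "\<And>k s'. k < N \<Longrightarrow> I k s' \<Longrightarrow> wmem s' i 0 = int k \<Longrightarrow>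
        (\<And>a. a \<noteq> i \<Longrightarrow> a \<notin> wmods body \<Longrightarrow> wmem s' a = wmem s a) \<Longrightarrow>
        (\<And>a. a \<notin> nmods body \<Longrightarrow> nmem s' a = nmem s a) \<Longrightarrow>
        wp m body (\<lambda>t s''. t \<le> c \<and> wmem s'' i 0 = int k \<and> I (Suc k) (wupd i 0 (int (Suc k)) s'')) s'"
    and post: "\<And>t s'. I N s' \<Longrightarrow> wmem s' i 0 = int N \<Longrightarrow> t \<le> N * (c + wcost e + 20) + wcost e + 20 \<Longrightarrow>
        (\<And>a. a \<noteq> i \<Longrightarrow> a \<notin> wmods body \<Longrightarrow> wmem s' a = wmem s a) \<Longrightarrow>
        (\<And>a. a \<notin> nmods body \<Longrightarrow> nmem s' a = nmem s a) \<Longrightarrow> Q t s'"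
  shows "wp m (For i e body) Q s"
proof -
  have c01: "word m 0 = Some 0" "word m 1 = Some 1" using N by (auto simp: word_def)
  have "wp m (While (WLess (Var i) e) (Seq body (Assign i (Padd (Var i) (WConst 1)))))
      (\<lambda>t. Q (3 + t)) (wupd i 0 0 s)"
  proof (rule wp_While[where I = "\<lambda>k s'. k \<le> N \<and> wmem s' i 0 = int k \<and> I k s'" and J = N and c = "\<lambda>_. c + 7"])
    show "0 \<le> N \<and> wmem (wupd i 0 0 s) i 0 = int 0 \<and> I 0 (wupd i 0 0 s)" using init by simp
  next
    fix k s'
    assume I: "k \<le> N \<and> wmem s' i 0 = int k \<and> I k s'"
      and fw: "\<And>a. a \<notin> wmods (Seq body (Assign i (Padd (Var i) (WConst 1)))) \<Longrightarrow> wmem s' a = wmem (wupd i 0 0 s) a"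
      and fn: "\<And>a. a \<notin> nmods (Seq body (Assign i (Padd (Var i) (WConst 1)))) \<Longrightarrow> nmem s' a = nmem (wupd i 0 0 s) a"
    have fw': "wmem s' a = wmem s a" if "a \<noteq> i" "a \<notin> wmods body" for a using fw[of a] that by simp
    have fn': "nmem s' a = nmem s a" if "a \<notin> nmods body" for a using fn[of a] that by simp
    have ev: "weval m s' e = Some (int N)" using e I fw' by blast
    have b: "beval m s' (WLess (Var i) e) = Some (k < N)" using I ev c01 by simp
    have t: "wp m (Seq body (Assign i (Padd (Var i) (WConst 1))))
       (\<lambda>t s''. t \<le> c + 7 \<and> (Suc k \<le> N \<and> wmem s'' i 0 = int (Suc k) \<and> I (Suc k) s'')) s'" if "k < N"
    proof -
      have w: "word m (int k + 1) = Some (int k + 1)" using that N by (simp add: word_def)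
      show ?thesis unfolding wp_Seq
        by (rule wp_mono[OF body[OF that]]) (use I fw' fn' that w c01 in \<open>auto simp: add.commute\<close>)
    qed
    have f: "Q (3 + t) s'" if "\<not> k < N" "t \<le> (\<Sum>j<k. c + 7) + (k + 1) * (1 + bcost (WLess (Var i) e))" for t
    proof (rule post)
      have "k = N" using that I by simp
      then show "I N s'" "wmem s' i 0 = int N" using I by auto
      show "3 + t \<le> N * (c + wcost e + 20) + wcost e + 20" using that(2) \<open>k = N\<close> by (simp add: algebra_simps)
    qed (use fw' fn' in auto)
    show "\<exists>v. beval m s' (WLess (Var i) e) = Some v \<and>
          (v \<longrightarrow> k < N \<and> wp m (Seq body (Assign i (Padd (Var i) (WConst 1))))
             (\<lambda>t s''. t \<le> c + 7 \<and> (Suc k \<le> N \<and> wmem s'' i 0 = int (Suc k) \<and> I (Suc k) s'')) s') \<and>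
          (\<not> v \<longrightarrow> (\<forall>t. t \<le> (\<Sum>j<k. c + 7) + (k + 1) * (1 + bcost (WLess (Var i) e)) \<longrightarrow> Q (3 + t) s'))"
      using b t f by blast
  qed
  then show ?thesis unfolding For_def wp_Seq using c01 by (simp add: numeral_3_eq_3)
qed

section \<open>Running a program under a clock in a separate part of memory\<close>

fun wshift :: "wexp \<Rightarrow> wexp" where
  "wshift (WConst v) = WConst v"
| "wshift (WLoad a e) = WLoad (a + 100) (wshift e)"
| "wshift (WArith f d e) = WArith f (wshift d) (wshift e)"
| "wshift (WMod d e) = WMod (wshift d) (wshift e)"

fun nshift :: "nexp \<Rightarrow> nexp" where
  "nshift (NWord e) = NWord (wshift e)"
| "nshift NInfinity = NInfinity"
| "nshift (NLoad a e) = NLoad (a + 100) (wshift e)"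
| "nshift (NArith f d e) = NArith f (nshift d) (nshift e)"

fun bshift :: "bexp \<Rightarrow> bexp" where
  "bshift (WLess d e) = WLess (wshift d) (wshift e)"
| "bshift (NLess d e) = NLess (nshift d) (nshift e)"
| "bshift (Neg b) = Neg (bshift b)"
| "bshift (Conj b c) = Conj (bshift b) (bshift c)"

definition tick :: "nat \<Rightarrow> com" where
  "tick c = Assign 99 (Padd (Var 99) (WConst (int c)))"

lemma mods_tick [simp]: "wmods (tick c) = {99}" "nmods (tick c) = {}"
  by (simp_all add: tick_def)

text \<open>All arrays of the program move up by 100, and array 99 accumulates the cost that the
  original program would have had. A loop charges every successful test inside its body and the
  failing test after the loop.\<close>

fun clocked :: "com \<Rightarrow> com" where
  "clocked Skip = tick 1"
| "clocked (WStore a i e) = Seq (WStore (a + 100) (wshift i) (wshift e)) (tick (1 + wcost i + wcost e))"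
| "clocked (NStore a i e) = Seq (NStore (a + 100) (wshift i) (nshift e)) (tick (1 + wcost i + ncost e))"
| "clocked (Seq p q) = Seq (clocked p) (clocked q)"
| "clocked (Cond b p q) = Cond (bshift b) (Seq (tick (1 + bcost b)) (clocked p)) (Seq (tick (1 + bcost b)) (clocked q))"
| "clocked (While b p) = Seq (While (bshift b) (Seq (tick (1 + bcost b)) (clocked p))) (tick (1 + bcost b))"

definition shifted :: "state \<Rightarrow> state" where
  "shifted s = \<lparr>wmem = \<lambda>a. wmem s (a + 100), nmem = \<lambda>a. nmem s (a + 100)\<rparr>"

lemma shift_eval:
  "weval m s (wshift e) = weval m (shifted s) e"
  "neval m s (nshift d) = neval m (shifted s) d"
  "beval m s (bshift b) = beval m (shifted s) b"
proof -
  show w: "weval m s (wshift e) = weval m (shifted s) e" for e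
    by (induction e) (auto simp: shifted_def)
  show n: "neval m s (nshift d) = neval m (shifted s) d" for d
    by (induction d) (auto simp: w, auto simp: shifted_def)
  show "beval m s (bshift b) = beval m (shifted s) b"
    by (induction b) (auto simp: w n)
qed

lemma shift_cost [simp]: "wcost (wshift e) = wcost e" "ncost (nshift d) = ncost d" "bcost (bshift b) = bcost b"
proof -
  show w: "wcost (wshift e) = wcost e" for e by (induction e) auto
  show n: "ncost (nshift d) = ncost d" for d by (induction d) (auto simp: w)
  show "bcost (bshift b) = bcost b" by (induction b) (auto simp: w n)
qed

lemma shifted_upd [simp]:
  "shifted (wupd (a + 100) x v s) = wupd a x v (shifted s)"
  "shifted (nupd (a + 100) x y s) = nupd a x y (shifted s)"
  "shifted (wupd 99 x v s) = shifted s"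
  by (auto simp: shifted_def wupd_def nupd_def)

lemma mods_clocked: "wmods (clocked p) \<subseteq> insert 99 {100..}" "nmods (clocked p) \<subseteq> {100..}"
  by (induction p) auto

text \<open>A tick costs 6 and charges at least 1, so the clock slows a program down by a factor of
  at most 7. The final value of the clock has to be representable; it then bounds all intermediate
  values.\<close>

definition clock_run :: "machine \<Rightarrow> com \<Rightarrow> state \<Rightarrow> nat \<Rightarrow> state \<Rightarrow> bool" where
  "clock_run m p s t s0' \<longleftrightarrow> (0 \<le> wmem s 99 0 \<longrightarrow> real_of_int (wmem s 99 0 + int t) \<le> wmax m \<longrightarrow>
     wp m p (\<lambda>t' s'. t' \<le> 7 * t \<and> shifted s' = s0' \<and> wmem s' 99 0 = wmem s 99 0 + int t) s)"

lemma wp_tick: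
  assumes "0 \<le> wmem s 99 0" "real_of_int (wmem s 99 0 + int c) \<le> wmax m"
  shows "wp m (tick c) Q s \<longleftrightarrow> Q 6 (wupd 99 0 (wmem s 99 0 + int c) s)"
  using assms by (simp add: tick_def word_def eval_nat_numeral)

text \<open>Consumes a single test of the loop; used where the induction follows a given execution
  instead of an invariant.\<close>

lemma wp_While_unfold:
  "wp m (While b p) Q s \<longleftrightarrow> (\<exists>v. beval m s b = Some v \<and>
     (if v then wp m p (\<lambda>t s'. wp m (While b p) (\<lambda>t'. Q (1 + bcost b + t + t')) s') s else Q (1 + bcost b) s))"
  (is "?l \<longleftrightarrow> ?r")
proof
  assume ?l
  then obtain t s' where e: "exec m (While b p) s t s'" and q: "Q t s'" unfolding wp_def by blast
  from e show ?r
  proof (rule WhileE)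
    fix t1 s1 t2 assume "t = Suc (bcost b + t1 + t2)" "beval m s b = Some True" "exec m p s t1 s1" "exec m (While b p) s1 t2 s'"
    with q show ?r unfolding wp_def by auto
  qed (use q in auto)
next
  assume ?r
  then obtain v where v: "beval m s b = Some v" and
    r: "if v then wp m p (\<lambda>t s'. wp m (While b p) (\<lambda>t'. Q (1 + bcost b + t + t')) s') s else Q (1 + bcost b) s"
    by blast
  show ?l
  proof (cases v)
    case True
    then obtain t1 s1 t2 s2 where 1: "exec m p s t1 s1" "exec m (While b p) s1 t2 s2" "Q (1 + bcost b + t1 + t2) s2"
      using r unfolding wp_def by auto
    then have "exec m (While b p) s (1 + bcost b + t1 + t2) s2" using exec.WhileTrue[OF _ 1(1,2)] v True by simp
    then show ?thesis using 1(3) unfolding wp_def by blast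
  next
    case False
    then show ?thesis using v r unfolding wp_def by (metis exec.WhileFalse)
  qed
qed

text \<open>Induction on the execution of the original program. The clock may start at any
  nonnegative value, so the charges of successive parts add up.\<close>

lemma clocked_run:
  "exec m p s0 t s0' \<Longrightarrow> shifted s = s0 \<Longrightarrow> clock_run m (clocked p) s t s0'"
proof (induction arbitrary: s rule: exec.induct)
  case (Skip s0)
  then show ?case unfolding clock_run_def clocked.simps
    by (intro impI) (subst wp_tick, simp_all)
next
  case (WStore s0 i x e v a)
  let ?s = "wupd (a + 100) x v s" and ?c = "1 + wcost i + wcost e"
  have "wp m (tick ?c) (\<lambda>t' s'. 1 + wcost i + wcost e + t' \<le> 7 * ?c \<and> shifted s' = wupd a x v s0 \<and>
      wmem s' 99 0 = wmem s 99 0 + int ?c) ?s"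
    if "0 \<le> wmem s 99 0" "real_of_int (wmem s 99 0 + int ?c) \<le> wmax m"
    using that WStore.prems by (subst wp_tick) (simp_all del: of_nat_add of_nat_Suc)
  then show ?case using WStore
    by (simp add: clock_run_def shift_eval wupd_def[symmetric])
next
  case (NStore s0 i x e v a)
  let ?s = "nupd (a + 100) x v s" and ?c = "1 + wcost i + ncost e"
  have "wp m (tick ?c) (\<lambda>t' s'. 1 + wcost i + ncost e + t' \<le> 7 * ?c \<and> shifted s' = nupd a x v s0 \<and>
      wmem s' 99 0 = wmem s 99 0 + int ?c) ?s"
    if "0 \<le> wmem s 99 0" "real_of_int (wmem s 99 0 + int ?c) \<le> wmax m"
    using that NStore.prems by (subst wp_tick) (simp_all del: of_nat_add of_nat_Suc)
  then show ?case using NStore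
    by (simp add: clock_run_def shift_eval nupd_def[symmetric])
next
  case (Seq p s0 t s0' q t' s0'')
  show ?case unfolding clock_run_def clocked.simps wp_Seq
  proof (intro impI)
    assume a: "0 \<le> wmem s 99 0" "real_of_int (wmem s 99 0 + int (t + t')) \<le> wmax m"
    then have "wp m (clocked p) (\<lambda>t'' s'. t'' \<le> 7 * t \<and> shifted s' = s0' \<and> wmem s' 99 0 = wmem s 99 0 + int t) s"
      using Seq.IH(1)[OF Seq.prems] unfolding clock_run_def by simp
    then show "wp m (clocked p) (\<lambda>u s'. wp m (clocked q) (\<lambda>u' s''. u + u' \<le> 7 * (t + t') \<and>
       shifted s'' = s0'' \<and> wmem s'' 99 0 = wmem s 99 0 + int (t + t')) s') s"
    proof (rule wp_mono, elim conjE)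
      fix u s' assume b: "u \<le> 7 * t" "shifted s' = s0'" "wmem s' 99 0 = wmem s 99 0 + int t"
      then have "wp m (clocked q) (\<lambda>t'' s''. t'' \<le> 7 * t' \<and> shifted s'' = s0'' \<and> wmem s'' 99 0 = wmem s' 99 0 + int t') s'"
        using Seq.IH(2)[OF b(2)] a unfolding clock_run_def by simp
      then show "wp m (clocked q) (\<lambda>u' s''. u + u' \<le> 7 * (t + t') \<and>
       shifted s'' = s0'' \<and> wmem s'' 99 0 = wmem s 99 0 + int (t + t')) s'"
        by (rule wp_mono) (use b in auto)
    qed
  qed
next
  case (CondTrue s0 b p t s0' q)
  have *: "clock_run m (clocked p) (wupd 99 0 (wmem s 99 0 + int (1 + bcost b)) s) t s0'"
    using CondTrue by simp
  show ?case unfolding clock_run_def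
  proof (intro impI)
    assume a: "0 \<le> wmem s 99 0" "real_of_int (wmem s 99 0 + int (1 + bcost b + t)) \<le> wmax m"
    then have "wp m (clocked p) (\<lambda>t' s'. t' \<le> 7 * t \<and> shifted s' = s0' \<and>
        wmem s' 99 0 = wmem s 99 0 + int (1 + bcost b + t)) (wupd 99 0 (wmem s 99 0 + int (1 + bcost b)) s)"
      using * unfolding clock_run_def by (simp add: add.assoc)
    then have "wp m (Seq (tick (1 + bcost b)) (clocked p)) (\<lambda>t' s'. 1 + bcost b + t' \<le> 7 * (1 + bcost b + t) \<and>
        shifted s' = s0' \<and> wmem s' 99 0 = wmem s 99 0 + int (1 + bcost b + t)) s"
      unfolding wp_Seq by (subst wp_tick) (use a in \<open>auto elim!: wp_mono\<close>)
    then show "wp m (clocked (Cond b p q)) (\<lambda>t' s'. t' \<le> 7 * (1 + bcost b + t) \<and>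
        shifted s' = s0' \<and> wmem s' 99 0 = wmem s 99 0 + int (1 + bcost b + t)) s"
      using CondTrue.hyps(1) CondTrue.prems by (simp only: clocked.simps wp_Cond shift_eval shift_cost) simp
  qed
next
  case (CondFalse s0 b q t s0' p)
  have *: "clock_run m (clocked q) (wupd 99 0 (wmem s 99 0 + int (1 + bcost b)) s) t s0'"
    using CondFalse by simp
  show ?case unfolding clock_run_def
  proof (intro impI)
    assume a: "0 \<le> wmem s 99 0" "real_of_int (wmem s 99 0 + int (1 + bcost b + t)) \<le> wmax m"
    then have "wp m (clocked q) (\<lambda>t' s'. t' \<le> 7 * t \<and> shifted s' = s0' \<and>
        wmem s' 99 0 = wmem s 99 0 + int (1 + bcost b + t)) (wupd 99 0 (wmem s 99 0 + int (1 + bcost b)) s)"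
      using * unfolding clock_run_def by (simp add: add.assoc)
    then have "wp m (Seq (tick (1 + bcost b)) (clocked q)) (\<lambda>t' s'. 1 + bcost b + t' \<le> 7 * (1 + bcost b + t) \<and>
        shifted s' = s0' \<and> wmem s' 99 0 = wmem s 99 0 + int (1 + bcost b + t)) s"
      unfolding wp_Seq by (subst wp_tick) (use a in \<open>auto elim!: wp_mono\<close>)
    then show "wp m (clocked (Cond b p q)) (\<lambda>t' s'. t' \<le> 7 * (1 + bcost b + t) \<and>
        shifted s' = s0' \<and> wmem s' 99 0 = wmem s 99 0 + int (1 + bcost b + t)) s"
      using CondFalse.hyps(1) CondFalse.prems by (simp only: clocked.simps wp_Cond shift_eval shift_cost) simp
  qed
next
  case (WhileTrue s0 b p t s0' t' s0'')
  have 1: "clock_run m (clocked p) (wupd 99 0 (wmem s 99 0 + int (1 + bcost b)) s) t s0'"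
    using WhileTrue by simp
  let ?body = "Seq (tick (1 + bcost b)) (clocked p)"
  let ?Q = "\<lambda>u s''. u \<le> 7 * (1 + bcost b + t + t') \<and> shifted s'' = s0'' \<and>
        wmem s'' 99 0 = wmem s 99 0 + int (1 + bcost b + t + t')"
  show ?case unfolding clock_run_def 
  proof (intro impI)
    assume a: "0 \<le> wmem s 99 0" "real_of_int (wmem s 99 0 + int (1 + bcost b + t + t')) \<le> wmax m"
    have "wp m (clocked p) (\<lambda>u s'. u \<le> 7 * t \<and> shifted s' = s0' \<and>
       wmem s' 99 0 = wmem s 99 0 + int (1 + bcost b + t)) (wupd 99 0 (wmem s 99 0 + int (1 + bcost b)) s)"
      using 1 a unfolding clock_run_def by (auto simp: add.assoc)
    then have "wp m ?body (\<lambda>u s'. u \<le> 7 * t + 6 \<and> shifted s' = s0' \<and>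
       wmem s' 99 0 = wmem s 99 0 + int (1 + bcost b + t)) s"
      unfolding wp_Seq by (subst wp_tick) (use a in \<open>auto elim!: wp_mono\<close>)
    then have "wp m ?body (\<lambda>u s'. wp m (clocked (While b p)) (\<lambda>u'. ?Q (1 + bcost b + u + u')) s') s"
    proof (rule wp_mono, elim conjE)
      fix u s' assume b: "u \<le> 7 * t + 6" "shifted s' = s0'" "wmem s' 99 0 = wmem s 99 0 + int (1 + bcost b + t)"
      have "wp m (clocked (While b p)) (\<lambda>u s''. u \<le> 7 * t' \<and> shifted s'' = s0'' \<and> wmem s'' 99 0 = wmem s' 99 0 + int t') s'"
        using WhileTrue.IH(2)[OF b(2)] a b unfolding clock_run_def by (simp del: clocked.simps add: add.assoc)
      then show "wp m (clocked (While b p)) (\<lambda>u'. ?Q (1 + bcost b + u + u')) s'"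
        by (rule wp_mono) (use b in auto)
    qed
    moreover have "beval m s (bshift b) = Some True" using WhileTrue.hyps(1) WhileTrue.prems by (simp add: shift_eval)
    ultimately show "wp m (clocked (While b p)) ?Q s"
      unfolding clocked.simps(6) wp_Seq[of m "While _ _"] wp_While_unfold[of m _ _ _ s]
      by (simp only: option.inject simp_thms if_True ex_simps shift_cost add.assoc) auto
  qed
next
  case (WhileFalse s0 b p)
  let ?Q = "\<lambda>u s''. u \<le> 7 * (1 + bcost b) \<and> shifted s'' = s0 \<and>
        wmem s'' 99 0 = wmem s 99 0 + int (1 + bcost b)"
  show ?case unfolding clock_run_def
  proof (intro impI)
    assume a: "0 \<le> wmem s 99 0" "real_of_int (wmem s 99 0 + int (1 + bcost b)) \<le> wmax m"
    have "wp m (tick (1 + bcost b)) (\<lambda>u. ?Q (1 + bcost b + u)) s"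
      by (subst wp_tick) (use a WhileFalse.prems in auto)
    moreover have "beval m s (bshift b) = Some False" using WhileFalse.hyps(1) WhileFalse.prems by (simp add: shift_eval)
    ultimately show "wp m (clocked (While b p)) ?Q s"
      unfolding clocked.simps(6) wp_Seq[of m "While _ _"] wp_While_unfold[of m _ _ _ s] by auto
  qed
qed

section \<open>Range checks for word arithmetic\<close>

definition szn :: "nat \<Rightarrow> nat \<Rightarrow> nat \<Rightarrow> bool" where
  "szn Y j a \<longleftrightarrow> a \<le> Y ^ 2 ^ j"

text \<open>The exponent 64 is 2^6: an expression of depth at most 6 over values up to Y stays
  within Y^64. The iterated \<open>Suc\<close> in \<open>word_szn\<close> lets the simplifier count
  this depth while it applies \<open>szn_mult\<close> and \<open>szn_add\<close>.\<close>

locale bounded_machine =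
  fixes m :: machine and Y :: nat
  assumes Y_ge: "16 \<le> Y" and Y_wmax: "real Y ^ 64 \<le> wmax m"
begin

lemma szn_leaf: "a \<le> Y \<Longrightarrow> szn Y j a"
  using Y_ge self_le_power[of Y "2 ^ j"] unfolding szn_def by simp

lemma szn_mult: "szn Y j a \<Longrightarrow> szn Y j b \<Longrightarrow> szn Y (Suc j) (a * b)"
  unfolding szn_def by (simp add: mult_mono power_mult power2_eq_square mult.commute[of 2])

lemma szn_add: "szn Y j a \<Longrightarrow> szn Y j b \<Longrightarrow> szn Y (Suc j) (a + b)"
proof -
  assume "szn Y j a" "szn Y j b"
  then have "a + b \<le> 2 * Y ^ 2 ^ j" unfolding szn_def by simp
  also have "\<dots> \<le> Y ^ 2 ^ j * Y ^ 2 ^ j"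
    using Y_ge self_le_power[of Y "2 ^ j"] by (intro mult_right_mono) auto
  finally show ?thesis unfolding szn_def by (simp add: power_mult power2_eq_square mult.commute[of 2])
qed

lemma szn_Suc: "szn Y j a \<Longrightarrow> szn Y (Suc j) (Suc a)"
  using szn_add[of j a 1] szn_leaf[of 1 j] Y_ge by simp

lemma szn_sub: "szn Y j a \<Longrightarrow> szn Y j (a - b)"
  unfolding szn_def by simp

lemma szn_div: "szn Y j a \<Longrightarrow> szn Y j (a div b)"
  unfolding szn_def by (meson div_le_dividend le_trans)

lemma szn_mod: "szn Y j a \<Longrightarrow> szn Y j (a mod b)"
  unfolding szn_def by (meson mod_less_eq_dividend le_trans)

lemma word_szn: "szn Y (Suc (Suc (Suc (Suc (Suc (Suc 0)))))) a \<Longrightarrow> word m (int a) = Some (int a)"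
proof -
  assume "szn Y (Suc (Suc (Suc (Suc (Suc (Suc 0)))))) a"
  then have "a \<le> Y ^ 64" unfolding szn_def by (simp add: eval_nat_numeral)
  then have "real a \<le> real Y ^ 64" by (metis of_nat_le_iff of_nat_power)
  with Y_wmax have "real a \<le> wmax m" by linarith
  then show ?thesis by (simp add: word_def)
qed

lemma wmax_Y: "a \<le> Y \<Longrightarrow> real a + 1 \<le> wmax m"
proof -
  assume a: "a \<le> Y"
  have "real a + 1 \<le> 2 * real Y" using a Y_ge by linarith
  also have "\<dots> \<le> real Y ^ 2" unfolding power2_eq_square using Y_ge by (intro mult_right_mono) auto
  also have "\<dots> \<le> real Y ^ 64" using Y_ge by (intro power_increasing) auto
  finally show ?thesis using Y_wmax by simp
qed

lemma word_const:
  "word m 0 = Some 0" "word m 1 = Some 1" "word m 2 = Some 2" "word m 4 = Some 4" "word m 8 = Some 8"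
  using wmax_Y[of Y] Y_ge by (auto simp: word_def)

lemmas sz = szn_leaf szn_mult szn_add szn_Suc szn_sub szn_div szn_mod word_szn word_const

end

text \<open>Moves \<open>int\<close> outwards, so that a word expression becomes the image of one
  natural number, to which the size rules apply. Subtraction carries a side condition because it
  truncates on natural numbers.\<close>

lemma nf:
  "int a + int b = int (a + b)" "int a * int b = int (a * b)"
  "int a div int b = int (a div b)" "int a mod int b = int (a mod b)"
  "int a + 1 = int (Suc a)" "1 + int a = int (Suc a)"
  "numeral w * int a = int (numeral w * a)" "int a * numeral w = int (a * numeral w)"
  "int a + numeral w = int (a + numeral w)" "numeral w + int a = int (numeral w + a)"
  "int a div numeral w = int (a div numeral w)" "int a mod numeral w = int (a mod numeral w)"
  "b \<le> a \<Longrightarrow> int a - int b = int (a - b)" "1 \<le> a \<Longrightarrow> int a - 1 = int (a - 1)"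
  by (simp_all add: zdiv_int zmod_int of_nat_diff)

section \<open>Merge sort\<close>

declare of_nat_add [simp del] of_nat_mult [simp del] of_nat_Suc [simp del]

text \<open>State of a bottom-up merge pass after x positions have been written. The current pair of
  runs is [b, d) and [d, e), read up to i and j; \<open>i + j = x + d\<close> says that as many
  entries were read as written. E is the input, T the output and v the key. By the last clause
  everything written for this pair is at most everything still unread in it.\<close>

definition merge_inv ::
  "(nat \<Rightarrow> int) \<Rightarrow> (nat \<Rightarrow> int) \<Rightarrow> (int \<Rightarrow> ereal) \<Rightarrow> nat \<Rightarrow> nat \<Rightarrow> nat \<Rightarrow> nat \<Rightarrow> nat \<Rightarrow> nat \<Rightarrow> nat \<Rightarrow> nat \<Rightarrow> bool" where
  "merge_inv E T v L w x i d j e b \<longleftrightarrow>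
     2 * w dvd b \<and> b \<le> i \<and> i \<le> d \<and> d \<le> j \<and> j \<le> e \<and> e \<le> L \<and> d \<le> b + w \<and> e \<le> b + 2 * w \<and>
     (d = b + w \<or> d = e) \<and> (2 * w dvd e \<or> e = L) \<and> i + j = x + d \<and>
     T ` {..<x} = E ` ({..<i} \<union> {d..<j}) \<and>
     (\<forall>y z. y < z \<and> z < x \<and> y div (2 * w) = z div (2 * w) \<longrightarrow> v (T y) \<le> v (T z)) \<and>
     (\<forall>y z. b \<le> y \<and> y < x \<and> (i \<le> z \<and> z < d \<or> j \<le> z \<and> z < e) \<longrightarrow> v (T y) \<le> v (E z))"

definition block_sorted :: "(nat \<Rightarrow> int) \<Rightarrow> (int \<Rightarrow> ereal) \<Rightarrow> nat \<Rightarrow> nat \<Rightarrow> bool" where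
  "block_sorted E v L w \<longleftrightarrow> (\<forall>y z. y < z \<and> z < L \<and> y div w = z div w \<longrightarrow> v (E y) \<le> v (E z))"

lemma merge_inv_init: "merge_inv E T v L w 0 0 0 0 0 0"
  by (simp add: merge_inv_def)

text \<open>When a pair is exhausted the next one starts at x. Clipping at L covers a right run that
  is missing or too short.\<close>

lemma merge_inv_reset:
  assumes "merge_inv E T v L w x i d j e b" "\<not> x < e" "x < L"
  shows "merge_inv E T v L w x x (min (x + w) L) (min (x + w) L) (min (x + 2 * w) L) x"
    and "x < min (x + 2 * w) L \<or> w = 0"
proof -
  note a = assms[unfolded merge_inv_def]
  have e: "x = e" "i = d" "j = e" using a by auto
  have im: "{..<d} \<union> {d..<e} = {..<e}" using a by auto
  have "2 * w dvd x" using a e by auto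
  then show "merge_inv E T v L w x x (min (x + w) L) (min (x + w) L) (min (x + 2 * w) L) x"
    using a e im unfolding merge_inv_def by (auto simp: min_def)
  show "x < min (x + 2 * w) L \<or> w = 0" using assms by auto
qed

lemma div_block: "q dvd b \<Longrightarrow> b \<le> x \<Longrightarrow> x < b + q \<Longrightarrow> x div q = b div (q::nat)"
  by (metis dvd_div_mult_self div_nat_eqI mult.commute mult_Suc_right add.commute)

text \<open>Each run is an aligned block of length w and therefore sorted, so the smaller of the two
  heads is a lower bound for all unread entries of the pair. This is what the last clause of the
  invariant needs.\<close>

lemma merge_inv_left:
  assumes a: "merge_inv E T v L w x i d j e b" and bs: "block_sorted E v L w" and x: "x < e"
    and i: "i < d" and le: "j < e \<Longrightarrow> v (E i) \<le> v (E j)"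
    and T': "T' x = E i" "\<And>y. y < x \<Longrightarrow> T' y = T y"
  shows "merge_inv E T' v L w (Suc x) (Suc i) d j e b"
proof -
  note A = a[unfolded merge_inv_def]
  have Le: "v (E i) \<le> v (E z)" if "i \<le> z \<and> z < d \<or> j \<le> z \<and> z < e" for z
  proof -
    have wb: "w dvd b" using A by (meson dvd_mult_left dvd_trans dvd_triv_right)
    show ?thesis
    proof (cases "z < d \<and> i \<le> z")
      case True
      then have "z div w = i div w" using div_block[OF wb, of z] div_block[OF wb, of i] A i by auto
      then show ?thesis using bs True A unfolding block_sorted_def by (cases "z = i") auto
    next
      case False
      then have z: "j \<le> z" "z < e" using that by auto
      then have "d = b + w" using A by auto
      then have "z div w = j div w" using div_block[of w "b + w" z] div_block[of w "b + w" j] A z wb by auto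
      then have "v (E j) \<le> v (E z)" using bs z A unfolding block_sorted_def by (cases "z = j") auto
      then show ?thesis using le z by auto
    qed
  qed
  have img: "T' ` {..<Suc x} = E ` ({..<Suc i} \<union> {d..<j})"
  proof -
    have "T' ` {..<Suc x} = insert (E i) (T ` {..<x})" using T' by (auto simp: lessThan_Suc)
    also have "\<dots> = E ` ({..<Suc i} \<union> {d..<j})" using A by (auto simp: lessThan_Suc)
    finally show ?thesis .
  qed
  have srt: "v (T' y) \<le> v (T' z)" if "y < z" "z < Suc x" "y div (2 * w) = z div (2 * w)" for y z
  proof (cases "z = x")
    case True
    have "x div (2 * w) = b div (2 * w)" using A x i by (intro div_block) auto
    then have "y \<ge> b" using that True A 
      by (metis div_times_less_eq_dividend dvd_div_mult_self)
    then show ?thesis using True that T' A i by auto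
  next
    case False
    then show ?thesis using that T' A by auto
  qed
  show ?thesis unfolding merge_inv_def
    using A i x img srt T' Le by (auto simp: less_Suc_eq)
qed

lemma merge_inv_right:
  assumes a: "merge_inv E T v L w x i d j e b" and bs: "block_sorted E v L w" and x: "x < e"
    and le: "i < d \<Longrightarrow> j < e \<and> v (E j) \<le> v (E i)"
    and T': "T' x = E j" "\<And>y. y < x \<Longrightarrow> T' y = T y"
  shows "merge_inv E T' v L w (Suc x) i d (Suc j) e b"
proof -
  note A = a[unfolded merge_inv_def]
  have j: "j < e" using le A x by (cases "i < d") auto
  have Le: "v (E j) \<le> v (E z)" if "i \<le> z \<and> z < d \<or> j \<le> z \<and> z < e" for z
  proof -
    have wb: "w dvd b" using A by (meson dvd_mult_left dvd_trans dvd_triv_right)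
    show ?thesis
    proof (cases "z < d \<and> i \<le> z")
      case True
      then have "z div w = i div w" using div_block[OF wb, of z] div_block[OF wb, of i] A by auto
      then have "v (E i) \<le> v (E z)" using bs True A unfolding block_sorted_def by (cases "z = i") auto
      then show ?thesis using le True by auto
    next
      case False
      then have z: "j \<le> z" "z < e" using that by auto
      then have "d = b + w" using A by auto
      then have "z div w = j div w" using div_block[of w "b + w" z] div_block[of w "b + w" j] A z wb by auto
      then show "v (E j) \<le> v (E z)" using bs z A unfolding block_sorted_def by (cases "z = j") auto
    qed
  qed
  have img: "T' ` {..<Suc x} = E ` ({..<i} \<union> {d..<Suc j})"
  proof -
    have "T' ` {..<Suc x} = insert (E j) (T ` {..<x})" using T' by (auto simp: lessThan_Suc)
    also have "\<dots> = E ` ({..<i} \<union> {d..<Suc j})" using A by (auto simp: atLeastLessThanSuc)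
    finally show ?thesis .
  qed
  have srt: "v (T' y) \<le> v (T' z)" if "y < z" "z < Suc x" "y div (2 * w) = z div (2 * w)" for y z
  proof (cases "z = x")
    case True
    have "x div (2 * w) = b div (2 * w)" using A x by (intro div_block) auto
    then have "y \<ge> b" using that True A 
      by (metis div_times_less_eq_dividend dvd_div_mult_self)
    then show ?thesis using True that T' A j by auto
  next
    case False
    then show ?thesis using that T' A by auto
  qed
  show ?thesis unfolding merge_inv_def
    using A j x img srt T' Le by (auto simp: less_Suc_eq)
qed

lemma merge_inv_final:
  assumes "merge_inv E T v L w L i d j e b"
  shows "T ` {..<L} = E ` {..<L}" "block_sorted T v L (2 * w)"
proof -
  note A = assms[unfolded merge_inv_def]
  have "e = L" "i = d" "j = L" using A by auto
  moreover have "{..<d} \<union> {d..<L} = {..<L}" using A by auto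
  ultimately show "T ` {..<L} = E ` {..<L}" using A by auto
  show "block_sorted T v L (2 * w)" using A unfolding block_sorted_def by blast
qed

text \<open>Writes exactly one position and opens the next pair of runs on demand. A pass is thereby
  one counted loop of L steps, without nested loops over the runs.\<close>

definition merge_step :: com where
  "merge_step =
    Seq (Cond (WLess (Var 13) (Var 17)) Skip
      (Seq (Assign 18 (Var 13)) (Seq (Assign 14 (Var 13))
      (Seq (Cond (WLess (Var 7) (Padd (Var 13) (Var 12))) (Assign 15 (Var 7)) (Assign 15 (Padd (Var 13) (Var 12))))
      (Seq (Assign 16 (Var 15))
        (Cond (WLess (Var 7) (Padd (Var 13) (Pmul (WConst 2) (Var 12)))) (Assign 17 (Var 7))
          (Assign 17 (Padd (Var 13) (Pmul (WConst 2) (Var 12))))))))))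
    (Cond (Conj (WLess (Var 14) (Var 15))
           (Neg (Conj (WLess (Var 16) (Var 17))
             (NLess (NLoad 5 (WLoad 10 (Var 16))) (NLoad 5 (WLoad 10 (Var 14)))))))
      (Seq (WStore 11 (Var 13) (WLoad 10 (Var 14))) (Assign 14 (Padd (Var 14) (WConst 1))))
      (Seq (WStore 11 (Var 13) (WLoad 10 (Var 16))) (Assign 16 (Padd (Var 16) (WConst 1)))))"

definition merge_pass :: com where
  "merge_pass =
    Seq (Assign 14 (WConst 0)) (Seq (Assign 15 (WConst 0)) (Seq (Assign 16 (WConst 0))
    (Seq (Assign 17 (WConst 0)) (Seq (Assign 18 (WConst 0))
    (Seq (For 13 (Var 7) merge_step)
    (Seq (For 19 (Var 7) (WStore 10 (Var 19) (WLoad 11 (Var 19))))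
      (Assign 12 (Pmul (WConst 2) (Var 12)))))))))"

definition merge_sort :: com where
  "merge_sort = Seq (Assign 12 (WConst 1)) (While (WLess (Var 12) (Var 7)) merge_pass)"

lemma mods_merge_step [simp]: "wmods merge_step = {11,14,15,16,17,18}" "nmods merge_step = {}"
  by (auto simp: merge_step_def)

lemma mods_merge_pass [simp]: "wmods merge_pass = {10,11,12,13,14,15,16,17,18,19}" "nmods merge_pass = {}"
  by (auto simp: merge_pass_def)

lemma mods_merge_sort [simp]: "wmods merge_sort = {10,11,12,13,14,15,16,17,18,19}" "nmods merge_sort = {}"
  by (auto simp: merge_sort_def)

context bounded_machine begin

lemma wp_Assign:
  assumes "weval m s e = Some v" "wp m q (\<lambda>t. Q (2 + wcost e + t)) (wupd a 0 v s)"
  shows "wp m (Seq (Assign a e) q) Q s"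
  using assms by (simp add: sz)

lemma merge_step_wp:
  fixes x w L i d j e b :: nat
  assumes bs: "block_sorted E v L w" and Y: "3 * L \<le> Y" and w: "0 < w" "w < L" and x: "x < L"
    and E: "\<And>y. wmem s 10 (int y) = E y" and v: "\<And>y. nmem s 5 y = v y"
    and sc: "wmem s 7 0 = int L" "wmem s 12 0 = int w" "wmem s 13 0 = int x"
      "wmem s 14 0 = int i" "wmem s 15 0 = int d" "wmem s 16 0 = int j" "wmem s 17 0 = int e" "wmem s 18 0 = int b"
    and inv: "merge_inv E (\<lambda>y. wmem s 11 (int y)) v L w x i d j e b"
  shows "wp m merge_step (\<lambda>t s'. t \<le> 120 \<and> wmem s' 13 0 = int x \<and>
     (\<exists>i d j e b. wmem s' 14 0 = int i \<and> wmem s' 15 0 = int d \<and> wmem s' 16 0 = int j \<and>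
        wmem s' 17 0 = int e \<and> wmem s' 18 0 = int b \<and>
        merge_inv E (\<lambda>y. wmem s' 11 (int y)) v L w (Suc x) i d j e b)) s"
proof -
  define A where "A = Cond (WLess (Var 13) (Var 17)) Skip
      (Seq (Assign 18 (Var 13)) (Seq (Assign 14 (Var 13))
      (Seq (Cond (WLess (Var 7) (Padd (Var 13) (Var 12))) (Assign 15 (Var 7)) (Assign 15 (Padd (Var 13) (Var 12))))
      (Seq (Assign 16 (Var 15))
        (Cond (WLess (Var 7) (Padd (Var 13) (Pmul (WConst 2) (Var 12)))) (Assign 17 (Var 7))
          (Assign 17 (Padd (Var 13) (Pmul (WConst 2) (Var 12)))))))))"
  let ?R = "\<lambda>t s'. t \<le> 70 \<and> (\<exists>i d j e b. wmem s' 14 0 = int i \<and> wmem s' 15 0 = int d \<and> wmem s' 16 0 = int j \<and>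
        wmem s' 17 0 = int e \<and> wmem s' 18 0 = int b \<and> x < e \<and>
        merge_inv E (\<lambda>y. wmem s' 11 (int y)) v L w x i d j e b)"
  have le: "i \<le> Y" "j \<le> Y" "x + 2 * w \<le> Y" "e \<le> Y" using inv Y x w unfolding merge_inv_def by auto
  have "wp m A ?R s"
  proof (cases "x < e")
    case True
    then show ?thesis using sc inv by (auto simp: A_def sz)
  next
    case False
    note r = merge_inv_reset[OF inv False x]
    have r': "merge_inv E (\<lambda>y. wmem s 11 (int y)) v L w x x (if L < x + w then L else x + w) (if L < x + w then L else x + w) 
        (if L < x + 2 * w then L else x + 2 * w) x"
      "x < (if L < x + 2 * w then L else x + 2 * w)" using r w by (auto simp: min_def split: if_splits)
    show ?thesis unfolding A_def using sc False le r'
      by (auto simp: sz nf)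
  qed
  then have "wp m A (\<lambda>t s'. ?R t s' \<and> (\<forall>a. a \<notin> {14,15,16,17,18} \<longrightarrow> wmem s' a = wmem s a) \<and> (\<forall>a. nmem s' a = nmem s a)) s"
    by (rule wp_frame) (auto simp: A_def)
  then show ?thesis unfolding merge_step_def A_def[symmetric] wp_Seq[of m A]
  proof (rule wp_mono, elim conjE exE)
    fix t :: nat and s' :: state and i d j e b :: nat
    assume t: "t \<le> 70" and fr: "\<forall>a. a \<notin> {14,15,16,17,18} \<longrightarrow> wmem s' a = wmem s a" "\<forall>a. nmem s' a = nmem s a"
      and sc': "wmem s' 14 0 = int i" "wmem s' 15 0 = int d" "wmem s' 16 0 = int j"
        "wmem s' 17 0 = int e" "wmem s' 18 0 = int b" and xe: "x < e"
      and inv': "merge_inv E (\<lambda>y. wmem s' 11 (int y)) v L w x i d j e b"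
    have le: "i \<le> Y" "j \<le> Y" using inv' Y unfolding merge_inv_def by auto
    have sc2: "wmem s' 13 0 = int x" "\<And>y. wmem s' 10 (int y) = E y" "\<And>y. nmem s' 5 y = v y"
      using fr sc E v by auto
    show "wp m (Cond (Conj (WLess (Var 14) (Var 15))
           (Neg (Conj (WLess (Var 16) (Var 17))
             (NLess (NLoad 5 (WLoad 10 (Var 16))) (NLoad 5 (WLoad 10 (Var 14)))))))
      (Seq (WStore 11 (Var 13) (WLoad 10 (Var 14))) (Assign 14 (Padd (Var 14) (WConst 1))))
      (Seq (WStore 11 (Var 13) (WLoad 10 (Var 16))) (Assign 16 (Padd (Var 16) (WConst 1)))))
      (\<lambda>t' s'. t + t' \<le> 120 \<and> wmem s' 13 0 = int x \<and>
     (\<exists>i d j e b. wmem s' 14 0 = int i \<and> wmem s' 15 0 = int d \<and> wmem s' 16 0 = int j \<and>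
        wmem s' 17 0 = int e \<and> wmem s' 18 0 = int b \<and>
        merge_inv E (\<lambda>y. wmem s' 11 (int y)) v L w (Suc x) i d j e b)) s'"
    proof (cases "i < d \<and> \<not> (j < e \<and> v (E j) < v (E i))")
      case True
      have "merge_inv E ((\<lambda>y. wmem s' 11 (int y))(x := E i)) v L w (Suc x) (Suc i) d j e b"
        by (rule merge_inv_left[OF inv' bs xe]) (use True in auto)
      then show ?thesis using True t le sc2 sc'
        by (auto simp: sz nf fun_upd_def)
    next
      case False
      have "merge_inv E ((\<lambda>y. wmem s' 11 (int y))(x := E j)) v L w (Suc x) i d (Suc j) e b"
        by (rule merge_inv_right[OF inv' bs xe]) (use False in auto)
      then show ?thesis using False t le sc2 sc'
        by (auto simp: sz nf fun_upd_def)
    qed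
  qed
qed

lemma merge_pass_wp:
  fixes w L :: nat
  assumes Y: "3 * L \<le> Y" and w: "0 < w" "w < L"
    and sc: "wmem s 7 0 = int L" "wmem s 12 0 = int w"
    and bs: "block_sorted (\<lambda>y. wmem s 10 (int y)) (nmem s 5) L w"
  shows "wp m merge_pass (\<lambda>t s'. t \<le> 200 * L + 200 \<and> wmem s' 12 0 = int (2 * w) \<and>
     (\<lambda>y. wmem s' 10 (int y)) ` {..<L} = (\<lambda>y. wmem s 10 (int y)) ` {..<L} \<and>
     block_sorted (\<lambda>y. wmem s' 10 (int y)) (nmem s 5) L (2 * w)) s"
proof -
  let ?E = "\<lambda>y. wmem s 10 (int y)"
  let ?s = "wupd 18 0 0 (wupd 17 0 0 (wupd 16 0 0 (wupd 15 0 0 (wupd 14 0 0 s))))"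
  let ?copy = "For 19 (Var 7) (WStore 10 (Var 19) (WLoad 11 (Var 19)))"
  let ?Q = "\<lambda>t s'. t + 15 \<le> 200 * L + 200 \<and> wmem s' 12 0 = int (2 * w) \<and>
     (\<lambda>y. wmem s' 10 (int y)) ` {..<L} = ?E ` {..<L} \<and>
     block_sorted (\<lambda>y. wmem s' 10 (int y)) (nmem s 5) L (2 * w)"
  have main: "wp m (Seq (For 13 (Var 7) merge_step) (Seq ?copy (Assign 12 (Pmul (WConst 2) (Var 12))))) ?Q ?s"
    unfolding wp_Seq[of m "For 13 _ _"]
  proof (rule wp_For[where N = L and c = 120 and I = "\<lambda>x s'. (\<exists>i d j e b. wmem s' 14 0 = int i \<and> wmem s' 15 0 = int d \<and> wmem s' 16 0 = int j \<and>
        wmem s' 17 0 = int e \<and> wmem s' 18 0 = int b \<and>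
        merge_inv ?E (\<lambda>y. wmem s' 11 (int y)) (nmem s 5) L w x i d j e b)"], goal_cases)
    case (1 k s')
    then show ?case using sc by (simp add: sz)
  next
    case 2
    then show ?case using Y by (intro wmax_Y) simp
  next
    case 3
    then show ?case by (intro exI[of _ 0]) (simp add: merge_inv_init)
  next
    case (4 k s')
    from 4(2) obtain i d j e b where I: "wmem s' 14 0 = int i" "wmem s' 15 0 = int d" "wmem s' 16 0 = int j"
        "wmem s' 17 0 = int e" "wmem s' 18 0 = int b" 
        "merge_inv ?E (\<lambda>y. wmem s' 11 (int y)) (nmem s 5) L w k i d j e b" by blast
    have fr: "wmem s' 7 0 = int L" "wmem s' 12 0 = int w" "\<And>y. wmem s' 10 (int y) = ?E y" "\<And>y. nmem s' 5 y = nmem s 5 y"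
      using 4(4,5) sc by auto
    show ?case
      by (rule wp_mono[OF merge_step_wp[OF bs Y w 4(1) fr(3,4,1,2) 4(3) I]]) auto
  next
    case (5 t s')
    from 5(1) obtain i d j e b where I: 
        "merge_inv ?E (\<lambda>y. wmem s' 11 (int y)) (nmem s 5) L w L i d j e b" by blast
    note fin = merge_inv_final[OF I]
    have fr: "wmem s' 7 0 = int L" "wmem s' 12 0 = int w" using 5(4) sc by auto
    show ?case unfolding wp_Seq
    proof (rule wp_For[where N = L and c = 10 and I = "\<lambda>x s''. \<forall>y<x. wmem s'' 10 (int y) = wmem s' 11 (int y)"], goal_cases)
      case (1 k s')
      then show ?case using fr by (simp add: sz)
    next
      case 2
      then show ?case using Y by (intro wmax_Y) simp
    next
      case 3
      then show ?case by simp
    next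
      case (4 k s'')
      then show ?case by (auto simp: sz less_Suc_eq)
    next
      case (5 t' s'')
      have eq: "wmem s'' 10 (int y) = wmem s' 11 (int y)" if "y < L" for y using 5(1) that by blast
      have im: "(\<lambda>y. wmem s'' 10 (int y)) ` {..<L} = (\<lambda>y. wmem s' 11 (int y)) ` {..<L}" using eq by auto
      have bs': "block_sorted (\<lambda>y. wmem s'' 10 (int y)) (nmem s 5) L (2 * w)"
        unfolding block_sorted_def
      proof (intro allI impI, elim conjE)
        fix y z assume "y < z" "z < L" "y div (2 * w) = z div (2 * w)"
        then show "nmem s 5 (wmem s'' 10 (int y)) \<le> nmem s 5 (wmem s'' 10 (int z))"
          using fin(2) eq[of y] eq[of z] unfolding block_sorted_def by simp
      qed
      have t: "t + t' + 50 \<le> 200 * L + 200" using \<open>t \<le> _\<close> \<open>t' \<le> _\<close> by simp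
      have "wmem s'' 12 0 = int w" using 5(4) fr by simp
      then show ?case using im bs' t fin(1) Y w by (simp add: sz nf)
    qed
  qed
  show ?thesis unfolding merge_pass_def
    apply (rule wp_Assign, simp add: sz)+
    apply (rule wp_mono[OF main])
    apply simp
    done
qed

text \<open>Indices are sorted by the keys in number array 5, which are only compared. The image
  equation states that the result is a permutation; the order among equal keys is left open.\<close>

lemma merge_sort_wp:
  fixes L :: nat
  assumes Y: "3 * L \<le> Y" and J: "L \<le> 2 ^ J"
    and sc: "wmem s 7 0 = int L" "\<And>y. y < L \<Longrightarrow> wmem s 10 (int y) = int y"
  shows "wp m merge_sort (\<lambda>t s'. t \<le> (J + 1) * (200 * L + 210) \<and>
     (\<lambda>y. wmem s' 10 (int y)) ` {..<L} = int ` {..<L} \<and>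
     (\<forall>y z. y \<le> z \<longrightarrow> z < L \<longrightarrow> nmem s 5 (wmem s' 10 (int y)) \<le> nmem s 5 (wmem s' 10 (int z)))) s"
proof -
  have main: "wp m (While (WLess (Var 12) (Var 7)) merge_pass) (\<lambda>t s'. t + 3 \<le> (J + 1) * (200 * L + 210) \<and>
     (\<lambda>y. wmem s' 10 (int y)) ` {..<L} = int ` {..<L} \<and>
     (\<forall>y z. y \<le> z \<longrightarrow> z < L \<longrightarrow> nmem s 5 (wmem s' 10 (int y)) \<le> nmem s 5 (wmem s' 10 (int z)))) (wupd 12 0 1 s)"
  proof (rule wp_While[where J = J and c = "\<lambda>_. 200 * L + 200" and I = "\<lambda>k s'. wmem s' 12 0 = int (2 ^ k) \<and>
      (\<lambda>y. wmem s' 10 (int y)) ` {..<L} = int ` {..<L} \<and>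
      block_sorted (\<lambda>y. wmem s' 10 (int y)) (nmem s 5) L (2 ^ k)"], goal_cases)
    case 1
    have "(\<lambda>y. wmem s 10 (int y)) ` {..<L} = int ` {..<L}" using sc(2) by auto
    then show ?case by (simp add: block_sorted_def)
  next
    case (2 k s')
    have fr: "wmem s' 7 0 = int L" "\<And>a. nmem s' a = nmem s a" using 2(3,4) sc by auto
    have v: "beval m s' (WLess (Var 12) (Var 7)) = Some (2 ^ k < L)" using 2(1) fr by (simp add: sz nf flip: of_nat_power)
    have "wp m merge_pass (\<lambda>t s''. t \<le> 200 * L + 200 \<and> wmem s'' 12 0 = int (2 ^ Suc k) \<and>
      (\<lambda>y. wmem s'' 10 (int y)) ` {..<L} = int ` {..<L} \<and>
      block_sorted (\<lambda>y. wmem s'' 10 (int y)) (nmem s 5) L (2 ^ Suc k)) s'" if "2 ^ k < L"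
      by (rule wp_mono[OF merge_pass_wp[OF Y _ that]]) (use 2(1) fr in auto)
    moreover have "k < J" if "2 ^ k < L" using less_le_trans[OF that J] by simp
    moreover have "(t + 3 \<le> (J + 1) * (200 * L + 210) \<and>
     (\<lambda>y. wmem s' 10 (int y)) ` {..<L} = int ` {..<L} \<and>
     (\<forall>y z. y \<le> z \<longrightarrow> z < L \<longrightarrow> nmem s 5 (wmem s' 10 (int y)) \<le> nmem s 5 (wmem s' 10 (int z))))"
      if nl: "\<not> 2 ^ k < L" and t: "t \<le> (\<Sum>j<k. 200 * L + 200) + (k + 1) * (1 + bcost (WLess (Var 12) (Var 7)))" for t
    proof -
      have "t \<le> k * (200 * L + 206) + 6" using t by (simp add: algebra_simps)
      also have "\<dots> \<le> J * (200 * L + 206) + 6" using 2(2) by simp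
      finally have "t + 3 \<le> (J + 1) * (200 * L + 210)" by (simp add: algebra_simps)
      \<comment> \<open>Once 2^k reaches L all positions lie in the first block, so sortedness
        within blocks is sortedness of the whole array.\<close>
      moreover have "y div 2 ^ k = 0" if "y < L" for y using nl that by simp
      moreover have "nmem s 5 (wmem s' 10 (int y)) \<le> nmem s 5 (wmem s' 10 (int z))"
        if "y \<le> z" "z < L" "\<And>y. y < L \<Longrightarrow> y div 2 ^ k = 0" for y z
        using 2(1) that unfolding block_sorted_def by (cases "y = z") auto
      ultimately show ?thesis using 2(1) by blast
    qed
    ultimately show ?case using v by blast
  qed
  show ?thesis unfolding merge_sort_def
    apply (rule wp_Assign, simp add: sz)
    apply (rule wp_mono[OF main])
    apply simp
    done
qed

end

section \<open>Ranks within rows and columns\<close>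

text \<open>Applied to ranks, with the row or the column as key, this is the place of an entry in
  its sorted row or column.\<close>

definition pos :: "(nat \<Rightarrow> nat) \<Rightarrow> nat \<Rightarrow> nat" where
  "pos key q = card {x. x < q \<and> key x = key q}"

lemma pos_strict: "key q = key q' \<Longrightarrow> q < q' \<Longrightarrow> pos key q < pos key q'"
  unfolding pos_def by (intro psubset_card_mono) auto

lemma pos_less_iff: "key q = key q' \<Longrightarrow> pos key q < pos key q' \<longleftrightarrow> q < q'"
  using pos_strict[of key q q'] pos_strict[of key q' q] by (cases q q' rule: linorder_cases) auto

lemma pos_inj: "key q = key q' \<Longrightarrow> pos key q = pos key q' \<Longrightarrow> q = q'"
  using pos_strict[of key q q'] pos_strict[of key q' q] by (cases q q' rule: linorder_cases) auto

lemma card_key_Suc: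
  "card {x. x < Suc q \<and> key x = u} = card {x. x < q \<and> key x = u} + (if key q = u then 1 else 0)"
proof -
  have "{x. x < Suc q \<and> key x = u} = {x. x < q \<and> key x = u} \<union> (if key q = u then {q} else {})"
    by (auto simp: less_Suc_eq)
  then show ?thesis by simp
qed

lemma mult_add_inj: "a * n + b = a' * n + b' \<Longrightarrow> b < n \<Longrightarrow> b' < n \<Longrightarrow> a = a' \<and> b = (b'::nat)"
proof -
  assume eq: "a * n + b = a' * n + b'" and b: "b < n" "b' < n"
  have "(a * n + b) mod n = b" "(a' * n + b') mod n = b'" using b by auto
  then show ?thesis using eq b by auto
qed

lemma mult_add_less: "a < k \<Longrightarrow> b < n \<Longrightarrow> a * n + b < k * (n::nat)"
proof -
  assume "a < k" "b < n"
  then have "a * n + b < Suc a * n" by simp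
  also have "\<dots> \<le> k * n" using \<open>a < k\<close> by (intro mult_right_mono) auto
  finally show ?thesis .
qed

text \<open>\<open>ent q\<close> is the entry of rank q, coded as row times n plus column, in a
  table with 2 n rows. Ranks remove ties and make the entries of both factors comparable.\<close>

locale ranking =
  fixes n :: nat and ent :: "nat \<Rightarrow> nat"
  assumes n_pos: "1 \<le> n" and ent_bij: "bij_betw ent {..<2 * n * n} {..<2 * n * n}"
begin

abbreviation L :: nat where "L \<equiv> 2 * n * n"
definition row :: "nat \<Rightarrow> nat" where "row q = ent q div n"
definition col :: "nat \<Rightarrow> nat" where "col q = ent q mod n"
definition rank :: "nat \<Rightarrow> nat" where "rank e = inv_into {..<L} ent e"
abbreviation "rp \<equiv> pos row"
abbreviation "cp \<equiv> pos col"

lemma ent_less: "q < L \<Longrightarrow> ent q < L"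
  using ent_bij by (auto simp: bij_betw_def)

lemma row_less: "q < L \<Longrightarrow> row q < 2 * n"
  using ent_less[of q] n_pos unfolding row_def by (simp add: less_mult_imp_div_less)

lemma col_less: "col q < n"
  using n_pos unfolding col_def by simp

lemma ent_eq: "ent q = row q * n + col q"
  by (simp add: row_def col_def)

lemma rank_ent: "q < L \<Longrightarrow> rank (ent q) = q"
  unfolding rank_def using ent_bij by (auto simp: bij_betw_def inv_into_f_f)

lemma rank_less: assumes "e < L" shows "rank e < L"
proof -
  have "e \<in> ent ` {..<L}" using assms ent_bij unfolding bij_betw_def by blast
  from inv_into_into[OF this] show ?thesis unfolding rank_def by blast
qed

lemma ent_rank: assumes "e < L" shows "ent (rank e) = e"
proof -
  have "e \<in> ent ` {..<L}" using assms ent_bij unfolding bij_betw_def by blast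
  from f_inv_into_f[OF this] show ?thesis unfolding rank_def .
qed

lemma row_col_rank: "u < 2 * n \<Longrightarrow> k < n \<Longrightarrow> rank (u * n + k) < L \<and> row (rank (u * n + k)) = u \<and> col (rank (u * n + k)) = k"
  using mult_add_less[of u "2 * n" k n] rank_less[of "u * n + k"] ent_rank[of "u * n + k"] by (simp add: row_def col_def)

lemma entry_inj: "q < L \<Longrightarrow> q' < L \<Longrightarrow> row q = row q' \<Longrightarrow> col q = col q' \<Longrightarrow> q = q'"
  by (metis ent_eq rank_ent)

lemma rp_less: "q < L \<Longrightarrow> rp q < n"
proof -
  assume q: "q < L"
  have "card (insert q {x. x < q \<and> row x = row q}) \<le> card {..<n}"
  proof (rule card_inj_on_le[where f = col])
    show "inj_on col (insert q {x. x < q \<and> row x = row q})"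
    proof (rule inj_onI, goal_cases)
      case (1 x y)
      then show ?case using q entry_inj[of x y] by auto
    qed
  qed (use col_less in auto)
  then show ?thesis unfolding pos_def by simp
qed

lemma cp_less: "q < L \<Longrightarrow> cp q < 2 * n"
proof -
  assume q: "q < L"
  have "card (insert q {x. x < q \<and> col x = col q}) \<le> card {..<2 * n}"
  proof (rule card_inj_on_le[where f = row])
    show "inj_on row (insert q {x. x < q \<and> col x = col q})"
    proof (rule inj_onI, goal_cases)
      case (1 x y)
      then show ?case using q entry_inj[of x y] by auto
    qed
  qed (use row_less q in auto)
  then show ?thesis unfolding pos_def by simp
qed

definition dims :: "state \<Rightarrow> bool" where
  "dims s \<longleftrightarrow> wmem s 0 0 = int n \<and> wmem s 6 0 = int (2 * n) \<and> wmem s 7 0 = int L \<and> wmem s 8 0 = int (4 * n) \<and>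
     (\<forall>q<L. wmem s 10 (int q) = int (ent q))"

text \<open>Array 20 inverts the sorting permutation; 21 and 22 give the place of a rank in its row
  and in its column, 23 and 24 the rank at a given place of a row or column. The last two let sorted
  rows and columns be walked at constant cost per step.\<close>

definition ranked :: "state \<Rightarrow> bool" where
  "ranked s \<longleftrightarrow> dims s \<and> (\<forall>q<L. wmem s 20 (int (ent q)) = int q \<and> wmem s 21 (int q) = int (rp q) \<and>
     wmem s 22 (int q) = int (cp q) \<and> wmem s 23 (int (row q * n + rp q)) = int q \<and>
     wmem s 24 (int (col q * (2 * n) + cp q)) = int q)"

end

text \<open>Arrays 25 and 26 count the entries met so far in each row and each column. As the ranks
  are visited upwards, the count found at an entry is its place.\<close>

definition index_step :: com where
  "index_step =
    Seq (Assign 28 (WLoad 10 (Var 27))) (Seq (WStore 20 (Var 28) (Var 27))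
    (Seq (Assign 29 (Pdiv (Var 28) (Var 0))) (Seq (WStore 21 (Var 27) (WLoad 25 (Var 29)))
    (Seq (WStore 23 (Padd (Pmul (Var 29) (Var 0)) (WLoad 25 (Var 29))) (Var 27))
    (Seq (WStore 25 (Var 29) (Padd (WLoad 25 (Var 29)) (WConst 1)))
    (Seq (Assign 29 (WMod (Var 28) (Var 0))) (Seq (WStore 22 (Var 27) (WLoad 26 (Var 29)))
    (Seq (WStore 24 (Padd (Pmul (Var 29) (Var 6)) (WLoad 26 (Var 29))) (Var 27))
    (WStore 26 (Var 29) (Padd (WLoad 26 (Var 29)) (WConst 1)))))))))))"

definition index_ranks :: com where
  "index_ranks = Seq (For 27 (Var 6) (Seq (WStore 25 (Var 27) (WConst 0)) (WStore 26 (Var 27) (WConst 0))))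
    (For 27 (Var 7) index_step)"

lemma mods_index_step [simp]: "wmods index_step = {20,21,22,23,24,25,26,28,29}" "nmods index_step = {}"
  by (auto simp: index_step_def)

lemma mods_index_ranks [simp]: "wmods index_ranks = {20,21,22,23,24,25,26,27,28,29}" "nmods index_ranks = {}"
  by (auto simp: index_ranks_def)

locale ranking_machine = ranking n ent + bounded_machine m Y for n ent m Y +
  assumes nY: "20 * (n * n) \<le> Y"
begin

lemma n_Y: "n \<le> Y" "2 * n \<le> Y" "4 * n \<le> Y" "L \<le> Y" "16 * (n * n) \<le> Y"
proof -
  have "n \<le> n * n" using n_pos by simp
  then show "n \<le> Y" "2 * n \<le> Y" "4 * n \<le> Y" "L \<le> Y" "16 * (n * n) \<le> Y" using nY by linarith+
qed

definition index_inv :: "nat \<Rightarrow> state \<Rightarrow> bool" where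
  "index_inv k s \<longleftrightarrow> (\<forall>u<2 * n. wmem s 25 (int u) = int (card {x. x < k \<and> row x = u})) \<and>
     (\<forall>u<n. wmem s 26 (int u) = int (card {x. x < k \<and> col x = u})) \<and>
     (\<forall>q<k. wmem s 20 (int (ent q)) = int q \<and> wmem s 21 (int q) = int (rp q) \<and>
     wmem s 22 (int q) = int (cp q) \<and> wmem s 23 (int (row q * n + rp q)) = int q \<and>
     wmem s 24 (int (col q * (2 * n) + cp q)) = int q)"

lemma index_step_wp:
  assumes d: "dims s" and k: "k < L" "wmem s 27 0 = int k" and inv: "index_inv k s"
  shows "wp m index_step (\<lambda>t s'. t \<le> 100 \<and> wmem s' 27 0 = int k \<and> index_inv (Suc k) (wupd 27 0 (int (Suc k)) s')) s"
proof -
  have r: "row k < 2 * n" "col k < n" "rp k < n" "cp k < 2 * n" "ent k < L"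
    using k row_less col_less rp_less cp_less ent_less by auto
  have c: "wmem s 25 (int (row k)) = int (rp k)" "wmem s 26 (int (col k)) = int (cp k)"
    using inv r unfolding index_inv_def pos_def by auto
  have e: "wmem s 10 (int k) = int (ent k)" "wmem s 0 0 = int n" "wmem s 6 0 = int (2 * n)" using d k unfolding dims_def by auto
  have rd: "ent k div n = row k" "ent k mod n = col k" by (auto simp: row_def col_def)
  \<comment> \<open>No cell written for an earlier rank is hit again: places within one row or
    column are distinct, and different rows or columns use disjoint ranges of cells.\<close>
  have ne: "ent q \<noteq> ent k" "row q * n + rp q \<noteq> row k * n + rp k" "col q * (2 * n) + cp q \<noteq> col k * (2 * n) + cp k"
    if "q < k" for q
  proof -
    have qL: "q < L" using that k by simp
    show "ent q \<noteq> ent k" using rank_ent qL k that by (metis less_irrefl)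
    show "row q * n + rp q \<noteq> row k * n + rp k"
      using mult_add_inj[of "row q" n "rp q" "row k" "rp k"] rp_less qL k pos_inj[of row q k] that by auto
    show "col q * (2 * n) + cp q \<noteq> col k * (2 * n) + cp k"
      using mult_add_inj[of "col q" "2 * n" "cp q" "col k" "cp k"] cp_less qL k pos_inj[of col q k] that by auto
  qed
  have kY: "k \<le> Y" "rp k \<le> Y" "cp k \<le> Y" "row k \<le> Y" "col k \<le> Y" "ent k \<le> Y" using r k n_Y by auto
  define s1 where "s1 = wupd 26 (int (col k)) (int (Suc (cp k))) (wupd 24 (int (col k * (2 * n) + cp k)) (int k)
     (wupd 22 (int k) (int (cp k)) (wupd 29 0 (int (col k)) (wupd 25 (int (row k)) (int (Suc (rp k))) 
     (wupd 23 (int (row k * n + rp k)) (int k) (wupd 21 (int k) (int (rp k)) (wupd 29 0 (int (row k)) 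
     (wupd 20 (int (ent k)) (int k) (wupd 28 0 (int (ent k)) s)))))))))"
  have 1: "index_inv (Suc k) (wupd 27 0 (int (Suc k)) s1)"
    unfolding index_inv_def
  proof (intro conjI allI impI)
    fix u assume "u < 2 * n"
    then show "wmem (wupd 27 0 (int (Suc k)) s1) 25 (int u) = int (card {x. x < Suc k \<and> row x = u})"
      using inv r unfolding index_inv_def card_key_Suc s1_def by (auto simp: pos_def)
  next
    fix u assume "u < n"
    then show "wmem (wupd 27 0 (int (Suc k)) s1) 26 (int u) = int (card {x. x < Suc k \<and> col x = u})"
      using inv r unfolding index_inv_def card_key_Suc s1_def by (auto simp: pos_def)
  next
    fix q assume "q < Suc k"
    then consider "q < k" | "q = k" by linarith
    note q = this
    show "wmem (wupd 27 0 (int (Suc k)) s1) 20 (int (ent q)) = int q"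
      using q by cases (use inv ne in \<open>auto simp: index_inv_def s1_def\<close>)
    show "wmem (wupd 27 0 (int (Suc k)) s1) 21 (int q) = int (rp q)"
      using q by cases (use inv in \<open>auto simp: index_inv_def s1_def\<close>)
    show "wmem (wupd 27 0 (int (Suc k)) s1) 22 (int q) = int (cp q)"
      using q by cases (use inv in \<open>auto simp: index_inv_def s1_def\<close>)
    show "wmem (wupd 27 0 (int (Suc k)) s1) 23 (int (row q * n + rp q)) = int q"
      using q by cases (use inv ne in \<open>auto simp: index_inv_def s1_def\<close>)
    show "wmem (wupd 27 0 (int (Suc k)) s1) 24 (int (col q * (2 * n) + cp q)) = int q"
      using q by cases (use inv ne in \<open>auto simp: index_inv_def s1_def\<close>)
  qed
  show ?thesis unfolding index_step_def
    using 1 kY n_Y by (simp add: sz nf e k c rd s1_def)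
qed

lemma index_ranks_wp:
  assumes d: "dims s"
  shows "wp m index_ranks (\<lambda>t s'. t \<le> 250 * L + 250 \<and> ranked s') s"
  unfolding index_ranks_def wp_Seq
proof (rule wp_For[where N = "2 * n" and c = 10 and
    I = "\<lambda>k s'. \<forall>u<k. wmem s' 25 (int u) = 0 \<and> wmem s' 26 (int u) = 0"], goal_cases)
  case (1 k s')
  then show ?case using d by (simp add: sz dims_def)
next
  case 2
  then show ?case using n_Y by (intro wmax_Y) simp
next
  case 3
  then show ?case by simp
next
  case (4 k s')
  then show ?case by (auto simp: sz less_Suc_eq)
next
  case (5 t s')
  note 1 = 5
  have d': "dims s'" using d 5(4) by (auto simp: dims_def)
  show ?case
  proof (rule wp_For[where N = L and c = 100 and I = index_inv], goal_cases)
    case (1 k s'')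
    then show ?case using d' by (simp add: sz dims_def)
  next
    case 2
    then show ?case using n_Y by (intro wmax_Y) simp
  next
    case 3
    then show ?case using 1(1) by (simp add: index_inv_def)
  next
    case (4 k s'')
    have "dims s''" using d' 4(4) by (auto simp: dims_def)
    then show ?case using index_step_wp 4 by auto
  next
    case (5 t' s'')
    have "dims s''" using d' 5(4) by (auto simp: dims_def)
    then have r: "ranked s''" using 5(1) unfolding ranked_def index_inv_def by simp
    have "n \<le> n * n" using n_pos by simp
    moreover have "t \<le> 64 * n + 22" "t' \<le> 244 * (n * n) + 22" using 1(3) 5(3) by simp_all
    ultimately have "t + t' \<le> 250 * L + 250" by linarith
    with r show ?case by simp
  qed
qed

end

text \<open>Every key class is filled into buckets of s entries: \<open>c u\<close> is the filling
  of the open bucket of class u, \<open>cur u\<close> its number, \<open>first i\<close> the rank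
  that opened bucket i, and \<open>ID x\<close> the bucket of rank x. The equation with the sum is a
  count: all \<open>cnt\<close> buckets hold s entries, except for s - \<open>c u\<close> free
  places in the open bucket of each class.\<close>

definition bucket_inv ::
  "(nat \<Rightarrow> nat) \<Rightarrow> nat \<Rightarrow> nat \<Rightarrow> nat \<Rightarrow> nat \<Rightarrow> (nat \<Rightarrow> nat) \<Rightarrow> (nat \<Rightarrow> nat) \<Rightarrow> nat \<Rightarrow> (nat \<Rightarrow> nat) \<Rightarrow> (nat \<Rightarrow> nat) \<Rightarrow> bool" where
  "bucket_inv key K s q0 q c cur cnt first ID \<longleftrightarrow>
     q0 \<le> q \<and> (\<forall>u<K. c u \<le> s) \<and> s * cnt + (\<Sum>u<K. c u) = (q - q0) + K * s \<and>
     (\<forall>i<cnt. q0 \<le> first i \<and> first i < q) \<and>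
     (\<forall>x. q0 \<le> x \<and> x < q \<longrightarrow> ID x < cnt \<and> key (first (ID x)) = key x \<and>
        pos key (first (ID x)) \<le> pos key x \<and> pos key x < pos key (first (ID x)) + s) \<and>
     (\<forall>u<K. c u < s \<longrightarrow> cur u < cnt \<and> key (first (cur u)) = u \<and>
        pos key (first (cur u)) + c u = card {x. x < q \<and> key x = u})"

text \<open>Counters start full although no bucket exists, so the first entry of each class opens
  one.\<close>

lemma bucket_init: "bucket_inv key K s q0 q0 (\<lambda>_. s) cur 0 first ID"
  by (simp add: bucket_inv_def)

lemma sum_fun_upd: "(u::nat) < K \<Longrightarrow> (\<Sum>x<K. (c(u := y)) x) + c u = (\<Sum>x<K. c x) + (y::nat)"
proof -
  assume "u < K"
  then have "sum c {..<K} = c u + sum c ({..<K} - {u})" "sum (c(u := y)) {..<K} = y + sum (c(u := y)) ({..<K} - {u})"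
    by (simp_all add: sum.remove[of "{..<K}" u])
  moreover have "sum (c(u := y)) ({..<K} - {u}) = sum c ({..<K} - {u})" by (intro sum.cong) auto
  ultimately show ?thesis by simp
qed

lemma bucket_old:
  assumes inv: "bucket_inv key K s q0 q c cur cnt first ID" and u: "key q < K" "c (key q) < s"
  shows "bucket_inv key K s q0 (Suc q) (c(key q := Suc (c (key q)))) cur cnt first (ID(q := cur (key q)))"
proof -
  note A = inv[unfolded bucket_inv_def]
  have sum: "s * cnt + (\<Sum>x<K. (c(key q := Suc (c (key q)))) x) = Suc q - q0 + K * s"
    using A sum_fun_upd[OF u(1), of c "Suc (c (key q))"] by (simp add: Suc_diff_le)
  have p: "pos key q = card {x. x < q \<and> key x = key q}" by (simp add: pos_def)
  show ?thesis unfolding bucket_inv_def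
    using A u sum p by (auto simp: less_Suc_eq card_key_Suc[unfolded less_Suc_eq])
qed

lemma bucket_new:
  assumes inv: "bucket_inv key K s q0 q c cur cnt first ID" and u: "key q < K" "\<not> c (key q) < s" and s: "1 \<le> s"
  shows "bucket_inv key K s q0 (Suc q) (c(key q := 1)) (cur(key q := cnt)) (Suc cnt) (first(cnt := q)) (ID(q := cnt))"
proof -
  note A = inv[unfolded bucket_inv_def]
  have "c (key q) = s" using A u by (simp add: le_antisym)
  moreover have "s * cnt + sum c {..<K} = q - q0 + K * s" "q0 \<le> q" using A by auto
  ultimately have sum: "s * Suc cnt + (\<Sum>x<K. (c(key q := 1)) x) = Suc q - q0 + K * s"
    using sum_fun_upd[OF u(1), of c 1] by (simp del: fun_upd_apply)
  have p: "pos key q = card {x. x < q \<and> key x = key q}" by (simp add: pos_def)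
  show ?thesis unfolding bucket_inv_def
    using A u sum p s by (auto simp: less_Suc_eq card_key_Suc[unfolded less_Suc_eq])
qed

text \<open>A stretch of at most n s ranks fills at most n buckets completely, and each of the K
  classes has at most one further bucket. With n as bound this gives 3 n pieces of rows and 2 n
  chunks of columns.\<close>

lemma bucket_count:
  assumes "bucket_inv key K s q0 q c cur cnt first ID" "q \<le> q0 + n * s" "1 \<le> s"
  shows "cnt \<le> n + K"
proof -
  have "s * cnt + (\<Sum>u<K. c u) = (q - q0) + K * s" using assms(1) unfolding bucket_inv_def by blast
  then have "s * cnt \<le> (q - q0) + K * s" by linarith
  also have "\<dots> \<le> s * (n + K)" using assms(2) by (simp add: algebra_simps)
  finally show ?thesis using assms(3) by simp
qed

section \<open>Boolean products for groups of ranks\<close>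

declare of_nat_diff [simp del]

text \<open>The same code serves rows and columns. Its parameters are the arrays for the fillings,
  the open buckets, the number of buckets, the ranks that opened them, the bucket numbers, and the
  key of the current rank.\<close>

definition alloc :: "nat \<Rightarrow> nat \<Rightarrow> nat \<Rightarrow> nat \<Rightarrow> nat \<Rightarrow> nat \<Rightarrow> com" where
  "alloc c cu ct fi di ky =
    Seq (Cond (WLess (WLoad c (Var ky)) (Var 30)) (WStore c (Var ky) (Padd (WLoad c (Var ky)) (WConst 1)))
      (Seq (WStore c (Var ky) (WConst 1)) (Seq (WStore cu (Var ky) (Var ct))
      (Seq (WStore fi (Var ct) (Var 45)) (Assign ct (Padd (Var ct) (WConst 1)))))))
    (WStore di (Var 45) (WLoad cu (Var ky)))"

lemma mods_alloc [simp]: "wmods (alloc c cu ct fi di ky) = {c,cu,ct,fi,di}" "nmods (alloc c cu ct fi di ky) = {}"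
  by (auto simp: alloc_def)

definition bucket_st ::
  "nat \<Rightarrow> nat \<Rightarrow> nat \<Rightarrow> nat \<Rightarrow> nat \<Rightarrow> (nat \<Rightarrow> nat) \<Rightarrow> nat \<Rightarrow> nat \<Rightarrow> nat \<Rightarrow> nat \<Rightarrow> state \<Rightarrow> bool" where
  "bucket_st ac acu act afi adi key K \<sigma> q0 q s \<longleftrightarrow> (\<exists>c cur cnt first ID.
     (\<forall>u<K. wmem s ac (int u) = int (c u) \<and> (c u < \<sigma> \<longrightarrow> wmem s acu (int u) = int (cur u))) \<and>
     wmem s act 0 = int cnt \<and> (\<forall>i<cnt. wmem s afi (int i) = int (first i)) \<and>
     (\<forall>x. q0 \<le> x \<and> x < q \<longrightarrow> wmem s adi (int x) = int (ID x)) \<and>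
     bucket_inv key K \<sigma> q0 q c cur cnt first ID)"

text \<open>Array 101 is the left factor in the relocated memory. It has a 1 at (piece, chunk) if
  some rank of the group lies in both.\<close>

definition entry_step :: com where
  "entry_step = Seq (Assign 45 (Padd (Var 31) (Var 33)))
    (Seq (Assign 46 (Pdiv (WLoad 10 (Var 45)) (Var 0))) (Seq (Assign 47 (WMod (WLoad 10 (Var 45)) (Var 0)))
    (Seq (alloc 36 38 34 42 40 46) (Seq (alloc 37 39 35 43 41 47)
      (WStore 101 (Padd (Pmul (WLoad 40 (Var 45)) (Var 8)) (WLoad 41 (Var 45))) (WConst 1))))))"

text \<open>In the right factor a row stands for a chunk and a column for a row v of the table. A 1
  means that the entry of v in the column of the chunk precedes the first element of the chunk and
  thus the whole chunk.\<close>

definition right_step :: com where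
  "right_step = Seq (Assign 46 (Pdiv (Var 33) (Var 8))) (Seq (Assign 47 (WMod (Var 33) (Var 8)))
    (Cond (Conj (WLess (Var 46) (Var 35)) (WLess (Var 47) (Var 6)))
      (Cond (WLess (WLoad 20 (Padd (Pmul (Var 47) (Var 0)) (WMod (WLoad 10 (WLoad 43 (Var 46))) (Var 0)))) (WLoad 43 (Var 46)))
        (WStore 102 (Var 33) (WConst 1)) (WStore 102 (Var 33) (WConst 0)))
      (WStore 102 (Var 33) (WConst 0))))"

text \<open>A positive entry of the product at (piece, v) lowers the place recorded for v and the
  row of the piece to the place where the piece starts.\<close>

definition first_step :: com where
  "first_step = Seq (Assign 46 (Pdiv (Var 33) (Var 8))) (Seq (Assign 47 (WMod (Var 33) (Var 8)))
    (Seq (Assign 48 (WLoad 21 (WLoad 42 (Var 46))))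
    (Seq (Assign 49 (Padd (Pmul (Pdiv (WLoad 10 (WLoad 42 (Var 46))) (Var 0)) (Var 6)) (Var 47)))
    (Cond (Conj (WLess (Var 47) (Var 6)) (Conj (WLess (WConst 0) (WLoad 103 (Var 33))) (WLess (Var 48) (WLoad 32 (Var 49)))))
      (WStore 32 (Var 49) (Var 48)) Skip))))"

definition left_part :: com where
  "left_part =
    Seq (Assign 44 (Padd (Var 31) (Pmul (Var 0) (Var 30))))
    (Seq (Cond (WLess (Var 7) (Var 44)) (Assign 44 (Var 7)) Skip)
    (Seq (Assign 34 (WConst 0)) (Seq (Assign 35 (WConst 0))
    (Seq (For 33 (Var 6) (Seq (WStore 36 (Var 33) (Var 30)) (WStore 37 (Var 33) (Var 30))))
    (Seq (For 33 (Pmul (Var 8) (Var 8)) (WStore 101 (Var 33) (WConst 0)))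
    (For 33 (Psub (Var 44) (Var 31)) entry_step))))))"

lemma mods_left_part [simp]:
  "wmods left_part = {33,34,35,36,37,38,39,40,41,42,43,44,45,46,47,101}" "nmods left_part = {}"
  "wmods entry_step = {34,35,36,37,38,39,40,41,42,43,45,46,47,101}" "nmods entry_step = {}"
  "wmods right_step = {46,47,102}" "nmods right_step = {}"
  "wmods first_step = {46,47,48,49,32}" "nmods first_step = {}"
  by (auto simp: left_part_def entry_step_def right_step_def first_step_def)

context bounded_machine begin

lemma alloc_wp:
  assumes dist: "distinct [c,cu,ct,fi,di,ky,30,45]"
    and st: "bucket_st c cu ct fi di key K \<sigma> q0 q s" and u: "key q < K"
    and sc: "wmem s ky 0 = int (key q)" "wmem s 45 0 = int q" "wmem s 30 0 = int \<sigma>"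
    and b: "1 \<le> \<sigma>" "\<sigma> \<le> Y" "q \<le> Y" "K \<le> Y" "q \<le> q0 + n * \<sigma>" "n + K \<le> Y"
  shows "wp m (alloc c cu ct fi di ky) (\<lambda>t s'. t \<le> 60 \<and> bucket_st c cu ct fi di key K \<sigma> q0 (Suc q) s' \<and>
     (\<forall>x. x \<noteq> int q \<longrightarrow> wmem s' di x = wmem s di x)) s"
proof -
  from st obtain C cur cnt first ID where S: "\<forall>u<K. wmem s c (int u) = int (C u) \<and> (C u < \<sigma> \<longrightarrow> wmem s cu (int u) = int (cur u))"
     "wmem s ct 0 = int cnt" "\<forall>i<cnt. wmem s fi (int i) = int (first i)"
     "\<forall>x. q0 \<le> x \<and> x < q \<longrightarrow> wmem s di (int x) = int (ID x)"
    and inv: "bucket_inv key K \<sigma> q0 q C cur cnt first ID"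
    unfolding bucket_st_def by blast
  have dist2: "distinct [45,30,ky,di,fi,ct,cu,c]" using dist by auto
  have cnt: "cnt \<le> Y" using bucket_count[OF inv b(5,1)] b by linarith
  have C: "C (key q) \<le> Y" using inv u b(2) unfolding bucket_inv_def by (meson le_trans)
  have cq: "wmem s c (int (key q)) = int (C (key q))" using S(1) u by blast
  show ?thesis
  proof (cases "C (key q) < \<sigma>")
    case True
    note N = bucket_old[OF inv u True]
    have cuq: "wmem s cu (int (key q)) = int (cur (key q))" using S(1) u True by blast
    have "bucket_st c cu ct fi di key K \<sigma> q0 (Suc q) (wupd di (int q) (int (cur (key q))) (wupd c (int (key q)) (int (Suc (C (key q)))) s))"
      unfolding bucket_st_def
      by (rule exI, rule exI, rule exI, rule exI, rule exI, intro conjI, rule_tac[5] N) (use S dist dist2 in \<open>auto simp: less_Suc_eq\<close>)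
    then show ?thesis using dist dist2 C b True u cq cuq sc unfolding alloc_def by (simp add: sz nf)
  next
    case False
    note N = bucket_new[OF inv u False b(1)]
    have "bucket_st c cu ct fi di key K \<sigma> q0 (Suc q) (wupd di (int q) (int cnt) (wupd ct 0 (int (Suc cnt)) (wupd fi (int cnt) (int q)
       (wupd cu (int (key q)) (int cnt) (wupd c (int (key q)) 1 s)))))"
      unfolding bucket_st_def
      by (rule exI, rule exI, rule exI, rule exI, rule exI, intro conjI, rule_tac[5] N) (use S dist dist2 in \<open>auto simp: less_Suc_eq\<close>)
    then show ?thesis using dist dist2 C b False u cq sc cnt S(2) unfolding alloc_def by (simp add: sz nf)
  qed
qed

end

context ranking_machine begin

definition left_inv :: "nat \<Rightarrow> nat \<Rightarrow> nat \<Rightarrow> state \<Rightarrow> bool" where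
  "left_inv \<sigma> q0 q s \<longleftrightarrow> bucket_st 36 38 34 42 40 row (2 * n) \<sigma> q0 q s \<and> bucket_st 37 39 35 43 41 col n \<sigma> q0 q s \<and>
     (\<forall>f<4 * n * (4 * n). wmem s 101 (int f) =
        (if \<exists>x. q0 \<le> x \<and> x < q \<and> int f = wmem s 40 (int x) * int (4 * n) + wmem s 41 (int x) then 1 else 0))"

lemma bucket_st_cong:
  assumes "bucket_st a b c d e key K \<sigma> q0 q s"
    "wmem s' a = wmem s a" "wmem s' b = wmem s b" "wmem s' c = wmem s c" "wmem s' d = wmem s d" "wmem s' e = wmem s e"
  shows "bucket_st a b c d e key K \<sigma> q0 q s'"
  using assms unfolding bucket_st_def by simp

lemma entry_step_wp:
  assumes d: "dims s" and sc: "wmem s 30 0 = int \<sigma>" "wmem s 31 0 = int q0" "wmem s 33 0 = int k"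
    and inv: "left_inv \<sigma> q0 (q0 + k) s" and b: "1 \<le> \<sigma>" "\<sigma> \<le> Y" "q0 + k < L" "k < n * \<sigma>"
  shows "wp m entry_step (\<lambda>t s'. t \<le> 200 \<and> wmem s' 33 0 = int k \<and> left_inv \<sigma> q0 (Suc (q0 + k)) (wupd 33 0 (int (Suc k)) s')) s"
proof -
  let ?q = "q0 + k"
  let ?s1 = "wupd 47 0 (int (col ?q)) (wupd 46 0 (int (row ?q)) (wupd 45 0 (int ?q) s))"
  have D: "wmem s 0 0 = int n" "wmem s 8 0 = int (4 * n)" "wmem s 10 (int ?q) = int (ent ?q)" using d b unfolding dims_def by auto
  have rd: "ent ?q div n = row ?q" "ent ?q mod n = col ?q" by (auto simp: row_def col_def)
  have Yb: "q0 \<le> Y" "k \<le> Y" "?q \<le> Y" "ent ?q \<le> Y" "n + 2 * n \<le> Y" "n + n \<le> Y" using b n_Y ent_less[of ?q] by auto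
  have r: "row ?q < 2 * n" "col ?q < n" using row_less col_less b by auto
  have rY: "row ?q \<le> Y" "col ?q \<le> Y" using r n_Y by auto
  note iv = inv[unfolded left_inv_def]
  have 1: "wp m (alloc 36 38 34 42 40 46) (\<lambda>t s'. t \<le> 60 \<and> bucket_st 36 38 34 42 40 row (2 * n) \<sigma> q0 (Suc ?q) s' \<and>
     (\<forall>x. x \<noteq> int ?q \<longrightarrow> wmem s' 40 x = wmem s 40 x) \<and> (\<forall>a. a \<notin> {36,38,34,42,40} \<longrightarrow> wmem s' a = wmem ?s1 a)) ?s1"
    apply (rule wp_frame)
     apply (rule alloc_wp[where q = ?q and key = row and K = "2 * n" and \<sigma> = \<sigma> and n = n and ?q0.0 = q0])
    subgoal by simp
    subgoal by (rule bucket_st_cong[OF iv[THEN conjunct1]]) auto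
    using r sc b Yb n_Y by auto
  have 2: "wp m (alloc 37 39 35 43 41 47) (\<lambda>t s''. t \<le> 60 \<and> bucket_st 37 39 35 43 41 col n \<sigma> q0 (Suc ?q) s'' \<and>
     (\<forall>x. x \<noteq> int ?q \<longrightarrow> wmem s'' 41 x = wmem s' 41 x) \<and> (\<forall>a. a \<notin> {37,39,35,43,41} \<longrightarrow> wmem s'' a = wmem s' a)) s'"
    if fr: "\<forall>a. a \<notin> {36,38,34,42,40} \<longrightarrow> wmem s' a = wmem ?s1 a" for s'
    apply (rule wp_frame)
     apply (rule alloc_wp[where q = ?q and key = col and K = n and \<sigma> = \<sigma> and n = n and ?q0.0 = q0])
    subgoal by simp
    subgoal by (rule bucket_st_cong[OF iv[THEN conjunct2, THEN conjunct1]]) (use fr in auto)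
    using r sc b Yb n_Y fr by auto
  have 3: "wp m (WStore 101 (Padd (Pmul (WLoad 40 (Var 45)) (Var 8)) (WLoad 41 (Var 45))) (WConst 1))
      (\<lambda>t s3. t \<le> 20 \<and> wmem s3 33 0 = int k \<and> left_inv \<sigma> q0 (Suc ?q) (wupd 33 0 (int (Suc k)) s3)) s2"
    if fr1: "\<forall>a. a \<notin> {36,38,34,42,40} \<longrightarrow> wmem s' a = wmem ?s1 a" "bucket_st 36 38 34 42 40 row (2 * n) \<sigma> q0 (Suc ?q) s'"
       "\<forall>x. x \<noteq> int ?q \<longrightarrow> wmem s' 40 x = wmem s 40 x"
      and fr2: "\<forall>a. a \<notin> {37,39,35,43,41} \<longrightarrow> wmem s2 a = wmem s' a" "bucket_st 37 39 35 43 41 col n \<sigma> q0 (Suc ?q) s2"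
       "\<forall>x. x \<noteq> int ?q \<longrightarrow> wmem s2 41 x = wmem s' 41 x" for s' s2
  proof -
    have sc2: "wmem s2 45 0 = int ?q" "wmem s2 8 0 = int (4 * n)" "wmem s2 33 0 = int k"
      using fr1(1) fr2(1) D sc by auto
    have old: "wmem s2 40 (int x) = wmem s 40 (int x)" "wmem s2 41 (int x) = wmem s 41 (int x)" if "x < ?q" for x
      using that fr1 fr2 by auto
    have X: "wmem s2 101 = wmem s 101" using fr1(1) fr2(1) by auto
    have st1: "bucket_st 36 38 34 42 40 row (2 * n) \<sigma> q0 (Suc ?q) s2"
      by (rule bucket_st_cong[OF fr1(2)]) (use fr2(1) in auto)
    \<comment> \<open>The ranks of the group seen so far number at most n \<sigma>, so there are at
      most 3 n pieces; the same count gives at most 2 n chunks below.\<close>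
    obtain i where i: "wmem s2 40 (int ?q) = int i" "i < 4 * n"
    proof -
      from st1 obtain c cur cnt first ID where *: "\<forall>x. q0 \<le> x \<and> x < Suc ?q \<longrightarrow> wmem s2 40 (int x) = int (ID x)"
        "bucket_inv row (2 * n) \<sigma> q0 (Suc ?q) c cur cnt first ID" unfolding bucket_st_def by blast
      have "cnt \<le> n + 2 * n" using bucket_count[OF *(2), of n] b by simp
      moreover have "ID ?q < cnt" using *(2) unfolding bucket_inv_def by simp
      ultimately show ?thesis using that[of "ID ?q"] *(1) by auto
    qed
    obtain j where j: "wmem s2 41 (int ?q) = int j" "j < 4 * n"
    proof -
      from fr2(2) obtain c cur cnt first ID where *: "\<forall>x. q0 \<le> x \<and> x < Suc ?q \<longrightarrow> wmem s2 41 (int x) = int (ID x)"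
        "bucket_inv col n \<sigma> q0 (Suc ?q) c cur cnt first ID" unfolding bucket_st_def by blast
      have "cnt \<le> n + n" using bucket_count[OF *(2), of n] b by simp
      moreover have "ID ?q < cnt" using *(2) unfolding bucket_inv_def by simp
      ultimately show ?thesis using that[of "ID ?q"] *(1) by auto
    qed
    have ij: "i \<le> Y" "j \<le> Y" using i j n_Y by auto
    let ?s3 = "wupd 101 (int (i * (4 * n) + j)) 1 s2"
    have "left_inv \<sigma> q0 (Suc ?q) (wupd 33 0 (int (Suc k)) ?s3)"
      unfolding left_inv_def
    proof (intro conjI allI impI)
      show "bucket_st 36 38 34 42 40 row (2 * n) \<sigma> q0 (Suc ?q) (wupd 33 0 (int (Suc k)) ?s3)"
        by (rule bucket_st_cong[OF st1]) auto
      show "bucket_st 37 39 35 43 41 col n \<sigma> q0 (Suc ?q) (wupd 33 0 (int (Suc k)) ?s3)"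
        by (rule bucket_st_cong[OF fr2(2)]) auto
      fix f assume f: "f < 4 * n * (4 * n)"
      have old2: "(\<exists>x. q0 \<le> x \<and> x < ?q \<and> int f = wmem s2 40 (int x) * int (4 * n) + wmem s2 41 (int x)) \<longleftrightarrow>
         (\<exists>x. q0 \<le> x \<and> x < ?q \<and> int f = wmem s 40 (int x) * int (4 * n) + wmem s 41 (int x))"
        using old by (intro ex_cong1) auto
      have new: "(\<exists>x. q0 \<le> x \<and> x < Suc ?q \<and> int f = wmem s2 40 (int x) * int (4 * n) + wmem s2 41 (int x)) \<longleftrightarrow>
         f = i * (4 * n) + j \<or> (\<exists>x. q0 \<le> x \<and> x < ?q \<and> int f = wmem s2 40 (int x) * int (4 * n) + wmem s2 41 (int x))"
      proof -
        have "int f = wmem s2 40 (int ?q) * int (4 * n) + wmem s2 41 (int ?q) \<longleftrightarrow> f = i * (4 * n) + j"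
          unfolding i j by (simp only: nf of_nat_eq_iff)
        then show ?thesis by (metis le_add1 less_Suc_eq)
      qed
      have "wmem s 101 (int f) = (if \<exists>x. q0 \<le> x \<and> x < ?q \<and> int f = wmem s 40 (int x) * int (4 * n) + wmem s 41 (int x) then 1 else 0)"
        using iv f by blast
      then show "wmem (wupd 33 0 (int (Suc k)) ?s3) 101 (int f) = (if \<exists>x. q0 \<le> x \<and> x < Suc ?q \<and>
          int f = wmem (wupd 33 0 (int (Suc k)) ?s3) 40 (int x) * int (4 * n) + wmem (wupd 33 0 (int (Suc k)) ?s3) 41 (int x) then 1 else 0)"
        using new old2 X by (simp, blast?)
    qed
    then show ?thesis using sc2 i j ij n_Y by (simp add: sz nf)
  qed
  have 4: "wp m (Seq (alloc 36 38 34 42 40 46) (Seq (alloc 37 39 35 43 41 47)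
      (WStore 101 (Padd (Pmul (WLoad 40 (Var 45)) (Var 8)) (WLoad 41 (Var 45))) (WConst 1))))
      (\<lambda>t s'. t \<le> 140 \<and> wmem s' 33 0 = int k \<and> left_inv \<sigma> q0 (Suc ?q) (wupd 33 0 (int (Suc k)) s')) ?s1"
    unfolding wp_Seq[of m "alloc _ _ _ _ _ _"]
    apply (rule wp_mono[OF 1]) apply (elim conjE)
    apply (rule wp_mono[OF 2], assumption) apply (elim conjE)
    apply (rule wp_mono[OF 3]) by auto
  show ?thesis unfolding entry_step_def
    apply (rule wp_Assign) using sc Yb apply (simp add: sz nf)
    apply (rule wp_Assign) using D Yb rY apply (simp add: sz nf rd)
    apply (rule wp_Assign) using D Yb rY apply (simp add: sz nf rd)
    apply (rule wp_mono[OF 4]) by simp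
qed

lemma left_part_wp:
  assumes d: "dims s" and sc: "wmem s 30 0 = int \<sigma>" "wmem s 31 0 = int q0"
    and b: "1 \<le> \<sigma>" "\<sigma> \<le> Y" "q0 < L"
  shows "wp m left_part (\<lambda>t s'. t \<le> 2000 * (n * n) + 200 \<and> left_inv \<sigma> q0 (min (q0 + n * \<sigma>) L) s') s"
proof -
  have D: "wmem s 0 0 = int n" "wmem s 8 0 = int (4 * n)" "wmem s 7 0 = int L" "wmem s 6 0 = int (2 * n)" using d unfolding dims_def by auto
  define hi where "hi = min (q0 + n * \<sigma>) L"
  define s1 where "s1 = wupd 35 0 0 (wupd 34 0 0 (wupd 44 0 (int hi) s))"
  have s1D: "dims s1" "wmem s1 30 0 = int \<sigma>" "wmem s1 31 0 = int q0" "wmem s1 44 0 = int hi" "wmem s1 34 0 = 0" "wmem s1 35 0 = 0"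
    using d sc unfolding s1_def dims_def by auto
  have hi: "hi \<le> L" "q0 \<le> hi" "hi \<le> Y" using b n_Y unfolding hi_def by auto
  let ?A = "For 33 (Var 6) (Seq (WStore 36 (Var 33) (Var 30)) (WStore 37 (Var 33) (Var 30)))"
  let ?B = "For 33 (Pmul (Var 8) (Var 8)) (WStore 101 (Var 33) (WConst 0))"
  let ?C = "For 33 (Psub (Var 44) (Var 31)) entry_step"
  have A: "wp m ?A (\<lambda>t s'. t \<le> 70 * n + 22 \<and> (\<forall>u<2 * n. wmem s' 36 (int u) = int \<sigma> \<and> wmem s' 37 (int u) = int \<sigma>)) s1"
  proof (rule wp_For[where N = "2 * n" and c = 12 and
      I = "\<lambda>k s'. (\<forall>u<k. wmem s' 36 (int u) = int \<sigma> \<and> wmem s' 37 (int u) = int \<sigma>)"], goal_cases)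
    case (4 k s')
    then show ?case using s1D by (auto simp: sz less_Suc_eq)
  next
    case (1 k s') then show ?case using s1D by (simp add: sz dims_def)
  next
    case 2 then show ?case using n_Y by (intro wmax_Y) simp
  qed auto
  have B: "wp m ?B (\<lambda>t s'. t \<le> 600 * (n * n) + 30 \<and> (\<forall>u<4 * n * (4 * n). wmem s' 101 (int u) = 0)) s'" 
    if "dims s'" for s'
  proof (rule wp_For[where N = "4 * n * (4 * n)" and c = 10 and
      I = "\<lambda>k s'. (\<forall>u<k. wmem s' 101 (int u) = 0)"], goal_cases)
    case (4 k s'')
    then show ?case using that by (auto simp: sz less_Suc_eq)
  next
    case (1 k s'') then show ?case using that n_Y by (simp add: sz nf dims_def)
  next
    case 2 then show ?case using n_Y by (intro wmax_Y) simp
  qed auto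
  have C: "wp m ?C (\<lambda>t s''. t \<le> 500 * (n * n) + 30 \<and> left_inv \<sigma> q0 hi s'') s'"
    if d': "dims s'" "wmem s' 30 0 = int \<sigma>" "wmem s' 31 0 = int q0" "wmem s' 44 0 = int hi" and init: "left_inv \<sigma> q0 q0 s'" for s'
  proof (rule wp_For[where N = "hi - q0" and c = 200 and I = "\<lambda>k s''. left_inv \<sigma> q0 (q0 + k) s''"], goal_cases)
    case (1 k s'') then show ?case using d' hi b n_Y by (simp add: sz nf dims_def)
  next
    case 2 then show ?case using hi by (intro wmax_Y) simp
  next
    case 3
    note iv = init[unfolded left_inv_def]
    have "bucket_st 36 38 34 42 40 row (2 * n) \<sigma> q0 q0 (wupd 33 0 0 s')"
      by (rule bucket_st_cong[OF iv[THEN conjunct1]]) auto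
    moreover have "bucket_st 37 39 35 43 41 col n \<sigma> q0 q0 (wupd 33 0 0 s')"
      by (rule bucket_st_cong[OF iv[THEN conjunct2, THEN conjunct1]]) auto
    ultimately show ?case using init unfolding left_inv_def by simp
  next
    case (4 k s'')
    have "q0 + k < L" using 4(1) hi by simp
    moreover have "k < n * \<sigma>" using 4(1) unfolding hi_def by simp
    moreover have "dims s''" "wmem s'' 30 0 = int \<sigma>" "wmem s'' 31 0 = int q0" using 4(4) d' unfolding dims_def by auto
    ultimately show ?case using entry_step_wp[of s'' \<sigma> q0 k] 4 b by simp
  next
    case (5 t s'')
    have "t \<le> (hi - q0) * 225 + 25" using 5(3) by simp
    also have "\<dots> \<le> L * 225 + 25" using hi by (intro add_mono mult_right_mono) auto
    finally show ?case using 5(1) hi by simp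
  qed
  have ABC: "wp m (Seq ?A (Seq ?B ?C)) (\<lambda>t s'. t \<le> 1100 * (n * n) + 70 * n + 90 \<and> left_inv \<sigma> q0 hi s') s1"
    unfolding wp_Seq[of m "For _ _ _"]
  proof (rule wp_frame[OF A], elim conjE)
    fix t :: nat and s' :: state assume a: "t \<le> 70 * n + 22" "\<forall>u<2 * n. wmem s' 36 (int u) = int \<sigma> \<and> wmem s' 37 (int u) = int \<sigma>"
      and f: "\<And>a. a \<notin> wmods ?A \<Longrightarrow> wmem s' a = wmem s1 a"
    have s': "dims s'" "wmem s' 30 0 = int \<sigma>" "wmem s' 31 0 = int q0" "wmem s' 44 0 = int hi" "wmem s' 34 0 = 0" "wmem s' 35 0 = 0"
      using f s1D unfolding dims_def by auto
    show "wp m ?B (\<lambda>ta s'. wp m ?C (\<lambda>t' s''. t + (ta + t') \<le> 1100 * (n * n) + 70 * n + 90 \<and> left_inv \<sigma> q0 hi s'') s') s'"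
    proof (rule wp_frame[OF B[OF s'(1)]], elim conjE)
      fix t2 :: nat and s2 :: state assume a2: "t2 \<le> 600 * (n * n) + 30" "\<forall>u<4 * n * (4 * n). wmem s2 101 (int u) = 0"
        and f2: "\<And>a. a \<notin> wmods ?B \<Longrightarrow> wmem s2 a = wmem s' a"
      have s2: "dims s2" "wmem s2 30 0 = int \<sigma>" "wmem s2 31 0 = int q0" "wmem s2 44 0 = int hi" "wmem s2 34 0 = int 0" "wmem s2 35 0 = int 0"
        using f2 s' unfolding dims_def by auto
      have "bucket_st 36 38 34 42 40 row (2 * n) \<sigma> q0 q0 s2"
        unfolding bucket_st_def
        by (rule exI[of _ "\<lambda>_. \<sigma>"], rule exI[of _ "\<lambda>_. 0"], rule exI[of _ 0], rule exI[of _ "\<lambda>_. 0"],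
            rule exI[of _ "\<lambda>_. 0"], use a f2 s2 bucket_init in auto)
      moreover have "bucket_st 37 39 35 43 41 col n \<sigma> q0 q0 s2"
        unfolding bucket_st_def
        by (rule exI[of _ "\<lambda>_. \<sigma>"], rule exI[of _ "\<lambda>_. 0"], rule exI[of _ 0], rule exI[of _ "\<lambda>_. 0"],
            rule exI[of _ "\<lambda>_. 0"], use a f2 s2 bucket_init in auto)
      ultimately have "left_inv \<sigma> q0 q0 s2" using a2 unfolding left_inv_def by auto
      from C[OF s2(1-4) this]
      show "wp m ?C (\<lambda>t' s''. t + (t2 + t') \<le> 1100 * (n * n) + 70 * n + 90 \<and> left_inv \<sigma> q0 hi s'') s2"
        by (rule wp_mono) (use a a2 in auto)
    qed
  qed
  have nn: "n \<le> n * n" using n_pos by simp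
  have fin: "t + 50 \<le> 2000 * (n * n) + 200" if "t \<le> 1100 * (n * n) + 70 * n + 90" for t using that nn by linarith
  have cnd: "wp m (Cond (WLess (Var 7) (Var 44)) (Assign 44 (Var 7)) Skip) (\<lambda>t s'. t \<le> 15 \<and> s' = wupd 44 0 (int hi) s)
      (wupd 44 0 (int (q0 + n * \<sigma>)) s)"
    using D by (auto simp: sz hi_def min_def wupd_def)
  have 2: "wp m (Seq (Assign 34 (WConst 0)) (Seq (Assign 35 (WConst 0)) (Seq ?A (Seq ?B ?C))))
     (\<lambda>t s'. t + 40 \<le> 2000 * (n * n) + 200 \<and> left_inv \<sigma> q0 hi s') (wupd 44 0 (int hi) s)"
    apply (rule wp_Assign, simp add: sz)
    apply (rule wp_Assign, simp add: sz)
    apply (rule wp_mono[OF ABC[unfolded s1_def]])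
    using fin by force
  show ?thesis unfolding left_part_def hi_def[symmetric]
    apply (rule wp_Assign) using D sc b n_Y apply (simp add: sz nf)
    apply (subst wp_Seq)
    apply (rule wp_mono[OF cnd])
    apply (elim conjE, hypsubst)
    apply (rule wp_mono[OF 2])
    by auto
qed

end

text \<open>Here the invariant sees the time spent so far. This serves a loop whose iterations have
  no useful individual bound and are paid for by the clock.\<close>

lemma wp_While_time:
  assumes init: "I 0 0 s"
    and step: "\<And>k T s'. I k T s' \<Longrightarrow>
        (\<And>a. a \<notin> wmods body \<Longrightarrow> wmem s' a = wmem s a) \<Longrightarrow>
        (\<And>a. a \<notin> nmods body \<Longrightarrow> nmem s' a = nmem s a) \<Longrightarrow>
        \<exists>v. beval m s' b = Some v \<and>
          (v \<longrightarrow> k < J \<and> wp m body (\<lambda>t s''. I (Suc k) (T + 1 + bcost b + t) s'') s') \<and>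
          (\<not> v \<longrightarrow> Q (T + 1 + bcost b) s')"
  shows "wp m (While b body) Q s"
proof -
  let ?fr = "\<lambda>s'. (\<forall>a. a \<notin> wmods body \<longrightarrow> wmem s' a = wmem s a) \<and> (\<forall>a. a \<notin> nmods body \<longrightarrow> nmem s' a = nmem s a)"
  have "wp m (While b body) (\<lambda>t. Q (T + t)) s'"
    if "I k T s'" "?fr s'" for k s' T
    using that
  proof (induction "J - k" arbitrary: k s' T rule: less_induct)
    case less
    from step[OF less.prems(1)] less.prems(2) obtain v where v: "beval m s' b = Some v"
      "v \<Longrightarrow> k < J \<and> wp m body (\<lambda>t s''. I (Suc k) (T + 1 + bcost b + t) s'') s'"
      "\<not> v \<Longrightarrow> Q (T + 1 + bcost b) s'"
      by blast
    show ?case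
    proof (cases v)
      case True
      with v obtain t1 s1 where 1: "k < J" "exec m body s' t1 s1" "I (Suc k) (T + 1 + bcost b + t1) s1"
        unfolding wp_def by blast
      have fr1: "?fr s1" using exec_frame[OF 1(2)] less.prems(2) by simp
      have "wp m (While b body) (\<lambda>t. Q (T + 1 + bcost b + t1 + t)) s1"
        by (rule less.hyps[of "Suc k"]) (use 1 fr1 in simp_all)
      then obtain t2 s2 where 2: "exec m (While b body) s1 t2 s2" "Q (T + 1 + bcost b + t1 + t2) s2"
        unfolding wp_def by blast
      have "exec m (While b body) s' (1 + bcost b + t1 + t2) s2"
        using exec.WhileTrue[OF _ 1(2) 2(1)] True v(1) by simp
      then show ?thesis using 2(2) unfolding wp_def by (metis add.assoc)
    next
      case False
      then have "Q (T + (1 + bcost b)) s'" using v(3) by (simp add: algebra_simps)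
      moreover have "exec m (While b body) s' (1 + bcost b) s'" using False v(1) exec.WhileFalse by simp
      ultimately show ?thesis unfolding wp_def by blast
    qed
  qed
  from this[of 0 0 s] init show ?thesis by simp
qed

section \<open>Groups of ranks within a budget\<close>

definition right_part :: com where "right_part = For 33 (Pmul (Var 8) (Var 8)) right_step"
definition first_part :: com where "first_part = For 33 (Pmul (Var 34) (Var 8)) first_step"

lemma mods_parts [simp]: "wmods right_part = {33,46,47,102}" "nmods right_part = {}"
  "wmods first_part = {33,46,47,48,49,32}" "nmods first_part = {}"
  by (auto simp: right_part_def first_part_def)

text \<open>The clock also receives n^2 for the work outside the call, so that it measures the whole
  cost of a group up to a constant factor.\<close>

definition group :: "com \<Rightarrow> com" where
  "group call = Seq left_part (Seq right_part (Seq (Assign 100 (Var 8)) (Seq call (Seq first_part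
     (Seq (Assign 99 (Padd (Var 99) (Pmul (Var 0) (Var 0)))) (Assign 31 (Padd (Var 31) (Pmul (Var 0) (Var 30)))))))))"

text \<open>The value n in array 32 means that no piece has been found. The budget n^2 \<sigma> is
  tested before each group, so it is exceeded by at most the cost of one group. The size is doubled
  after every attempt, also after a complete one.\<close>

definition attempt :: "com \<Rightarrow> com" where
  "attempt call = Seq (For 33 (Pmul (Var 6) (Var 6)) (WStore 32 (Var 33) (Var 0)))
    (Seq (Assign 99 (WConst 0)) (Seq (Assign 31 (WConst 0))
    (Seq (While (Conj (WLess (Var 31) (Var 7)) (Neg (WLess (Pmul (Pmul (Var 0) (Var 0)) (Var 30)) (Var 99)))) (group call))
      (Assign 30 (Pmul (WConst 2) (Var 30))))))"

definition search :: "com \<Rightarrow> com" where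
  "search call = Seq (Assign 31 (WConst 0)) (Seq (Assign 30 (WConst 1)) (While (WLess (Var 31) (Var 7)) (attempt call)))"

context ranking_machine begin

lemma ranked_rank: "ranked s \<Longrightarrow> e < L \<Longrightarrow> wmem s 20 (int e) = int (rank e)"
  using ent_rank[of e] rank_less[of e] unfolding ranked_def by metis

definition F_st :: "(nat \<Rightarrow> nat) \<Rightarrow> state \<Rightarrow> bool" where
  "F_st F s \<longleftrightarrow> (\<forall>g<2 * n * (2 * n). wmem s 32 (int g) = int (F g) \<and> F g \<le> n)"

definition F_sound :: "nat \<Rightarrow> (nat \<Rightarrow> nat) \<Rightarrow> bool" where
  "F_sound \<sigma> F \<longleftrightarrow> (\<forall>u<2 * n. \<forall>v<2 * n. F (u * (2 * n) + v) < n \<longrightarrow>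
     (\<exists>q<L. row q = u \<and> F (u * (2 * n) + v) \<le> rp q \<and> rp q < F (u * (2 * n) + v) + \<sigma> \<and> rank (v * n + col q) < q))"

text \<open>Only those candidates are promised whose neighbour is at least \<sigma> places earlier
  in the column: it then precedes the whole chunk and is seen by the product. Closer ones are left
  to the direct comparisons, and ranks from q0 on to the groups still to come.\<close>

definition F_complete :: "nat \<Rightarrow> nat \<Rightarrow> (nat \<Rightarrow> nat) \<Rightarrow> bool" where
  "F_complete \<sigma> q0 F \<longleftrightarrow> (\<forall>q<L. \<forall>v<2 * n. q < q0 \<longrightarrow> cp (rank (v * n + col q)) + \<sigma> \<le> cp q \<longrightarrow>
     F (row q * (2 * n) + v) \<le> rp q)"

lemma right_part_wp:
  assumes r: "ranked s" and nc: "wmem s 35 0 = int nc" "\<And>i. i < nc \<Longrightarrow> wmem s 43 (int i) = int (first i) \<and> first i < L"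
  shows "wp m right_part (\<lambda>t s'. t \<le> 2000 * (n * n) + 100 \<and> (\<forall>f<4 * n * (4 * n). wmem s' 102 (int f) =
     (if f div (4 * n) < nc \<and> f mod (4 * n) < 2 * n \<and>
        rank (f mod (4 * n) * n + col (first (f div (4 * n)))) < first (f div (4 * n)) then 1 else 0))) s"
  unfolding right_part_def
proof (rule wp_For[where N = "4 * n * (4 * n)" and c = 80 and I = "\<lambda>k s'. (\<forall>f<k. wmem s' 102 (int f) =
     (if f div (4 * n) < nc \<and> f mod (4 * n) < 2 * n \<and>
        rank (f mod (4 * n) * n + col (first (f div (4 * n)))) < first (f div (4 * n)) then 1 else 0))"], goal_cases)
  case (1 k s')
  then show ?case using r n_Y by (simp add: sz nf dims_def ranked_def)
next
  case 2
  then show ?case using n_Y by (intro wmax_Y) simp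
next
  case 3
  then show ?case by simp
next
  case (4 k s')
  have kY: "k \<le> Y" using 4(1) n_Y by simp
  have sc: "wmem s' 0 0 = int n" "wmem s' 6 0 = int (2 * n)" "wmem s' 8 0 = int (4 * n)" "wmem s' 35 0 = int nc" 
    "\<And>i. i < nc \<Longrightarrow> wmem s' 43 (int i) = int (first i)"
    "\<And>q. q < L \<Longrightarrow> wmem s' 10 (int q) = int (ent q)" "\<And>e. e < L \<Longrightarrow> wmem s' 20 (int e) = int (rank e)"
    using 4(4) r nc ranked_rank[OF r] unfolding ranked_def dims_def by auto
  let ?i = "k div (4 * n)" and ?v = "k mod (4 * n)"
  have le: "?i \<le> Y" "?v \<le> Y" using kY by (meson div_le_dividend mod_less_eq_dividend le_trans)+
  show ?case
  proof (cases "?i < nc \<and> ?v < 2 * n")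
    case True
    then have f: "wmem s' 43 (int ?i) = int (first ?i)" "first ?i < L" using sc nc by auto
    have c: "ent (first ?i) mod n = col (first ?i)" "col (first ?i) \<le> Y" using col_less[of "first ?i"] n_Y by (auto simp: col_def)
    have "?v * n + col (first ?i) < 2 * n * n" using True col_less by (intro mult_add_less) auto
    then have P: "wmem s' 20 (int (?v * n + col (first ?i))) = int (rank (?v * n + col (first ?i)))" by (rule sc(7))
    have e: "wmem s' 10 (int (first ?i)) = int (ent (first ?i))" using sc(6) f by blast
    have eY: "ent (first ?i) \<le> Y" using ent_less[OF f(2)] n_Y by simp
    show ?thesis using True f(1) e c P sc(1-4) kY le n_Y 4(2,3) eY unfolding right_step_def
      by (auto simp: sz nf less_Suc_eq)
  next
    case False
    then show ?thesis using sc(1-4) kY le n_Y 4(2,3) unfolding right_step_def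
      by (auto simp: sz nf less_Suc_eq)
  qed
next
  case (5 t s')
  then show ?case by auto
qed

lemma pieces_Y: "np \<le> 3 * n \<Longrightarrow> np * (4 * n) \<le> Y"
proof -
  assume "np \<le> 3 * n"
  then have "np * (4 * n) \<le> 3 * n * (4 * n)" by (intro mult_right_mono) auto
  also have "\<dots> = 12 * (n * n)" by simp
  also have "\<dots> \<le> Y" using nY by linarith
  finally show ?thesis .
qed

text \<open>By the last hypothesis a positive entry of the product certifies a candidate inside its
  piece. This keeps the recorded places sound while the minimum over all positive entries is
  formed.\<close>

lemma first_part_wp:
  assumes r: "ranked s" and np: "wmem s 34 0 = int np" "np \<le> 3 * n" "\<And>i. i < np \<Longrightarrow> wmem s 42 (int i) = int (first i) \<and> first i < L"
    and F: "F_st F s" "F_sound \<sigma> F"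
    and Z: "\<And>i v. i < np \<Longrightarrow> v < 2 * n \<Longrightarrow> 0 < wmem s 103 (int (i * (4 * n) + v)) \<Longrightarrow>
      \<exists>q<L. row q = row (first i) \<and> rp (first i) \<le> rp q \<and> rp q < rp (first i) + \<sigma> \<and> rank (v * n + col q) < q"
  shows "wp m first_part (\<lambda>t s'. t \<le> 1800 * (n * n) + 100 \<and> (\<exists>F'. F_st F' s' \<and> F_sound \<sigma> F' \<and> (\<forall>g. F' g \<le> F g) \<and>
     (\<forall>i<np. \<forall>v<2 * n. 0 < wmem s 103 (int (i * (4 * n) + v)) \<longrightarrow> F' (row (first i) * (2 * n) + v) \<le> rp (first i)))) s"
  unfolding first_part_def
proof (rule wp_For[where N = "np * (4 * n)" and c = 80 and I = "\<lambda>k s'. \<exists>F'. F_st F' s' \<and> F_sound \<sigma> F' \<and> (\<forall>g. F' g \<le> F g) \<and>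
     (\<forall>f<k. f mod (4 * n) < 2 * n \<longrightarrow> 0 < wmem s 103 (int f) \<longrightarrow> F' (row (first (f div (4 * n))) * (2 * n) + f mod (4 * n)) \<le> rp (first (f div (4 * n))))"], goal_cases)
  case (1 k s')
  have "np \<le> Y" using np n_Y nY by linarith
  with 1 show ?case using r np n_Y by (simp add: sz nf dims_def ranked_def)
next
  case 2
  show ?case by (rule wmax_Y[OF pieces_Y[OF np(2)]])
next
  case 3
  then show ?case using F by (intro exI[of _ F]) (auto simp: F_st_def)
next
  case (4 k s')
  from 4(2) obtain F' where F': "F_st F' s'" "F_sound \<sigma> F'" "\<forall>g. F' g \<le> F g"
     "\<forall>f<k. f mod (4 * n) < 2 * n \<longrightarrow> 0 < wmem s 103 (int f) \<longrightarrow> F' (row (first (f div (4 * n))) * (2 * n) + f mod (4 * n)) \<le> rp (first (f div (4 * n)))"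
    by blast
  have kY: "k \<le> Y" using pieces_Y[OF np(2)] 4(1) by linarith
  have sc: "wmem s' 0 0 = int n" "wmem s' 6 0 = int (2 * n)" "wmem s' 8 0 = int (4 * n)" 
    "\<And>i. i < np \<Longrightarrow> wmem s' 42 (int i) = int (first i)" "wmem s' 103 = wmem s 103"
    "\<And>q. q < L \<Longrightarrow> wmem s' 10 (int q) = int (ent q)" "\<And>q. q < L \<Longrightarrow> wmem s' 21 (int q) = int (rp q)"
    using 4(4) r np unfolding ranked_def dims_def by auto
  let ?i = "k div (4 * n)" and ?v = "k mod (4 * n)"
  have i: "?i < np" using 4(1) by (simp add: less_mult_imp_div_less)
  have f: "wmem s' 42 (int ?i) = int (first ?i)" "first ?i < L" using i sc np by auto
  have f2: "wmem s' 10 (int (first ?i)) = int (ent (first ?i))" "wmem s' 21 (int (first ?i)) = int (rp (first ?i))" "ent (first ?i) div n = row (first ?i)"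
    using sc(6,7) f by (auto simp: row_def)
  have le: "?i \<le> Y" "?v \<le> Y" using kY by (meson div_le_dividend mod_less_eq_dividend le_trans)+
  have le2: "rp (first ?i) \<le> Y" "row (first ?i) \<le> Y" "ent (first ?i) \<le> Y" "first ?i \<le> Y" using rp_less[OF f(2)] row_less[OF f(2)] ent_less[OF f(2)] f n_Y by auto
  let ?g = "row (first ?i) * (2 * n) + ?v"
  define upd where "upd \<longleftrightarrow> ?v < 2 * n \<and> 0 < wmem s 103 (int k) \<and> rp (first ?i) < F' ?g"
  define F2 where "F2 = (if upd then F'(?g := rp (first ?i)) else F')"
  have k_eq: "?i * (4 * n) + ?v = k" by (rule div_mult_mod_eq)
  have g: "?g < 2 * n * (2 * n)" if "?v < 2 * n" using mult_add_less[OF row_less[OF f(2)] that] .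
  have Fg: "wmem s' 32 (int ?g) = int (F' ?g)" if "?v < 2 * n" using F'(1) g[OF that] unfolding F_st_def by blast
  have P2: "\<forall>g. F2 g \<le> F' g" unfolding F2_def upd_def by auto
  have P1: "F_sound \<sigma> F2" unfolding F_sound_def
  proof (intro allI impI)
    fix u v assume uv: "u < 2 * n" "v < 2 * n" "F2 (u * (2 * n) + v) < n"
    show "\<exists>q<L. row q = u \<and> F2 (u * (2 * n) + v) \<le> rp q \<and> rp q < F2 (u * (2 * n) + v) + \<sigma> \<and> rank (v * n + col q) < q"
    proof (cases "upd \<and> u * (2 * n) + v = ?g")
      case True
      then have "u = row (first ?i)" "v = ?v" using mult_add_inj[of u "2 * n" v "row (first ?i)" ?v] uv unfolding upd_def by auto
      moreover have "F2 (u * (2 * n) + v) = rp (first ?i)" using True unfolding F2_def by simp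
      moreover have "0 < wmem s 103 (int (?i * (4 * n) + ?v))" using True unfolding upd_def k_eq by simp
      ultimately show ?thesis using Z[OF i, of ?v] uv by auto
    next
      case False
      then have "F2 (u * (2 * n) + v) = F' (u * (2 * n) + v)" unfolding F2_def by auto
      then show ?thesis using F'(2) uv unfolding F_sound_def by auto
    qed
  qed
  have P3: "\<forall>f<Suc k. f mod (4 * n) < 2 * n \<longrightarrow> 0 < wmem s 103 (int f) \<longrightarrow> F2 (row (first (f div (4 * n))) * (2 * n) + f mod (4 * n)) \<le> rp (first (f div (4 * n)))"
  proof (intro allI impI)
    fix f assume a: "f < Suc k" "f mod (4 * n) < 2 * n" "0 < wmem s 103 (int f)"
    show "F2 (row (first (f div (4 * n))) * (2 * n) + f mod (4 * n)) \<le> rp (first (f div (4 * n)))"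
    proof (cases "f = k")
      case True
      then show ?thesis using a unfolding F2_def upd_def by auto
    next
      case False
      then have "F' (row (first (f div (4 * n))) * (2 * n) + f mod (4 * n)) \<le> rp (first (f div (4 * n)))" using F'(4) a by auto
      then show ?thesis using P2 le_trans by blast
    qed
  qed
  have main: "wp m first_step (\<lambda>t s''. t \<le> 80 \<and> wmem s'' 33 0 = int k \<and> F_st F2 s'') s'"
  proof (cases upd)
    case True
    then have "F_st F2 (wupd 32 (int ?g) (int (rp (first ?i))) s'')" if "wmem s'' 32 = wmem s' 32" for s''
      using F'(1) that rp_less[OF f(2)] unfolding F_st_def F2_def by auto
    then show ?thesis using True Fg sc(1-3,5) f f2 kY le le2 n_Y 4(3) unfolding first_step_def upd_def
      by (simp add: sz nf)
  next
    case False
    then have "F_st F2 s''" if "wmem s'' 32 = wmem s' 32" for s''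
      using F'(1) that unfolding F_st_def F2_def by auto
    then show ?thesis using False Fg sc(1-3,5) f f2 kY le le2 n_Y 4(3) unfolding first_step_def upd_def
      by (auto simp: sz nf)
  qed
  show ?case
    by (rule wp_mono[OF main]) (use P1 P2 P3 F'(3) le_trans in \<open>auto simp: F_st_def intro!: exI[of _ F2], blast+\<close>)
next
  case (5 t s')
  from 5(1) obtain F' where F': "F_st F' s'" "F_sound \<sigma> F'" "\<forall>g. F' g \<le> F g"
     "\<forall>f<np * (4 * n). f mod (4 * n) < 2 * n \<longrightarrow> 0 < wmem s 103 (int f) \<longrightarrow> F' (row (first (f div (4 * n))) * (2 * n) + f mod (4 * n)) \<le> rp (first (f div (4 * n)))"
    by blast
  have "F' (row (first i) * (2 * n) + v) \<le> rp (first i)" if "i < np" "v < 2 * n" "0 < wmem s 103 (int (i * (4 * n) + v))" for i v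
  proof -
    have "i * (4 * n) + v < np * (4 * n)" using that by (intro mult_add_less) auto
    moreover have "(i * (4 * n) + v) mod (4 * n) = v" "(i * (4 * n) + v) div (4 * n) = i" using that by auto
    ultimately show ?thesis using F'(4) that by metis
  qed
  moreover have "t \<le> 1800 * (n * n) + 100"
  proof -
    have "t \<le> np * n * 420 + 25" using 5(3) by simp
    moreover have "np * n * 420 \<le> 3 * n * n * 420" using np by (intro mult_right_mono) auto
    moreover have "3 * n * n * 420 = 1260 * (n * n)" by simp
    ultimately show ?thesis by linarith
  qed
  ultimately show ?case using F' by auto
qed

end

lemma group_cost_bound:
  "t \<le> 6000 * N + 500 + 7 * \<tau> \<Longrightarrow> T \<le> 7000 * c \<Longrightarrow> 1 + b = 19 \<Longrightarrow> 1 \<le> N \<Longrightarrow> T + 1 + b + t \<le> 7000 * (c + \<tau> + (N::nat))"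
  by (simp add: algebra_simps)

lemma attempt_cost_bound:
  "t1 \<le> 160 * N + 30 \<Longrightarrow> t \<le> 7000 * (M + T + N) + 20 \<Longrightarrow> 1 \<le> N \<Longrightarrow> t1 + (t + 6) + 10 \<le> 8000 * (M + T + (N::nat))"
  by (simp add: distrib_left)

text \<open>\<open>call\<close> stands for a matrix product under the clock and Tm bounds what it
  charges. The size 4 n exceeds the numbers of pieces, of chunks and of rows of the table.\<close>

locale group_machine = ranking_machine n ent m Y for n ent m Y +
  fixes call :: com and Tm :: nat
  assumes call_mods: "wmods call \<subseteq> insert 99 {100..}" "nmods call \<subseteq> {100..}"
    and call_wp: "\<And>s A B c. wmem s 100 0 = int (4 * n) \<Longrightarrow> holds_matrix (4 * n) (wmem s 101) A \<Longrightarrow>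
      holds_matrix (4 * n) (wmem s 102) B \<Longrightarrow> (\<And>i j. i < 4 * n \<Longrightarrow> j < 4 * n \<Longrightarrow> \<bar>A i j\<bar> \<le> 1 \<and> \<bar>B i j\<bar> \<le> 1) \<Longrightarrow>
      wmem s 99 0 = int c \<Longrightarrow> c + Tm \<le> Y \<Longrightarrow>
      wp m call (\<lambda>t s'. \<exists>\<tau>\<le>Tm. t \<le> 7 * \<tau> \<and> wmem s' 99 0 = int (c + \<tau>) \<and>
        holds_matrix (4 * n) (wmem s' 103) (mat_prod (4 * n) A B)) s"
begin

lemma call_frame: "a \<noteq> 99 \<Longrightarrow> a < 100 \<Longrightarrow> a \<notin> wmods call" "a < 100 \<Longrightarrow> a \<notin> nmods call"
  using call_mods by auto

text \<open>Both directions of the Boolean product are used: a positive entry yields a candidate in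
  the piece, which gives soundness, and a far candidate yields a positive entry, which gives
  completeness.\<close>

lemma group_wp:
  assumes r: "ranked s" and sc: "wmem s 30 0 = int \<sigma>" "wmem s 31 0 = int q0" "wmem s 99 0 = int c"
    and b: "1 \<le> \<sigma>" "\<sigma> \<le> Y" "q0 < L" "c + Tm + n * n \<le> Y"
    and F: "F_st F s" "F_sound \<sigma> F" "F_complete \<sigma> q0 F"
  shows "wp m (group call) (\<lambda>t s'. \<exists>\<tau>\<le>Tm. t \<le> 6000 * (n * n) + 500 + 7 * \<tau> \<and>
     wmem s' 99 0 = int (c + \<tau> + n * n) \<and> wmem s' 31 0 = int (q0 + n * \<sigma>) \<and>
     (\<exists>F'. F_st F' s' \<and> F_sound \<sigma> F' \<and> F_complete \<sigma> (q0 + n * \<sigma>) F')) s"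
proof -
  define hi where "hi = min (q0 + n * \<sigma>) L"
  have d: "dims s" using r unfolding ranked_def by simp
  note lp = left_part_wp[OF d sc(1,2) b(1,2,3), folded hi_def]
  show ?thesis unfolding group_def wp_Seq[of m left_part]
  proof (rule wp_frame[OF lp], elim conjE)
    fix t1 :: nat and s1 :: state
    assume t1: "t1 \<le> 2000 * (n * n) + 200" and li: "left_inv \<sigma> q0 hi s1"
      and f1: "\<And>a. a \<notin> wmods left_part \<Longrightarrow> wmem s1 a = wmem s a"
    have f1': "wmem s1 a = wmem s a" if "a < 33 \<or> a = 99" for a using f1[of a] that by auto
    have r1: "ranked s1" using r f1' unfolding ranked_def dims_def by simp
    from li obtain cR curR np fR IR where R: "wmem s1 34 0 = int np" "\<forall>i<np. wmem s1 42 (int i) = int (fR i)"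
        "\<forall>x. q0 \<le> x \<and> x < hi \<longrightarrow> wmem s1 40 (int x) = int (IR x)"
        and Ri: "bucket_inv row (2 * n) \<sigma> q0 hi cR curR np fR IR"
      unfolding left_inv_def bucket_st_def by blast
    from li obtain cC curC nc fC IC where C: "wmem s1 35 0 = int nc" "\<forall>i<nc. wmem s1 43 (int i) = int (fC i)"
        "\<forall>x. q0 \<le> x \<and> x < hi \<longrightarrow> wmem s1 41 (int x) = int (IC x)"
        and Ci: "bucket_inv col n \<sigma> q0 hi cC curC nc fC IC"
      unfolding left_inv_def bucket_st_def by blast
    have hi: "hi \<le> q0 + n * \<sigma>" "hi \<le> L" unfolding hi_def by auto
    have np: "np \<le> 3 * n" "nc \<le> 2 * n" using bucket_count[OF Ri hi(1) b(1)] bucket_count[OF Ci hi(1) b(1)] by auto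
    have fL: "fR i < L" if "i < np" for i using Ri that hi unfolding bucket_inv_def by (meson less_le_trans)
    have fL': "fC i < L" if "i < nc" for i using Ci that hi unfolding bucket_inv_def by (meson less_le_trans)
    have RI: "IR x < np" "row (fR (IR x)) = row x" "rp (fR (IR x)) \<le> rp x" "rp x < rp (fR (IR x)) + \<sigma>"
      if "q0 \<le> x" "x < hi" for x using Ri that unfolding bucket_inv_def by auto
    have CI: "IC x < nc" "col (fC (IC x)) = col x" "cp (fC (IC x)) \<le> cp x" "cp x < cp (fC (IC x)) + \<sigma>"
      if "q0 \<le> x" "x < hi" for x using Ci that unfolding bucket_inv_def by auto
    define X where "X = (\<lambda>i j. wmem s1 101 (int (i * (4 * n) + j)))"
    \<comment> \<open>Row-major codes with column indices below 4 n are injective, so a 1 comes from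
      a rank with exactly this piece and this chunk.\<close>
    have X: "X i j = (if \<exists>x. q0 \<le> x \<and> x < hi \<and> i = IR x \<and> j = IC x then 1 else 0)" if "i < 4 * n" "j < 4 * n" for i j
    proof -
      have "int (i * (4 * n) + j) = wmem s1 40 (int x) * int (4 * n) + wmem s1 41 (int x) \<longleftrightarrow> i = IR x \<and> j = IC x"
        if "q0 \<le> x" "x < hi" for x
      proof -
        have "wmem s1 40 (int x) * int (4 * n) + wmem s1 41 (int x) = int (IR x * (4 * n) + IC x)"
          using R(3) C(3) that by (simp only: nf)
        moreover have "IC x < 4 * n" using CI(1)[OF that] np by simp
        ultimately show ?thesis using mult_add_inj[of i "4 * n" j "IR x" "IC x"] \<open>j < 4 * n\<close> by (auto simp only: of_nat_eq_iff)
      qed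
      then have "(\<exists>x. q0 \<le> x \<and> x < hi \<and> int (i * (4 * n) + j) = wmem s1 40 (int x) * int (4 * n) + wmem s1 41 (int x)) \<longleftrightarrow>
          (\<exists>x. q0 \<le> x \<and> x < hi \<and> i = IR x \<and> j = IC x)" by blast
      moreover have "i * (4 * n) + j < 4 * n * (4 * n)" using that by (intro mult_add_less) auto
      ultimately show ?thesis using li unfolding left_inv_def X_def by simp
    qed
    show "wp m (Seq right_part (Seq (Assign 100 (Var 8)) (Seq call (Seq first_part
       (Seq (Assign 99 (Padd (Var 99) (Pmul (Var 0) (Var 0)))) (Assign 31 (Padd (Var 31) (Pmul (Var 0) (Var 30)))))))))
       (\<lambda>t' s'. \<exists>\<tau>\<le>Tm. t1 + t' \<le> 6000 * (n * n) + 500 + 7 * \<tau> \<and>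
     wmem s' 99 0 = int (c + \<tau> + n * n) \<and> wmem s' 31 0 = int (q0 + n * \<sigma>) \<and>
     (\<exists>F'. F_st F' s' \<and> F_sound \<sigma> F' \<and> F_complete \<sigma> (q0 + n * \<sigma>) F')) s1"
      unfolding wp_Seq[of m right_part]
    proof (rule wp_frame[OF right_part_wp[where nc = nc and first = fC]], goal_cases)
      case 1 then show ?case by (rule r1)
    next
      case 2 then show ?case by (rule C(1))
    next
      case (3 i) then show ?case using C(2) fL' by blast
    next
      case (4 t2 s2)
      note t2 = 4(1)[THEN conjunct1] and Y2 = 4(1)[THEN conjunct2]
      have f2: "wmem s2 a = wmem s1 a" if "a \<notin> {33,46,47,102}" for a using 4(2)[of a] that by simp
      define B where "B = (\<lambda>i j. wmem s2 102 (int (i * (4 * n) + j)))"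
      have B: "B i j = (if i < nc \<and> j < 2 * n \<and> rank (j * n + col (fC i)) < fC i then 1 else 0)" if "i < 4 * n" "j < 4 * n" for i j
      proof -
        have "(i * (4 * n) + j) div (4 * n) = i" "(i * (4 * n) + j) mod (4 * n) = j" using that by auto
        moreover have "i * (4 * n) + j < 4 * n * (4 * n)" using that by (intro mult_add_less) auto
        ultimately show ?thesis using Y2 unfolding B_def by auto
      qed
      have sc2: "wmem s2 8 0 = int (4 * n)" "wmem s2 0 0 = int n" "wmem s2 30 0 = int \<sigma>" "wmem s2 31 0 = int q0" "wmem s2 99 0 = int c"
        using f2 f1' sc d unfolding dims_def by auto
      have r2: "ranked s2" using r1 f2 unfolding ranked_def dims_def by simp
      let ?s2 = "wupd 100 0 (int (4 * n)) s2"
      have hm: "holds_matrix (4 * n) (wmem ?s2 101) X" "holds_matrix (4 * n) (wmem ?s2 102) B"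
        using f2[of 101] unfolding holds_matrix_def X_def B_def by auto
      have cw: "wp m call (\<lambda>t s'. \<exists>\<tau>\<le>Tm. t \<le> 7 * \<tau> \<and> wmem s' 99 0 = int (c + \<tau>) \<and>
        holds_matrix (4 * n) (wmem s' 103) (mat_prod (4 * n) X B)) ?s2"
        by (rule call_wp[OF _ hm]) (use X B b sc2 in auto)
      \<comment> \<open>A nonzero summand provides a chunk k shared with a rank x of the piece. The
        neighbour precedes the first element of this chunk and hence x.\<close>
      have Z1: "\<exists>x. q0 \<le> x \<and> x < hi \<and> IR x = i \<and> rank (v * n + col x) < x" 
        if zv: "i < 4 * n" "v < 2 * n" "0 < mat_prod (4 * n) X B i v" for i v
      proof -
        have "\<exists>k<4 * n. X i k * B k v \<noteq> 0"
        proof (rule ccontr)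
          assume "\<not> ?thesis"
          then have "mat_prod (4 * n) X B i v = 0" unfolding mat_prod_def by (intro sum.neutral) auto
          then show False using zv by simp
        qed
        then obtain k where k: "k < 4 * n" "X i k \<noteq> 0" "B k v \<noteq> 0" by auto
        then obtain x where x: "q0 \<le> x" "x < hi" "i = IR x" "k = IC x" using X[of i k] zv by (auto split: if_splits)
        have "rank (v * n + col (fC k)) < fC k" using B[of k v] k zv by (auto split: if_splits)
        moreover have "col (fC k) = col x" "fC k \<le> x" using CI[OF x(1,2)] x pos_less_iff[of col x "fC k"] by auto
        ultimately show ?thesis using x by auto
      qed
      \<comment> \<open>A gap of \<sigma> places is longer than a chunk, so the neighbour lies
        before its first element.\<close>
      have Z2: "0 < mat_prod (4 * n) X B (IR x) v" if x: "q0 \<le> x" "x < hi" and v: "v < 2 * n" "cp (rank (v * n + col x)) + \<sigma> \<le> cp x" for x v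
      proof -
        let ?k = "IC x"
        have k: "?k < nc" "?k < 4 * n" "IR x < 4 * n" using CI(1)[OF x] RI(1)[OF x] np n_pos by auto
        have cl: "col (rank (v * n + col x)) = col x" using row_col_rank[OF v(1) col_less] by simp
        have "cp (rank (v * n + col x)) < cp (fC ?k)" using v(2) CI(4)[OF x] by linarith
        then have "rank (v * n + col x) < fC ?k" using pos_less_iff[of col "rank (v * n + col x)" "fC ?k"] cl CI(2)[OF x] by simp
        then have "B ?k v = 1" using B[of ?k v] k v CI(2)[OF x] by auto
        moreover have "X (IR x) ?k = 1" using X[of "IR x" ?k] k x by auto
        ultimately have "1 \<le> X (IR x) ?k * B ?k v" by simp
        also have "\<dots> \<le> mat_prod (4 * n) X B (IR x) v" unfolding mat_prod_def
          by (rule member_le_sum) (use k v X[of "IR x"] B in \<open>auto\<close>)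
        finally show ?thesis by simp
      qed
      have rest: "wp m (Seq call (Seq first_part
       (Seq (Assign 99 (Padd (Var 99) (Pmul (Var 0) (Var 0)))) (Assign 31 (Padd (Var 31) (Pmul (Var 0) (Var 30)))))))
       (\<lambda>t' s'. \<exists>\<tau>\<le>Tm. t' \<le> 1800 * (n * n) + 150 + 7 * \<tau> \<and>
     wmem s' 99 0 = int (c + \<tau> + n * n) \<and> wmem s' 31 0 = int (q0 + n * \<sigma>) \<and>
     (\<exists>F'. F_st F' s' \<and> F_sound \<sigma> F' \<and> F_complete \<sigma> (q0 + n * \<sigma>) F')) ?s2"
        unfolding wp_Seq[of m call]
      proof (rule wp_frame[OF cw], elim exE conjE)
        fix t3 :: nat and s3 :: state and \<tau> :: nat
        assume a3: "\<tau> \<le> Tm" "t3 \<le> 7 * \<tau>" "wmem s3 99 0 = int (c + \<tau>)" 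
          and hz: "holds_matrix (4 * n) (wmem s3 103) (mat_prod (4 * n) X B)"
          and "\<And>a. a \<notin> wmods call \<Longrightarrow> wmem s3 a = wmem ?s2 a"
        then have f3: "wmem s3 a = wmem s2 a" if "a \<noteq> 99" "a < 100" for a using that call_frame(1)[of a] by simp
        have r3: "ranked s3" using r2 f3 unfolding ranked_def dims_def by simp
        have Fs3: "F_st F s3" using F(1) f3[of 32] f2[of 32] f1'[of 32] unfolding F_st_def by simp
        have n3: "wmem s3 34 0 = int np" "\<And>i. i < np \<Longrightarrow> wmem s3 42 (int i) = int (fR i) \<and> fR i < L"
          using f3 f2 R fL by auto
        have sc3: "wmem s3 0 0 = int n" "wmem s3 30 0 = int \<sigma>" "wmem s3 31 0 = int q0" using f3 sc2 by auto
        have z: "wmem s3 103 (int (i * (4 * n) + v)) = mat_prod (4 * n) X B i v" if "i < 4 * n" "v < 4 * n" for i v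
          using hz that unfolding holds_matrix_def by blast
        have np4: "i < 4 * n" if "i < np" for i using that np by simp
        have fp: "wp m first_part (\<lambda>t s'. t \<le> 1800 * (n * n) + 100 \<and> (\<exists>F'. F_st F' s' \<and> F_sound \<sigma> F' \<and> (\<forall>g. F' g \<le> F g) \<and>
     (\<forall>i<np. \<forall>v<2 * n. 0 < wmem s3 103 (int (i * (4 * n) + v)) \<longrightarrow> F' (row (fR i) * (2 * n) + v) \<le> rp (fR i)))) s3"
        proof (rule first_part_wp[OF r3 n3(1) np(1) n3(2) Fs3 F(2)])
          fix i v assume iv: "i < np" "v < 2 * n" "0 < wmem s3 103 (int (i * (4 * n) + v))"
          then have "0 < mat_prod (4 * n) X B i v" using z[of i v] np4 by simp
          from Z1[OF np4[OF iv(1)] iv(2) this] obtain x where x: "q0 \<le> x" "x < hi" "IR x = i" "rank (v * n + col x) < x" by blast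
          then show "\<exists>q<L. row q = row (fR i) \<and> rp (fR i) \<le> rp q \<and> rp q < rp (fR i) + \<sigma> \<and> rank (v * n + col q) < q"
            using RI[OF x(1,2)] hi by (intro exI[of _ x]) auto
        qed
        show "wp m (Seq first_part (Seq (Assign 99 (Padd (Var 99) (Pmul (Var 0) (Var 0)))) (Assign 31 (Padd (Var 31) (Pmul (Var 0) (Var 30))))))
          (\<lambda>t' s'. \<exists>\<tau>\<le>Tm. t3 + t' \<le> 1800 * (n * n) + 150 + 7 * \<tau> \<and>
     wmem s' 99 0 = int (c + \<tau> + n * n) \<and> wmem s' 31 0 = int (q0 + n * \<sigma>) \<and>
     (\<exists>F'. F_st F' s' \<and> F_sound \<sigma> F' \<and> F_complete \<sigma> (q0 + n * \<sigma>) F')) s3"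
          unfolding wp_Seq[of m first_part]
        proof (rule wp_frame[OF fp], elim exE conjE)
          fix t4 :: nat and s4 :: state and F'
          assume t4: "t4 \<le> 1800 * (n * n) + 100" and F': "F_st F' s4" "F_sound \<sigma> F'" "\<forall>g. F' g \<le> F g"
            and F4: "\<forall>i<np. \<forall>v<2 * n. 0 < wmem s3 103 (int (i * (4 * n) + v)) \<longrightarrow> F' (row (fR i) * (2 * n) + v) \<le> rp (fR i)"
            and "\<And>a. a \<notin> wmods first_part \<Longrightarrow> wmem s4 a = wmem s3 a"
          then have f4: "wmem s4 99 0 = int (c + \<tau>)" "wmem s4 0 0 = int n" "wmem s4 30 0 = int \<sigma>" "wmem s4 31 0 = int q0"
            using a3 sc3 by auto
          have comp: "F_complete \<sigma> (q0 + n * \<sigma>) F'" unfolding F_complete_def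
          proof (intro allI impI)
            fix q v assume q: "q < L" "v < 2 * n" "q < q0 + n * \<sigma>" "cp (rank (v * n + col q)) + \<sigma> \<le> cp q"
            show "F' (row q * (2 * n) + v) \<le> rp q"
            proof (cases "q < q0")
              case True
              \<comment> \<open>Recorded places only decrease, so the candidates of earlier groups
                stay covered.\<close>
              then have "F (row q * (2 * n) + v) \<le> rp q" using F(3) q unfolding F_complete_def by blast
              then show ?thesis using F'(3) le_trans by blast
            next
              case False
              then have x: "q0 \<le> q" "q < hi" using q unfolding hi_def by auto
              have "0 < wmem s3 103 (int (IR q * (4 * n) + v))" using Z2[OF x q(2,4)] z[of "IR q" v] RI(1)[OF x] np4 q(2) by simp
              then have "F' (row (fR (IR q)) * (2 * n) + v) \<le> rp (fR (IR q))" using F4 RI(1)[OF x] q(2) by blast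
              then show ?thesis using RI(2,3)[OF x] by simp
            qed
          qed
          have Yb: "c + \<tau> \<le> Y" "n \<le> Y" "\<sigma> \<le> Y" "q0 \<le> Y" using b a3 n_Y by auto
          have st: "F_st F' (wupd 31 x y (wupd 99 x' y' s4))" for x y x' y' using F'(1) unfolding F_st_def by simp
          show "wp m (Seq (Assign 99 (Padd (Var 99) (Pmul (Var 0) (Var 0)))) (Assign 31 (Padd (Var 31) (Pmul (Var 0) (Var 30)))))
            (\<lambda>t' s'. \<exists>\<tau>\<le>Tm. t3 + (t4 + t') \<le> 1800 * (n * n) + 150 + 7 * \<tau> \<and>
              wmem s' 99 0 = int (c + \<tau> + n * n) \<and> wmem s' 31 0 = int (q0 + n * \<sigma>) \<and>
              (\<exists>F'. F_st F' s' \<and> F_sound \<sigma> F' \<and> F_complete \<sigma> (q0 + n * \<sigma>) F')) s4"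
            apply (rule wp_Assign) using f4 Yb apply (simp add: sz nf)
            using f4 Yb st a3 t4 comp F'(2)
            by (simp add: sz nf) (rule exI[of _ F'], simp)
        qed
      qed
      show ?case
        apply (rule wp_Assign) using sc2 n_Y apply (simp add: sz)
        apply (rule wp_mono[OF rest])
        using t1 t2 by auto
    qed
  qed
qed

lemma wmods_group: "wmods (group call) \<subseteq> {31..49} \<union> insert 99 {100..}"
  using call_mods unfolding group_def by auto

lemma group_frame: "a < 31 \<or> 49 < a \<and> a < 99 \<Longrightarrow> a \<notin> wmods (group call)"
  using wmods_group by fastforce

lemma ranked_cong: "ranked s \<Longrightarrow> (\<And>a. a < 30 \<Longrightarrow> wmem s' a = wmem s a) \<Longrightarrow> ranked s'"
  unfolding ranked_def dims_def by simp

text \<open>A larger \<sigma> widens the windows and leaves fewer far candidates, so the doubling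
  after a complete attempt does no harm.\<close>

lemma F_mono: "F_sound \<sigma> F \<Longrightarrow> \<sigma> \<le> \<sigma>' \<Longrightarrow> F_sound \<sigma>' F" "F_complete \<sigma> q F \<Longrightarrow> \<sigma> \<le> \<sigma>' \<Longrightarrow> F_complete \<sigma>' q F"
  unfolding F_sound_def F_complete_def by (meson add_left_mono le_trans less_le_trans)+

text \<open>The time is charged against the clock c, which overshoots the budget by at most one
  group. If the budget is exhausted early, then j groups with j \<sigma> \<le> 2 n have charged more
  than n^2 \<sigma>, and this bounds \<sigma>^2 by 2 (Tm + n^2) / n.\<close>

lemma groups_wp:
  assumes r: "ranked s" and sc: "wmem s 30 0 = int \<sigma>" "wmem s 31 0 = 0" "wmem s 99 0 = 0"
    and b: "1 \<le> \<sigma>" "\<sigma> \<le> Y" "n * n * \<sigma> + Tm + n * n \<le> Y"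
    and F: "F_st F s" "F_sound \<sigma> F" "F_complete \<sigma> 0 F"
  shows "wp m (While (Conj (WLess (Var 31) (Var 7)) (Neg (WLess (Pmul (Pmul (Var 0) (Var 0)) (Var 30)) (Var 99)))) (group call))
    (\<lambda>t s'. t \<le> 7000 * (n * n * \<sigma> + Tm + n * n) + 20 \<and> (\<exists>q0. wmem s' 31 0 = int q0 \<and>
      (q0 < L \<longrightarrow> n * (\<sigma> * \<sigma>) < 2 * (Tm + n * n)) \<and>
      (\<not> q0 < L \<longrightarrow> (\<exists>F. F_st F s' \<and> F_sound \<sigma> F \<and> F_complete \<sigma> L F)))) s"
proof (rule wp_While_time[where J = L and I = "\<lambda>j T s'. \<exists>c. wmem s' 31 0 = int (j * (n * \<sigma>)) \<and> wmem s' 99 0 = int c \<and>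
     T \<le> 7000 * c \<and> c \<le> j * (Tm + n * n) \<and> c \<le> n * n * \<sigma> + Tm + n * n \<and>
     (\<exists>F. F_st F s' \<and> F_sound \<sigma> F \<and> F_complete \<sigma> (j * (n * \<sigma>)) F)"], goal_cases)
  case 1
  then show ?case using sc F by (intro exI[of _ 0]) auto
next
  case (2 j T s')
  let ?b = "Conj (WLess (Var 31) (Var 7)) (Neg (WLess (Pmul (Pmul (Var 0) (Var 0)) (Var 30)) (Var 99)))"
  from 2(1) obtain c F where I: "wmem s' 31 0 = int (j * (n * \<sigma>))" "wmem s' 99 0 = int c" "T \<le> 7000 * c"
     "c \<le> j * (Tm + n * n)" "c \<le> n * n * \<sigma> + Tm + n * n" "F_st F s'" "F_sound \<sigma> F" "F_complete \<sigma> (j * (n * \<sigma>)) F"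
    by blast
  have fr: "wmem s' a = wmem s a" if "a < 31" for a using 2(2)[of a] group_frame that by simp
  have r': "ranked s'" by (rule ranked_cong[OF r]) (use fr in auto)
  have D: "wmem s' 7 0 = int L" "wmem s' 0 0 = int n" "wmem s' 30 0 = int \<sigma>" using r' fr sc unfolding ranked_def dims_def by auto
  let ?v = "j * (n * \<sigma>) < L \<and> \<not> n * n * \<sigma> < c"
  have bv: "beval m s' ?b = Some ?v" using D I(1,2) n_Y b(2) by (simp add: sz nf)
  have cost: "1 + bcost ?b = 19" by simp
  have n1: "1 \<le> n * n" using n_pos by simp
  have "j < L \<and> wp m (group call) (\<lambda>t s''. \<exists>c. wmem s'' 31 0 = int (Suc j * (n * \<sigma>)) \<and> wmem s'' 99 0 = int c \<and>
     T + 1 + bcost ?b + t \<le> 7000 * c \<and> c \<le> Suc j * (Tm + n * n) \<and> c \<le> n * n * \<sigma> + Tm + n * n \<and>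
     (\<exists>F. F_st F s'' \<and> F_sound \<sigma> F \<and> F_complete \<sigma> (Suc j * (n * \<sigma>)) F)) s'" if v: ?v
  proof
    \<comment> \<open>Each group advances by at least one rank, so L bounds the number of
      iterations.\<close>
    have "1 \<le> n * \<sigma>" using n_pos b(1) by simp
    then have "j * 1 \<le> j * (n * \<sigma>)" by (intro mult_left_mono) auto
    then show "j < L" using v by linarith
    have "c + Tm + n * n \<le> Y" using v b(3) by linarith
    note g = group_wp[OF r' D(3) I(1,2) b(1,2) v[THEN conjunct1] this I(6-8)]
    show "wp m (group call) (\<lambda>t s''. \<exists>c. wmem s'' 31 0 = int (Suc j * (n * \<sigma>)) \<and> wmem s'' 99 0 = int c \<and>
     T + 1 + bcost ?b + t \<le> 7000 * c \<and> c \<le> Suc j * (Tm + n * n) \<and> c \<le> n * n * \<sigma> + Tm + n * n \<and>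
     (\<exists>F. F_st F s'' \<and> F_sound \<sigma> F \<and> F_complete \<sigma> (Suc j * (n * \<sigma>)) F)) s'"
    proof (rule wp_mono[OF g], elim exE conjE)
      fix t :: nat and s'' :: state and \<tau> F'
      assume a: "\<tau> \<le> Tm" "t \<le> 6000 * (n * n) + 500 + 7 * \<tau>" "wmem s'' 99 0 = int (c + \<tau> + n * n)"
        "wmem s'' 31 0 = int (j * (n * \<sigma>) + n * \<sigma>)" "F_st F' s''" "F_sound \<sigma> F'" "F_complete \<sigma> (j * (n * \<sigma>) + n * \<sigma>) F'"
      have "T + 1 + bcost ?b + t \<le> 7000 * (c + \<tau> + n * n)" by (rule group_cost_bound[OF a(2) I(3) cost n1])
      moreover have "c + \<tau> + n * n \<le> Suc j * (Tm + n * n)" using I(4) a(1) by simp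
      moreover have "c + \<tau> + n * n \<le> n * n * \<sigma> + Tm + n * n" using v a(1) by linarith
      moreover have "j * (n * \<sigma>) + n * \<sigma> = Suc j * (n * \<sigma>)" by simp
      ultimately show "\<exists>c. wmem s'' 31 0 = int (Suc j * (n * \<sigma>)) \<and> wmem s'' 99 0 = int c \<and>
     T + 1 + bcost ?b + t \<le> 7000 * c \<and> c \<le> Suc j * (Tm + n * n) \<and> c \<le> n * n * \<sigma> + Tm + n * n \<and>
     (\<exists>F. F_st F s'' \<and> F_sound \<sigma> F \<and> F_complete \<sigma> (Suc j * (n * \<sigma>)) F)"
        using a(3-7) by (intro exI[of _ "c + \<tau> + n * n"]) metis
    qed
  qed
  moreover have "(T + 1 + bcost ?b \<le> 7000 * (n * n * \<sigma> + Tm + n * n) + 20 \<and> (\<exists>q0. wmem s' 31 0 = int q0 \<and>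
      (q0 < L \<longrightarrow> n * (\<sigma> * \<sigma>) < 2 * (Tm + n * n)) \<and>
      (\<not> q0 < L \<longrightarrow> (\<exists>F. F_st F s' \<and> F_sound \<sigma> F \<and> F_complete \<sigma> L F))))" if nv: "\<not> ?v"
  proof (intro conjI exI[of _ "j * (n * \<sigma>)"] impI)
    show "T + 1 + bcost ?b \<le> 7000 * (n * n * \<sigma> + Tm + n * n) + 20" using I(3,5) cost by (simp add: distrib_left)
    show "wmem s' 31 0 = int (j * (n * \<sigma>))" by (rule I)
  next
    assume q: "j * (n * \<sigma>) < L"
    then have "n * n * \<sigma> < c" using nv by simp
    then have "n * n * \<sigma> * \<sigma> < c * \<sigma>" using b(1) by simp
    also have "\<dots> \<le> j * (Tm + n * n) * \<sigma>" using I(4) by (intro mult_right_mono) auto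
    also have "\<dots> = j * \<sigma> * (Tm + n * n)" by simp
    also have "\<dots> \<le> 2 * n * (Tm + n * n)"
    proof (rule mult_right_mono)
      have "n * (j * \<sigma>) < n * (2 * n)" using q by (simp add: algebra_simps)
      then show "j * \<sigma> \<le> 2 * n" using n_pos by simp
    qed simp
    finally have "n * (n * (\<sigma> * \<sigma>)) < n * (2 * (Tm + n * n))" by (simp add: algebra_simps)
    then show "n * (\<sigma> * \<sigma>) < 2 * (Tm + n * n)" by simp
  next
    assume "\<not> j * (n * \<sigma>) < L"
    then have "F_complete \<sigma> L F" using I(8) unfolding F_complete_def by (meson le_less_linear less_le_trans)
    then show "\<exists>F. F_st F s' \<and> F_sound \<sigma> F \<and> F_complete \<sigma> L F" using I(6,7) by blast
  qed
  ultimately show ?case using bv by blast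
qed

lemma attempt_wp:
  assumes r: "ranked s" and sc: "wmem s 30 0 = int \<sigma>"
    and b: "1 \<le> \<sigma>" "\<sigma> \<le> Y" "n * n * \<sigma> + Tm + n * n \<le> Y"
  shows "wp m (attempt call) (\<lambda>t s'. t \<le> 8000 * (n * n * \<sigma> + Tm + n * n) \<and> wmem s' 30 0 = int (2 * \<sigma>) \<and> (\<exists>q0. wmem s' 31 0 = int q0 \<and>
      (q0 < L \<longrightarrow> n * (\<sigma> * \<sigma>) < 2 * (Tm + n * n)) \<and>
      (\<not> q0 < L \<longrightarrow> (\<exists>F. F_st F s' \<and> F_sound (2 * \<sigma>) F \<and> F_complete (2 * \<sigma>) L F)))) s"
  unfolding attempt_def wp_Seq[of m "For _ _ _"]
proof (rule wp_For[where N = "2 * n * (2 * n)" and c = 10 and I = "\<lambda>k s'. \<forall>g<k. wmem s' 32 (int g) = int n"], goal_cases)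
  case (1 k s')
  then show ?case using r n_Y by (simp add: sz nf ranked_def dims_def)
next
  case 2
  then show ?case using n_Y by (intro wmax_Y) simp
next
  case 3
  then show ?case by simp
next
  case (4 k s')
  have "wmem s' 0 0 = int n" using 4(4) r unfolding ranked_def dims_def by simp
  then show ?case using 4 n_Y by (auto simp: sz less_Suc_eq)
next
  case (5 t1 s1)
  let ?s1 = "wupd 31 0 0 (wupd 99 0 0 s1)"
  have fr: "wmem s1 a = wmem s a" if "a < 31" for a using 5(4)[of a] that by simp
  have r1: "ranked ?s1" by (rule ranked_cong[OF r]) (use fr in auto)
  have sc1: "wmem ?s1 30 0 = int \<sigma>" using fr sc by simp
  have F: "F_st (\<lambda>_. n) ?s1" "F_sound \<sigma> (\<lambda>_. n)" "F_complete \<sigma> 0 (\<lambda>_. n)"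
    using 5(1) unfolding F_st_def F_sound_def F_complete_def by auto
  let ?W = "While (Conj (WLess (Var 31) (Var 7)) (Neg (WLess (Pmul (Pmul (Var 0) (Var 0)) (Var 30)) (Var 99)))) (group call)"
  have g: "wp m ?W (\<lambda>t s'. t \<le> 7000 * (n * n * \<sigma> + Tm + n * n) + 20 \<and> (\<exists>q0. wmem s' 31 0 = int q0 \<and>
      (q0 < L \<longrightarrow> n * (\<sigma> * \<sigma>) < 2 * (Tm + n * n)) \<and>
      (\<not> q0 < L \<longrightarrow> (\<exists>F. F_st F s' \<and> F_sound \<sigma> F \<and> F_complete \<sigma> L F)))) ?s1"
    by (rule groups_wp[OF r1 sc1 _ _ b F]) auto
  have n1: "1 \<le> n * n" "n * n \<le> n * n * \<sigma>" using n_pos b(1) by auto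
  have t1: "t1 \<le> 160 * (n * n) + 30" using 5(3) by simp
  have g': "wp m (Seq ?W (Assign 30 (Pmul (WConst 2) (Var 30)))) (\<lambda>t s'. t1 + t + 10 \<le> 8000 * (n * n * \<sigma> + Tm + n * n) \<and> wmem s' 30 0 = int (2 * \<sigma>) \<and> (\<exists>q0. wmem s' 31 0 = int q0 \<and>
      (q0 < L \<longrightarrow> n * (\<sigma> * \<sigma>) < 2 * (Tm + n * n)) \<and>
      (\<not> q0 < L \<longrightarrow> (\<exists>F. F_st F s' \<and> F_sound (2 * \<sigma>) F \<and> F_complete (2 * \<sigma>) L F)))) ?s1"
    unfolding wp_Seq[of m ?W]
  proof (rule wp_frame[OF g], elim exE conjE)
    fix t :: nat and s' :: state and q0 :: nat
    assume a: "t \<le> 7000 * (n * n * \<sigma> + Tm + n * n) + 20" "wmem s' 31 0 = int q0"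
      "q0 < L \<longrightarrow> n * (\<sigma> * \<sigma>) < 2 * (Tm + n * n)" "\<not> q0 < L \<longrightarrow> (\<exists>F. F_st F s' \<and> F_sound \<sigma> F \<and> F_complete \<sigma> L F)"
      and f: "\<And>a. a \<notin> wmods ?W \<Longrightarrow> wmem s' a = wmem ?s1 a"
    have s30: "wmem s' 30 0 = int \<sigma>" using f[of 30] group_frame[of 30] sc1 by simp
    let ?s' = "wupd 30 0 (int (2 * \<sigma>)) s'"
    have "\<exists>F. F_st F ?s' \<and> F_sound (2 * \<sigma>) F \<and> F_complete (2 * \<sigma>) L F" if nq: "\<not> q0 < L"
    proof -
      from a(4) nq obtain F where F: "F_st F s'" "F_sound \<sigma> F" "F_complete \<sigma> L F" by blast
      have "F_st F ?s'" using F(1) unfolding F_st_def by simp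
      moreover have "F_sound (2 * \<sigma>) F" by (rule F_mono(1)[OF F(2)]) simp
      moreover have "F_complete (2 * \<sigma>) L F" by (rule F_mono(2)[OF F(3)]) simp
      ultimately show ?thesis by blast
    qed
    moreover have "t1 + (t + 6) + 10 \<le> 8000 * (n * n * \<sigma> + Tm + n * n)" by (rule attempt_cost_bound[OF t1 a(1) n1(1)])
    ultimately show "wp m (Assign 30 (Pmul (WConst 2) (Var 30))) (\<lambda>t' s'. t1 + (t + t') + 10 \<le> 8000 * (n * n * \<sigma> + Tm + n * n) \<and> wmem s' 30 0 = int (2 * \<sigma>) \<and> (\<exists>q0. wmem s' 31 0 = int q0 \<and>
      (q0 < L \<longrightarrow> n * (\<sigma> * \<sigma>) < 2 * (Tm + n * n)) \<and>
      (\<not> q0 < L \<longrightarrow> (\<exists>F. F_st F s' \<and> F_sound (2 * \<sigma>) F \<and> F_complete (2 * \<sigma>) L F)))) s'"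
      using a(2,3) s30 b(2) Y_ge by (simp add: sz nf)
  qed
  show ?case
    apply (rule wp_Assign, simp add: sz)
    apply (rule wp_Assign, simp add: sz)
    apply (rule wp_mono[OF g'])
    by simp
qed

lemma wmods_attempt: "wmods (attempt call) \<subseteq> {30..49} \<union> insert 99 {100..}"
  using wmods_group unfolding attempt_def by fastforce

text \<open>By the first condition on J an attempt with \<sigma> = 2^J cannot exhaust its budget, so
  there are at most J + 1 attempts. Their budgets form a geometric series dominated by its last
  term.\<close>

lemma search_wp:
  assumes r: "ranked s" and J: "2 * (Tm + n * n) \<le> n * 4 ^ J" "n * n * 2 ^ J + Tm + n * n \<le> Y"
  shows "wp m (search call) (\<lambda>t s'. t \<le> 8000 * (n * n * 2 ^ (J + 1) + (J + 1) * (Tm + n * n)) + 7 * (J + 3) \<and>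
     (\<exists>\<sigma> F. 1 \<le> \<sigma> \<and> \<sigma> \<le> 2 ^ (J + 1) \<and> wmem s' 30 0 = int \<sigma> \<and> F_st F s' \<and> F_sound \<sigma> F \<and> F_complete \<sigma> L F)) s"
proof -
  let ?s = "wupd 30 0 1 (wupd 31 0 0 s)"
  have n1: "1 \<le> n * n" using n_pos by simp
  have "wp m (While (WLess (Var 31) (Var 7)) (attempt call)) (\<lambda>t s'. t + 6 \<le> 8000 * (n * n * 2 ^ (J + 1) + (J + 1) * (Tm + n * n)) + 7 * (J + 3) \<and>
     (\<exists>\<sigma> F. 1 \<le> \<sigma> \<and> \<sigma> \<le> 2 ^ (J + 1) \<and> wmem s' 30 0 = int \<sigma> \<and> F_st F s' \<and> F_sound \<sigma> F \<and> F_complete \<sigma> L F)) ?s"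
  \<comment> \<open>After k attempts the size is 2^k; the strict inequality in the invariant records
    the failure of the attempt with 2^(k - 1).\<close>
  proof (rule wp_While[where J = "J + 1" and c = "\<lambda>k. 8000 * (n * n * 2 ^ k + Tm + n * n)" and
      I = "\<lambda>k s'. wmem s' 30 0 = int (2 ^ k) \<and> (\<exists>q0. wmem s' 31 0 = int q0 \<and>
      (q0 < L \<longrightarrow> k = 0 \<or> n * 4 ^ (k - 1) < 2 * (Tm + n * n)) \<and>
      (\<not> q0 < L \<longrightarrow> (\<exists>F. F_st F s' \<and> F_sound (2 ^ k) F \<and> F_complete (2 ^ k) L F)))"], goal_cases)
    case 1
    have "0 < L" using n_pos by simp
    then show ?case by (auto intro!: exI[of _ 0])
  next
    case (2 k s')
    from 2(1) obtain q0 where I: "wmem s' 30 0 = int (2 ^ k)" "wmem s' 31 0 = int q0"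
      "q0 < L \<longrightarrow> k = 0 \<or> n * 4 ^ (k - 1) < 2 * (Tm + n * n)"
      "\<not> q0 < L \<longrightarrow> (\<exists>F. F_st F s' \<and> F_sound (2 ^ k) F \<and> F_complete (2 ^ k) L F)" by blast
    have fr: "wmem s' a = wmem s a" if "a < 30" for a using 2(3)[of a] wmods_attempt that by fastforce
    have r': "ranked s'" by (rule ranked_cong[OF r]) (use fr in auto)
    have bv: "beval m s' (WLess (Var 31) (Var 7)) = Some (q0 < L)" using r' I(2) unfolding ranked_def dims_def by (simp add: sz)
    have "k < J + 1 \<and> wp m (attempt call) (\<lambda>t s''. t \<le> 8000 * (n * n * 2 ^ k + Tm + n * n) \<and> wmem s'' 30 0 = int (2 ^ Suc k) \<and> (\<exists>q0. wmem s'' 31 0 = int q0 \<and>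
      (q0 < L \<longrightarrow> Suc k = 0 \<or> n * 4 ^ (Suc k - 1) < 2 * (Tm + n * n)) \<and>
      (\<not> q0 < L \<longrightarrow> (\<exists>F. F_st F s'' \<and> F_sound (2 ^ Suc k) F \<and> F_complete (2 ^ Suc k) L F)))) s'" if q: "q0 < L"
    proof
      show kJ: "k < J + 1"
      proof (cases "k = 0")
        case False
        \<comment> \<open>A failure with size 2^(k - 1) is compatible with the choice of J only if k
          - 1 < J.\<close>
        then have "n * 4 ^ (k - 1) < n * 4 ^ J" using I(3) q J(1) by linarith
        then have "4 ^ (k - 1) < (4::nat) ^ J" by simp
        then have "k - 1 < J" by (rule power_less_imp_less_exp[rotated]) simp
        then show ?thesis by simp
      qed simp
      then have le: "(2::nat) ^ k \<le> 2 ^ J" by (intro power_increasing) auto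
      then have "n * n * 2 ^ k \<le> n * n * 2 ^ J" by (intro mult_left_mono) auto
      then have b3: "n * n * 2 ^ k + Tm + n * n \<le> Y" using J(2) by linarith
      have "2 ^ k \<le> n * n * 2 ^ k" using n1 by simp
      then have b2: "2 ^ k \<le> Y" using b3 by linarith
      have e: "n * (2 ^ k * 2 ^ k) = n * 4 ^ k" by (simp flip: power_mult_distrib)
      show "wp m (attempt call) (\<lambda>t s''. t \<le> 8000 * (n * n * 2 ^ k + Tm + n * n) \<and> wmem s'' 30 0 = int (2 ^ Suc k) \<and> (\<exists>q0. wmem s'' 31 0 = int q0 \<and>
      (q0 < L \<longrightarrow> Suc k = 0 \<or> n * 4 ^ (Suc k - 1) < 2 * (Tm + n * n)) \<and>
      (\<not> q0 < L \<longrightarrow> (\<exists>F. F_st F s'' \<and> F_sound (2 ^ Suc k) F \<and> F_complete (2 ^ Suc k) L F)))) s'"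
        by (rule wp_mono[OF attempt_wp[OF r' I(1) _ b2 b3]]) (auto simp: e)
    qed
    moreover have "(t + 6 \<le> 8000 * (n * n * 2 ^ (J + 1) + (J + 1) * (Tm + n * n)) + 7 * (J + 3) \<and>
     (\<exists>\<sigma> F. 1 \<le> \<sigma> \<and> \<sigma> \<le> 2 ^ (J + 1) \<and> wmem s' 30 0 = int \<sigma> \<and> F_st F s' \<and> F_sound \<sigma> F \<and> F_complete \<sigma> L F))"
      if nq: "\<not> q0 < L" and t: "t \<le> (\<Sum>j<k. 8000 * (n * n * 2 ^ j + Tm + n * n)) + (k + 1) * (1 + bcost (WLess (Var 31) (Var 7)))" for t
    proof
      from nq I(4) obtain F where "F_st F s'" "F_sound (2 ^ k) F" "F_complete (2 ^ k) L F" by blast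
      moreover have "(2::nat) ^ k \<le> 2 ^ (J + 1)" using 2(2) by (intro power_increasing) auto
      ultimately show "\<exists>\<sigma> F. 1 \<le> \<sigma> \<and> \<sigma> \<le> 2 ^ (J + 1) \<and> wmem s' 30 0 = int \<sigma> \<and> F_st F s' \<and> F_sound \<sigma> F \<and> F_complete \<sigma> L F"
        using I(1) by (intro exI[of _ "2 ^ k"] exI[of _ F]) auto
      have "(\<Sum>j<k. 8000 * (n * n * 2 ^ j + Tm + n * n)) \<le> 8000 * (n * n * 2 ^ k + k * (Tm + n * n))"
        by (induction k) (simp_all add: algebra_simps)
      also have "\<dots> \<le> 8000 * (n * n * 2 ^ (J + 1) + (J + 1) * (Tm + n * n))"
        using 2(2) by (intro mult_left_mono add_mono mult_right_mono power_increasing) auto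
      finally show "t + 6 \<le> 8000 * (n * n * 2 ^ (J + 1) + (J + 1) * (Tm + n * n)) + 7 * (J + 3)"
        using t 2(2) by simp
    qed
    ultimately show ?case using bv by blast
  qed
  note main = this
  show ?thesis unfolding search_def
    apply (rule wp_Assign, simp add: sz)
    apply (rule wp_Assign, simp add: sz)
    apply (rule wp_mono[OF main])
    by simp
qed

end

section \<open>Min-max products\<close>

text \<open>The places within a class form an initial segment of the natural numbers, so going back
  from an entry by any admissible number of places meets an entry of the same class.\<close>

lemma pos_surj: "p < pos key q \<Longrightarrow> \<exists>x<q. key x = key q \<and> pos key x = p"
proof -
  assume p: "p < pos key q"
  let ?S = "{x. x < q \<and> key x = key q}"
  have inj: "inj_on (pos key) ?S"
  proof (rule inj_onI)
    fix x y assume "x \<in> ?S" "y \<in> ?S" "pos key x = pos key y"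
    then show "x = y" using pos_inj[of key x y] by simp
  qed
  have "pos key ` ?S \<subseteq> {..<pos key q}" using pos_strict[of key _ q] by auto
  moreover have "card (pos key ` ?S) = card {..<pos key q}" using card_image[OF inj] by (simp add: pos_def)
  ultimately have "pos key ` ?S = {..<pos key q}" by (intro card_subset_eq) auto
  then have "p \<in> pos key ` ?S" using p by simp
  then show ?thesis by auto
qed

section \<open>Direct comparisons and scans\<close>

definition near_step :: com where
  "near_step = Cond (WLess (Var 51) (Var 52))
    (Seq (Assign 55 (WLoad 24 (Psub (Padd (Var 53) (Var 52)) (Padd (Var 51) (WConst 1)))))
    (Seq (Assign 56 (Padd (Var 54) (Pdiv (WLoad 10 (Var 55)) (Var 0))))
    (Cond (NLess (NLoad 5 (WLoad 10 (Var 50))) (NLoad 6 (Var 56))) (NStore 6 (Var 56) (NLoad 5 (WLoad 10 (Var 50)))) Skip))) Skip"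

text \<open>For each entry the \<sigma> entries just before it in its column are visited. Closeness
  is measured in places and ignores the boundaries of chunks; these predecessors include the earlier
  entries of the chunk.\<close>

definition near :: com where
  "near = For 50 (Var 7) (Seq (Assign 52 (WLoad 22 (Var 50)))
    (Seq (Assign 53 (Pmul (WMod (WLoad 10 (Var 50)) (Var 0)) (Var 6)))
    (Seq (Assign 54 (Pmul (Pdiv (WLoad 10 (Var 50)) (Var 0)) (Var 6))) (For 51 (Var 30) near_step))))"

definition far_step :: com where
  "far_step = Seq (Assign 57 (Padd (Var 52) (Var 51))) (Cond (WLess (Var 57) (Var 0))
    (Seq (Assign 55 (WLoad 23 (Padd (Var 53) (Var 57))))
    (Cond (Conj (WLess (WLoad 20 (Padd (Var 54) (WMod (WLoad 10 (Var 55)) (Var 0)))) (Var 55))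
        (NLess (NLoad 5 (WLoad 10 (Var 55))) (NLoad 6 (Var 50))))
      (NStore 6 (Var 50) (NLoad 5 (WLoad 10 (Var 55)))) Skip)) Skip)"

definition far :: com where
  "far = For 50 (Pmul (Var 6) (Var 6)) (Seq (Assign 52 (WLoad 32 (Var 50)))
    (Seq (Assign 53 (Pmul (Pdiv (Var 50) (Var 6)) (Var 0)))
    (Seq (Assign 54 (Pmul (WMod (Var 50) (Var 6)) (Var 0))) (For 51 (Var 30) far_step))))"

lemma mods_near_far [simp]: "wmods near_step = {55,56}" "nmods near_step = {6}"
  "wmods near = {50,51,52,53,54,55,56}" "nmods near = {6}"
  "wmods far_step = {55,57}" "nmods far_step = {6}"
  "wmods far = {50,51,52,53,54,55,57}" "nmods far = {6}"
  by (auto simp: near_step_def near_def far_step_def far_def)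

definition minmax :: "com \<Rightarrow> com" where
  "minmax call = Seq merge_sort (Seq index_ranks (Seq (search call) (Seq near far)))"

abbreviation acc :: "state \<Rightarrow> nat \<Rightarrow> ereal" where "acc s g \<equiv> nmem s 6 (int g)"

context ranking_machine begin

text \<open>The soundness of the accumulators: a changed one holds the value of a true candidate. It
  is stated relative to \<open>A0\<close> because the accumulators persist over all
  scalings.\<close>

definition legit :: "(nat \<Rightarrow> ereal) \<Rightarrow> (nat \<Rightarrow> ereal) \<Rightarrow> (nat \<Rightarrow> ereal) \<Rightarrow> bool" where
  "legit V A0 A \<longleftrightarrow> (\<forall>u<2 * n. \<forall>v<2 * n. A (u * (2 * n) + v) \<le> A0 (u * (2 * n) + v) \<and>
     (A (u * (2 * n) + v) = A0 (u * (2 * n) + v) \<or>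
      (\<exists>q<L. row q = u \<and> rank (v * n + col q) < q \<and> A (u * (2 * n) + v) = V (ent q))))"

lemma legit_refl: "legit V A A"
  unfolding legit_def by simp

lemma legit_relax:
  assumes "legit V A0 A" "q < L" "v < 2 * n" "rank (v * n + col q) < q" "V (ent q) < A (row q * (2 * n) + v)"
  shows "legit V A0 (A(row q * (2 * n) + v := V (ent q)))"
  unfolding legit_def
proof (intro allI impI)
  fix u w assume uw: "u < 2 * n" "w < 2 * n"
  let ?A = "A(row q * (2 * n) + v := V (ent q))"
  show "?A (u * (2 * n) + w) \<le> A0 (u * (2 * n) + w) \<and> (?A (u * (2 * n) + w) = A0 (u * (2 * n) + w) \<or>
      (\<exists>q<L. row q = u \<and> rank (w * n + col q) < q \<and> ?A (u * (2 * n) + w) = V (ent q)))"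
  proof (cases "u * (2 * n) + w = row q * (2 * n) + v")
    case True
    then have e: "u = row q" "w = v" using mult_add_inj[of u "2 * n" w "row q" v] uw assms(3) by auto
    have "A (u * (2 * n) + w) \<le> A0 (u * (2 * n) + w)" using assms(1) uw unfolding legit_def by blast
    then have "V (ent q) \<le> A0 (u * (2 * n) + w)" using assms(5) e by (metis less_imp_le order_trans)
    then show ?thesis using e assms by auto
  next
    case False
    then show ?thesis using assms(1) uw unfolding legit_def by simp
  qed
qed

definition close :: "(nat \<Rightarrow> ereal) \<Rightarrow> nat \<Rightarrow> nat \<Rightarrow> (nat \<Rightarrow> ereal) \<Rightarrow> bool" where
  "close V q c A \<longleftrightarrow> (\<forall>x<q. col x = col q \<and> cp q \<le> cp x + c \<longrightarrow> A (row q * (2 * n) + row x) \<le> V (ent q))"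

lemma close_mono: "close V q c A \<Longrightarrow> (\<And>g. A' g \<le> A g) \<Longrightarrow> close V q c A'"
  unfolding close_def by (meson order_trans)

lemma near_step_wp:
  assumes r: "ranked s" and q: "q < L" and c: "c \<le> Y"
    and sc: "wmem s 50 0 = int q" "wmem s 51 0 = int c" "wmem s 52 0 = int (cp q)" "wmem s 53 0 = int (col q * (2 * n))"
      "wmem s 54 0 = int (row q * (2 * n))"
    and V: "\<And>e. nmem s 5 (int e) = V e"
    and inv: "legit V A0 (acc s)" "close V q c (acc s)"
  shows "wp m near_step (\<lambda>t s'. t \<le> 60 \<and> wmem s' 51 0 = int c \<and> legit V A0 (acc s') \<and> close V q (Suc c) (acc s') \<and> (\<forall>g. acc s' g \<le> acc s g)) s"
proof (cases "c < cp q")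
  case True
  have D: "wmem s 0 0 = int n" "\<And>q. q < L \<Longrightarrow> wmem s 10 (int q) = int (ent q)"
    "\<And>q. q < L \<Longrightarrow> wmem s 24 (int (col q * (2 * n) + cp q)) = int q" using r unfolding ranked_def dims_def by auto
  have "cp q - Suc c < cp q" using True by simp
  from pos_surj[OF this] obtain x where x: "x < q" "col x = col q" "cp x = cp q - Suc c" by blast
  have xL: "x < L" using x q by simp
  have bd: "row x < 2 * n" "row q < 2 * n" "col q < n" "cp q < 2 * n" using row_less xL q col_less cp_less by auto
  have Yb: "row x \<le> Y" "row q \<le> Y" "col q \<le> Y" "cp q \<le> Y" "ent x \<le> Y" "q \<le> Y" using bd n_Y ent_less[OF xL] q by auto
  have b4: "row q * (2 * n) + row x < 2 * n * (2 * n)" using bd by (intro mult_add_less) auto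
  have rx: "rank (row x * n + col q) = x" using rank_ent[OF xL] x by (simp add: ent_eq)
  have i24: "wmem s 24 (int (col q * (2 * n) + cp q - Suc c)) = int x"
    using D(3)[OF xL] x True by simp
  have ex: "wmem s 10 (int x) = int (ent x)" "wmem s 10 (int q) = int (ent q)" "ent x div n = row x" using D(2) xL q by (auto simp: row_def)
  have cl: "col q * (2 * n) \<le> Y"
  proof -
    have "col q * (2 * n) \<le> n * (2 * n)" using bd by (intro mult_right_mono) auto
    also have "\<dots> = L" by simp
    finally show ?thesis using n_Y(4) by linarith
  qed
  have rw: "row q * (2 * n) \<le> Y" using b4 n_Y by simp
  let ?g = "row q * (2 * n) + row x"
  have clo: "close V q (Suc c) A'" if "A' ?g \<le> V (ent q)" "\<And>g. A' g \<le> acc s g" for A'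
    unfolding close_def
  proof (intro allI impI, elim conjE)
    fix y assume y: "y < q" "col y = col q" "cp q \<le> cp y + Suc c"
    show "A' (row q * (2 * n) + row y) \<le> V (ent q)"
    proof (cases "cp q \<le> cp y + c")
      case True
      then have "acc s (row q * (2 * n) + row y) \<le> V (ent q)" using inv(2) y unfolding close_def by blast
      then show ?thesis using that(2) order_trans by blast
    next
      case False
      then have "cp y = cp x" using y x by simp
      then have "y = x" using pos_inj[of col y x] y x by simp
      then show ?thesis using that(1) by simp
    qed
  qed
  show ?thesis
  proof (cases "V (ent q) < acc s ?g")
    case lt: True
    have l: "legit V A0 ((acc s)(?g := V (ent q)))"
      by (rule legit_relax[OF inv(1) q bd(1) _ lt]) (use rx x in simp)
    have c2: "close V q (Suc c) ((acc s)(?g := V (ent q)))" by (rule clo) (use lt in \<open>auto intro: less_imp_le\<close>)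
    show ?thesis using l c2 lt True sc D(1) i24 ex V Yb c cl rw n_Y unfolding near_step_def
      by (auto simp: sz nf fun_upd_def less_imp_le cong: if_cong)
  next
    case ge: False
    have c2: "close V q (Suc c) (acc s)" by (rule clo) (use ge in auto)
    show ?thesis using inv(1) c2 ge True sc D(1) i24 ex V Yb c cl rw n_Y unfolding near_step_def
      by (simp add: sz nf)
  qed
next
  case False
  have "close V q (Suc c) (acc s)" using inv(2) False unfolding close_def by simp
  then show ?thesis using False sc inv(1) unfolding near_step_def by (simp add: sz)
qed

lemma near_wp:
  assumes r: "ranked s" and sg: "wmem s 30 0 = int \<sigma>" "\<sigma> \<le> Y" "1 \<le> \<sigma>"
    and V: "\<And>e. nmem s 5 (int e) = V e" and inv: "legit V A0 (acc s)"
  shows "wp m near (\<lambda>t s'. t \<le> 400 * (n * n * \<sigma>) + 30 \<and> legit V A0 (acc s') \<and> (\<forall>q<L. close V q \<sigma> (acc s'))) s"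
  unfolding near_def
proof (rule wp_For[where N = L and c = "82 * \<sigma> + 70" and I = "\<lambda>k s'. legit V A0 (acc s') \<and> (\<forall>q<k. close V q \<sigma> (acc s'))"], goal_cases)
  case (1 k s')
  then show ?case using r by (simp add: sz ranked_def dims_def)
next
  case 2
  then show ?case using n_Y by (intro wmax_Y) simp
next
  case 3
  then show ?case using inv by simp
next
  case (4 q s')
  have fr: "wmem s' a = wmem s a" if "a < 50" for a using 4(4)[of a] that by simp
  have fn: "nmem s' 5 = nmem s 5" using 4(5)[of 5] by simp
  have r': "ranked s'" using r fr unfolding ranked_def dims_def by simp
  have D: "wmem s' 0 0 = int n" "wmem s' 6 0 = int (2 * n)" "wmem s' 10 (int q) = int (ent q)" "wmem s' 22 (int q) = int (cp q)"
    "ent q div n = row q" "ent q mod n = col q"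
    using r' 4(1) unfolding ranked_def dims_def by (auto simp: row_def col_def)
  let ?s = "wupd 54 0 (int (row q * (2 * n))) (wupd 53 0 (int (col q * (2 * n))) (wupd 52 0 (int (cp q)) s'))"
  have Yb: "q \<le> Y" "row q \<le> Y" "col q \<le> Y" "ent q \<le> Y" using 4(1) n_Y ent_less[OF 4(1)] row_less[OF 4(1)] col_less[of q] by auto
  have rs: "ranked ?s" using r' unfolding ranked_def dims_def by simp
  have "wp m (For 51 (Var 30) near_step) (\<lambda>t s''. t \<le> 82 * \<sigma> + 30 \<and> wmem s'' 50 0 = int q \<and> legit V A0 (acc s'') \<and> close V q \<sigma> (acc s'') \<and> (\<forall>g. acc s'' g \<le> acc s' g)) ?s"
  proof (rule wp_For[where N = \<sigma> and c = 60 and I = "\<lambda>c s''. legit V A0 (acc s'') \<and> close V q c (acc s'') \<and> (\<forall>g. acc s'' g \<le> acc s' g)"], goal_cases)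
    case (1 k s'')
    then show ?case using fr sg by (simp add: sz)
  next
    case 2
    then show ?case using sg by (intro wmax_Y) simp
  next
    case 3
    \<comment> \<open>Earlier entries of a column have strictly smaller places, so zero steps
      promise nothing.\<close>
    have "close V q 0 A" for A
    proof -
      have "False" if "x < q" "col x = col q" "cp q \<le> cp x" for x using pos_strict[of col x q] that by simp
      then show ?thesis unfolding close_def by auto
    qed
    then show ?case using 4(2) by simp
  next
    case (4 c s'')
    have f2: "wmem s'' a = wmem ?s a" if "a < 50" for a using 4(4)[of a] that by simp
    have r2: "ranked s''" using rs f2 unfolding ranked_def dims_def by simp
    have sc: "wmem s'' 50 0 = int q" "wmem s'' 52 0 = int (cp q)" "wmem s'' 53 0 = int (col q * (2 * n))" "wmem s'' 54 0 = int (row q * (2 * n))"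
      using 4(4) \<open>wmem s' 50 0 = int q\<close> by auto
    have V2: "nmem s'' 5 (int e) = V e" for e using 4(5)[of 5] fn V by simp
    note ns = near_step_wp[OF r2 \<open>q < L\<close> _ sc(1) 4(3) sc(2-4) V2 4(2)[THEN conjunct1] 4(2)[THEN conjunct2, THEN conjunct1]]
    have "c \<le> Y" using 4(1) sg by simp
    have tr: "\<forall>g. acc s3 g \<le> acc s' g" if "\<forall>g. acc s3 g \<le> acc s'' g" for s3 :: state
      using that 4(2) order_trans by blast
    show ?case by (rule wp_mono[OF ns[OF \<open>c \<le> Y\<close>]]) (use tr in auto)
  next
    case (5 t s'')
    have "wmem s'' 50 0 = int q" using 5(4)[of 50] \<open>wmem s' 50 0 = int q\<close> by simp
    then show ?case using 5(1,3) by simp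
  qed
  note inner = this
  have fin: "\<forall>x<Suc q. close V x \<sigma> (acc s'')" if "close V q \<sigma> (acc s'')" "\<forall>g. acc s'' g \<le> acc s' g" for s'' :: state
    using that 4(2) close_mono[of V _ \<sigma> "acc s'" "acc s''"] by (auto simp: less_Suc_eq)
  show ?case
    apply (rule wp_Assign) using D 4(3) apply (simp add: sz)
    apply (rule wp_Assign) using D 4(3) Yb n_Y apply (simp add: sz nf)
    apply (rule wp_Assign) using D 4(3) Yb n_Y apply (simp add: sz nf)
    apply (rule wp_mono[OF inner])
    using fin by auto
next
  case (5 t s')
  have "t \<le> 2 * (n * n) * (82 * \<sigma> + 92) + 22" using 5(3) by (simp add: algebra_simps)
  also have "\<dots> \<le> 2 * (n * n) * (174 * \<sigma>) + 22" using sg(3) by (intro add_mono mult_left_mono) auto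
  finally show ?case using 5(1) by simp
qed

definition scanned :: "(nat \<Rightarrow> ereal) \<Rightarrow> (nat \<Rightarrow> nat) \<Rightarrow> nat \<Rightarrow> nat \<Rightarrow> nat \<Rightarrow> (nat \<Rightarrow> ereal) \<Rightarrow> bool" where
  "scanned V F u v c A \<longleftrightarrow> (\<forall>q<L. row q = u \<and> F (u * (2 * n) + v) \<le> rp q \<and> rp q < F (u * (2 * n) + v) + c \<and>
     rank (v * n + col q) < q \<longrightarrow> A (u * (2 * n) + v) \<le> V (ent q))"

text \<open>A row has n entries with distinct places below n, so by counting every place occurs.
  Hence a scan that stops at place n reads only cells of array 23 that were filled.\<close>

lemma row_full: "u < 2 * n \<Longrightarrow> p < n \<Longrightarrow> \<exists>q<L. row q = u \<and> rp q = p"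
proof -
  assume u: "u < 2 * n" and p: "p < n"
  let ?S = "{q. q < L \<and> row q = u}"
  have "(\<lambda>k. rank (u * n + k)) ` {..<n} \<subseteq> ?S" using row_col_rank[OF u] by auto
  moreover have "inj_on (\<lambda>k. rank (u * n + k)) {..<n}" 
  proof (rule inj_onI)
    fix x y assume "x \<in> {..<n}" "y \<in> {..<n}" "rank (u * n + x) = rank (u * n + y)"
    then show "x = y" using row_col_rank[OF u, of x] row_col_rank[OF u, of y] by (metis lessThan_iff)
  qed
  ultimately have card: "n \<le> card ?S" using card_inj_on_le[of "\<lambda>k. rank (u * n + k)" "{..<n}" ?S] by simp
  have inj: "inj_on rp ?S"
  proof (rule inj_onI)
    fix x y assume "x \<in> ?S" "y \<in> ?S" "rp x = rp y"
    then show "x = y" using pos_inj[of row x y] by simp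
  qed
  have "rp ` ?S \<subseteq> {..<n}" using rp_less by auto
  moreover have "n \<le> card (rp ` ?S)" using card card_image[OF inj] by simp
  ultimately have "rp ` ?S = {..<n}" by (intro card_seteq) auto
  then have "p \<in> rp ` ?S" using p by simp
  then show ?thesis by auto
qed

lemma far_step_wp:
  assumes r: "ranked s" and uv: "u < 2 * n" "v < 2 * n" and c: "c \<le> Y" and F: "F (u * (2 * n) + v) \<le> n"
    and sc: "wmem s 50 0 = int (u * (2 * n) + v)" "wmem s 51 0 = int c" "wmem s 52 0 = int (F (u * (2 * n) + v))" "wmem s 53 0 = int (u * n)"
      "wmem s 54 0 = int (v * n)"
    and V: "\<And>e. nmem s 5 (int e) = V e"
    and inv: "legit V A0 (acc s)" "scanned V F u v c (acc s)"
  shows "wp m far_step (\<lambda>t s'. t \<le> 70 \<and> wmem s' 51 0 = int c \<and> legit V A0 (acc s') \<and> scanned V F u v (Suc c) (acc s') \<and> (\<forall>g. acc s' g \<le> acc s g)) s"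
proof -
  let ?g = "u * (2 * n) + v"
  have D: "wmem s 0 0 = int n" "\<And>q. q < L \<Longrightarrow> wmem s 10 (int q) = int (ent q)" 
    "\<And>q. q < L \<Longrightarrow> wmem s 23 (int (row q * n + rp q)) = int q" using r unfolding ranked_def dims_def by auto
  have un: "u * n \<le> Y" "v * n \<le> Y"
  proof -
    have "u * n \<le> 2 * n * n" "v * n \<le> 2 * n * n" using uv by (auto intro!: mult_right_mono)
    then show "u * n \<le> Y" "v * n \<le> Y" using n_Y(4) by linarith+
  qed
  have Yb: "F ?g \<le> Y" using F n_Y by simp
  show ?thesis
  proof (cases "F ?g + c < n")
    case True
    from row_full[OF uv(1) True] obtain q where q: "q < L" "row q = u" "rp q = F ?g + c" by blast
    have i23: "wmem s 23 (int (u * n + (F ?g + c))) = int q" using D(3)[OF q(1)] q by simp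
    have e: "wmem s 10 (int q) = int (ent q)" "ent q mod n = col q" using D(2) q by (auto simp: col_def)
    have "v * n + col q < 2 * n * n" using uv col_less by (intro mult_add_less) auto
    then have P: "wmem s 20 (int (v * n + col q)) = int (rank (v * n + col q))" using ranked_rank[OF r] by simp
    have Yb2: "ent q \<le> Y" "col q \<le> Y" "q \<le> Y" using ent_less[OF q(1)] col_less[of q] n_Y q by auto
    have clo: "scanned V F u v (Suc c) A'" if "rank (v * n + col q) < q \<Longrightarrow> A' ?g \<le> V (ent q)" "\<And>g. A' g \<le> acc s g" for A'
      unfolding scanned_def
    proof (intro allI impI, elim conjE)
      fix y assume y: "y < L" "row y = u" "F ?g \<le> rp y" "rp y < F ?g + Suc c" "rank (v * n + col y) < y"
      show "A' ?g \<le> V (ent y)"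
      proof (cases "rp y < F ?g + c")
        case True
        then have "acc s ?g \<le> V (ent y)" using inv(2) y unfolding scanned_def by blast
        then show ?thesis using that(2) order_trans by blast
      next
        case False
        then have "rp y = rp q" using y q by simp
        then have "y = q" using pos_inj[of row y q] y q by simp
        then show ?thesis using that(1) y by simp
      qed
    qed
    show ?thesis
    proof (cases "rank (v * n + col q) < q \<and> V (ent q) < acc s ?g")
      case lt: True
      have l: "legit V A0 ((acc s)(?g := V (ent q)))"
        using legit_relax[OF inv(1) q(1) uv(2), of] lt q by simp
      have c2: "scanned V F u v (Suc c) ((acc s)(?g := V (ent q)))" by (rule clo) (use lt in \<open>auto intro: less_imp_le\<close>)
      show ?thesis using l c2 lt True sc D(1) i23 e P V Yb Yb2 c un n_Y unfolding far_step_def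
        by (auto simp: sz nf fun_upd_def less_imp_le cong: if_cong)
    next
      case ge: False
      have c2: "scanned V F u v (Suc c) (acc s)" by (rule clo) (use ge in auto)
      show ?thesis using inv(1) c2 ge True sc D(1) i23 e P V Yb Yb2 c un n_Y unfolding far_step_def
        by (auto simp: sz nf)
    qed
  next
    case False
    have "scanned V F u v (Suc c) (acc s)" unfolding scanned_def
    proof (intro allI impI, elim conjE)
      fix y assume y: "y < L" "row y = u" "F ?g \<le> rp y" "rp y < F ?g + Suc c" "rank (v * n + col y) < y"
      then have "rp y < F ?g + c" using rp_less[OF y(1)] False by simp
      then show "acc s ?g \<le> V (ent y)" using inv(2) y unfolding scanned_def by blast
    qed
    then show ?thesis using False sc D(1) Yb c n_Y inv(1) unfolding far_step_def by (simp add: sz nf)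
  qed
qed

lemma far_wp:
  assumes r: "ranked s" and sg: "wmem s 30 0 = int \<sigma>" "\<sigma> \<le> Y" "1 \<le> \<sigma>"
    and V: "\<And>e. nmem s 5 (int e) = V e" and inv: "legit V A0 (acc s)" and F: "F_st F s" "\<And>g. g < 2 * n * (2 * n) \<Longrightarrow> F g \<le> n"
  shows "wp m far (\<lambda>t s'. t \<le> 900 * (n * n * \<sigma>) + 30 \<and> legit V A0 (acc s') \<and> (\<forall>g. acc s' g \<le> acc s g) \<and>
     (\<forall>u<2 * n. \<forall>v<2 * n. scanned V F u v \<sigma> (acc s'))) s"
  unfolding far_def
proof (rule wp_For[where N = "2 * n * (2 * n)" and c = "92 * \<sigma> + 70" and I = "\<lambda>k s'. legit V A0 (acc s') \<and> (\<forall>g. acc s' g \<le> acc s g) \<and>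
    (\<forall>g<k. scanned V F (g div (2 * n)) (g mod (2 * n)) \<sigma> (acc s'))"], goal_cases)
  case (1 k s')
  then show ?case using r n_Y by (simp add: sz nf ranked_def dims_def)
next
  case 2
  then show ?case using n_Y by (intro wmax_Y) simp
next
  case 3
  then show ?case using inv by simp
next
  case (4 g s')
  have fr: "wmem s' a = wmem s a" if "a < 50" for a using 4(4)[of a] that by simp
  have fn: "nmem s' 5 = nmem s 5" using 4(5)[of 5] by simp
  have r': "ranked s'" using r fr unfolding ranked_def dims_def by simp
  have D: "wmem s' 0 0 = int n" "wmem s' 6 0 = int (2 * n)" 
    using r' unfolding ranked_def dims_def by auto
  have Fg: "wmem s' 32 (int g) = int (F g)" using F(1) 4(1) fr[of 32] unfolding F_st_def by simp
  define u v where "u = g div (2 * n)" and "v = g mod (2 * n)"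
  have g: "g = u * (2 * n) + v" unfolding u_def v_def by (rule div_mult_mod_eq[symmetric])
  have uv: "u < 2 * n" "v < 2 * n" using 4(1) n_pos unfolding u_def v_def by (auto simp: less_mult_imp_div_less)
  let ?s = "wupd 54 0 (int (v * n)) (wupd 53 0 (int (u * n)) (wupd 52 0 (int (F g)) s'))"
  have Yb: "g \<le> Y" "u \<le> Y" "v \<le> Y" using 4(1) n_Y uv by auto
  have rs: "ranked ?s" using r' unfolding ranked_def dims_def by simp
  have "wp m (For 51 (Var 30) far_step) (\<lambda>t s''. t \<le> 92 * \<sigma> + 30 \<and> wmem s'' 50 0 = int g \<and> legit V A0 (acc s'') \<and> scanned V F u v \<sigma> (acc s'') \<and> (\<forall>g. acc s'' g \<le> acc s' g)) ?s"
  proof (rule wp_For[where N = \<sigma> and c = 70 and I = "\<lambda>c s''. legit V A0 (acc s'') \<and> scanned V F u v c (acc s'') \<and> (\<forall>g. acc s'' g \<le> acc s' g)"], goal_cases)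
    case (1 k s'')
    then show ?case using fr sg by (simp add: sz)
  next
    case 2
    then show ?case using sg by (intro wmax_Y) simp
  next
    case 3
    have "scanned V F u v 0 (acc s')" unfolding scanned_def by auto
    then show ?case using 4(2) by simp
  next
    case (4 c s'')
    have f2: "wmem s'' a = wmem ?s a" if "a < 50" for a using 4(4)[of a] that by simp
    have r2: "ranked s''" using rs f2 unfolding ranked_def dims_def by simp
    have sc: "wmem s'' 50 0 = int (u * (2 * n) + v)" "wmem s'' 52 0 = int (F (u * (2 * n) + v))" "wmem s'' 53 0 = int (u * n)" "wmem s'' 54 0 = int (v * n)"
      using 4(4) \<open>wmem s' 50 0 = int g\<close> unfolding g[symmetric] by auto
    have V2: "nmem s'' 5 (int e) = V e" for e using 4(5)[of 5] fn V by simp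
    have "c \<le> Y" using 4(1) sg by simp
    have Fn: "F (u * (2 * n) + v) \<le> n" using F(2)[OF \<open>g < 2 * n * (2 * n)\<close>] g by simp
    note ns = far_step_wp[OF r2 uv \<open>c \<le> Y\<close> Fn sc(1) 4(3) sc(2-4) V2 4(2)[THEN conjunct1] 4(2)[THEN conjunct2, THEN conjunct1]]
    have tr: "\<forall>g. acc s3 g \<le> acc s' g" if "\<forall>g. acc s3 g \<le> acc s'' g" for s3 :: state
      using that 4(2) order_trans by blast
    show ?case by (rule wp_mono[OF ns]) (use tr in auto)
  next
    case (5 t s'')
    have "wmem s'' 50 0 = int g" using 5(4)[of 50] \<open>wmem s' 50 0 = int g\<close> by simp
    then show ?case using 5(1,3) by simp
  qed
  note inner = this
  have fin: "\<forall>x<Suc g. scanned V F (x div (2 * n)) (x mod (2 * n)) \<sigma> (acc s'')" "\<forall>g. acc s'' g \<le> acc s g"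
    if a: "scanned V F u v \<sigma> (acc s'')" "\<forall>g. acc s'' g \<le> acc s' g" for s'' :: state
  proof -
    show "\<forall>g. acc s'' g \<le> acc s g" using a 4(2) order_trans by blast
    have "scanned V F (x div (2 * n)) (x mod (2 * n)) \<sigma> (acc s'')" if "x < g" for x
      using 4(2) that a(2) unfolding scanned_def by (meson order_trans)
    then show "\<forall>x<Suc g. scanned V F (x div (2 * n)) (x mod (2 * n)) \<sigma> (acc s'')"
      using a(1) unfolding u_def v_def by (auto simp: less_Suc_eq)
  qed
  show ?case
    apply (rule wp_Assign) using Fg 4(3) apply (simp add: sz)
    apply (rule wp_Assign) using D 4(3) Yb n_Y apply (simp add: sz nf u_def[symmetric])
    apply (rule wp_Assign) using D 4(3) Yb n_Y apply (simp add: sz nf v_def[symmetric])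
    apply (rule wp_mono[OF inner])
    using fin by auto
next
  case (5 t s')
  have "t \<le> 4 * (n * n) * (92 * \<sigma> + 97) + 25" using 5(3) by (simp add: algebra_simps)
  also have "\<dots> \<le> 4 * (n * n) * (189 * \<sigma>) + 25" using sg(3) by (intro add_mono mult_left_mono) auto
  finally have "t \<le> 900 * (n * n * \<sigma>) + 30" by simp
  moreover have "scanned V F u v \<sigma> (acc s')" if "u < 2 * n" "v < 2 * n" for u v
  proof -
    have "u * (2 * n) + v < 2 * n * (2 * n)" using that by (intro mult_add_less)
    then have "scanned V F ((u * (2 * n) + v) div (2 * n)) ((u * (2 * n) + v) mod (2 * n)) \<sigma> (acc s')" using 5(1) by blast
    then show ?thesis using that by simp
  qed
  ultimately show ?case using 5(1) by blast
qed

end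

text \<open>The sorting permutation becomes known only during the run, so it cannot be a parameter
  here; \<open>group_machine\<close> is interpreted inside the proof about the whole
  program.\<close>

locale matmul_machine = bounded_machine m Y for m Y +
  fixes n :: nat and call :: com and Tm :: nat
  assumes n_pos: "1 \<le> n" and nY: "20 * (n * n) \<le> Y"
    and call_mods: "wmods call \<subseteq> insert 99 {100..}" "nmods call \<subseteq> {100..}"
    and call_wp: "\<And>s A B c. wmem s 100 0 = int (4 * n) \<Longrightarrow> holds_matrix (4 * n) (wmem s 101) A \<Longrightarrow>
      holds_matrix (4 * n) (wmem s 102) B \<Longrightarrow> (\<And>i j. i < 4 * n \<Longrightarrow> j < 4 * n \<Longrightarrow> \<bar>A i j\<bar> \<le> 1 \<and> \<bar>B i j\<bar> \<le> 1) \<Longrightarrow>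
      wmem s 99 0 = int c \<Longrightarrow> c + Tm \<le> Y \<Longrightarrow>
      wp m call (\<lambda>t s'. \<exists>\<tau>\<le>Tm. t \<le> 7 * \<tau> \<and> wmem s' 99 0 = int (c + \<tau>) \<and>
        holds_matrix (4 * n) (wmem s' 103) (mat_prod (4 * n) A B)) s"
begin

lemma wmods_minmax: "wmods (minmax call) \<subseteq> {10..57} \<union> insert 99 {100..}" "nmods (minmax call) \<subseteq> insert 6 {100..}"
  using call_mods unfolding minmax_def search_def attempt_def group_def by auto

lemma minmax_cost:
  assumes "1 \<le> N" "t1 \<le> (J1 + 1) * (200 * (2 * N) + 210)" "t2 \<le> 250 * (2 * N) + 250"
    "t3 \<le> 8000 * (N * 2 ^ (J + 1) + (J + 1) * (T + N)) + 7 * (J + 3)" "t4 \<le> 400 * (N * \<sigma>) + 30" "t5 \<le> 900 * (N * \<sigma>) + 30" "\<sigma> \<le> 2 ^ (J + 1)"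
  shows "t1 + (t2 + (t3 + (t4 + t5))) \<le> 2000 * ((J1 + 1) * N) + 10000 * (N * 2 ^ (J + 1) + (J + 1) * (T + N))"
proof -
  define a where "a = (J1 + 1) * N"
  define b where "b = (J + 1) * (T + N)"
  define d where "d = N * 2 ^ (J + 1)"
  have "(J1 + 1) * 1 \<le> (J1 + 1) * N" using assms(1) by (intro mult_left_mono) auto
  then have a: "N \<le> a" "J1 + 1 \<le> a" unfolding a_def by auto
  have "(J + 1) * 1 \<le> (J + 1) * (T + N)" using assms(1) by (intro mult_left_mono) auto
  then have b: "J + 1 \<le> b" unfolding b_def by simp
  have d: "N * \<sigma> \<le> d" using assms(7) unfolding d_def by simp
  have "(J1 + 1) * (200 * (2 * N) + 210) = 400 * a + 210 * (J1 + 1)" unfolding a_def by (simp add: algebra_simps)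
  then have "t1 \<le> 400 * a + 210 * (J1 + 1)" using assms(2) by argo
  also have "\<dots> \<le> 400 * a + 210 * a" using mult_le_mono2[OF a(2), of 210] by (rule add_left_mono)
  finally have "t1 \<le> 610 * a" by simp
  moreover have "t2 \<le> 750 * a" using assms(3) a(1) assms(1) by linarith
  moreover have "t3 \<le> 8000 * d + 8021 * b" using assms(4) b unfolding b_def[symmetric] d_def[symmetric] by (simp add: distrib_left)
  moreover have "t4 + t5 \<le> 1300 * d + 60 * a" using assms(5,6) d a(1) assms(1) by linarith
  ultimately show ?thesis unfolding a_def[symmetric] b_def[symmetric] d_def[symmetric] by (simp add: distrib_left)
qed

text \<open>Only the minimum over the two orders of a pair is bounded: of two entries in one column,
  the one of larger rank is a candidate for its own row. Accumulators are lowered and never set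
  anew, so runs with different scalings combine to a minimum.\<close>

lemma minmax_wp:
  assumes sc: "wmem s 0 0 = int n" "wmem s 6 0 = int (2 * n)" "wmem s 7 0 = int (2 * n * n)" "wmem s 8 0 = int (4 * n)"
    "\<And>y. y < 2 * n * n \<Longrightarrow> wmem s 10 (int y) = int y"
    and J1: "2 * n * n \<le> 2 ^ J1" and J: "2 * (Tm + n * n) \<le> n * 4 ^ J" "n * n * 2 ^ (J + 1) + Tm + n * n \<le> Y"
    and V: "\<And>e. nmem s 5 (int e) = V e"
  shows "wp m (minmax call) (\<lambda>t s'. t \<le> 2000 * ((J1 + 1) * (n * n)) + 10000 * (n * n * 2 ^ (J + 1) + (J + 1) * (Tm + n * n)) \<and>
     (\<forall>u<2 * n. \<forall>v<2 * n. acc s' (u * (2 * n) + v) = acc s (u * (2 * n) + v) \<or>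
        (\<exists>k<n. V (v * n + k) \<le> V (u * n + k) \<and> acc s' (u * (2 * n) + v) = V (u * n + k))) \<and>
     (\<forall>u<2 * n. \<forall>v<2 * n. acc s' (u * (2 * n) + v) \<le> acc s (u * (2 * n) + v)) \<and>
     (\<forall>u<2 * n. \<forall>v<2 * n. \<forall>k<n. u \<noteq> v \<longrightarrow>
        min (acc s' (u * (2 * n) + v)) (acc s' (v * (2 * n) + u)) \<le> max (V (u * n + k)) (V (v * n + k)))) s"
proof -
  let ?L = "2 * n * n"
  have Y3: "3 * ?L \<le> Y" using nY by (simp add: mult.assoc)
  let ?post = "\<lambda>s'. (\<forall>u<2 * n. \<forall>v<2 * n. acc s' (u * (2 * n) + v) = acc s (u * (2 * n) + v) \<or>
        (\<exists>k<n. V (v * n + k) \<le> V (u * n + k) \<and> acc s' (u * (2 * n) + v) = V (u * n + k))) \<and>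
     (\<forall>u<2 * n. \<forall>v<2 * n. acc s' (u * (2 * n) + v) \<le> acc s (u * (2 * n) + v)) \<and>
     (\<forall>u<2 * n. \<forall>v<2 * n. \<forall>k<n. u \<noteq> v \<longrightarrow>
        min (acc s' (u * (2 * n) + v)) (acc s' (v * (2 * n) + u)) \<le> max (V (u * n + k)) (V (v * n + k)))"
  let ?C = "2000 * ((J1 + 1) * (n * n)) + 10000 * (n * n * 2 ^ (J + 1) + (J + 1) * (Tm + n * n))"
  show ?thesis unfolding minmax_def wp_Seq[of m merge_sort]
  proof (rule wp_frame[OF merge_sort_wp[OF Y3 J1 sc(3,5)]], assumption, elim conjE)
    fix t1 :: nat and s1 :: state
    assume t1: "t1 \<le> (J1 + 1) * (200 * ?L + 210)"
      and img: "(\<lambda>y. wmem s1 10 (int y)) ` {..<?L} = int ` {..<?L}"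
      and srt: "\<forall>y z. y \<le> z \<longrightarrow> z < ?L \<longrightarrow> nmem s 5 (wmem s1 10 (int y)) \<le> nmem s 5 (wmem s1 10 (int z))"
      and "\<And>a. a \<notin> wmods merge_sort \<Longrightarrow> wmem s1 a = wmem s a" "\<And>a. a \<notin> nmods merge_sort \<Longrightarrow> nmem s1 a = nmem s a"
    then have f1: "wmem s1 a = wmem s a" if "a < 10" for a using that by auto
    have g1: "nmem s1 a = nmem s a" for a using \<open>\<And>a. a \<notin> nmods merge_sort \<Longrightarrow> nmem s1 a = nmem s a\<close> by simp
    \<comment> \<open>The permutation is read off from the sorted array; \<open>nat\<close> undoes
      the coding of indices as words.\<close>
    define ent where "ent = (\<lambda>q. nat (wmem s1 10 (int q)))"
    have ent: "wmem s1 10 (int q) = int (ent q)" if "q < ?L" for q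
    proof -
      have "wmem s1 10 (int q) \<in> int ` {..<?L}" using img that by blast
      then show ?thesis unfolding ent_def by auto
    qed
    have "ent ` {..<?L} = {..<?L}"
    proof -
      have "int ` (ent ` {..<?L}) = int ` {..<?L}" unfolding img[symmetric] image_image using ent by (intro image_cong) auto
      then show ?thesis by (rule inj_image_eq_iff[THEN iffD1, rotated]) (simp add: inj_on_def)
    qed
    then have bij: "bij_betw ent {..<?L} {..<?L}" unfolding bij_betw_def by (intro conjI eq_card_imp_inj_on) auto
    interpret group_machine n ent m Y call Tm
      by unfold_locales (use n_pos nY bij call_mods call_wp in auto)
    have d1: "dims s1" using f1 sc ent unfolding dims_def by auto
    have Vs: "V (ent y) \<le> V (ent z)" if "y \<le> z" "z < ?L" for y z
    proof -
      have "y < ?L" using that by simp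
      then show ?thesis using srt[rule_format, OF that] that ent[of y] ent[of z] V by simp
    qed
    show "wp m (Seq index_ranks (Seq (search call) (Seq near far))) (\<lambda>t' s'. t1 + t' \<le> ?C \<and> ?post s') s1"
      unfolding wp_Seq[of m index_ranks]
    proof (rule wp_frame[OF index_ranks_wp[OF d1]], elim conjE)
      fix t2 :: nat and s2 :: state
      assume t2: "t2 \<le> 250 * ?L + 250" and r2: "ranked s2"
        and "\<And>a. a \<notin> nmods index_ranks \<Longrightarrow> nmem s2 a = nmem s1 a"
      then have g2: "nmem s2 a = nmem s a" for a using g1 by simp
      have J': "n * n * 2 ^ J + Tm + n * n \<le> Y"
      proof -
        have "n * n * 2 ^ J \<le> n * n * 2 ^ (J + 1)" by (intro mult_left_mono power_increasing) auto
        then show ?thesis using J(2) by linarith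
      qed
      show "wp m (Seq (search call) (Seq near far)) (\<lambda>t' s'. t1 + (t2 + t') \<le> ?C \<and> ?post s') s2"
        unfolding wp_Seq[of m "search call"]
      proof (rule wp_frame[OF search_wp[OF r2 J(1) J']], elim conjE exE)
        fix t3 :: nat and s3 :: state and \<sigma> F
        assume t3: "t3 \<le> 8000 * (n * n * 2 ^ (J + 1) + (J + 1) * (Tm + n * n)) + 7 * (J + 3)"
          and sg: "1 \<le> \<sigma>" "\<sigma> \<le> 2 ^ (J + 1)" "wmem s3 30 0 = int \<sigma>" and F: "F_st F s3" "F_sound \<sigma> F" "F_complete \<sigma> L F"
          and a: "\<And>a. a \<notin> wmods (search call) \<Longrightarrow> wmem s3 a = wmem s2 a" "\<And>a. a \<notin> nmods (search call) \<Longrightarrow> nmem s3 a = nmem s2 a"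
        have m: "wmods (search call) \<subseteq> {30..49} \<union> insert 99 {100..}" "nmods (search call) \<subseteq> {100..}"
          using call_mods unfolding search_def attempt_def group_def by auto
        have f3: "wmem s3 a = wmem s2 a" if "a < 30" for a using a(1)[of a] m(1) that by fastforce
        have g3: "nmem s3 a = nmem s a" if "a < 100" for a using a(2)[of a] m(2) that g2 by fastforce
        have r3: "ranked s3" by (rule ranked_cong[OF r2]) (use f3 in auto)
        have sY: "\<sigma> \<le> Y"
        proof -
          have "1 * 2 ^ (J + 1) \<le> n * n * 2 ^ (J + 1)" using n_pos by (intro mult_right_mono) auto
          then show ?thesis using sg(2) J(2) by linarith
        qed
        have Fn: "F g \<le> n" if "g < 2 * n * (2 * n)" for g
          using F(1) that unfolding F_st_def by blast
        have V3: "nmem s3 5 (int e) = V e" for e using g3[of 5] V by simp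
        show "wp m (Seq near far) (\<lambda>t' s'. t1 + (t2 + (t3 + t')) \<le> ?C \<and> ?post s') s3"
          unfolding wp_Seq[of m near]
        proof (rule wp_frame[OF near_wp[OF r3 sg(3) sY sg(1) V3 legit_refl]], elim conjE)
          fix t4 :: nat and s4 :: state
          assume t4: "t4 \<le> 400 * (n * n * \<sigma>) + 30" and l4: "legit V (acc s3) (acc s4)" and c4: "\<forall>q<L. close V q \<sigma> (acc s4)"
            and "\<And>a. a \<notin> wmods near \<Longrightarrow> wmem s4 a = wmem s3 a" "\<And>a. a \<notin> nmods near \<Longrightarrow> nmem s4 a = nmem s3 a"
          then have f4: "wmem s4 a = wmem s3 a" if "a < 50" for a using that by auto
          have V4: "nmem s4 5 (int e) = V e" for e using \<open>\<And>a. a \<notin> nmods near \<Longrightarrow> nmem s4 a = nmem s3 a\<close>[of 5] V3 by simp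
          have r4: "ranked s4" by (rule ranked_cong[OF r3]) (use f4 in auto)
          have F4: "F_st F s4" using F(1) f4[of 32] unfolding F_st_def by simp
          have s4: "wmem s4 30 0 = int \<sigma>" using f4 sg by simp
          show "wp m far (\<lambda>t' s'. t1 + (t2 + (t3 + (t4 + t'))) \<le> ?C \<and> ?post s') s4"
          proof (rule wp_mono[OF far_wp[OF r4 s4 sY sg(1) V4 l4 F4 Fn]], assumption, elim conjE)
            fix t5 :: nat and s5 :: state
            assume t5: "t5 \<le> 900 * (n * n * \<sigma>) + 30" and l5: "legit V (acc s3) (acc s5)" and le5: "\<forall>g. acc s5 g \<le> acc s4 g"
              and sc5: "\<forall>u<2 * n. \<forall>v<2 * n. scanned V F u v \<sigma> (acc s5)"
            have a3: "acc s3 g = acc s g" for g using g3[of 6] by simp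
            \<comment> \<open>Three cases: a near candidate was compared directly, one inside the
              recorded window was scanned, and one beyond the window is no smaller than the
              candidate that backs the window.\<close>
            have full: "acc s5 (row q * (2 * n) + v) \<le> V (ent q)" if q: "q < L" "v < 2 * n" "rank (v * n + col q) < q" for q v
            proof -
              let ?x = "rank (v * n + col q)"
              have x: "row ?x = v" "col ?x = col q" using row_col_rank[OF q(2) col_less] by auto
              show ?thesis
              proof (cases "cp q \<le> cp ?x + \<sigma>")
                case True
                then have "acc s4 (row q * (2 * n) + row ?x) \<le> V (ent q)" using c4 q x unfolding close_def by blast
                then show ?thesis using le5 x order_trans by metis
              next
                case False
                then have Fl: "F (row q * (2 * n) + v) \<le> rp q" using F(3) q unfolding F_complete_def by simp
                have sn: "scanned V F (row q) v \<sigma> (acc s5)" using sc5 row_less[OF q(1)] q(2) by blast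
                show ?thesis
                proof (cases "rp q < F (row q * (2 * n) + v) + \<sigma>")
                  case True
                  then show ?thesis using sn q Fl unfolding scanned_def by blast
                next
                  case f: False
                  have "F (row q * (2 * n) + v) < n" using Fl rp_less[OF q(1)] by simp
                  then obtain y where y: "y < L" "row y = row q" "F (row q * (2 * n) + v) \<le> rp y" "rp y < F (row q * (2 * n) + v) + \<sigma>" "rank (v * n + col y) < y"
                    using F(2) row_less[OF q(1)] q(2) unfolding F_sound_def by blast
                  then have "acc s5 (row q * (2 * n) + v) \<le> V (ent y)" using sn unfolding scanned_def by blast
                  moreover have "y < q" using pos_less_iff[of row y q] y f by simp
                  then have "V (ent y) \<le> V (ent q)" using Vs q by simp
                  ultimately show ?thesis by (rule order_trans)
                qed
              qed
            qed
            have P1: "acc s5 (u * (2 * n) + v) = acc s (u * (2 * n) + v) \<or>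
               (\<exists>k<n. V (v * n + k) \<le> V (u * n + k) \<and> acc s5 (u * (2 * n) + v) = V (u * n + k))" if uv: "u < 2 * n" "v < 2 * n" for u v
            proof -
              have "acc s5 (u * (2 * n) + v) = acc s (u * (2 * n) + v) \<or> (\<exists>q<L. row q = u \<and> rank (v * n + col q) < q \<and> acc s5 (u * (2 * n) + v) = V (ent q))"
                using l5 uv unfolding legit_def a3 by blast
              then show ?thesis
              proof
                assume "\<exists>q<L. row q = u \<and> rank (v * n + col q) < q \<and> acc s5 (u * (2 * n) + v) = V (ent q)"
                then obtain q where q: "q < L" "row q = u" "rank (v * n + col q) < q" "acc s5 (u * (2 * n) + v) = V (ent q)" by blast
                have "v * n + col q < L" using uv col_less by (intro mult_add_less) auto
                then have "V (v * n + col q) \<le> V (ent q)" using Vs[of "rank (v * n + col q)" q] q ent_rank[of "v * n + col q"] by simp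
                then show ?thesis using q col_less[of q] ent_eq[of q] by auto
              qed simp
            qed
            have P3: "min (acc s5 (u * (2 * n) + v)) (acc s5 (v * (2 * n) + u)) \<le> max (V (u * n + k)) (V (v * n + k))"
              if uv: "u < 2 * n" "v < 2 * n" "k < n" "u \<noteq> v" for u v k
            proof -
              let ?q = "rank (u * n + k)" and ?q' = "rank (v * n + k)"
              have q: "?q < L" "row ?q = u" "col ?q = k" and q': "?q' < L" "row ?q' = v" "col ?q' = k"
                using row_col_rank uv by auto
              have e: "ent ?q = u * n + k" "ent ?q' = v * n + k" using ent_eq q q' by auto
              \<comment> \<open>Ranks differ even where values agree, so one of the two entries is
                strictly later.\<close>
              have "?q \<noteq> ?q'" using q q' uv by auto
              then consider "?q' < ?q" | "?q < ?q'" by linarith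
              then show ?thesis
              proof cases
                case 1
                then have "acc s5 (u * (2 * n) + v) \<le> V (u * n + k)" using full[OF q(1) uv(2)] q e by simp
                then show ?thesis by (simp add: min.coboundedI1 max.coboundedI1)
              next
                case 2
                then have "acc s5 (v * (2 * n) + u) \<le> V (v * n + k)" using full[OF q'(1) uv(1)] q' e by simp
                then show ?thesis by (simp add: min.coboundedI2 max.coboundedI2)
              qed
            qed
            have P2: "acc s5 (u * (2 * n) + v) \<le> acc s (u * (2 * n) + v)" if "u < 2 * n" "v < 2 * n" for u v
              using l5 that unfolding legit_def a3 by blast
            have "t1 + (t2 + (t3 + (t4 + t5))) \<le> ?C"
              by (rule minmax_cost[where \<sigma> = \<sigma>]) (use n_pos t1 t2 t3 t4 t5 sg in \<open>auto simp: mult.assoc\<close>)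
            then show "t1 + (t2 + (t3 + (t4 + t5))) \<le> ?C \<and> ?post s5" using P1 P2 P3 by blast
          qed
        qed
      qed
    qed
  qed
qed

end

section \<open>Approximation on a grid of scalings\<close>

text \<open>Rows below n belong to the first factor and are divided by x + 1, the others by N - 1 -
  x. The two divisors add up to N.\<close>

definition scale :: com where
  "scale = For 9 (Var 7) (Seq (WStore 10 (Var 9) (Var 9)) (Cond (WLess (Pdiv (Var 9) (Var 0)) (Var 0))
     (NStore 5 (Var 9) (NArith Divide (NLoad 4 (Var 9)) (NWord (Padd (Var 5) (WConst 1)))))
     (NStore 5 (Var 9) (NArith Divide (NLoad 4 (Var 9)) (NWord (Psub (Psub (Var 4) (WConst 1)) (Var 5)))))))"

text \<open>Numbers cannot be converted to words, so N is counted upwards until the computed value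
  of N \<epsilon> is no longer below 8. This takes a number of steps of order 1 /
  \<epsilon>.\<close>

definition grid_size :: com where
  "grid_size = Seq (Assign 4 (WConst 1))
     (While (NLess (NArith Times (NWord (Var 4)) (NLoad 0 (WConst 0))) (NWord (WConst 8))) (Assign 4 (Padd (Var 4) (WConst 1))))"

text \<open>The second factor is stored by columns, so that both factors form one table with a
  common inner index. The accumulators start at infinity.\<close>

definition setup_arrays :: com where
  "setup_arrays = Seq (Assign 6 (Pmul (WConst 2) (Var 0))) (Seq (Assign 7 (Pmul (Pmul (WConst 2) (Var 0)) (Var 0)))
    (Seq (Assign 8 (Pmul (WConst 4) (Var 0)))
    (Seq (For 9 (Var 7) (Cond (WLess (Pdiv (Var 9) (Var 0)) (Var 0)) (NStore 4 (Var 9) (NLoad 1 (Var 9)))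
      (NStore 4 (Var 9) (NLoad 2 (Padd (Pmul (WMod (Var 9) (Var 0)) (Var 0)) (Psub (Pdiv (Var 9) (Var 0)) (Var 0)))))))
    (For 9 (Pmul (Var 6) (Var 6)) (NStore 6 (Var 9) NInfinity)))))"

definition out_index1 :: wexp where
  "out_index1 = Padd (Pmul (Pdiv (Var 9) (Var 0)) (Var 6)) (Padd (Var 0) (WMod (Var 9) (Var 0)))"
definition out_index2 :: wexp where
  "out_index2 = Padd (Pmul (Padd (Var 0) (WMod (Var 9) (Var 0))) (Var 6)) (Pdiv (Var 9) (Var 0))"

text \<open>The factor N + 1 in place of N leaves a relative margin of 1 / N. It outweighs the
  rounding errors and keeps the result at or above the exact minimum.\<close>

definition write_output :: com where
  "write_output = For 9 (Pmul (Var 0) (Var 0)) (Cond (NLess (NLoad 6 out_index2) (NLoad 6 out_index1))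
     (NStore 3 (Var 9) (NArith Times (NWord (Padd (Var 4) (WConst 1))) (NLoad 6 out_index2)))
     (NStore 3 (Var 9) (NArith Times (NWord (Padd (Var 4) (WConst 1))) (NLoad 6 out_index1))))"

definition approx_program :: "com \<Rightarrow> com" where
  "approx_program call = Seq grid_size (Seq setup_arrays
     (Seq (For 5 (Psub (Var 4) (WConst 1)) (Seq scale (minmax call))) write_output))"

lemma mods_scale [simp]: "wmods scale = {9,10}" "nmods scale = {5}"
  by (auto simp: scale_def)

lemma mods_setup [simp]: "wmods grid_size = {4}" "nmods grid_size = {}" "wmods setup_arrays = {6,7,8,9}" "nmods setup_arrays = {4,6}"
  by (auto simp: grid_size_def setup_arrays_def)

text \<open>This is \<open>a + b = y (a / y) + z (b / z) \<le> (y + z) max (a / y) (b / z)\<close>,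
  up to the relative rounding error \<open>d\<close>.\<close>

lemma grid_lower:
  fixes a b y z d r R :: real
  assumes "0 < a" "0 < b" "1 \<le> y" "1 \<le> z" "0 \<le> d" "8 * d * (y + z) \<le> 1"
    and "(1 - d) * a \<le> (1 + d) * y * r" "(1 - d) * b \<le> (1 + d) * z * r" "(1 - d)\<^sup>2 * (y + z + 1) * r \<le> R"
  shows "a + b \<le> R"
proof -
  define N where "N = y + z"
  have N: "2 \<le> N" "8 * d * N \<le> 1" using assms unfolding N_def by auto
  have d: "d \<le> 1 / 16"
  proof -
    have "8 * d * 2 \<le> 8 * d * N" using N assms(5) by (intro mult_left_mono) auto
    then show ?thesis using N(2) by linarith
  qed
  have 1: "(1 - d) * (a + b) \<le> (1 + d) * N * r" using assms(7,8) unfolding N_def by (simp add: algebra_simps)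
  have r: "0 < r"
  proof (rule ccontr)
    assume "\<not> 0 < r"
    then have "(1 + d) * N * r \<le> 0" using assms(5) N by (intro mult_nonneg_nonpos) auto
    moreover have "0 < (1 - d) * (a + b)" using d assms by (intro mult_pos_pos) auto
    ultimately show False using 1 by linarith
  qed
  \<comment> \<open>As 8 d N is at most 1, the additional 1 in N + 1 pays for four factors of
    relative error d.\<close>
  have key: "(1 + d) * N \<le> (1 - d) ^ 3 * (N + 1)"
  proof -
    have "d * d \<ge> 0" "d * d * (3 - d) \<ge> 0" using d assms(5) by auto
    then have "1 - 3 * d \<le> (1 - d) ^ 3" by (simp add: power3_eq_cube algebra_simps)
    then have "(1 - 3 * d) * (N + 1) \<le> (1 - d) ^ 3 * (N + 1)" using N by (intro mult_right_mono) auto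
    moreover have "(1 + d) * N \<le> (1 - 3 * d) * (N + 1)" using N d assms(5) by (simp add: algebra_simps)
    ultimately show ?thesis by linarith
  qed
  have "(1 - d) * (a + b) \<le> (1 + d) * N * r" by (rule 1)
  also have "\<dots> \<le> (1 - d) ^ 3 * (N + 1) * r" using key r by (intro mult_right_mono) auto
  also have "\<dots> = (1 - d) * ((1 - d)\<^sup>2 * (N + 1) * r)" by (simp add: power3_eq_cube power2_eq_square)
  also have "\<dots> \<le> (1 - d) * R" using assms(9) d unfolding N_def by (intro mult_left_mono) auto
  finally show ?thesis using d by simp
qed

text \<open>Exact arithmetic loses the factor (N + 1) / (N - 2): one unit from the margin in the
  output, two from the choice of the grid point. With N \<epsilon> \<ge> 7 this is below 1 +
  \<epsilon>, with room for roundings of relative size \<epsilon> / 1000.\<close>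

lemma grid_upper:
  fixes a b N d r R \<epsilon> :: real
  assumes "0 < a" "0 < b" "0 \<le> d" "1000 * d \<le> \<epsilon>" "0 < \<epsilon>" "\<epsilon> < 1 / 10" "7 \<le> N * \<epsilon>"
    and "(1 - d) * (N - 2) * r \<le> (1 + d) * (a + b)" "R \<le> (1 + d)\<^sup>2 * (N + 1) * r"
  shows "R \<le> (1 + \<epsilon>) * (a + b)"
proof -
  have N70: "70 \<le> N"
  proof (rule ccontr)
    assume "\<not> 70 \<le> N"
    then have "N * \<epsilon> \<le> 70 * \<epsilon>" using assms(5) by (intro mult_right_mono) auto
    then show False using assms(6,7) by simp
  qed
  define q where "q = (1 - d) * (N - 2)"
  have d: "d \<le> 1 / 10000" using assms by simp
  have qpos: "0 < q" unfolding q_def using N70 d by (intro mult_pos_pos) auto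
  have c0: "0 \<le> (1 + d)\<^sup>2 * (N + 1)" using N70 by simp
  have "R * q \<le> (1 + d)\<^sup>2 * (N + 1) * r * q" using assms(9) qpos by (intro mult_right_mono) auto
  also have "\<dots> = (1 + d)\<^sup>2 * (N + 1) * (q * r)" by simp
  also have "\<dots> \<le> (1 + d)\<^sup>2 * (N + 1) * ((1 + d) * (a + b))" using assms(8) c0 unfolding q_def by (intro mult_left_mono) auto
  also have "\<dots> = (1 + d) ^ 3 * (N + 1) * (a + b)" by (simp add: power3_eq_cube power2_eq_square)
  also have "\<dots> \<le> (1 + \<epsilon>) * q * (a + b)"
  proof (rule mult_right_mono)
    have dd: "d * d \<le> d * (1 / 10000)" using d assms(3) by (intro mult_left_mono) auto
    have ddd: "d * d * d \<le> d * d * 1" using d assms(3) by (intro mult_left_mono) auto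
    have "(1 + d) ^ 3 = 1 + 3 * d + 3 * (d * d) + d * d * d" by (simp add: power3_eq_cube algebra_simps)
    then have c: "(1 + d) ^ 3 \<le> 1 + 4 * d" using assms(3) dd ddd by linarith
    have "(1 + d) ^ 3 * (N + 1) \<le> (1 + 4 * d) * (N + 1)" using c N70 by (intro mult_right_mono) auto
    also have "\<dots> \<le> (1 + \<epsilon>) * q"
    proof -
      define M where "M = N * \<epsilon>"
      have dN: "1000 * (d * N) \<le> M" using mult_right_mono[OF assms(4), of N] N70 unfolding M_def by (simp add: algebra_simps)
      have M7: "7 \<le> M" using assms(7) M_def by simp
      have ed: "\<epsilon> * d * N \<le> d * N" "0 \<le> \<epsilon> * d" "0 \<le> d * N" using assms N70 by (auto intro!: mult_right_mono mult_left_le_one_le)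
      have "(1 + \<epsilon>) * q = N + M - 2 - 2 * \<epsilon> - d * N - \<epsilon> * d * N + 2 * d + 2 * (\<epsilon> * d)"
        unfolding q_def M_def by (simp add: algebra_simps)
      moreover have "(1 + 4 * d) * (N + 1) = N + 1 + 4 * (d * N) + 4 * d" by (simp add: algebra_simps)
      ultimately show ?thesis using dN M7 ed assms d by linarith
    qed
    finally show "(1 + d) ^ 3 * (N + 1) \<le> (1 + \<epsilon>) * q" .
  qed (use assms in auto)
  finally have "R * q \<le> ((1 + \<epsilon>) * (a + b)) * q" by (simp add: algebra_simps)
  then show ?thesis using qpos by (rule mult_right_le_imp_le)
qed

text \<open>The grid point is \<open>y = \<lfloor>(N - 2) a / (a + b)\<rfloor> + 1\<close>.\<close>

lemma grid_point:
  fixes a b :: real and N :: nat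
  assumes "0 < a" "0 < b" "3 \<le> N"
  shows "\<exists>x<N - 1. (real N - 2) * a \<le> real (x + 1) * (a + b) \<and> (real N - 2) * b \<le> real (N - 1 - x) * (a + b)"
proof -
  \<comment> \<open>The 2 subtracted from N lets both divisors round up to integers that are at
    least 1 and add up to N.\<close>
  define w where "w = (real N - 2) * a / (a + b)"
  define x where "x = nat \<lfloor>w\<rfloor>"
  have w: "0 \<le> w" "w \<le> real N - 2" using assms unfolding w_def by (auto simp: field_simps)
  have x: "real x \<le> w" "w < real x + 1" using w unfolding x_def by auto
  have xN: "x < N - 1" using x w assms by linarith
  have wa: "(real N - 2) * a = w * (a + b)" unfolding w_def using assms by simp
  have wb: "(real N - 2) * b = (real N - 2 - w) * (a + b)" unfolding left_diff_distrib[of _ w] wa[symmetric] by (simp add: algebra_simps)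
  have "w * (a + b) \<le> real (x + 1) * (a + b)" using x assms by (intro mult_right_mono) (auto simp: of_nat_add)
  moreover have "(real N - 2 - w) * (a + b) \<le> real (N - 1 - x) * (a + b)"
  proof (rule mult_right_mono)
    have "real (N - 1 - x) = real N - 1 - real x" using xN by (simp add: of_nat_diff)
    then show "real N - 2 - w \<le> real (N - 1 - x)" using x by simp
  qed (use assms in auto)
  ultimately show ?thesis using xN wa wb by auto
qed

text \<open>1 / X bounds the relative rounding error and W the finite entries. The condition on X
  makes the rounding error at most \<epsilon> / 10000; the condition on Y covers the divisors and
  the final factor, since N + 1 stays below 20 / \<epsilon>.\<close>

locale approx_machine = matmul_machine m Y n call Tm for m Y n call Tm +
  fixes \<epsilon> X W :: real and A B :: "nat \<Rightarrow> nat \<Rightarrow> ereal"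
  assumes eps: "0 < \<epsilon>" "\<epsilon> < 1 / 10" and X: "10000 / \<epsilon> \<le> X"
    and rnd: "\<And>r. \<bar>rnd m r - r\<bar> \<le> \<bar>r\<bar> / X" and nmin: "nmin m \<le> 1 / X" and nmax: "X * W \<le> nmax m" and W: "1 \<le> W"
    and AB: "\<And>i j. i < n \<Longrightarrow> j < n \<Longrightarrow> A i j \<in> R_plus \<and> B i j \<in> R_plus"
    and AW: "\<And>i j r. i < n \<Longrightarrow> j < n \<Longrightarrow> A i j = ereal r \<or> B i j = ereal r \<Longrightarrow> r \<le> W"
    and epsY: "20 / \<epsilon> \<le> real Y"
begin

lemma X_pos: "0 < X" "100000 \<le> X" and d_eps: "1000 * (1 / X) \<le> \<epsilon> / 10"
proof -
  have "100000 \<le> 10000 / \<epsilon>" using eps by (simp add: field_simps)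
  then show 1: "100000 \<le> X" using X by simp
  then show 2: "0 < X" by simp
  show "1000 * (1 / X) \<le> \<epsilon> / 10" using X eps 2 by (simp add: field_simps)
qed

lemma rnd_bounds: "0 \<le> r \<Longrightarrow> (1 - 1 / X) * r \<le> rnd m r" "0 \<le> r \<Longrightarrow> rnd m r \<le> (1 + 1 / X) * r"
proof -
  assume r: "0 \<le> r"
  then have "\<bar>rnd m r - r\<bar> \<le> r / X" using rnd[of r] by simp
  then show "(1 - 1 / X) * r \<le> rnd m r" "rnd m r \<le> (1 + 1 / X) * r"
    by (auto simp: algebra_simps abs_le_iff)
qed

text \<open>Crude bounds by a factor 2 suffice for all range checks; the sharp ones are kept for the
  quality of the approximation.\<close>

lemma rnd_half: "0 \<le> r \<Longrightarrow> r / 2 \<le> rnd m r" "0 \<le> r \<Longrightarrow> rnd m r \<le> 2 * r"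
proof -
  assume r: "0 \<le> r"
  have "1 / X \<le> 1 / 2" using X_pos by (simp add: field_simps)
  then have "(1 / 2) * r \<le> (1 - 1 / X) * r" "(1 + 1 / X) * r \<le> 2 * r" using r by (intro mult_right_mono; linarith)+
  then show "r / 2 \<le> rnd m r" "rnd m r \<le> 2 * r" using rnd_bounds[OF r] by linarith+
qed

lemma number_real: "2 / X \<le> r \<Longrightarrow> 2 * r \<le> X * W \<Longrightarrow> number m (ereal r) = Some (ereal (rnd m r))"
proof -
  assume r: "2 / X \<le> r" "2 * r \<le> X * W"
  have "0 \<le> 2 / X" using X_pos by simp
  then have r0: "0 \<le> r" using r(1) by linarith
  have "nmin m \<le> rnd m r" using nmin rnd_half(1)[OF r0] r(1) by (simp add: field_simps)
  moreover have "rnd m r \<le> nmax m" using nmax rnd_half(2)[OF r0] r(2) by simp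
  moreover have "0 \<le> rnd m r" using rnd_half(1)[OF r0] r0 by simp
  ultimately show ?thesis unfolding number_def by (simp add: Let_def)
qed

lemma XW: "c \<le> 100000 \<Longrightarrow> c * W \<le> X * W" "X \<le> X * W"
proof -
  show "X \<le> X * W" using mult_left_mono[OF W, of X] X_pos by simp
  assume "c \<le> 100000"
  then show "c * W \<le> X * W" using X_pos W by (intro mult_right_mono) auto
qed

lemma eps_X: "20 / \<epsilon> \<le> X / 500"
  using X by simp

lemma number_word: "1 \<le> k \<Longrightarrow> real k \<le> 20 / \<epsilon> \<Longrightarrow> number m (ereal (real k)) = Some (ereal (rnd m (real k)))"
proof (rule number_real)
  assume k: "1 \<le> k" "real k \<le> 20 / \<epsilon>"
  show "2 / X \<le> real k" 
  proof -
    have "2 / X \<le> 1" using X_pos by (simp add: field_simps)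
    then show ?thesis using k(1) by linarith
  qed
  show "2 * real k \<le> X * W" using k eps_X XW(2) X_pos by linarith
qed

text \<open>The computed quotient, with two roundings: the divisor is a word and is rounded when it
  becomes a number, and the quotient is rounded again.\<close>

definition sval :: "ereal \<Rightarrow> nat \<Rightarrow> ereal" where
  "sval a y = (if a = \<infinity> then \<infinity> else ereal (rnd m (real_of_ereal a / rnd m (real y))))"

definition entry :: "nat \<Rightarrow> ereal" where
  "entry e = (if e div n < n then A (e div n) (e mod n) else B (e mod n) (e div n - n))"

lemma entry_bounds: "e < 2 * n * n \<Longrightarrow> entry e = \<infinity> \<or> (\<exists>r. entry e = ereal r \<and> 1 \<le> r \<and> r \<le> W)"
proof -
  assume e: "e < 2 * n * n"
  have m: "e mod n < n" using n_pos by simp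
  have d: "e div n < 2 * n" using e by (simp add: less_mult_imp_div_less)
  then have d': "e div n - n < n" using n_pos by linarith
  show ?thesis
  proof (cases "e div n < n")
    case True
    then show ?thesis using AB[OF True m] AW[OF True m] unfolding entry_def R_plus_def by auto
  next
    case False
    then show ?thesis using AB[OF m d'] AW[OF m d'] unfolding entry_def R_plus_def by auto
  qed
qed

lemma rnd_word_pos: "1 \<le> y \<Longrightarrow> real y / 2 \<le> rnd m (real y) \<and> rnd m (real y) \<le> 2 * real y \<and> 0 < rnd m (real y)"
  using rnd_half[of "real y"] by auto

lemma number_div:
  assumes e: "a = \<infinity> \<or> (\<exists>r. a = ereal r \<and> 1 \<le> r \<and> r \<le> W)" and y: "1 \<le> y" "real y \<le> 20 / \<epsilon>"
  shows "number m (a / ereal (rnd m (real y))) = Some (sval a y)"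
proof -
  have p: "real y / 2 \<le> rnd m (real y)" "rnd m (real y) \<le> 2 * real y" "0 < rnd m (real y)" using rnd_word_pos[OF y(1)] by auto
  from e show ?thesis
  proof
    assume "a = \<infinity>"
    then show ?thesis using p(3) by (simp add: sval_def number_def)
  next
    assume "\<exists>r. a = ereal r \<and> 1 \<le> r \<and> r \<le> W"
    then obtain r where r: "a = ereal r" "1 \<le> r" "r \<le> W" by blast
    have "number m (ereal (r / rnd m (real y))) = Some (ereal (rnd m (r / rnd m (real y))))"
    proof (rule number_real)
      have "rnd m (real y) \<le> X / 2" using p(2) y(2) eps_X X_pos by linarith
      then have "2 * rnd m (real y) \<le> r * X" using mult_right_mono[OF r(2), of X] X_pos by linarith
      then show "2 / X \<le> r / rnd m (real y)" using p(3) X_pos by (simp add: field_simps)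
      have "1 / 2 \<le> rnd m (real y)" using p(1) y(1) by linarith
      then have "r / rnd m (real y) \<le> r / (1 / 2)" using r by (intro divide_left_mono) auto
      then have "2 * (r / rnd m (real y)) \<le> 4 * W" using r by simp
      also have "4 * W \<le> X * W" by (rule XW(1)) simp
      finally show "2 * (r / rnd m (real y)) \<le> X * W" .
    qed
    then show ?thesis using r p(3) by (simp add: sval_def)
  qed
qed

end

context approx_machine begin

lemma grid_size_wp:
  assumes e: "nmem s 0 0 = ereal \<epsilon>"
  shows "wp m grid_size (\<lambda>t s'. \<exists>N. t \<le> 60 * N \<and> wmem s' 4 0 = int N \<and> 7 \<le> real N * \<epsilon> \<and> real N * \<epsilon> \<le> 9) s"
proof -
  define d where "d = 1 / X"
  have d: "0 \<le> d" "d \<le> 1 / 100000" using X_pos unfolding d_def by (auto simp: field_simps)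
  define f where "f N = rnd m (rnd m (real N) * \<epsilon>)" for N :: nat
  define g where "g = rnd m 8"
  have g: "8 * (1 - d) \<le> g" "g \<le> 8 * (1 + d)" using rnd_bounds[of 8] unfolding g_def d_def by auto
  have fb: "(1 - d) * ((1 - d) * (real N * \<epsilon>)) \<le> f N" "f N \<le> (1 + d) * ((1 + d) * (real N * \<epsilon>))" for N
  proof -
    have r: "(1 - d) * real N \<le> rnd m (real N)" "rnd m (real N) \<le> (1 + d) * real N" "0 \<le> rnd m (real N)"
      using rnd_bounds[of "real N"] rnd_half[of "real N"] unfolding d_def by auto
    have p: "0 \<le> rnd m (real N) * \<epsilon>" using r eps by simp
    have "(1 - d) * ((1 - d) * (real N * \<epsilon>)) \<le> (1 - d) * (rnd m (real N) * \<epsilon>)"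
      using mult_right_mono[OF r(1), of \<epsilon>] eps d by (intro mult_left_mono) (auto simp: mult.assoc)
    then show "(1 - d) * ((1 - d) * (real N * \<epsilon>)) \<le> f N" using rnd_bounds(1)[OF p] unfolding f_def d_def by linarith
    have "(1 + d) * (rnd m (real N) * \<epsilon>) \<le> (1 + d) * ((1 + d) * (real N * \<epsilon>))"
      using mult_right_mono[OF r(2), of \<epsilon>] eps d by (intro mult_left_mono) (auto simp: mult.assoc)
    then show "f N \<le> (1 + d) * ((1 + d) * (real N * \<epsilon>))" using rnd_bounds(2)[OF p] unfolding f_def d_def by linarith
  qed
  \<comment> \<open>A relative error of at most 1 / 100000 per operation cannot make a product above
    17 / 2 look smaller than 8, nor, in the next step, one below 7 look at least as large as
    8.\<close>
  have small: "real N * \<epsilon> \<le> 17 / 2" if "f N < g" for N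
  proof (rule ccontr)
    assume "\<not> ?thesis"
    then have c: "17 / 2 \<le> real N * \<epsilon>" by simp
    have "(1 - d) * ((1 - d) * (17 / 2)) \<le> (1 - d) * ((1 - d) * (real N * \<epsilon>))" using c d by (intro mult_left_mono) auto
    moreover have "0 \<le> d * d" by simp
    then have "17 / 2 - 17 * d \<le> (1 - d) * ((1 - d) * (17 / 2))" by (simp add: algebra_simps)
    ultimately have "17 / 2 - 17 * d \<le> f N" using fb(1)[of N] by (meson order_trans)
    moreover have "g \<le> 8 + 8 * d" using g(2) by simp
    ultimately show False using that d by linarith
  qed
  have large: "7 \<le> real N * \<epsilon>" if "\<not> f N < g" for N
  proof (rule ccontr)
    assume "\<not> ?thesis"
    then have c: "real N * \<epsilon> \<le> 7" by simp
    have "(1 + d) * ((1 + d) * (real N * \<epsilon>)) \<le> (1 + d) * ((1 + d) * 7)" using c d by (intro mult_left_mono) auto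
    moreover have "d * d \<le> d * 1" using d by (intro mult_left_mono) auto
    then have "(1 + d) * ((1 + d) * 7) \<le> 7 + 21 * d" by (simp add: algebra_simps)
    ultimately have "f N \<le> 7 + 21 * d" using fb(2)[of N] by (meson order_trans)
    moreover have "8 - 8 * d \<le> g" using g(1) by simp
    ultimately show False using that d by linarith
  qed
  let ?b = "NLess (NArith Times (NWord (Var 4)) (NLoad 0 (WConst 0))) (NWord (WConst 8))"
  let ?s = "wupd 4 0 1 s"
  define J where "J = nat \<lceil>17 / 2 / \<epsilon>\<rceil> + 1"
  have main: "wp m (While ?b (Assign 4 (Padd (Var 4) (WConst 1))))
     (\<lambda>t s'. \<exists>N. t + 3 \<le> 60 * N \<and> wmem s' 4 0 = int N \<and> 7 \<le> real N * \<epsilon> \<and> real N * \<epsilon> \<le> 9) ?s"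
  proof (rule wp_While[where J = J and c = "\<lambda>_. 7" and I = "\<lambda>k s'. wmem s' 4 0 = int (Suc k) \<and> real k * \<epsilon> \<le> 17 / 2"], goal_cases)
    case 1
    then show ?case by (simp add: of_nat_Suc)
  next
    case (2 k s')
    let ?N = "Suc k"
    have Ne: "real ?N * \<epsilon> \<le> 9" using 2(1) eps by (simp add: of_nat_Suc algebra_simps)
    then have N20: "real ?N \<le> 20 / \<epsilon>" using eps by (simp add: field_simps)
    then have "real ?N \<le> real Y" using epsY by linarith
    then have NY: "?N \<le> Y" by simp
    have n1: "number m (ereal (real ?N)) = Some (ereal (rnd m (real ?N)))" using number_word[OF _ N20] by simp
    have n8: "number m (ereal 8) = Some (ereal g)"
    proof -
      have "real 8 \<le> 20 / \<epsilon>" using eps by (simp add: field_simps)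
      from number_word[OF _ this] show ?thesis unfolding g_def by simp
    qed
    have n2: "number m (ereal (rnd m (real ?N) * \<epsilon>)) = Some (ereal (f ?N))" unfolding f_def
    proof (rule number_real)
      have r: "real ?N / 2 \<le> rnd m (real ?N)" "rnd m (real ?N) \<le> 2 * real ?N" using rnd_half[of "real ?N"] by auto
      have "1 / 2 * \<epsilon> \<le> rnd m (real ?N) * \<epsilon>" using r(1) eps by (intro mult_right_mono) auto
      moreover have "2 / X = 2 * (1 / X)" by simp
      ultimately show "2 / X \<le> rnd m (real ?N) * \<epsilon>" using d_eps eps by linarith
      have "rnd m (real ?N) * \<epsilon> \<le> 2 * real ?N * \<epsilon>" using r(2) eps by (intro mult_right_mono) auto
      also have "\<dots> = 2 * (real ?N * \<epsilon>)" by simp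
      finally have "2 * (rnd m (real ?N) * \<epsilon>) \<le> 36" using Ne by linarith
      then show "2 * (rnd m (real ?N) * \<epsilon>) \<le> X * W" using XW(2) X_pos by linarith
    qed
    have e': "nmem s' 0 0 = ereal \<epsilon>" using 2(4)[of 0] e by simp
    have bv: "beval m s' ?b = Some (f ?N < g)" using 2(1) n1 n8 n2 e' by (simp add: sz)
    have "k < J \<and> wp m (Assign 4 (Padd (Var 4) (WConst 1))) (\<lambda>t s''. t \<le> 7 \<and> wmem s'' 4 0 = int (Suc ?N) \<and> real ?N * \<epsilon> \<le> 17 / 2) s'"
      if v: "f ?N < g"
    proof
      have "real ?N \<le> 17 / 2 / \<epsilon>" using small[OF v] eps by (simp add: field_simps)
      then show "k < J" unfolding J_def by (simp add: of_nat_Suc) linarith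
      show "wp m (Assign 4 (Padd (Var 4) (WConst 1))) (\<lambda>t s''. t \<le> 7 \<and> wmem s'' 4 0 = int (Suc ?N) \<and> real ?N * \<epsilon> \<le> 17 / 2) s'"
        using 2(1) small[OF v] NY by (simp add: sz nf)
    qed
    moreover have "\<exists>N. t + 3 \<le> 60 * N \<and> wmem s' 4 0 = int N \<and> 7 \<le> real N * \<epsilon> \<and> real N * \<epsilon> \<le> 9"
      if v: "\<not> f ?N < g" and t: "t \<le> (\<Sum>j<k. 7) + (k + 1) * (1 + bcost ?b)" for t
      using large[OF v] Ne 2(1) t by (intro exI[of _ ?N]) auto
    ultimately show ?case using bv by blast
  qed
  show ?thesis unfolding grid_size_def
    apply (rule wp_Assign, simp add: sz)
    apply (rule wp_mono[OF main])
    by auto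
qed

lemma n_Y: "n \<le> Y" "2 * n \<le> Y" "4 * n \<le> Y" "2 * n * n \<le> Y" "16 * (n * n) \<le> Y"
proof -
  have "n \<le> n * n" using n_pos by simp
  then show "n \<le> Y" "2 * n \<le> Y" "4 * n \<le> Y" "2 * n * n \<le> Y" "16 * (n * n) \<le> Y" using nY by linarith+
qed

definition sizes :: "state \<Rightarrow> bool" where
  "sizes s \<longleftrightarrow> wmem s 0 0 = int n \<and> wmem s 6 0 = int (2 * n) \<and> wmem s 7 0 = int (2 * n * n) \<and> wmem s 8 0 = int (4 * n)"

lemma setup_arrays_wp:
  assumes n: "wmem s 0 0 = int n" and M: "holds_matrix n (nmem s 1) A" "holds_matrix n (nmem s 2) B"
  shows "wp m setup_arrays (\<lambda>t s'. t \<le> 500 * (n * n) + 200 \<and> sizes s' \<and>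
     (\<forall>e<2 * n * n. nmem s' 4 (int e) = entry e) \<and> (\<forall>g<2 * n * (2 * n). acc s' g = \<infinity>)) s"
proof -
  let ?s = "wupd 8 0 (int (4 * n)) (wupd 7 0 (int (2 * n * n)) (wupd 6 0 (int (2 * n)) s))"
  let ?F1 = "For 9 (Var 7) (Cond (WLess (Pdiv (Var 9) (Var 0)) (Var 0)) (NStore 4 (Var 9) (NLoad 1 (Var 9)))
      (NStore 4 (Var 9) (NLoad 2 (Padd (Pmul (WMod (Var 9) (Var 0)) (Var 0)) (Psub (Pdiv (Var 9) (Var 0)) (Var 0))))))"
  let ?F2 = "For 9 (Pmul (Var 6) (Var 6)) (NStore 6 (Var 9) NInfinity)"
  have F1: "wp m ?F1 (\<lambda>t s'. t \<le> 160 * (n * n) + 30 \<and> (\<forall>e<2 * n * n. nmem s' 4 (int e) = entry e)) ?s"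
  proof (rule wp_For[where N = "2 * n * n" and c = 40 and I = "\<lambda>k s'. \<forall>e<k. nmem s' 4 (int e) = entry e"], goal_cases)
    case (1 k s')
    then show ?case by (simp add: sz)
  next
    case 2
    show ?case by (rule wmax_Y[OF n_Y(4)])
  next
    case (4 k s')
    have kY: "k \<le> Y" using 4(1) n_Y by simp
    have fr: "wmem s' 0 0 = int n" "nmem s' 1 = nmem s 1" "nmem s' 2 = nmem s 2" using 4(4,5) n by auto
    have md: "k mod n < n" using n_pos by simp
    have dv: "k div n < 2 * n" using 4(1) by (simp add: less_mult_imp_div_less)
    have Yb: "k div n \<le> Y" "k mod n \<le> Y" using kY by (meson div_le_dividend mod_less_eq_dividend le_trans)+
    show ?case
    proof (cases "k div n < n")
      case True
      have "nmem s 1 (int (k div n * n + k mod n)) = A (k div n) (k mod n)" using M(1) True md unfolding holds_matrix_def by blast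
      then have "nmem s 1 (int k) = entry k" using True unfolding entry_def div_mult_mod_eq by simp
      then show ?thesis using True 4(2,3) fr kY n_Y by (auto simp: sz nf less_Suc_eq)
    next
      case False
      have "nmem s 2 (int (k mod n * n + (k div n - n))) = B (k mod n) (k div n - n)"
        using M(2) False md dv unfolding holds_matrix_def by (metis add_diff_inverse_nat mult_2 nat_add_left_cancel_less)
      then have "nmem s 2 (int (k mod n * n + (k div n - n))) = entry k" using False unfolding entry_def by simp
      then show ?thesis using False 4(2,3) fr kY Yb n_Y by (auto simp: sz nf less_Suc_eq)
    qed
  qed auto
  have F2: "wp m ?F2 (\<lambda>t s''. t \<le> 200 * (n * n) + 40 \<and> (\<forall>g<2 * n * (2 * n). acc s'' g = \<infinity>)) s'" if "sizes s'" for s'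
  proof (rule wp_For[where N = "2 * n * (2 * n)" and c = 10 and I = "\<lambda>k s'. \<forall>g<k. acc s' g = \<infinity>"], goal_cases)
    case (1 k s'')
    then show ?case using that n_Y by (simp add: sz nf sizes_def)
  next
    case 2
    have "2 * n * (2 * n) \<le> Y" using n_Y(5) by simp
    then show ?case by (rule wmax_Y)
  next
    case (4 k s'')
    then show ?case by (auto simp: sz less_Suc_eq)
  qed auto
  have F12: "wp m (Seq ?F1 ?F2) (\<lambda>t s'. t \<le> 360 * (n * n) + 70 \<and> sizes s' \<and>
     (\<forall>e<2 * n * n. nmem s' 4 (int e) = entry e) \<and> (\<forall>g<2 * n * (2 * n). acc s' g = \<infinity>)) ?s"
    unfolding wp_Seq[of m ?F1]
  proof (rule wp_frame[OF F1], elim conjE)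
    fix t1 :: nat and s1 :: state
    assume a: "t1 \<le> 160 * (n * n) + 30" "\<forall>e<2 * n * n. nmem s1 4 (int e) = entry e"
      and f: "\<And>a. a \<notin> wmods ?F1 \<Longrightarrow> wmem s1 a = wmem ?s a"
    have sz1: "sizes s1" using f n unfolding sizes_def by simp
    show "wp m ?F2 (\<lambda>t' s'. t1 + t' \<le> 360 * (n * n) + 70 \<and> sizes s' \<and>
     (\<forall>e<2 * n * n. nmem s' 4 (int e) = entry e) \<and> (\<forall>g<2 * n * (2 * n). acc s' g = \<infinity>)) s1"
      by (rule wp_frame[OF F2[OF sz1]]) (use a sz1 in \<open>auto simp: sizes_def\<close>)
  qed
  show ?thesis unfolding setup_arrays_def
    apply (rule wp_Assign) using n n_Y apply (simp add: sz nf)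
    apply (rule wp_Assign) using n n_Y apply (simp add: sz nf)
    apply (rule wp_Assign) using n n_Y apply (simp add: sz nf)
    apply (rule wp_mono[OF F12])
    by auto
qed

definition sv :: "nat \<Rightarrow> nat \<Rightarrow> nat \<Rightarrow> ereal" where
  "sv N x e = sval (entry e) (if e div n < n then x + 1 else N - 1 - x)"

lemma scale_wp:
  assumes s: "sizes s" and N: "wmem s 4 0 = int N" "real N \<le> 20 / \<epsilon>" and x: "wmem s 5 0 = int x" "x < N - 1"
    and E: "\<And>e. e < 2 * n * n \<Longrightarrow> nmem s 4 (int e) = entry e"
  shows "wp m scale (\<lambda>t s'. t \<le> 160 * (n * n) + 30 \<and> (\<forall>e<2 * n * n. wmem s' 10 (int e) = int e \<and> nmem s' 5 (int e) = sv N x e)) s"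
  unfolding scale_def
proof (rule wp_For[where N = "2 * n * n" and c = 50 and
    I = "\<lambda>k s'. \<forall>e<k. wmem s' 10 (int e) = int e \<and> nmem s' 5 (int e) = sv N x e"], goal_cases)
  case (1 k s')
  then show ?case using s by (simp add: sz sizes_def)
next
  case 2
  show ?case by (rule wmax_Y[OF n_Y(4)])
next
  case (4 k s')
  have NY: "N \<le> Y" using N(2) epsY by linarith
  have kY: "k \<le> Y" using 4(1) n_Y by simp
  have fr: "wmem s' 0 0 = int n" "wmem s' 4 0 = int N" "wmem s' 5 0 = int x" "nmem s' 4 (int k) = entry k"
    using 4(1,4,5) s N x E unfolding sizes_def by auto
  define y where "y = (if k div n < n then x + 1 else N - 1 - x)"
  have y: "1 \<le> y" "y \<le> N" using x(2) unfolding y_def by auto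
  then have yN: "real y \<le> 20 / \<epsilon>" using N(2) by linarith
  note nw = number_word[OF y(1) yN] and nd = number_div[OF entry_bounds[OF 4(1)] y(1) yN]
  have v: "sv N x k = sval (entry k) y" unfolding sv_def y_def by simp
  have nN: "1 \<le> N" "x \<le> N - 1" using x(2) by auto
  show ?case
  proof (cases "k div n < n")
    case True
    then have "y = Suc x" unfolding y_def by simp
    then show ?thesis using True 4(2,3) fr kY NY x nw nd v n_Y nN by (auto simp: sz nf less_Suc_eq)
  next
    case False
    then have "y = N - Suc x" unfolding y_def by simp
    then show ?thesis using False 4(2,3) fr kY NY x nw nd v n_Y nN by (auto simp: sz nf less_Suc_eq)
  qed
qed auto

text \<open>The range of the scaled values, from which it follows that the final multiplication by N
  + 1 stays representable.\<close>

lemma sval_bounds: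
  assumes e: "a = \<infinity> \<or> (\<exists>r. a = ereal r \<and> 1 \<le> r \<and> r \<le> W)" and y: "1 \<le> y" "real y \<le> 20 / \<epsilon>"
  shows "sval a y = \<infinity> \<or> (\<exists>r. sval a y = ereal r \<and> \<epsilon> / 80 \<le> r \<and> r \<le> 4 * W)"
proof -
  have p: "real y / 2 \<le> rnd m (real y)" "rnd m (real y) \<le> 2 * real y" "0 < rnd m (real y)" using rnd_word_pos[OF y(1)] by auto
  from e show ?thesis
  proof
    assume "\<exists>r. a = ereal r \<and> 1 \<le> r \<and> r \<le> W"
    then obtain r where r: "a = ereal r" "1 \<le> r" "r \<le> W" by blast
    define q where "q = r / rnd m (real y)"
    have q: "0 \<le> q" using r p unfolding q_def by simp
    have "rnd m (real y) \<le> 40 / \<epsilon>" using p(2) y(2) by simp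
    then have "\<epsilon> * rnd m (real y) \<le> 40" using eps by (simp add: field_simps)
    then have "\<epsilon> / 40 \<le> q" using r p(3) unfolding q_def by (simp add: field_simps)
    moreover have "1 / 2 \<le> rnd m (real y)" using p(1) y(1) by linarith
    then have "q \<le> r / (1 / 2)" using r unfolding q_def by (intro divide_left_mono) auto
    then have "q \<le> 2 * W" using r by simp
    ultimately have "\<epsilon> / 80 \<le> rnd m q" "rnd m q \<le> 4 * W" using rnd_half[OF q] by linarith+
    then show ?thesis using r by (auto simp: sval_def q_def)
  qed (simp add: sval_def)
qed

definition acc_sound :: "nat \<Rightarrow> nat \<Rightarrow> (nat \<Rightarrow> ereal) \<Rightarrow> bool" where
  "acc_sound N k a \<longleftrightarrow> (\<forall>u<2 * n. \<forall>v<2 * n. a (u * (2 * n) + v) = \<infinity> \<or>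
     (\<exists>x<k. \<exists>c<n. sv N x (v * n + c) \<le> sv N x (u * n + c) \<and> a (u * (2 * n) + v) = sv N x (u * n + c)))"

definition acc_complete :: "nat \<Rightarrow> nat \<Rightarrow> (nat \<Rightarrow> ereal) \<Rightarrow> bool" where
  "acc_complete N k a \<longleftrightarrow> (\<forall>x<k. \<forall>u<2 * n. \<forall>v<2 * n. \<forall>c<n. u \<noteq> v \<longrightarrow>
     min (a (u * (2 * n) + v)) (a (v * (2 * n) + u)) \<le> max (sv N x (u * n + c)) (sv N x (v * n + c)))"

text \<open>The accumulators are not reset between scalings. Soundness survives because an old value
  stays attained by an earlier scaling, completeness because values only decrease.\<close>

lemma rounds_wp:
  assumes s: "sizes s" and N: "wmem s 4 0 = int N" "real N \<le> 20 / \<epsilon>" "1 \<le> N"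
    and E: "\<And>e. e < 2 * n * n \<Longrightarrow> nmem s 4 (int e) = entry e" and a0: "\<And>g. g < 2 * n * (2 * n) \<Longrightarrow> acc s g = \<infinity>"
    and J1: "2 * n * n \<le> 2 ^ J1" and J: "2 * (Tm + n * n) \<le> n * 4 ^ J" "n * n * 2 ^ (J + 1) + Tm + n * n \<le> Y"
  shows "wp m (For 5 (Psub (Var 4) (WConst 1)) (Seq scale (minmax call))) (\<lambda>t s'.
     t \<le> N * (2500 * ((J1 + 1) * (n * n)) + 10000 * (n * n * 2 ^ (J + 1) + (J + 1) * (Tm + n * n))) \<and>
     acc_sound N (N - 1) (acc s') \<and> acc_complete N (N - 1) (acc s')) s"
proof -
  let ?c = "2200 * ((J1 + 1) * (n * n)) + 10000 * (n * n * 2 ^ (J + 1) + (J + 1) * (Tm + n * n))"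
  have NY: "N \<le> Y" using N(2) epsY by linarith
  have n1: "1 \<le> n * n" using n_pos by simp
  have j1: "n * n \<le> (J1 + 1) * (n * n)" by simp
  show ?thesis
  proof (rule wp_For[where N = "N - 1" and c = ?c and I = "\<lambda>k s'. acc_sound N k (acc s') \<and> acc_complete N k (acc s')"], goal_cases)
    case (1 k s')
    have "4 \<notin> wmods (minmax call)" using wmods_minmax(1) by auto
    then have "wmem s' 4 0 = int N" using 1(4)[of 4] N by simp
    then show ?case using N(3) NY by (simp add: sz nf)
  next
    case 2
    have "N - 1 \<le> Y" using NY by simp
    then show ?case by (rule wmax_Y)
  next
    case 3
    have "u * (2 * n) + v < 2 * n * (2 * n)" if "u < 2 * n" "v < 2 * n" for u v using that by (intro mult_add_less)
    then show ?case using a0 unfolding acc_sound_def acc_complete_def by simp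
  next
    case (4 x s')
    have nm: "a \<notin> wmods (minmax call)" if "a < 10" for a using wmods_minmax(1) that by auto
    have nn: "a \<notin> nmods (minmax call)" if "a < 6" for a using wmods_minmax(2) that by auto
    have s': "sizes s'" using s 4(4) nm unfolding sizes_def by simp
    have N': "wmem s' 4 0 = int N" using N 4(4)[of 4] nm by simp
    have E': "nmem s' 4 (int e) = entry e" if "e < 2 * n * n" for e using E[OF that] 4(5)[of 4] nn by simp
    show ?case unfolding wp_Seq[of m scale]
    proof (rule wp_frame[OF scale_wp[OF s' N' N(2) 4(3,1) E']], assumption, elim conjE)
      fix t1 :: nat and s1 :: state
      assume t1: "t1 \<le> 160 * (n * n) + 30" and sc: "\<forall>e<2 * n * n. wmem s1 10 (int e) = int e \<and> nmem s1 5 (int e) = sv N x e"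
        and f: "\<And>a. a \<notin> wmods scale \<Longrightarrow> wmem s1 a = wmem s' a" and g: "\<And>a. a \<notin> nmods scale \<Longrightarrow> nmem s1 a = nmem s' a"
      have s1: "sizes s1" using s' f unfolding sizes_def by simp
      have ac: "acc s1 i = acc s' i" for i using g[of 6] by simp
      note D = s1[unfolded sizes_def]
      note mm = minmax_wp[of s1 J1 J "\<lambda>e. nmem s1 5 (int e)"]
      have x5: "wmem s1 5 0 = int x" using f[of 5] 4(3) by simp
      have svb: "nmem s1 5 (int (u * n + c)) = sv N x (u * n + c)" if "u < 2 * n" "c < n" for u c
      proof -
        have "u * n + c < 2 * n * n" using that by (intro mult_add_less)
        then show ?thesis using sc by blast
      qed
      show "wp m (minmax call) (\<lambda>t' s''. t1 + t' \<le> ?c \<and> wmem s'' 5 0 = int x \<and>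
          acc_sound N (Suc x) (acc (wupd 5 0 (int (Suc x)) s'')) \<and> acc_complete N (Suc x) (acc (wupd 5 0 (int (Suc x)) s''))) s1"
      proof (rule wp_frame[OF mm], goal_cases)
        case (10 t2 s2)
        have x2: "wmem s2 5 0 = int x" using 10(2)[of 5] nm x5 by simp
        have P1: "acc s2 (u * (2 * n) + v) = acc s' (u * (2 * n) + v) \<or>
          (\<exists>c<n. sv N x (v * n + c) \<le> sv N x (u * n + c) \<and> acc s2 (u * (2 * n) + v) = sv N x (u * n + c))" if "u < 2 * n" "v < 2 * n" for u v
          using 10(1) that svb unfolding ac by metis
        have P2: "acc s2 (u * (2 * n) + v) \<le> acc s' (u * (2 * n) + v)" if "u < 2 * n" "v < 2 * n" for u v
          using 10(1) that unfolding ac by blast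
        have P3: "min (acc s2 (u * (2 * n) + v)) (acc s2 (v * (2 * n) + u)) \<le> max (sv N x (u * n + c)) (sv N x (v * n + c))"
          if "u < 2 * n" "v < 2 * n" "c < n" "u \<noteq> v" for u v c
          using 10(1) that svb[OF that(1,3)] svb[OF that(2,3)] by metis
        have so: "acc_sound N (Suc x) (acc s2)" unfolding acc_sound_def
        proof (intro allI impI)
          fix u v assume uv: "u < 2 * n" "v < 2 * n"
          show "acc s2 (u * (2 * n) + v) = \<infinity> \<or> (\<exists>y<Suc x. \<exists>c<n. sv N y (v * n + c) \<le> sv N y (u * n + c) \<and> acc s2 (u * (2 * n) + v) = sv N y (u * n + c))"
            using P1[OF uv]
          proof
            assume "acc s2 (u * (2 * n) + v) = acc s' (u * (2 * n) + v)"
            then show ?thesis using 4(2) uv unfolding acc_sound_def by (metis less_SucI)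
          qed blast
        qed
        have co: "acc_complete N (Suc x) (acc s2)" unfolding acc_complete_def
        proof (intro allI impI)
          fix y u v c assume a: "y < Suc x" "u < 2 * n" "v < 2 * n" "c < n" "u \<noteq> v"
          show "min (acc s2 (u * (2 * n) + v)) (acc s2 (v * (2 * n) + u)) \<le> max (sv N y (u * n + c)) (sv N y (v * n + c))"
          proof (cases "y = x")
            case True then show ?thesis using P3 a by blast
          next
            case False
            then have "min (acc s' (u * (2 * n) + v)) (acc s' (v * (2 * n) + u)) \<le> max (sv N y (u * n + c)) (sv N y (v * n + c))"
              using 4(2) a unfolding acc_complete_def by simp
            moreover have "min (acc s2 (u * (2 * n) + v)) (acc s2 (v * (2 * n) + u)) \<le> min (acc s' (u * (2 * n) + v)) (acc s' (v * (2 * n) + u))"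
              using P2 a by (intro min.mono) auto
            ultimately show ?thesis by (rule order_trans[rotated])
          qed
        qed
        have "t1 + t2 \<le> ?c" using 10(1) t1 n1 j1 by linarith
        then show ?case using x2 so co by simp
      qed (use D sc J1 J in auto)
    qed
  next
    case (5 t s')
    define C where "C = ?c"
    have w: "wcost (Psub (Var 4) (WConst 1)) = 4" by simp
    have "t \<le> (N - 1) * (?c + 24) + 24" using 5(3) unfolding w C_def[symmetric] by (simp add: algebra_simps)
    also have "\<dots> \<le> (N - 1) * (?c + 24) + (?c + 24)" by simp
    also have "\<dots> = N * (?c + 24)" using N(3) by (cases N) auto
    also have "\<dots> \<le> N * (2500 * ((J1 + 1) * (n * n)) + 10000 * (n * n * 2 ^ (J + 1) + (J + 1) * (Tm + n * n)))"
      using n1 j1 by (intro mult_left_mono) linarith+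
    finally show ?case using 5(1) by blast
  qed
qed

definition outv :: "nat \<Rightarrow> ereal \<Rightarrow> ereal" where
  "outv N r = (if r = \<infinity> then \<infinity> else ereal (rnd m (rnd m (real (N + 1)) * real_of_ereal r)))"

lemma number_out:
  assumes N: "real (N + 1) \<le> 20 / \<epsilon>" and r: "r = \<infinity> \<or> (\<exists>q. r = ereal q \<and> \<epsilon> / 80 \<le> q \<and> q \<le> 4 * W)"
  shows "number m (ereal (rnd m (real (N + 1))) * r) = Some (outv N r)"
proof -
  have p: "real (N + 1) / 2 \<le> rnd m (real (N + 1))" "rnd m (real (N + 1)) \<le> 2 * real (N + 1)" "0 < rnd m (real (N + 1))" 
    using rnd_word_pos[of "N + 1"] by auto
  from r show ?thesis
  proof
    assume "\<exists>q. r = ereal q \<and> \<epsilon> / 80 \<le> q \<and> q \<le> 4 * W"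
    then obtain q where q: "r = ereal q" "\<epsilon> / 80 \<le> q" "q \<le> 4 * W" by blast
    have "number m (ereal (rnd m (real (N + 1)) * q)) = Some (ereal (rnd m (rnd m (real (N + 1)) * q)))"
    proof (rule number_real)
      have "1 / 2 \<le> rnd m (real (N + 1))" using p(1) by simp
      then have "1 / 2 * (\<epsilon> / 80) \<le> rnd m (real (N + 1)) * q" using q eps by (intro mult_mono) auto
      then show "2 / X \<le> rnd m (real (N + 1)) * q" using d_eps eps by (simp add: field_simps)
      have "2 * (20 / \<epsilon>) = 40 / \<epsilon>" by simp
      then have "rnd m (real (N + 1)) \<le> 40 / \<epsilon>" using order_trans[OF p(2) mult_left_mono[OF N, of 2]] by simp
      then have "rnd m (real (N + 1)) * q \<le> 40 / \<epsilon> * (4 * W)" using q eps p W by (intro mult_mono) auto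
      then have "2 * (rnd m (real (N + 1)) * q) \<le> 320 / \<epsilon> * W" by simp
      also have "\<dots> \<le> X * W" using X W eps by (intro mult_right_mono) (auto simp: field_simps)
      finally show "2 * (rnd m (real (N + 1)) * q) \<le> X * W" .
    qed
    then show ?thesis using q by (simp add: outv_def)
  qed (use p(3) in \<open>simp add: outv_def number_def\<close>)
qed

end

context approx_machine begin

lemma write_output_wp:
  assumes s: "sizes s" and N: "wmem s 4 0 = int N" "real (N + 1) \<le> 20 / \<epsilon>"
    and r: "\<And>i j. i < n \<Longrightarrow> j < n \<Longrightarrow> min (acc s (i * (2 * n) + (n + j))) (acc s ((n + j) * (2 * n) + i)) = \<infinity> \<or>
       (\<exists>q. min (acc s (i * (2 * n) + (n + j))) (acc s ((n + j) * (2 * n) + i)) = ereal q \<and> \<epsilon> / 80 \<le> q \<and> q \<le> 4 * W)"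
  shows "wp m write_output (\<lambda>t s'. t \<le> 200 * (n * n) + 30 \<and> (\<forall>i<n. \<forall>j<n. nmem s' 3 (int (i * n + j)) =
     outv N (min (acc s (i * (2 * n) + (n + j))) (acc s ((n + j) * (2 * n) + i))))) s"
  unfolding write_output_def
proof (rule wp_For[where N = "n * n" and c = 120 and I = "\<lambda>k s'. \<forall>e<k. nmem s' 3 (int e) =
     outv N (min (acc s (e div n * (2 * n) + (n + e mod n))) (acc s ((n + e mod n) * (2 * n) + e div n)))"], goal_cases)
  case (1 k s')
  then show ?case using s n_Y by (simp add: sz nf sizes_def)
next
  case 2
  have "n * n \<le> Y" using n_Y(5) by simp
  then show ?case by (rule wmax_Y)
next
  case (4 k s')
  have "real N \<le> real (N + 1)" by simp
  then have "real N \<le> real Y" using N(2) epsY eps by linarith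
  then have NY: "N \<le> Y" by simp
  have kY: "k \<le> Y" using 4(1) n_Y by simp
  have fr: "wmem s' 0 0 = int n" "wmem s' 4 0 = int N" "wmem s' 6 0 = int (2 * n)" "\<And>g. acc s' g = acc s g"
    using 4(4,5) s N unfolding sizes_def by auto
  have md: "k mod n < n" "k div n < n" using n_pos 4(1) by (auto simp: less_mult_imp_div_less)
  have Yb: "k div n \<le> Y" "k mod n \<le> Y" using md n_Y(1) by linarith+
  note no = number_out[OF N(2) r[OF md(2,1)]]
  note nw = number_word[of "N + 1", OF _ N(2)]
  have i: "weval m s' out_index1 = Some (int (k div n * (2 * n) + (n + k mod n)))"
    "weval m s' out_index2 = Some (int ((n + k mod n) * (2 * n) + k div n))"
    using fr 4(3) kY Yb n_Y unfolding out_index1_def out_index2_def by (simp_all add: sz nf)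
  have c: "wcost out_index1 \<le> 20" "wcost out_index2 \<le> 20" unfolding out_index1_def out_index2_def by simp_all
  show ?case
  proof (cases "acc s ((n + k mod n) * (2 * n) + k div n) < acc s (k div n * (2 * n) + (n + k mod n))")
    case True
    then have "min (acc s (k div n * (2 * n) + (n + k mod n))) (acc s ((n + k mod n) * (2 * n) + k div n)) = acc s ((n + k mod n) * (2 * n) + k div n)"
      by (rule min.absorb4)
    then show ?thesis using True no nw fr 4(2,3) i c NY by (auto simp: sz nf less_Suc_eq)
  next
    case False
    then have "min (acc s (k div n * (2 * n) + (n + k mod n))) (acc s ((n + k mod n) * (2 * n) + k div n)) = acc s (k div n * (2 * n) + (n + k mod n))"
      unfolding not_less by (rule min.absorb1)
    then show ?thesis using False no nw fr 4(2,3) i c NY by (auto simp: sz nf less_Suc_eq)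
  qed
next
  case (5 t s')
  have "nmem s' 3 (int (i * n + j)) = outv N (min (acc s (i * (2 * n) + (n + j))) (acc s ((n + j) * (2 * n) + i)))" if "i < n" "j < n" for i j
  proof -
    have "i * n + j < n * n" using that by (intro mult_add_less)
    moreover have "(i * n + j) div n = i" "(i * n + j) mod n = j" using that by auto
    ultimately show ?thesis using 5(1) by metis
  qed
  then show ?case using 5(3) by simp
qed auto

text \<open>The error bounds without division, in the form in which the grid inequalities use them;
  the roundings of divisor and quotient are collected on opposite sides.\<close>

lemma sval_rounding:
  assumes a: "a = ereal r" "1 \<le> r" "r \<le> W" and y: "1 \<le> y"
  shows "\<exists>q. sval a y = ereal q \<and> (1 - 1 / X) * r \<le> (1 + 1 / X) * real y * q \<and> (1 - 1 / X) * (real y * q) \<le> (1 + 1 / X) * r"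
proof -
  define d where "d = 1 / X"
  have d: "0 \<le> d" "d \<le> 1 / 2" using X_pos unfolding d_def by (auto simp: field_simps)
  define w where "w = rnd m (real y)"
  have w: "(1 - d) * real y \<le> w" "w \<le> (1 + d) * real y" "0 < w"
    using rnd_bounds[of "real y"] rnd_word_pos[OF y] unfolding w_def d_def by auto
  define q where "q = rnd m (r / w)"
  have p: "0 \<le> r / w" using a w by simp
  have q: "(1 - d) * (r / w) \<le> q" "q \<le> (1 + d) * (r / w)" using rnd_bounds[OF p] unfolding q_def d_def by auto
  have q0: "0 \<le> q" using rnd_half(1)[OF p] p unfolding q_def by simp
  have e: "(1 - d) * (r / w) * w = (1 - d) * r" "(1 + d) * (r / w) * w = (1 + d) * r" using w(3) by simp_all
  have "(1 - d) * r \<le> q * w" using mult_right_mono[OF q(1), of w] w(3) unfolding e by simp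
  also have "\<dots> \<le> q * ((1 + d) * real y)" using w(2) q0 by (intro mult_left_mono) auto
  finally have 1: "(1 - d) * r \<le> (1 + d) * real y * q" by (simp add: algebra_simps)
  have "(1 - d) * real y * q \<le> w * q" using w(1) q0 by (intro mult_right_mono) auto
  also have "\<dots> \<le> (1 + d) * r" using mult_right_mono[OF q(2), of w] w(3) unfolding e by (simp add: mult.commute)
  finally have 2: "(1 - d) * (real y * q) \<le> (1 + d) * r" by (simp add: algebra_simps)
  have "sval a y = ereal q" unfolding sval_def q_def w_def using a by simp
  then show ?thesis using 1 2 unfolding d_def by blast
qed

lemma entry_AB: "i < n \<Longrightarrow> c < n \<Longrightarrow> A i c = \<infinity> \<or> (\<exists>r. A i c = ereal r \<and> 1 \<le> r \<and> r \<le> W)"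
  "i < n \<Longrightarrow> c < n \<Longrightarrow> B i c = \<infinity> \<or> (\<exists>r. B i c = ereal r \<and> 1 \<le> r \<and> r \<le> W)"
  using AB[of i c] AW[of i c] unfolding R_plus_def by auto

text \<open>The lower bound uses the scaling and inner index that attain r; the upper bound uses the
  grid point that belongs to an optimal inner index of the exact product.\<close>

lemma outv_approx:
  assumes ij: "i < n" "j < n" and N: "7 \<le> real N * \<epsilon>" "real N * \<epsilon> \<le> 9"
    and so: "r = \<infinity> \<or> (\<exists>x<N - 1. \<exists>c<n. r = max (sval (A i c) (x + 1)) (sval (B c j) (N - 1 - x)))"
    and co: "\<And>x c. x < N - 1 \<Longrightarrow> c < n \<Longrightarrow> r \<le> max (sval (A i c) (x + 1)) (sval (B c j) (N - 1 - x))"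
  shows "min_plus n A B i j \<le> outv N r \<and> outv N r \<le> ereal (1 + \<epsilon>) * min_plus n A B i j"
proof -
  define d where "d = 1 / X"
  have d: "0 \<le> d" "1000 * d \<le> \<epsilon> / 10" "d \<le> 1 / 2" using X_pos d_eps unfolding d_def by (auto simp: field_simps)
  have N70: "70 \<le> real N"
  proof (rule ccontr)
    assume "\<not> ?thesis"
    then have "real N * \<epsilon> \<le> 70 * \<epsilon>" using eps by (intro mult_right_mono) auto
    then show False using N(1) eps by linarith
  qed
  \<comment> \<open>From N \<epsilon> \<le> 9 and d \<le> \<epsilon> / 10000; this is the smallness
    condition of \<open>grid_lower\<close>.\<close>
  have dN: "8 * d * real N \<le> 1"
  proof -
    have "1000 * d * real N \<le> \<epsilon> / 10 * real N" using d(2) by (intro mult_right_mono) auto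
    also have "\<dots> \<le> 9 / 10" using N(2) by (simp add: mult.commute)
    finally have "1000 * (d * real N) \<le> 9 / 10" by (simp only: mult.assoc)
    moreover have "0 \<le> d * real N" using d(1) by simp
    ultimately have "8 * (d * real N) \<le> 1" by linarith
    then show ?thesis by (simp only: mult.assoc)
  qed
  have rN: "(1 - d) * real (N + 1) \<le> rnd m (real (N + 1))" "rnd m (real (N + 1)) \<le> (1 + d) * real (N + 1)" "0 < rnd m (real (N + 1))"
    using rnd_bounds[of "real (N + 1)"] rnd_word_pos[of "N + 1"] unfolding d_def by auto
  have out: "\<exists>R. outv N (ereal q) = ereal R \<and> (1 - d)\<^sup>2 * (real N + 1) * q \<le> R \<and> R \<le> (1 + d)\<^sup>2 * (real N + 1) * q" if q: "0 \<le> q" for q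
  proof -
    let ?z = "rnd m (real (N + 1)) * q"
    have z: "0 \<le> ?z" using q rN by simp
    have "(1 - d) * ((1 - d) * real (N + 1) * q) \<le> (1 - d) * ?z" using rN(1) q d by (intro mult_left_mono mult_right_mono) auto
    also have "\<dots> \<le> rnd m ?z" using rnd_bounds(1)[OF z] unfolding d_def .
    finally have 1: "(1 - d)\<^sup>2 * (real N + 1) * q \<le> rnd m ?z" by (simp add: power2_eq_square mult.assoc of_nat_Suc add.commute)
    have "rnd m ?z \<le> (1 + d) * ?z" using rnd_bounds(2)[OF z] unfolding d_def .
    also have "\<dots> \<le> (1 + d) * ((1 + d) * real (N + 1) * q)" using rN(2) q d by (intro mult_left_mono mult_right_mono) auto
    finally have 2: "rnd m ?z \<le> (1 + d)\<^sup>2 * (real N + 1) * q" by (simp add: power2_eq_square mult.assoc of_nat_Suc add.commute)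
    show ?thesis using 1 2 unfolding outv_def by simp
  qed
  have MP: "min_plus n A B i j = Min ((\<lambda>k. A i k + B k j) ` {..<n})" unfolding min_plus_def ..
  have lower: "min_plus n A B i j \<le> outv N r"
  proof (cases "r = \<infinity>")
    case True then show ?thesis by (simp add: outv_def)
  next
    case False
    with so obtain x c where xc: "x < N - 1" "c < n" "r = max (sval (A i c) (x + 1)) (sval (B c j) (N - 1 - x))" by blast
    have "A i c \<noteq> \<infinity>" "B c j \<noteq> \<infinity>" using False xc(3) by (auto simp: sval_def)
    then obtain a b where a: "A i c = ereal a" "1 \<le> a" "a \<le> W" and b: "B c j = ereal b" "1 \<le> b" "b \<le> W"
      using entry_AB(1)[OF ij(1) xc(2)] entry_AB(2)[OF xc(2) ij(2)] by blast
    let ?y = "x + 1" and ?z = "N - 1 - x"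
    have yz: "1 \<le> ?y" "1 \<le> ?z" "real ?y + real ?z = real N" using xc(1) by (auto simp: of_nat_Suc of_nat_diff)
    obtain q1 where q1: "sval (A i c) ?y = ereal q1" "(1 - d) * a \<le> (1 + d) * real ?y * q1"
      using sval_rounding[OF a yz(1)] unfolding d_def by blast
    obtain q2 where q2: "sval (B c j) ?z = ereal q2" "(1 - d) * b \<le> (1 + d) * real ?z * q2"
      using sval_rounding[OF b yz(2)] unfolding d_def by blast
    define q where "q = max q1 q2"
    have rq: "r = ereal q" unfolding q_def xc(3) q1(1) q2(1) by (simp add: max_def)
    have A1: "(1 - d) * a \<le> (1 + d) * real ?y * q"
      by (rule order_trans[OF q1(2)]) (use d(1) in \<open>auto simp: q_def intro!: mult_left_mono\<close>)
    have A2: "(1 - d) * b \<le> (1 + d) * real ?z * q"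
      by (rule order_trans[OF q2(2)]) (use d(1) in \<open>auto simp: q_def intro!: mult_left_mono\<close>)
    \<comment> \<open>The rounding function is arbitrary, so the sign of a computed value is deduced
      from its error bound.\<close>
    have "0 \<le> q"
    proof (rule ccontr)
      assume "\<not> 0 \<le> q"
      then have "(1 + d) * real ?y * q \<le> 0" using d(1) by (intro mult_nonneg_nonpos) auto
      moreover have "0 < (1 - d) * a" using d(3) a(2) by (intro mult_pos_pos) auto
      ultimately show False using A1 by linarith
    qed
    from out[OF this] obtain R where R: "outv N (ereal q) = ereal R" "(1 - d)\<^sup>2 * (real N + 1) * q \<le> R" by blast
    have "a + b \<le> R"
      by (rule grid_lower[of a b "real ?y" "real ?z" d q R]) (use a b yz d(1) dN A1 A2 R(2) in \<open>auto simp: yz(3)\<close>)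
    then have "A i c + B c j \<le> outv N r" using a b rq R(1) by simp
    moreover have "min_plus n A B i j \<le> A i c + B c j" unfolding MP using xc(2) by (intro Min_le) auto
    ultimately show ?thesis by (rule order_trans[rotated])
  qed
  have upper: "outv N r \<le> ereal (1 + \<epsilon>) * min_plus n A B i j"
  proof (cases "min_plus n A B i j = \<infinity>")
    case True then show ?thesis using eps by simp
  next
    case False
    have "min_plus n A B i j \<in> (\<lambda>k. A i k + B k j) ` {..<n}" unfolding MP using n_pos by (intro Min_in) (auto simp: lessThan_empty_iff)
    then obtain c where c: "c < n" "min_plus n A B i j = A i c + B c j" by blast
    have "A i c \<noteq> \<infinity>" "B c j \<noteq> \<infinity>" using False c(2) by auto
    then obtain a b where a: "A i c = ereal a" "1 \<le> a" "a \<le> W" and b: "B c j = ereal b" "1 \<le> b" "b \<le> W"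
      using entry_AB(1)[OF ij(1) c(1)] entry_AB(2)[OF c(1) ij(2)] by blast
    have N3: "3 \<le> N" using N70 by simp
    obtain x where x: "x < N - 1" "(real N - 2) * a \<le> real (x + 1) * (a + b)" "(real N - 2) * b \<le> real (N - 1 - x) * (a + b)"
      using grid_point[of a b N] a b N3 by auto
    let ?y = "x + 1" and ?z = "N - 1 - x"
    have yz: "1 \<le> ?y" "1 \<le> ?z" using x(1) by auto
    obtain q1 where q1: "sval (A i c) ?y = ereal q1" "(1 - d) * a \<le> (1 + d) * real ?y * q1" "(1 - d) * (real ?y * q1) \<le> (1 + d) * a"
      using sval_rounding[OF a yz(1)] unfolding d_def by blast
    obtain q2 where q2: "sval (B c j) ?z = ereal q2" "(1 - d) * (real ?z * q2) \<le> (1 + d) * b"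
      using sval_rounding[OF b yz(2)] unfolding d_def by blast
    \<comment> \<open>One argument for both summands: the grid bound on e and the rounding bound on
      p are multiplied, and the divisor y cancels.\<close>
    have gen: "(1 - d) * (real N - 2) * p \<le> (1 + d) * (a + b)"
      if y: "1 \<le> y" "(real N - 2) * e \<le> real y * (a + b)" "(1 - d) * (real y * p) \<le> (1 + d) * e" for y :: nat and e p
    proof -
      have "real y * ((1 - d) * (real N - 2) * p) = (real N - 2) * ((1 - d) * (real y * p))" by simp
      also have "\<dots> \<le> (real N - 2) * ((1 + d) * e)" using y(3) N70 by (intro mult_left_mono) auto
      also have "\<dots> = (1 + d) * ((real N - 2) * e)" by simp
      also have "\<dots> \<le> (1 + d) * (real y * (a + b))" using y(2) d(1) by (intro mult_left_mono) auto
      finally have "real y * ((1 - d) * (real N - 2) * p) \<le> real y * ((1 + d) * (a + b))" by (simp add: mult.left_commute)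
      then show ?thesis by (rule mult_left_le_imp_le) (use y(1) in simp)
    qed
    define q where "q = max q1 q2"
    have qb: "(1 - d) * (real N - 2) * q \<le> (1 + d) * (a + b)"
      using gen[OF yz(1) x(2) q1(3)] gen[OF yz(2) x(3) q2(2)] unfolding q_def by (simp add: max_def)
    have "0 \<le> q1"
    proof (rule ccontr)
      assume "\<not> 0 \<le> q1"
      then have "(1 + d) * real ?y * q1 \<le> 0" using d(1) by (intro mult_nonneg_nonpos) auto
      moreover have "0 < (1 - d) * a" using d(3) a(2) by (intro mult_pos_pos) auto
      ultimately show False using q1(2) by linarith
    qed
    have rq: "r \<le> ereal q" using co[OF x(1) c(1)] unfolding q1(1) q2(1) q_def by (simp add: max_def split: if_splits)
    have "r \<noteq> \<infinity>" using rq by auto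
    with so obtain x' c' where xc: "x' < N - 1" "c' < n" "r = max (sval (A i c') (x' + 1)) (sval (B c' j) (N - 1 - x'))" by blast
    have "A i c' \<noteq> \<infinity>" using \<open>r \<noteq> \<infinity>\<close> xc(3) by (auto simp: sval_def)
    then obtain a' where a': "A i c' = ereal a'" "1 \<le> a'" "a' \<le> W" using entry_AB(1)[OF ij(1) xc(2)] by blast
    obtain p where p: "sval (A i c') (x' + 1) = ereal p" "(1 - d) * a' \<le> (1 + d) * real (x' + 1) * p"
      using sval_rounding[OF a', of "x' + 1"] unfolding d_def by auto
    have "0 \<le> p"
    proof (rule ccontr)
      assume "\<not> 0 \<le> p"
      then have "(1 + d) * real (x' + 1) * p \<le> 0" using d(1) by (intro mult_nonneg_nonpos) auto
      moreover have "0 < (1 - d) * a'" using d(3) a'(2) by (intro mult_pos_pos) auto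
      ultimately show False using p(2) by linarith
    qed
    then have r0: "ereal 0 \<le> r" unfolding xc(3) p(1) by (simp add: le_max_iff_disj)
    obtain q' where q': "r = ereal q'" using r0 rq by (cases r) auto
    have q'0: "0 \<le> q'" "q' \<le> q" using r0 rq q' by auto
    from out[OF q'0(1)] obtain R where R: "outv N r = ereal R" "R \<le> (1 + d)\<^sup>2 * (real N + 1) * q'" unfolding q' by blast
    have "(1 + d)\<^sup>2 * (real N + 1) * q' \<le> (1 + d)\<^sup>2 * (real N + 1) * q" using q'0 by (intro mult_left_mono) auto
    then have R2: "R \<le> (1 + d)\<^sup>2 * (real N + 1) * q" using R(2) by (rule order_trans[rotated])
    have "R \<le> (1 + \<epsilon>) * (a + b)"
      by (rule grid_upper[OF _ _ d(1) _ eps N(1) qb R2]) (use a b d(2) eps in auto)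
    then show ?thesis unfolding R(1) c(2) a(1) b(1) by simp
  qed
  show ?thesis using lower upper ..
qed

lemma approx_program_wp:
  assumes s: "wmem s 0 0 = int n" "nmem s 0 0 = ereal \<epsilon>" "holds_matrix n (nmem s 1) A" "holds_matrix n (nmem s 2) B"
    and J1: "2 * n * n \<le> 2 ^ J1" and J: "2 * (Tm + n * n) \<le> n * 4 ^ J" "n * n * 2 ^ (J + 1) + Tm + n * n \<le> Y"
  shows "wp m (approx_program call) (\<lambda>t s'. \<exists>N C. real N * \<epsilon> \<le> 9 \<and>
     t \<le> N * (10000 * ((J1 + 1) * (n * n) + n * n * 2 ^ (J + 1) + (J + 1) * (Tm + n * n))) \<and>
     holds_matrix n (nmem s' 3) C \<and> approximates n \<epsilon> (min_plus n A B) C) s"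
  unfolding approx_program_def wp_Seq[of m grid_size]
proof (rule wp_frame[OF grid_size_wp[OF s(2)]], elim exE conjE)
  fix t1 :: nat and s1 :: state and N :: nat
  assume t1: "t1 \<le> 60 * N" and N: "wmem s1 4 0 = int N" "7 \<le> real N * \<epsilon>" "real N * \<epsilon> \<le> 9"
    and f1: "\<And>a. a \<notin> wmods grid_size \<Longrightarrow> wmem s1 a = wmem s a" "\<And>a. a \<notin> nmods grid_size \<Longrightarrow> nmem s1 a = nmem s a"
  have N20: "real (N + 1) \<le> 20 / \<epsilon>" "real N \<le> 20 / \<epsilon>"
    using N(3) eps by (auto simp: field_simps of_nat_Suc)
  have N1: "1 \<le> N" using N(2) by (cases N) auto
  have n1: "1 \<le> n * n" using n_pos by simp
  let ?M = "2500 * ((J1 + 1) * (n * n)) + 10000 * (n * n * 2 ^ (J + 1) + (J + 1) * (Tm + n * n))"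
  let ?rounds = "For 5 (Psub (Var 4) (WConst 1)) (Seq scale (minmax call))"
  let ?Q = "\<lambda>t s'. \<exists>N C. real N * \<epsilon> \<le> 9 \<and>
     t \<le> N * (10000 * ((J1 + 1) * (n * n) + n * n * 2 ^ (J + 1) + (J + 1) * (Tm + n * n))) \<and>
     holds_matrix n (nmem s' 3) C \<and> approximates n \<epsilon> (min_plus n A B) C"
  show "wp m (Seq setup_arrays (Seq ?rounds write_output)) (\<lambda>t'. ?Q (t1 + t')) s1"
    unfolding wp_Seq[of m setup_arrays]
  proof (rule wp_frame[OF setup_arrays_wp], goal_cases)
    case 1 then show ?case using f1 s by simp
  next
    case 2 then show ?case using f1 s by simp
  next
    case 3 then show ?case using f1 s by simp
  next
    case (4 t2 s2)
    have t2: "t2 \<le> 500 * (n * n) + 200" and s2: "sizes s2" and E2: "\<And>e. e < 2 * n * n \<Longrightarrow> nmem s2 4 (int e) = entry e"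
      and A2: "\<And>g. g < 2 * n * (2 * n) \<Longrightarrow> acc s2 g = \<infinity>" using 4(1) by auto
    have N2: "wmem s2 4 0 = int N" using 4(2)[of 4] N by simp
    show ?case unfolding wp_Seq[of m ?rounds]
    proof (rule wp_frame[OF rounds_wp[OF s2 N2 N20(2) N1 E2 A2 J1 J]], assumption, assumption, elim conjE)
      fix t3 :: nat and s3 :: state
      assume t3: "t3 \<le> N * ?M" and so: "acc_sound N (N - 1) (acc s3)" and co: "acc_complete N (N - 1) (acc s3)"
        and f3: "\<And>a. a \<notin> wmods ?rounds \<Longrightarrow> wmem s3 a = wmem s2 a"
      have nm: "a \<notin> wmods (minmax call)" if "a < 10" for a using wmods_minmax(1) that by auto
      have s3: "sizes s3" "wmem s3 4 0 = int N" using s2 N2 f3 nm unfolding sizes_def by auto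
      \<comment> \<open>Row i of the first factor against column j of the second, which is row n + j
        of the table, with both orders of the pair combined.\<close>
      define rr where "rr i j = min (acc s3 (i * (2 * n) + (n + j))) (acc s3 ((n + j) * (2 * n) + i))" for i j
      have sv1: "sv N x (i * n + c) = sval (A i c) (x + 1)" if "i < n" "c < n" for x i c
        using that unfolding sv_def entry_def by simp
      have sv2: "sv N x ((n + j) * n + c) = sval (B c j) (N - 1 - x)" if "c < n" for x j c
      proof -
        have "((n + j) * n + c) div n = n + j" "((n + j) * n + c) mod n = c" using that by (auto simp: div_mult_self3)
        then show ?thesis unfolding sv_def entry_def by simp
      qed
      have S: "rr i j = \<infinity> \<or> (\<exists>x<N - 1. \<exists>c<n. rr i j = max (sval (A i c) (x + 1)) (sval (B c j) (N - 1 - x)))" if ij: "i < n" "j < n" for i j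
      proof -
        have b: "i < 2 * n" "n + j < 2 * n" using ij by auto
        have 1: "acc s3 (i * (2 * n) + (n + j)) = \<infinity> \<or> (\<exists>x<N - 1. \<exists>c<n. acc s3 (i * (2 * n) + (n + j)) = max (sval (A i c) (x + 1)) (sval (B c j) (N - 1 - x)))"
          using so b ij unfolding acc_sound_def by (metis sv1 sv2 max.absorb1)
        have 2: "acc s3 ((n + j) * (2 * n) + i) = \<infinity> \<or> (\<exists>x<N - 1. \<exists>c<n. acc s3 ((n + j) * (2 * n) + i) = max (sval (A i c) (x + 1)) (sval (B c j) (N - 1 - x)))"
          using so b ij unfolding acc_sound_def by (metis sv1 sv2 max.absorb2)
        show ?thesis using 1 2 unfolding rr_def min_def by presburger
      qed
      have C: "rr i j \<le> max (sval (A i c) (x + 1)) (sval (B c j) (N - 1 - x))" if "i < n" "j < n" "x < N - 1" "c < n" for i j x c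
      proof -
        have "i < 2 * n" "n + j < 2 * n" "i \<noteq> n + j" using that by auto
        then show ?thesis using co that unfolding acc_complete_def rr_def by (metis sv1 sv2)
      qed
      have bd: "rr i j = \<infinity> \<or> (\<exists>q. rr i j = ereal q \<and> \<epsilon> / 80 \<le> q \<and> q \<le> 4 * W)" if ij: "i < n" "j < n" for i j
        using S[OF ij]
      proof (elim disjE exE conjE)
        fix x c assume x: "x < N - 1" "c < n" "rr i j = max (sval (A i c) (x + 1)) (sval (B c j) (N - 1 - x))"
        have y: "1 \<le> x + 1" "1 \<le> N - 1 - x" "x + 1 \<le> N" "N - 1 - x \<le> N" using x(1) by auto
        have y': "real (x + 1) \<le> 20 / \<epsilon>" "real (N - 1 - x) \<le> 20 / \<epsilon>" using N20(2) y(3,4) by (meson of_nat_mono order_trans)+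
        show ?thesis using sval_bounds[OF entry_AB(1)[OF ij(1) x(2)] y(1) y'(1)] sval_bounds[OF entry_AB(2)[OF x(2) ij(2)] y(2) y'(2)]
          unfolding x(3) by (auto simp: max_def)
      qed simp
      show "wp m write_output (\<lambda>t'. ?Q (t1 + (t2 + (t3 + t')))) s3"
      proof (rule wp_mono[OF write_output_wp[OF s3 N20(1) bd[unfolded rr_def]]], assumption, assumption, elim conjE, fold rr_def)
        fix t4 :: nat and s4 :: state
        assume t4: "t4 \<le> 200 * (n * n) + 30" and o: "\<forall>i<n. \<forall>j<n. nmem s4 3 (int (i * n + j)) = outv N (rr i j)"
        have "approximates n \<epsilon> (min_plus n A B) (\<lambda>i j. outv N (rr i j))"
          unfolding approximates_def using outv_approx[OF _ _ N(2,3) S C] by blast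
        moreover have "holds_matrix n (nmem s4 3) (\<lambda>i j. outv N (rr i j))" using o unfolding holds_matrix_def by blast
        moreover have "t1 + (t2 + (t3 + t4)) \<le> N * (10000 * ((J1 + 1) * (n * n) + n * n * 2 ^ (J + 1) + (J + 1) * (Tm + n * n)))"
        proof -
          have "t1 + (t2 + t4) \<le> N * (990 * (n * n))"
          proof -
            have a: "60 * N \<le> N * (60 * (n * n))" using n1 by simp
            have b: "1 * (930 * (n * n)) \<le> N * (930 * (n * n))" using N1 by (intro mult_right_mono) auto
            have "t2 + t4 \<le> 930 * (n * n)" using t2 t4 n1 by linarith
            then have "t1 + (t2 + t4) \<le> N * (60 * (n * n)) + N * (930 * (n * n))" using a b t1 by linarith
            also have "\<dots> = N * (990 * (n * n))" by (simp only: distrib_left[symmetric] distrib_right[symmetric]) simp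
            finally show ?thesis .
          qed
          then have "t1 + (t2 + (t3 + t4)) \<le> N * (990 * (n * n)) + N * ?M" using t3 by linarith
          also have "\<dots> = N * (990 * (n * n) + ?M)" by (simp only: distrib_left)
          also have "\<dots> \<le> N * (10000 * ((J1 + 1) * (n * n) + n * n * 2 ^ (J + 1) + (J + 1) * (Tm + n * n)))"
            by (intro mult_left_mono) (auto simp: algebra_simps)
          finally show ?thesis .
        qed
        ultimately show "?Q (t1 + (t2 + (t3 + t4))) s4" using N(3) by blast
      qed
    qed
  qed
qed

end

section \<open>Running time of the approximation\<close>

text \<open>The common interface to the two sources of fast products, the assumed one with exponent
  \<omega> and the one built from straight-line programs. Absolute values up to 1 are the case
  \<open>d = 0\<close> of \<open>matmul_in_soft_O\<close>.\<close>

definition bool_matmul :: "real \<Rightarrow> bool" where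
  "bool_matmul \<tau> \<longleftrightarrow>
     (\<exists>p. \<exists>c::nat. \<exists>K. \<exists>k::nat. \<forall>n A B m s.
        n \<ge> 1 \<longrightarrow>
        (\<forall>i<n. \<forall>j<n. \<bar>A i j\<bar> \<le> 1 \<and> \<bar>B i j\<bar> \<le> 1) \<longrightarrow>
        supports m (real (n + 1) ^ c) 1 \<longrightarrow>
        wmem s 0 0 = int n \<longrightarrow>
        holds_matrix n (wmem s 1) A \<longrightarrow> holds_matrix n (wmem s 2) B \<longrightarrow>
        (\<exists>t s'. exec m p s t s' \<and> real t \<le> K * real n powr \<tau> * (1 + ln (real n)) ^ k \<and>
           holds_matrix n (wmem s' 3) (mat_prod n A B)))"

lemma matmul_bool_matmul: "matmul_in_soft_O \<tau> \<Longrightarrow> bool_matmul \<tau>"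
  unfolding matmul_in_soft_O_def bool_matmul_def by (drule spec[of _ 0]) simp

lemma supports_mono:
  assumes "supports m X W" "0 < X'" "X' \<le> X" "0 \<le> W'" "W' \<le> W"
  shows "supports m X' W'"
  unfolding supports_def
proof (intro conjI allI)
  note s = assms(1)[unfolded supports_def]
  show "X' \<le> wmax m" using s assms(3) by linarith
  show "\<bar>rnd m r - r\<bar> \<le> \<bar>r\<bar> / X'" for r
  proof -
    have "\<bar>r\<bar> / X \<le> \<bar>r\<bar> / X'" using assms(2,3) by (intro divide_left_mono) auto
    then show ?thesis using s by (meson order_trans)
  qed
  have "1 / X \<le> 1 / X'" using assms(2,3) by (intro divide_left_mono) auto
  then show "nmin m \<le> 1 / X'" using s by linarith
  have "X' * W' \<le> X * W" using assms by (intro mult_mono) auto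
  then show "X' * W' \<le> nmax m" using s by linarith
qed

text \<open>\<open>Max\<close> is informative for finite sets only; this one is covered by the
  images of the index square under the two matrices.\<close>

lemma max_finite_entry_bounds:
  shows "1 \<le> max_finite_entry n A B"
    and "i < n \<Longrightarrow> j < n \<Longrightarrow> A i j = ereal r \<or> B i j = ereal r \<Longrightarrow> r \<le> max_finite_entry n A B"
proof -
  let ?S = "{r. \<exists>i<n. \<exists>j<n. A i j = ereal r \<or> B i j = ereal r}"
  have "?S \<subseteq> (\<lambda>(i, j). real_of_ereal (A i j)) ` ({..<n} \<times> {..<n}) \<union> (\<lambda>(i, j). real_of_ereal (B i j)) ` ({..<n} \<times> {..<n})"
  proof
    fix r assume "r \<in> ?S"
    then obtain i j where ij: "i < n" "j < n" "A i j = ereal r \<or> B i j = ereal r" by blast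
    then have "r = real_of_ereal (A i j) \<or> r = real_of_ereal (B i j)" by auto
    then show "r \<in> (\<lambda>(i, j). real_of_ereal (A i j)) ` ({..<n} \<times> {..<n}) \<union> (\<lambda>(i, j). real_of_ereal (B i j)) ` ({..<n} \<times> {..<n})"
      using ij by (auto intro!: image_eqI[of _ _ "(i, j)"])
  qed
  then have fin: "finite (insert 1 ?S)" by (meson finite_SigmaI finite_UnI finite_imageI finite_insert finite_lessThan finite_subset)
  show "1 \<le> max_finite_entry n A B" unfolding max_finite_entry_def using fin by (intro Max_ge) auto
  show "i < n \<Longrightarrow> j < n \<Longrightarrow> A i j = ereal r \<or> B i j = ereal r \<Longrightarrow> r \<le> max_finite_entry n A B"
    unfolding max_finite_entry_def using fin by (intro Max_ge) auto
qed

text \<open>2^J is of the order of the square root of T / n + n, the group parameter \<sigma> at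
  which all groups fit into the budget.\<close>

lemma exists_pow4:
  fixes n T :: nat
  assumes "1 \<le> n"
  shows "\<exists>J. 2 * (T + n * n) \<le> n * 4 ^ J \<and> n * 4 ^ J \<le> 8 * (T + n * n)"
proof -
  let ?P = "\<lambda>J. 2 * (T + n * n) \<le> n * 4 ^ J"
  have "2 * (T + n * n) \<le> n * 4 ^ (2 * (T + n * n))"
  proof -
    have "2 * (T + n * n) \<le> 2 ^ (2 * (T + n * n))" by (simp add: less_imp_le)
    also have "\<dots> \<le> 4 ^ (2 * (T + n * n))" by (intro power_mono) auto
    also have "\<dots> \<le> n * 4 ^ (2 * (T + n * n))" using assms by simp
    finally show ?thesis .
  qed
  then have ex: "\<exists>J. ?P J" by blast
  define J where "J = (LEAST J. ?P J)"
  have 1: "?P J" unfolding J_def using ex by (rule LeastI_ex)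
  have "n * 4 ^ J \<le> 8 * (T + n * n)"
  proof (cases J)
    case 0
    have "n \<le> n * n" using assms by simp
    then have "n * 4 ^ J \<le> n * n" using 0 by simp
    also have "n * n \<le> 8 * (T + n * n)" by simp
    finally show ?thesis .
  next
    case (Suc J')
    then have "\<not> ?P J'" using not_less_Least[of J' ?P] unfolding J_def[symmetric] by simp
    then show ?thesis using Suc by simp
  qed
  then show ?thesis using 1 by blast
qed

text \<open>With T for the time of one product, the dominant terms per scaling are n^2 2^J, of order
  sqrt(n^3 T), and J T; they lead to the two conditions on e. The number of scalings contributes the
  factor 1 / \<epsilon>.\<close>

lemma approx_from_bool_matmul:
  assumes mm: "bool_matmul \<tau>" and \<tau>: "2 \<le> \<tau>" and e: "\<tau> \<le> e" "(\<tau> + 3) / 2 \<le> e"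
  shows "approx_min_plus_in_soft_O (\<lambda>n \<epsilon>. real n powr e * \<epsilon> powr (-1))"
proof -
  from mm obtain p and c :: nat and K and k :: nat where p: "\<And>n A B m s.
        n \<ge> 1 \<Longrightarrow> (\<forall>i<n. \<forall>j<n. \<bar>A i j\<bar> \<le> 1 \<and> \<bar>B i j\<bar> \<le> 1) \<Longrightarrow> supports m (real (n + 1) ^ c) 1 \<Longrightarrow> wmem s 0 0 = int n \<Longrightarrow>
        holds_matrix n (wmem s 1) A \<Longrightarrow> holds_matrix n (wmem s 2) B \<Longrightarrow>
        (\<exists>t s'. exec m p s t s' \<and> real t \<le> K * real n powr \<tau> * (1 + ln (real n)) ^ k \<and>
           holds_matrix n (wmem s' 3) (mat_prod n A B))"
    unfolding bool_matmul_def by blast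
  \<comment> \<open>The constant in the bound K1 n^\<tau> l^k for Tm + n^2, where l = ln (n /
    \<epsilon>): 4^\<tau> stems from the size 4 n, 2^k from 1 + ln (4 n) \<le> 2 l, and the final 1
    from n^2.\<close>
  define K1 where "K1 = max K 1 * 4 powr \<tau> * 2 ^ k + 1"
  have K1: "1 \<le> K1" unfolding K1_def by simp
  \<comment> \<open>Chosen for J + 1 \<le> D l, since 4^J is at most 8 K1 n^\<tau> l^k.\<close>
  define D where "D = \<bar>ln (8 * K1)\<bar> + \<tau> + real k + 1"
  define KK where "KK = 90000 * (4 + 6 * sqrt K1 + D * K1)"
  define T where "T = (\<lambda>n \<epsilon>. KK * (real n powr e * \<epsilon> powr (-1)) * ln (real n / \<epsilon>) ^ (k + 1))"
  \<comment> \<open>Constants are absorbed by powers of n / \<epsilon>, which is at least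
    10.\<close>
  obtain a :: nat where a: "100 * K1 \<le> 10 ^ a" using real_arch_pow[of 10 "100 * K1"] by (auto intro: less_imp_le)
  define c0 where "c0 = a + nat \<lceil>\<tau>\<rceil> + k + 5"
  \<comment> \<open>Y will be about (n / \<epsilon>)^c0. The summand 64 c0 provides Y^64, c the word
    range that the product program asks for, and 5 the bound 10000 / \<epsilon>.\<close>
  define c' where "c' = 64 * c0 + c + 5"
  have "solves_approx_min_plus (approx_program (clocked p)) T"
    unfolding solves_approx_min_plus_def
  proof (rule exI[of _ c'], intro allI impI)
    fix n :: nat and \<epsilon> :: real and A B :: "nat \<Rightarrow> nat \<Rightarrow> ereal" and m :: machine and s :: state
    assume n: "1 \<le> n" and eps: "0 < \<epsilon>" "\<epsilon> < 1 / 10" and AB: "\<forall>i<n. \<forall>j<n. A i j \<in> R_plus \<and> B i j \<in> R_plus"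
      and sup: "supports m ((real n / \<epsilon>) ^ c') (max_finite_entry n A B)"
      and s: "wmem s 0 0 = int n" "nmem s 0 0 = ereal \<epsilon>" "holds_matrix n (nmem s 1) A" "holds_matrix n (nmem s 2) B"
    define z where "z = real n / \<epsilon>"
    have z10: "10 * real n \<le> z" using eps n unfolding z_def by (simp add: field_simps)
    have z1: "10 \<le> z" "1 \<le> z" "real n \<le> z" using z10 n by auto
    have ze: "1 / \<epsilon> \<le> z" unfolding z_def using n eps by (intro divide_right_mono) auto
    define l where "l = ln z"
    have ln10: "2 \<le> ln (10::real)"
    proof -
      have "exp (2::real) = exp 1 * exp 1" by (simp flip: exp_add)
      also have "\<dots> \<le> 3 * 3" using exp_le by (intro mult_mono) auto
      finally have "exp (2::real) \<le> 10" by simp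
      then have "ln (exp 2) \<le> ln (10::real)" by (subst ln_le_cancel_iff) auto
      then show ?thesis by simp
    qed
    have l: "ln (real n) + 2 \<le> l" "2 \<le> l"
    proof -
      have "ln (10 * real n) \<le> l" unfolding l_def using z10 n by (subst ln_le_cancel_iff) auto
      moreover have "ln (10 * real n) = ln 10 + ln (real n)" using n by (simp add: ln_mult)
      ultimately show "ln (real n) + 2 \<le> l" using ln10 by linarith
      moreover have "0 \<le> ln (real n)" using n by simp
      ultimately show "2 \<le> l" by linarith
    qed
    have lz: "l \<le> z" unfolding l_def using z1 ln_le_minus_one[of z] by linarith
    have lnn: "0 \<le> ln (real n)" using n by simp
    have l4: "1 + ln (real (4 * n)) \<le> 2 * l"
    proof -
      have "ln (real (4 * n)) = ln 4 + ln (real n)" using n by (simp add: ln_mult of_nat_mult)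
      moreover have "ln (4::real) \<le> 4 - 1" by (rule ln_le_minus_one) simp
      ultimately show ?thesis using l lnn by linarith
    qed
    \<comment> \<open>K might be negative; the maximum with 1 keeps the factors of the bound
      nonnegative.\<close>
    define Tm where "Tm = nat \<lfloor>max K 1 * real (4 * n) powr \<tau> * (1 + ln (real (4 * n))) ^ k\<rfloor>"
    define P where "P = real n powr \<tau>"
    have P1: "1 \<le> P" unfolding P_def using n \<tau> by (intro ge_one_powr_ge_zero) auto
    have nn: "real (n * n) \<le> P"
    proof -
      have "real (n * n) = real n powr 2" using n by (simp add: powr_numeral power2_eq_square of_nat_mult)
      also have "\<dots> \<le> P" unfolding P_def using n \<tau> by (intro powr_mono) auto
      finally show ?thesis .
    qed
    have lk: "1 \<le> l ^ k" using l by (intro one_le_power) auto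
    have Tm: "real Tm \<le> max K 1 * 4 powr \<tau> * 2 ^ k * P * l ^ k"
    proof -
      have "real Tm \<le> max K 1 * real (4 * n) powr \<tau> * (1 + ln (real (4 * n))) ^ k" unfolding Tm_def
        using n by (intro of_nat_floor) (auto intro!: mult_nonneg_nonneg zero_le_power add_nonneg_nonneg)
      also have "\<dots> \<le> max K 1 * real (4 * n) powr \<tau> * (2 * l) ^ k"
        using l4 n by (intro mult_left_mono power_mono) (auto intro!: add_nonneg_nonneg)
      also have "\<dots> = max K 1 * 4 powr \<tau> * 2 ^ k * P * l ^ k"
        unfolding P_def using n by (simp add: powr_mult of_nat_mult power_mult_distrib)
      finally show ?thesis .
    qed
    have TmS: "real (Tm + n * n) \<le> K1 * P * l ^ k"
    proof -
      have "real (n * n) \<le> P * l ^ k" using mult_mono[OF nn lk] P1 by simp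
      then show ?thesis using Tm unfolding K1_def by (simp add: algebra_simps of_nat_add)
    qed
    define X where "X = z ^ c'"
    define W where "W = max_finite_entry n A B"
    have W1: "1 \<le> W" unfolding W_def by (rule max_finite_entry_bounds)
    define Y where "Y = nat \<lfloor>z ^ c0\<rfloor>"
    have zc: "1 \<le> z ^ c0" using z1 by (intro one_le_power) auto
    have YX: "real Y \<le> z ^ c0" "z ^ c0 - 1 \<le> real Y" unfolding Y_def using zc by linarith+
    have "z ^ (64 * c0) \<le> X" unfolding X_def c'_def using z1 by (intro power_increasing) auto
    moreover have "real Y ^ 64 \<le> (z ^ c0) ^ 64" using YX by (intro power_mono) auto
    moreover have Xw: "X \<le> wmax m" using sup unfolding supports_def X_def z_def by simp
    ultimately have Ymax: "real Y ^ 64 \<le> wmax m" by (simp add: power_mult[symmetric] mult.commute)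
    have powz: "real n powr \<tau> \<le> z ^ nat \<lceil>\<tau>\<rceil>"
    proof -
      have "real n powr \<tau> \<le> z powr \<tau>" using z1 n \<tau> by (intro powr_mono2) auto
      also have "\<dots> \<le> z powr real (nat \<lceil>\<tau>\<rceil>)" using z1 \<tau> by (intro powr_mono) linarith+
      also have "\<dots> = z ^ nat \<lceil>\<tau>\<rceil>" using z1 by (simp add: powr_realpow)
      finally show ?thesis .
    qed
    define Z where "Z = z ^ (nat \<lceil>\<tau>\<rceil> + k)"
    have PZ: "P * l ^ k \<le> Z"
    proof -
      have "l ^ k \<le> z ^ k" using lz l by (intro power_mono) auto
      then show ?thesis unfolding Z_def power_add P_def using powz l z1 by (intro mult_mono) auto
    qed
    have Z1: "1 \<le> Z" unfolding Z_def using z1 by (intro one_le_power) auto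
    have big: "100 * K1 * Z * z ^ 2 \<le> z ^ c0 - 1"
    proof -
      have "100 * K1 * Z * z ^ 2 \<le> z ^ a * Z * z ^ 2"
      proof (intro mult_right_mono)
        have "(10::real) ^ a \<le> z ^ a" using z1 by (intro power_mono) auto
        then show "100 * K1 \<le> z ^ a" using a by linarith
      qed (use Z1 in auto)
      also have "\<dots> = z ^ (c0 - 3)" unfolding Z_def c0_def by (simp flip: power_add add: add.assoc add.commute add.left_commute)
      finally have 1: "100 * K1 * Z * z ^ 2 \<le> z ^ (c0 - 3)" .
      have "c0 = (c0 - 3) + 3" by (simp add: c0_def)
      then have "z ^ c0 = z ^ (c0 - 3) * z ^ 3" by (metis power_add)
      moreover have "z ^ (c0 - 3) * 2 \<le> z ^ (c0 - 3) * z ^ 3"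
      proof (rule mult_left_mono)
        have "z ^ 1 \<le> z ^ 3" using z1 by (intro power_increasing) auto
        then show "2 \<le> z ^ 3" using z1 by simp
      qed (use z1 in auto)
      moreover have "1 \<le> z ^ (c0 - 3)" using z1 by (intro one_le_power) auto
      ultimately show ?thesis using 1 by linarith
    qed
    have KZ: "1 \<le> K1 * Z" using mult_mono[OF K1 Z1] K1 by simp
    have z2: "1 \<le> z ^ 2" "z \<le> z ^ 2" using z1 by (auto simp: one_le_power self_le_power)
    have KZz: "z ^ 2 \<le> K1 * Z * z ^ 2" using mult_right_mono[OF KZ, of "z ^ 2"] by simp
    have Yge: "y \<le> real Y" if "y \<le> 100 * (K1 * Z * z ^ 2)" for y using that big YX(2) by (simp add: mult.assoc)
    have Y16: "16 \<le> Y"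
    proof -
      have "real 16 \<le> real Y" by (rule Yge) (use KZz z2 in simp)
      then show ?thesis by simp
    qed
    have nY: "20 * (n * n) \<le> Y"
    proof -
      have "real (n * n) \<le> z ^ 2" unfolding power2_eq_square of_nat_mult using z1 by (intro mult_mono) auto
      then have "real (20 * (n * n)) \<le> 100 * (K1 * Z * z ^ 2)" using KZz z2 by (simp add: of_nat_mult)
      from Yge[OF this] show ?thesis by (simp only: of_nat_le_iff)
    qed
    have eY: "20 / \<epsilon> \<le> real Y"
      by (rule Yge) (use ze KZz z2 in \<open>simp add: divide_inverse\<close>)
    obtain J where J: "2 * (Tm + n * n) \<le> n * 4 ^ J" "n * 4 ^ J \<le> 8 * (Tm + n * n)" using exists_pow4[OF n] by blast
    have TmZ: "real (Tm + n * n) \<le> K1 * Z" using order_trans[OF TmS[unfolded mult.assoc] mult_left_mono[OF PZ, of K1]] K1 by simp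
    have JY: "n * n * 2 ^ (J + 1) + Tm + n * n \<le> Y"
    proof -
      have "n * n * 2 ^ (J + 1) \<le> 2 * n * (n * 4 ^ J)"
      proof -
        have "(2::nat) ^ J \<le> 4 ^ J" by (intro power_mono) auto
        then show ?thesis by (simp add: mult.assoc mult.left_commute)
      qed
      also have "\<dots> \<le> 2 * n * (8 * (Tm + n * n))" using J(2) by (intro mult_left_mono) auto
      finally have "n * n * 2 ^ (J + 1) + Tm + n * n \<le> 16 * n * (Tm + n * n) + 1 * (Tm + n * n)" by simp
      also have "\<dots> \<le> 16 * n * (Tm + n * n) + n * (Tm + n * n)" using n by (intro add_left_mono mult_right_mono) auto
      also have "\<dots> = 17 * (n * (Tm + n * n))" by simp
      finally have 1: "real (n * n * 2 ^ (J + 1) + Tm + n * n) \<le> 17 * (real n * real (Tm + n * n))"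
        by (metis of_nat_le_iff of_nat_mult of_nat_numeral)
      have "real n * real (Tm + n * n) \<le> z ^ 2 * (K1 * Z)" using TmZ z1 z2 KZ by (intro mult_mono) auto
      then have "real (n * n * 2 ^ (J + 1) + Tm + n * n) \<le> 100 * (K1 * Z * z ^ 2)" using 1 KZz z2 by (simp add: mult.commute)
      from Yge[OF this] show ?thesis by (simp only: of_nat_le_iff)
    qed
    have TmY: "Tm \<le> Y" using JY by simp
    have supp: "supports m X W" using sup unfolding X_def W_def z_def .
    have X1: "1 \<le> X" unfolding X_def using z1 by (intro one_le_power) auto
    have sup4: "supports m (real (4 * n + 1) ^ c) 1"
    proof (rule supports_mono[OF supp])
      have "real (4 * n + 1) \<le> z" using z10 n by (simp add: of_nat_add of_nat_mult of_nat_Suc)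
      then have "real (4 * n + 1) ^ c \<le> z ^ c" by (intro power_mono) auto
      also have "\<dots> \<le> X" unfolding X_def c'_def using z1 by (intro power_increasing) auto
      finally show "real (4 * n + 1) ^ c \<le> X" .
    qed (use W1 in auto)
    have Xe: "10000 / \<epsilon> \<le> X"
    proof -
      have "10000 * (1 / \<epsilon>) \<le> z ^ 4 * z"
      proof (rule mult_mono)
        have "(10::real) ^ 4 \<le> z ^ 4" using z1 by (intro power_mono) auto
        then show "10000 \<le> z ^ 4" by simp
      qed (use ze eps z1 in auto)
      also have "\<dots> = z ^ 5" by (simp add: eval_nat_numeral)
      also have "\<dots> \<le> X" unfolding X_def c'_def using z1 by (intro power_increasing) auto
      finally show ?thesis by simp
    qed
    \<comment> \<open>The specification of \<open>call\<close> comes from running \<open>p\<close>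
      on the relocated memory under the clock; overflow of the clock is excluded by q + Tm \<le>
      Y.\<close>
    interpret approx_machine m Y n "clocked p" Tm \<epsilon> X W A B
    proof
      fix s :: state and A B :: "nat \<Rightarrow> nat \<Rightarrow> int" and q :: nat
      assume h: "wmem s 100 0 = int (4 * n)" "holds_matrix (4 * n) (wmem s 101) A" "holds_matrix (4 * n) (wmem s 102) B"
        "\<And>i j. i < 4 * n \<Longrightarrow> j < 4 * n \<Longrightarrow> \<bar>A i j\<bar> \<le> 1 \<and> \<bar>B i j\<bar> \<le> 1" "wmem s 99 0 = int q" "q + Tm \<le> Y"
      have sh: "wmem (shifted s) a = wmem s (a + 100)" for a by (simp add: shifted_def)
      have "\<exists>t s'. exec m p (shifted s) t s' \<and> real t \<le> K * real (4 * n) powr \<tau> * (1 + ln (real (4 * n))) ^ k \<and>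
           holds_matrix (4 * n) (wmem s' 3) (mat_prod (4 * n) A B)"
        by (rule p) (use n h sup4 in \<open>auto simp: sh\<close>)
      then obtain t s' where t: "exec m p (shifted s) t s'" "real t \<le> K * real (4 * n) powr \<tau> * (1 + ln (real (4 * n))) ^ k"
        "holds_matrix (4 * n) (wmem s' 3) (mat_prod (4 * n) A B)" by blast
      have "real t \<le> max K 1 * real (4 * n) powr \<tau> * (1 + ln (real (4 * n))) ^ k"
        by (rule order_trans[OF t(2)]) (use n in \<open>auto intro!: mult_right_mono add_nonneg_nonneg\<close>)
      then have tT: "t \<le> Tm" unfolding Tm_def by (simp add: le_nat_floor)
      have "real Y \<le> real Y ^ 64" using Y16 by (intro self_le_power) auto
      moreover have "real (q + t) \<le> real Y" using h(6) tT by simp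
      ultimately have "real (q + t) \<le> wmax m" using Ymax by linarith
      then have "real_of_int (wmem s 99 0 + int t) \<le> wmax m" using h(5) by (simp add: of_nat_add)
      then have "wp m (clocked p) (\<lambda>t' s''. t' \<le> 7 * t \<and> shifted s'' = s' \<and> wmem s'' 99 0 = wmem s 99 0 + int t) s"
        using clocked_run[OF t(1) refl] h(5) unfolding clock_run_def by simp
      then show "wp m (clocked p) (\<lambda>t s'. \<exists>\<tau>\<le>Tm. t \<le> 7 * \<tau> \<and> wmem s' 99 0 = int (q + \<tau>) \<and>
          holds_matrix (4 * n) (wmem s' 103) (mat_prod (4 * n) A B)) s"
      proof (rule wp_mono, elim conjE)
        fix t' :: nat and s'' :: state
        assume u: "t' \<le> 7 * t" "shifted s'' = s'" "wmem s'' 99 0 = wmem s 99 0 + int t"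
        have "wmem s'' 103 = wmem s' 3" unfolding u(2)[symmetric] by (simp add: shifted_def)
        then show "\<exists>\<tau>\<le>Tm. t' \<le> 7 * \<tau> \<and> wmem s'' 99 0 = int (q + \<tau>) \<and> holds_matrix (4 * n) (wmem s'' 103) (mat_prod (4 * n) A B)"
          using u t(3) tT h(5) by (intro exI[of _ t]) (auto simp: of_nat_add)
      qed
    next
      show "A i j \<in> R_plus \<and> B i j \<in> R_plus" if "i < n" "j < n" for i j using AB that by blast
    next
      show "r \<le> W" if "i < n" "j < n" "A i j = ereal r \<or> B i j = ereal r" for i j r
        unfolding W_def using max_finite_entry_bounds(2)[of i n j A r B] that by blast
    next
      show "\<bar>rnd m r - r\<bar> \<le> \<bar>r\<bar> / X" for r using supp unfolding supports_def by blast
    next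
      show "nmin m \<le> 1 / X" "X * W \<le> nmax m" using supp unfolding supports_def by auto
    qed (use Y16 Ymax n nY mods_clocked eps Xe W1 eY in auto)
    define J1 where "J1 = nat \<lceil>log 2 (real (2 * n * n))\<rceil>"
    have n2: "1 \<le> 2 * n * n" using n by simp
    have J1: "2 * n * n \<le> 2 ^ J1"
    proof -
      have "real (2 * n * n) = 2 powr log 2 (real (2 * n * n))" using n2 by (subst powr_log_cancel) auto
      also have "\<dots> \<le> 2 powr real J1" unfolding J1_def by (intro powr_mono) linarith+
      also have "\<dots> = real (2 ^ J1)" by (simp add: powr_realpow)
      finally show ?thesis by (simp only: of_nat_le_iff)
    qed
    have ln2: "1 / 2 \<le> ln (2::real)"
    proof -
      have "ln (1 / 2 :: real) \<le> 1 / 2 - 1" by (rule ln_le_minus_one) simp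
      then show ?thesis by (simp add: ln_div)
    qed
    have J1l: "real (J1 + 1) \<le> 4 * l"
    proof -
      have "log 2 (real (2 * n * n)) = 1 + 2 * (ln (real n) / ln 2)"
        using n by (simp add: log_def ln_mult of_nat_mult field_simps)
      moreover have "ln (real n) / ln 2 \<le> ln (real n) / (1 / 2)" using ln2 lnn by (intro divide_left_mono) auto
      ultimately have "log 2 (real (2 * n * n)) \<le> 1 + 4 * ln (real n)" by simp
      moreover have "real J1 \<le> log 2 (real (2 * n * n)) + 1" unfolding J1_def using n2 by (auto simp: le_log_iff)
      ultimately show ?thesis using l by (simp add: of_nat_add of_nat_Suc)
    qed
    from approx_program_wp[OF s J1 J(1) JY] obtain t s' N C where
      res: "exec m (approx_program (clocked p)) s t s'" "real N * \<epsilon> \<le> 9"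
        "t \<le> N * (10000 * ((J1 + 1) * (n * n) + n * n * 2 ^ (J + 1) + (J + 1) * (Tm + n * n)))"
        "holds_matrix n (nmem s' 3) C" "approximates n \<epsilon> (min_plus n A B) C"
      unfolding wp_def by blast
    define E where "E = real n powr e"
    have PE: "P \<le> E" unfolding P_def E_def using n e by (intro powr_mono) auto
    have E1: "1 \<le> E" using P1 PE by linarith
    have ll: "l \<le> l ^ (k + 1)" using l lk mult_left_mono[OF lk, of l] by simp
    have l1: "l ^ k \<le> l ^ (k + 1)" using l by (intro power_increasing) auto
    have b1: "real ((J1 + 1) * (n * n)) \<le> 4 * (E * l ^ (k + 1))"
    proof -
      have "real (J1 + 1) * real (n * n) \<le> 4 * l ^ (k + 1) * E" 
      proof (rule mult_mono)
        show "real (J1 + 1) \<le> 4 * l ^ (k + 1)" using J1l ll by linarith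
        show "real (n * n) \<le> E" using nn PE by linarith
      qed (use l in auto)
      then show ?thesis by (simp only: of_nat_mult mult.assoc mult.commute mult.left_commute)
    qed
    \<comment> \<open>Compared after squaring: (n^2 2^J)^2 = n^3 (n 4^J), and n 4^J is of the order
      of one product. This is the origin of the exponent (\<tau> + 3) / 2.\<close>
    have b2: "real (n * n * 2 ^ (J + 1)) \<le> 6 * sqrt K1 * (E * l ^ (k + 1))"
    proof -
      let ?x = "real (n * n * 2 ^ J)"
      have "?x\<^sup>2 = real n ^ 3 * real (n * 4 ^ J)"
      proof -
        have "(n * n * 2 ^ J) ^ 2 = n ^ 3 * (n * 4 ^ J)"
          by (simp add: power2_eq_square power3_eq_cube power_mult_distrib[symmetric] mult.assoc mult.left_commute)
        then show ?thesis by (metis of_nat_mult of_nat_power)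
      qed
      also have "\<dots> \<le> real n ^ 3 * (8 * (K1 * P * l ^ k))"
      proof (intro mult_left_mono)
        have "real (n * 4 ^ J) \<le> real (8 * (Tm + n * n))" using J(2) by (simp only: of_nat_le_iff)
        then show "real (n * 4 ^ J) \<le> 8 * (K1 * P * l ^ k)" using TmS by (simp add: of_nat_mult)
      qed auto
      also have "\<dots> \<le> 9 * K1 * (E\<^sup>2 * (l ^ (k + 1))\<^sup>2)"
      proof -
        have "real n ^ 3 * P = real n powr (3 + \<tau>)" unfolding P_def using n by (simp add: powr_add powr_numeral)
        also have "\<dots> \<le> real n powr (2 * e)" using e n by (intro powr_mono) auto
        also have "\<dots> = E\<^sup>2" unfolding E_def using n by (simp add: power2_eq_square flip: powr_add)
        finally have 1: "real n ^ 3 * P \<le> E\<^sup>2" .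
        have "1 \<le> l ^ (k + 1)" using lk l1 by linarith
        then have "l ^ (k + 1) \<le> (l ^ (k + 1))\<^sup>2" by (rule self_le_power) simp
        then have 2: "l ^ k \<le> (l ^ (k + 1))\<^sup>2" using l1 by linarith
        have "real n ^ 3 * (8 * (K1 * P * l ^ k)) = 8 * K1 * ((real n ^ 3 * P) * l ^ k)" by simp
        also have "\<dots> \<le> 9 * K1 * (E\<^sup>2 * (l ^ (k + 1))\<^sup>2)" using 1 2 K1 P1 lk by (intro mult_mono) auto
        finally show ?thesis .
      qed
      also have "\<dots> = (3 * sqrt K1 * (E * l ^ (k + 1)))\<^sup>2" using K1 by (simp add: power_mult_distrib)
      finally have "?x \<le> 3 * sqrt K1 * (E * l ^ (k + 1))"
        by (rule power2_le_imp_le) (use K1 E1 l in auto)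
      moreover have "real (n * n * 2 ^ (J + 1)) = 2 * ?x" by (simp add: of_nat_mult)
      ultimately have "real (n * n * 2 ^ (J + 1)) \<le> 2 * (3 * sqrt K1 * (E * l ^ (k + 1)))" by linarith
      also have "\<dots> = 6 * sqrt K1 * (E * l ^ (k + 1))" by simp
      finally show ?thesis .
    qed
    have Jl: "real (J + 1) \<le> D * l"
    proof -
      have "real (4 ^ J) \<le> 8 * K1 * P * l ^ k"
      proof -
        have "real (4 ^ J) \<le> real (n * 4 ^ J)" using n by simp
        also have "\<dots> \<le> real (8 * (Tm + n * n))" using J(2) by (simp only: of_nat_le_iff)
        also have "\<dots> = 8 * real (Tm + n * n)" by (simp only: of_nat_mult of_nat_numeral)
        also have "\<dots> \<le> 8 * (K1 * P * l ^ k)" using TmS by simp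
        finally show ?thesis by (simp only: mult.assoc)
      qed
      then have "ln (real (4 ^ J)) \<le> ln (8 * K1 * P * l ^ k)" using K1 P1 lk by (subst ln_le_cancel_iff) auto
      also have "\<dots> = ln (8 * K1) + \<tau> * ln (real n) + real k * ln l"
        using K1 P1 l n by (simp add: ln_mult ln_realpow P_def ln_powr)
      also have "\<dots> \<le> \<bar>ln (8 * K1)\<bar> * l + \<tau> * l + real k * l"
      proof (intro add_mono mult_left_mono)
        have "\<bar>ln (8 * K1)\<bar> * 1 \<le> \<bar>ln (8 * K1)\<bar> * l" using l by (intro mult_left_mono) auto
        then show "ln (8 * K1) \<le> \<bar>ln (8 * K1)\<bar> * l" by simp
        show "ln l \<le> l" using ln_le_minus_one[of l] l by linarith
      qed (use \<tau> l in auto)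
      finally have "real J * ln 4 \<le> (\<bar>ln (8 * K1)\<bar> + \<tau> + real k) * l" by (simp add: ln_realpow algebra_simps)
      moreover have "real J * 1 \<le> real J * ln 4"
      proof (rule mult_left_mono)
        have "ln (4::real) = 2 * ln 2" using ln_realpow[of 2 2] by simp
        then show "1 \<le> ln (4::real)" using ln2 by simp
      qed simp
      ultimately show ?thesis unfolding D_def using l by (simp add: algebra_simps of_nat_add of_nat_Suc)
    qed
    have D0: "0 \<le> D" unfolding D_def using \<tau> by simp
    have b3: "real ((J + 1) * (Tm + n * n)) \<le> D * K1 * (E * l ^ (k + 1))"
    proof -
      have "real ((J + 1) * (Tm + n * n)) \<le> (D * l) * (K1 * P * l ^ k)"
        unfolding of_nat_mult[of "J + 1"] using Jl TmS D0 l by (intro mult_mono) auto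
      also have "\<dots> = D * K1 * (P * l ^ (k + 1))" by simp
      also have "\<dots> \<le> D * K1 * (E * l ^ (k + 1))" using PE D0 K1 l by (intro mult_left_mono mult_right_mono) auto
      finally show ?thesis .
    qed
    have "real t \<le> T n \<epsilon>"
    proof -
      let ?S = "(J1 + 1) * (n * n) + n * n * 2 ^ (J + 1) + (J + 1) * (Tm + n * n)"
      have S: "real ?S \<le> (4 + 6 * sqrt K1 + D * K1) * (E * l ^ (k + 1))"
        using b1 b2 b3 by (simp add: of_nat_add distrib_right)
      have "real t \<le> real (N * (10000 * ?S))" using res(3) by (simp only: of_nat_le_iff)
      also have "\<dots> = real N * (10000 * real ?S)" by (simp only: of_nat_mult of_nat_numeral)
      also have "\<dots> \<le> (9 * (1 / \<epsilon>)) * (10000 * ((4 + 6 * sqrt K1 + D * K1) * (E * l ^ (k + 1))))"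
        using S res(2) eps by (intro mult_mono mult_left_mono) (auto simp: field_simps)
      also have "\<dots> = T n \<epsilon>" unfolding T_def KK_def E_def l_def z_def using eps by (simp add: powr_minus field_simps)
      finally show ?thesis .
    qed
    then show "\<exists>t s' C. exec m (approx_program (clocked p)) s t s' \<and> real t \<le> T n \<epsilon> \<and>
        holds_matrix n (nmem s' 3) C \<and> approximates n \<epsilon> (min_plus n A B) C" using res by blast
  qed
  moreover have "T \<in> soft_O (\<lambda>n \<epsilon>. real n powr e * \<epsilon> powr (-1))" unfolding soft_O_def T_def by blast
  ultimately show ?thesis unfolding approx_min_plus_in_soft_O_def by blast
qed

section \<open>Yates transforms\<close>

text \<open>The h-fold tensor power of the R by Q matrix g applied to the vector c, with indices
  read as h digits in base R and base Q. The recursion applies g to the lowest digit.\<close>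

fun yates :: "nat \<Rightarrow> nat \<Rightarrow> (nat \<Rightarrow> nat \<Rightarrow> int) \<Rightarrow> nat \<Rightarrow> (nat \<Rightarrow> int) \<Rightarrow> nat \<Rightarrow> int" where
  "yates R Q g 0 c x = c x"
| "yates R Q g (Suc h) c x = yates R Q g h (\<lambda>y. \<Sum>z<Q. g (x mod R) z * c (y * Q + z)) (x div R)"

lemma yates_cong:
  "(\<And>y. y < Q ^ h \<Longrightarrow> c y = c' y) \<Longrightarrow> x < R ^ h \<Longrightarrow> yates R Q g h c x = yates R Q g h c' x"
proof (induction h arbitrary: c c' x)
  case (Suc h)
  have "yates R Q g h (\<lambda>y. \<Sum>z<Q. g (x mod R) z * c (y * Q + z)) (x div R) =
        yates R Q g h (\<lambda>y. \<Sum>z<Q. g (x mod R) z * c' (y * Q + z)) (x div R)"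
  proof (rule Suc.IH)
    fix y assume y: "y < Q ^ h"
    have "c (y * Q + z) = c' (y * Q + z)" if "z < Q" for z
      using mult_add_less[OF y that] by (intro Suc.prems) (simp add: mult.commute)
    then show "(\<Sum>z<Q. g (x mod R) z * c (y * Q + z)) = (\<Sum>z<Q. g (x mod R) z * c' (y * Q + z))" by simp
  next
    show "x div R < R ^ h" using Suc.prems(2) by (simp add: less_mult_imp_div_less mult.commute)
  qed
  then show ?case by simp
qed simp

lemma yates_sum:
  "yates R Q g h (\<lambda>y. \<Sum>l<r. w l * c l y) x = (\<Sum>l<r. w l * yates R Q g h (c l) x)"
proof (induction h arbitrary: c x)
  case (Suc h)
  have "(\<Sum>z<Q. g (x mod R) z * (\<Sum>l<r. w l * c l (y * Q + z))) = (\<Sum>l<r. w l * (\<Sum>z<Q. g (x mod R) z * c l (y * Q + z)))" for y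
    by (simp add: sum_distrib_left sum.swap[of _ "{..<r}"] mult.left_commute)
  then show ?case by (simp add: Suc.IH)
qed simp

lemma mult_add_div_mod: "z < n \<Longrightarrow> (a * n + z) div n = a" "z < n \<Longrightarrow> (a * n + z) mod n = (z::nat)"
  by auto

text \<open>After j levels a position consists of unprocessed digits in base Q above j finished
  digits in base R. One more level applies g to the lowest unprocessed digit and puts the new digit
  at weight R^j; what remains is a transform with one level less.\<close>

lemma yates_step:
  assumes arr: "\<And>f. f < Q ^ h' * R ^ Suc j \<Longrightarrow>
      arr' f = (\<Sum>z<Q. g (f mod R ^ Suc j div R ^ j) z * arr ((f div R ^ Suc j * Q + z) * R ^ j + f mod R ^ j))"
    and inv: "\<And>x x'. x < R ^ j \<Longrightarrow> x' < R ^ Suc h' \<Longrightarrow> yates R Q g (Suc h') (\<lambda>y. arr (y * R ^ j + x)) x' = yates R Q g h c (x' * R ^ j + x)"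
    and x: "x < R ^ Suc j" "x' < R ^ h'"
  shows "yates R Q g h' (\<lambda>y. arr' (y * R ^ Suc j + x)) x' = yates R Q g h c (x' * R ^ Suc j + x)"
proof -
  let ?l = "x div R ^ j" and ?x0 = "x mod R ^ j"
  have R0: "0 < R" using x by (cases R) auto
  have Rj: "0 < R ^ j" using R0 by simp
  have l: "?l < R" using x(1) by (simp add: less_mult_imp_div_less mult.commute)
  have x0: "?x0 < R ^ j" using Rj by simp
  have e: "x' * R ^ Suc j + x = (x' * R + ?l) * R ^ j + ?x0"
  proof -
    have "(x' * R + ?l) * R ^ j + ?x0 = x' * R * R ^ j + (?l * R ^ j + ?x0)" by (simp add: algebra_simps)
    then show ?thesis by (simp add: div_mult_mod_eq mult.assoc)
  qed
  have b: "x' * R + ?l < R ^ Suc h'" using mult_add_less[OF x(2) l] by (simp add: mult.commute)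
  have dm: "(x' * R + ?l) mod R = ?l" "(x' * R + ?l) div R = x'" using l by auto
  have "yates R Q g h c (x' * R ^ Suc j + x) = yates R Q g (Suc h') (\<lambda>y. arr (y * R ^ j + ?x0)) (x' * R + ?l)"
    unfolding e by (rule inv[OF x0 b, symmetric])
  also have "\<dots> = yates R Q g h' (\<lambda>y. \<Sum>z<Q. g ?l z * arr ((y * Q + z) * R ^ j + ?x0)) x'"
    by (simp only: yates.simps dm)
  also have "\<dots> = yates R Q g h' (\<lambda>y. arr' (y * R ^ Suc j + x)) x'"
  proof (rule yates_cong[OF _ x(2)])
    fix y assume y: "y < Q ^ h'"
    let ?f = "y * R ^ Suc j + x"
    have f: "?f < Q ^ h' * R ^ Suc j" using mult_add_less[OF y x(1)] .
    have m: "?f mod R ^ Suc j = x" "?f div R ^ Suc j = y" using mult_add_div_mod[OF x(1)] by auto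
    have "?f = y * R * R ^ j + x" by simp
    then have m2: "?f mod R ^ j = ?x0" by (metis mod_mult_self3)
    show "(\<Sum>z<Q. g ?l z * arr ((y * Q + z) * R ^ j + ?x0)) = arr' ?f"
      unfolding arr[OF f] m m2 ..
  qed
  finally show ?thesis ..
qed

text \<open>d is the format of the matrices and r the number of products; \<open>\<alpha>\<close>
  and \<open>\<beta>\<close> hold the linear forms, \<open>\<gamma>\<close> the weights. The
  condition \<open>d * d \<le> r\<close> makes r^h a bound for the lengths of all intermediate
  vectors.\<close>

locale bilinear_algorithm =
  fixes d r :: nat and \<alpha> \<beta> \<gamma> :: "nat \<Rightarrow> nat \<Rightarrow> int" and D :: int
  assumes d2: "2 \<le> d" and D0: "0 < D" and r_ge: "d * d \<le> r"
    and bilinear: "\<And>A B i j. i < d \<Longrightarrow> j < d \<Longrightarrow>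
      (\<Sum>l<r. \<gamma> (i * d + j) l * ((\<Sum>z<d * d. \<alpha> l z * A (z div d) (z mod d)) * (\<Sum>z<d * d. \<beta> l z * B (z div d) (z mod d)))) =
      D * mat_prod d A B i j"
begin

abbreviation "q \<equiv> d * d"

text \<open>With \<open>ci\<close>, the row and column of position f in the recursive block order:
  each digit of f in base d^2 splits into a row digit and a column digit in base d.\<close>

fun ri :: "nat \<Rightarrow> nat \<Rightarrow> nat" where
  "ri 0 f = 0"
| "ri (Suc h) f = ri h (f div q) * d + f mod q div d"

fun ci :: "nat \<Rightarrow> nat \<Rightarrow> nat" where
  "ci 0 f = 0"
| "ci (Suc h) f = ci h (f div q) * d + f mod q mod d"

lemma q_pos: "0 < q" "4 \<le> q"
  using d2 mult_mono[OF d2 d2] by auto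

lemma digit_less: "z < q \<Longrightarrow> z div d < d" "z mod d < d"
  using d2 by (auto simp: less_mult_imp_div_less)

lemma ri_less: "f < q ^ h \<Longrightarrow> ri h f < d ^ h" "f < q ^ h \<Longrightarrow> ci h f < d ^ h"
proof (induction h arbitrary: f)
  case (Suc h)
  { case 1
    then have "f div q < q ^ h" by (simp add: less_mult_imp_div_less mult.commute)
    then show ?case using Suc.IH(1) mult_add_less[of "ri h (f div q)" "d ^ h" "f mod q div d" d] digit_less q_pos by (simp add: mult.commute)
  next
    case 2
    then have "f div q < q ^ h" by (simp add: less_mult_imp_div_less mult.commute)
    then show ?case using Suc.IH(2) mult_add_less[of "ci h (f div q)" "d ^ h" "f mod q mod d" d] digit_less q_pos by (simp add: mult.commute) }
qed auto

text \<open>A leading digit 0 changes nothing. Hence the coordinates of f follow from those of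
  \<open>f div q\<close> with the same h, which is how the program tabulates them.\<close>

lemma ri_stable: "f < q ^ h \<Longrightarrow> ri (Suc h) f = ri h f" "f < q ^ h \<Longrightarrow> ci (Suc h) f = ci h f"
proof (induction h arbitrary: f)
  case (Suc h)
  { case 1
    then have "f div q < q ^ h" by (simp add: less_mult_imp_div_less mult.commute)
    then show ?case using Suc.IH(1)[of "f div q"] by simp
  next
    case 2
    then have "f div q < q ^ h" by (simp add: less_mult_imp_div_less mult.commute)
    then show ?case using Suc.IH(2)[of "f div q"] by simp }
qed (use d2 in auto)

lemma ri_rec: "f < q ^ h \<Longrightarrow> ri h f = ri h (f div q) * d + f mod q div d" "f < q ^ h \<Longrightarrow> ci h f = ci h (f div q) * d + f mod q mod d"
  using ri_stable[of f h] by auto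

lemma ri_surj: "i < d ^ h \<Longrightarrow> j < d ^ h \<Longrightarrow> \<exists>f<q ^ h. ri h f = i \<and> ci h f = j"
proof (induction h arbitrary: i j)
  case (Suc h)
  have "i div d < d ^ h" "j div d < d ^ h" using Suc.prems by (auto simp: less_mult_imp_div_less mult.commute)
  from Suc.IH[OF this] obtain f where f: "f < q ^ h" "ri h f = i div d" "ci h f = j div d" by blast
  let ?z = "i mod d * d + j mod d"
  have z: "?z < q" using d2 by (intro mult_add_less) auto
  have m: "(f * q + ?z) mod q = ?z" "(f * q + ?z) div q = f" using mult_add_div_mod[OF z] by auto
  have zz: "?z div d = i mod d" "?z mod d = j mod d" using d2 by auto
  have "f * q + ?z < q ^ Suc h" using mult_add_less[OF f(1) z] by (simp add: mult.commute)
  moreover have "ri (Suc h) (f * q + ?z) = i" "ci (Suc h) (f * q + ?z) = j"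
    unfolding ri.simps ci.simps m zz f(2,3) by (simp_all add: div_mult_mod_eq)
  ultimately show ?case by blast
qed simp

lemma sum_split: "(\<Sum>k<a * (b::nat). (f k :: int)) = (\<Sum>k'<a. \<Sum>k<b. f (k' * b + k))"
proof -
  have "(\<Sum>k'<a. \<Sum>k<b. f (k' * b + k)) = (\<Sum>k'<a. sum f {k' * b..<k' * b + b})"
  proof (rule sum.cong[OF refl])
    fix k'
    have "sum f {k' * b..<k' * b + b} = sum f {0 + k' * b..<b + k' * b}" by (simp add: add.commute)
    also have "\<dots> = (\<Sum>k<b. f (k' * b + k))" by (subst sum.shift_bounds_nat_ivl) (simp add: lessThan_atLeast0 add.commute)
    finally show "(\<Sum>k<b. f (k' * b + k)) = sum f {k' * b..<k' * b + b}" ..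
  qed
  also have "\<dots> = sum f {..<a * b}" by (rule sum.nat_group)
  finally show ?thesis ..
qed

text \<open>Splitting off the lowest digit turns each input into r matrices of size d^h, obtained by
  applying the linear forms inside every block of size d. The induction hypothesis multiplies these
  matrices, and for each inner block index k' the bilinear identity recombines the results.\<close>

lemma yates_matmul:
  "f < q ^ h \<Longrightarrow> yates q r \<gamma> h (\<lambda>x. yates r q \<alpha> h (\<lambda>z. A (ri h z) (ci h z)) x * yates r q \<beta> h (\<lambda>z. B (ri h z) (ci h z)) x) f =
    D ^ h * mat_prod (d ^ h) A B (ri h f) (ci h f)"
proof (induction h arbitrary: A B f)
  case 0
  then show ?case by (simp add: mat_prod_def)
next
  case (Suc h)
  let ?f' = "f div q" and ?z = "f mod q"
  let ?i = "ri h ?f'" and ?j = "ci h ?f'" and ?a = "?z div d" and ?b = "?z mod d"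
  have f': "?f' < q ^ h" using Suc.prems by (simp add: less_mult_imp_div_less mult.commute)
  have z: "?a < d" "?b < d" "?z = ?a * d + ?b" using digit_less q_pos by (auto simp: div_mult_mod_eq)
  define Al where "Al l i k = (\<Sum>z<q. \<alpha> l z * A (i * d + z div d) (k * d + z mod d))" for l i k
  define Bl where "Bl l i k = (\<Sum>z<q. \<beta> l z * B (i * d + z div d) (k * d + z mod d))" for l i k
  have ya: "yates r q \<alpha> (Suc h) (\<lambda>z. A (ri (Suc h) z) (ci (Suc h) z)) (y * r + l) = yates r q \<alpha> h (\<lambda>y. Al l (ri h y) (ci h y)) y" if "l < r" for y l
  proof -
    have "(\<Sum>z<q. \<alpha> l z * A (ri (Suc h) (y * q + z)) (ci (Suc h) (y * q + z))) = Al l (ri h y) (ci h y)" for y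
      unfolding Al_def by (rule sum.cong[OF refl]) (simp only: ri.simps ci.simps mult_add_div_mod lessThan_iff)
    then show ?thesis by (simp only: yates.simps mult_add_div_mod[OF that])
  qed
  have yb: "yates r q \<beta> (Suc h) (\<lambda>z. B (ri (Suc h) z) (ci (Suc h) z)) (y * r + l) = yates r q \<beta> h (\<lambda>y. Bl l (ri h y) (ci h y)) y" if "l < r" for y l
  proof -
    have "(\<Sum>z<q. \<beta> l z * B (ri (Suc h) (y * q + z)) (ci (Suc h) (y * q + z))) = Bl l (ri h y) (ci h y)" for y
      unfolding Bl_def by (rule sum.cong[OF refl]) (simp only: ri.simps ci.simps mult_add_div_mod lessThan_iff)
    then show ?thesis by (simp only: yates.simps mult_add_div_mod[OF that])
  qed
  have "yates q r \<gamma> (Suc h) (\<lambda>x. yates r q \<alpha> (Suc h) (\<lambda>z. A (ri (Suc h) z) (ci (Suc h) z)) x * yates r q \<beta> (Suc h) (\<lambda>z. B (ri (Suc h) z) (ci (Suc h) z)) x) f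
    = yates q r \<gamma> h (\<lambda>y. \<Sum>l<r. \<gamma> ?z l * (yates r q \<alpha> h (\<lambda>y. Al l (ri h y) (ci h y)) y * yates r q \<beta> h (\<lambda>y. Bl l (ri h y) (ci h y)) y)) ?f'"
  proof -
    have "(\<Sum>l<r. \<gamma> ?z l * (yates r q \<alpha> (Suc h) (\<lambda>z. A (ri (Suc h) z) (ci (Suc h) z)) (y * r + l) * yates r q \<beta> (Suc h) (\<lambda>z. B (ri (Suc h) z) (ci (Suc h) z)) (y * r + l)))
      = (\<Sum>l<r. \<gamma> ?z l * (yates r q \<alpha> h (\<lambda>y. Al l (ri h y) (ci h y)) y * yates r q \<beta> h (\<lambda>y. Bl l (ri h y) (ci h y)) y))" for y
      by (rule sum.cong[OF refl]) (simp only: ya yb lessThan_iff)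
    then show ?thesis by (subst yates.simps(2)[of q]) (simp only:)
  qed
  also have "\<dots> = (\<Sum>l<r. \<gamma> ?z l * (D ^ h * mat_prod (d ^ h) (Al l) (Bl l) ?i ?j))"
    unfolding yates_sum Suc.IH[OF f'] ..
  also have "\<dots> = (\<Sum>l<r. \<Sum>k'<d ^ h. D ^ h * (\<gamma> ?z l * (Al l ?i k' * Bl l k' ?j)))"
    unfolding mat_prod_def by (simp add: sum_distrib_left mult.left_commute)
  also have "\<dots> = (\<Sum>k'<d ^ h. D ^ h * (\<Sum>l<r. \<gamma> ?z l * (Al l ?i k' * Bl l k' ?j)))"
    by (subst sum.swap) (simp add: sum_distrib_left)
  also have "\<dots> = (\<Sum>k'<d ^ h. D ^ h * (D * (\<Sum>k<d. A (?i * d + ?a) (k' * d + k) * B (k' * d + k) (?j * d + ?b))))"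
  proof (rule sum.cong[OF refl])
    fix k'
    have "(\<Sum>l<r. \<gamma> ?z l * (Al l ?i k' * Bl l k' ?j)) =
      D * mat_prod d (\<lambda>i k. A (?i * d + i) (k' * d + k)) (\<lambda>k j. B (k' * d + k) (?j * d + j)) ?a ?b"
      using bilinear[OF z(1,2), of "\<lambda>i k. A (?i * d + i) (k' * d + k)" "\<lambda>k j. B (k' * d + k) (?j * d + j)"]
      unfolding z(3)[symmetric] Al_def Bl_def .
    then show "D ^ h * (\<Sum>l<r. \<gamma> ?z l * (Al l ?i k' * Bl l k' ?j)) = D ^ h * (D * (\<Sum>k<d. A (?i * d + ?a) (k' * d + k) * B (k' * d + k) (?j * d + ?b)))"
      unfolding mat_prod_def by simp
  qed
  also have "\<dots> = D ^ Suc h * (\<Sum>k'<d ^ h. \<Sum>k<d. A (?i * d + ?a) (k' * d + k) * B (k' * d + k) (?j * d + ?b))"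
    by (simp add: sum_distrib_left mult.assoc mult.left_commute)
  also have "\<dots> = D ^ Suc h * mat_prod (d ^ Suc h) A B (ri (Suc h) f) (ci (Suc h) f)"
    unfolding mat_prod_def ri.simps ci.simps power_Suc2 sum_split ..
  finally show ?case .
qed

end

declare of_nat_power [simp del]

text \<open>With the weights R^j in 41 and R^(j + 1) in 49, the position in 43 is split into the
  unprocessed part 46, the new digit 47 and the finished digits 48.\<close>

definition transform_cell :: "nat \<Rightarrow> nat \<Rightarrow> nat \<Rightarrow> com" where
  "transform_cell Q tab buf =
    Seq (Assign 46 (Pdiv (Var 43) (Var 49)))
    (Seq (Assign 47 (Pdiv (WMod (Var 43) (Var 49)) (Var 41)))
    (Seq (Assign 48 (WMod (Var 43) (Var 41)))
    (Seq (Assign 44 (WConst 0))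
    (Seq (For 45 (WConst (int Q)) (Assign 44 (Padd (Var 44)
        (Pmul (WLoad tab (Padd (Pmul (Var 47) (WConst (int Q))) (Var 45)))
          (WLoad buf (Padd (Pmul (Padd (Pmul (Var 46) (WConst (int Q))) (Var 45)) (Var 41)) (Var 48)))))))
    (WStore 32 (Var 43) (Var 44))))))"

text \<open>The new vector is built in array 32 and copied back, because a level still needs cells
  that it would overwrite. The length in 42 has a factor Q left, so dividing it by Q is
  exact.\<close>

definition transform_level :: "nat \<Rightarrow> nat \<Rightarrow> nat \<Rightarrow> nat \<Rightarrow> com" where
  "transform_level R Q tab buf =
    Seq (Assign 42 (Pmul (Pdiv (Var 42) (WConst (int Q))) (WConst (int R))))
    (Seq (Assign 49 (Pmul (Var 41) (WConst (int R))))
    (Seq (For 43 (Var 42) (transform_cell Q tab buf))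
    (Seq (For 43 (Var 42) (WStore buf (Var 43) (WLoad 32 (Var 43)))) (Assign 41 (Var 49)))))"

definition transform :: "nat \<Rightarrow> nat \<Rightarrow> nat \<Rightarrow> nat \<Rightarrow> nat \<Rightarrow> com" where
  "transform R Q tab buf sv =
    Seq (Assign 41 (WConst 1)) (Seq (Assign 42 (Var sv)) (For 40 (Var 21) (transform_level R Q tab buf)))"

lemma mods_transform [simp]:
  "wmods (transform_cell Q tab buf) = {32,44,45,46,47,48}" "nmods (transform_cell Q tab buf) = {}"
  "wmods (transform_level R Q tab buf) = {32,41,42,43,44,45,46,47,48,49,buf}" "nmods (transform_level R Q tab buf) = {}"
  "wmods (transform R Q tab buf sv) = {32,40,41,42,43,44,45,46,47,48,49,buf}" "nmods (transform R Q tab buf sv) = {}"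
  by (auto simp: transform_cell_def transform_level_def transform_def)

text \<open>The coefficient tables are constants of the program and are written cell by cell; their
  size depends on the fixed bilinear algorithm and not on n.\<close>

fun store_list :: "nat \<Rightarrow> nat \<Rightarrow> int list \<Rightarrow> com" where
  "store_list a i [] = Skip"
| "store_list a i (x # xs) = Seq (WStore a (WConst (int i)) (WConst x)) (store_list a (Suc i) xs)"

lemma mods_store_list: "wmods (store_list a i xs) \<subseteq> {a}" "nmods (store_list a i xs) = {}"
  by (induction xs arbitrary: i) auto

context bounded_machine begin

lemma word_int: "\<bar>v\<bar> \<le> int Y \<Longrightarrow> word m v = Some v"
proof -
  assume "\<bar>v\<bar> \<le> int Y"
  then have "real_of_int \<bar>v\<bar> \<le> real Y" by (metis of_int_le_iff of_int_of_nat_eq)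
  then show ?thesis using wmax_Y[of Y] by (simp add: word_def)
qed

lemma store_list_wp:
  assumes "\<And>x. x \<in> set xs \<Longrightarrow> \<bar>x\<bar> \<le> int Y" "i + length xs \<le> Y"
  shows "wp m (store_list a i xs) (\<lambda>t s'. t \<le> 3 * length xs + 1 \<and> (\<forall>j<length xs. wmem s' a (int (i + j)) = xs ! j) \<and>
     (\<forall>y. y < int i \<longrightarrow> wmem s' a y = wmem s a y)) s"
  using assms
proof (induction xs arbitrary: i s)
  case (Cons x xs)
  have w: "word m x = Some x" "i \<le> Y" using Cons.prems by (auto intro: word_int)
  have IH: "wp m (store_list a (Suc i) xs) (\<lambda>t s'. t \<le> 3 * length xs + 1 \<and> (\<forall>j<length xs. wmem s' a (int (Suc i + j)) = xs ! j) \<and>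
     (\<forall>y. y < int (Suc i) \<longrightarrow> wmem s' a y = wmem (wupd a (int i) x s) a y)) (wupd a (int i) x s)"
    by (rule Cons.IH) (use Cons.prems in auto)
  have fin: "(\<forall>j<length (x # xs). wmem s' a (int (i + j)) = (x # xs) ! j)"
    if h: "\<forall>j<length xs. wmem s' a (int (Suc i + j)) = xs ! j" "\<forall>y. y < int (Suc i) \<longrightarrow> wmem s' a y = wmem (wupd a (int i) x s) a y" for s' :: state
  proof (intro allI impI)
    fix j assume "j < length (x # xs)"
    then show "wmem s' a (int (i + j)) = (x # xs) ! j" using h(1) h(2)[rule_format, of "int i"] by (cases j) (auto simp: of_nat_Suc)
  qed
  have fin2: "\<forall>y. y < int i \<longrightarrow> wmem s' a y = wmem s a y"
    if h: "\<forall>y. y < int (Suc i) \<longrightarrow> wmem s' a y = wmem (wupd a (int i) x s) a y" for s' :: state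
    using h by (auto simp: of_nat_Suc)
  have "wp m (store_list a (Suc i) xs) (\<lambda>t s'. 3 + t \<le> 3 * length (x # xs) + 1 \<and> (\<forall>j<length (x # xs). wmem s' a (int (i + j)) = (x # xs) ! j) \<and>
     (\<forall>y. y < int i \<longrightarrow> wmem s' a y = wmem s a y)) (wupd a (int i) x s)"
  proof (rule wp_mono[OF IH], elim conjE)
    fix t :: nat and s' :: state
    assume h: "t \<le> 3 * length xs + 1" "\<forall>j<length xs. wmem s' a (int (Suc i + j)) = xs ! j"
      "\<forall>y. y < int (Suc i) \<longrightarrow> wmem s' a y = wmem (wupd a (int i) x s) a y"
    have "3 + t \<le> 3 * length (x # xs) + 1" using h(1) by simp
    then show "3 + t \<le> 3 * length (x # xs) + 1 \<and> (\<forall>j<length (x # xs). wmem s' a (int (i + j)) = (x # xs) ! j) \<and>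
     (\<forall>y. y < int i \<longrightarrow> wmem s' a y = wmem s a y)" using fin[OF h(2,3)] fin2[OF h(3)] by (intro conjI)
  qed
  then show ?case using w by (simp add: sz numeral_3_eq_3)
qed simp

lemma transform_cell_wp:
  assumes tab: "tab \<in> {10,11,12}" and buf: "buf \<in> {30,31}"
    and sc: "wmem s 43 0 = int f" "wmem s 41 0 = int Rs" "wmem s 49 0 = int (Rs * R)"
    and Yb: "f \<le> Y" "Rs \<le> Y" "Rs * R \<le> Y" "Q \<le> Y" "0 < Rs * R"
    and g: "\<And>l z. l < R \<Longrightarrow> z < Q \<Longrightarrow> wmem s tab (int (l * Q + z)) = g l z"
    and bd: "\<And>z. z < Q \<Longrightarrow> \<bar>g (f mod (Rs * R) div Rs) z * wmem s buf (int ((f div (Rs * R) * Q + z) * Rs + f mod Rs))\<bar> \<le> int b" "Q * b \<le> Y"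
  shows "wp m (transform_cell Q tab buf) (\<lambda>t s'. t \<le> 60 * Q + 100 \<and> wmem s' 43 0 = int f \<and>
     wmem s' 32 = (wmem s 32)(int f := (\<Sum>z<Q. g (f mod (Rs * R) div Rs) z * wmem s buf (int ((f div (Rs * R) * Q + z) * Rs + f mod Rs))))) s"
proof -
  define y l x where "y = f div (Rs * R)" and "l = f mod (Rs * R) div Rs" and "x = f mod Rs"
  have l: "l < R"
  proof -
    have "f mod (Rs * R) < R * Rs" using Yb(5) by (simp add: mult.commute)
    then show ?thesis unfolding l_def by (simp add: less_mult_imp_div_less)
  qed
  have "f mod (Rs * R) \<le> f" by simp
  then have le: "y \<le> Y" "l \<le> Y" "x \<le> Y" "f mod (Rs * R) \<le> Y" unfolding y_def l_def x_def using Yb(1)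
    by (meson div_le_dividend mod_less_eq_dividend le_trans)+
  have ne: "tab \<noteq> 44" "tab \<noteq> 45" "tab \<noteq> 46" "tab \<noteq> 47" "tab \<noteq> 48" "tab \<noteq> 32" "buf \<noteq> 44" "buf \<noteq> 45" "buf \<noteq> 46" "buf \<noteq> 47" "buf \<noteq> 48" "buf \<noteq> 32"
    using tab buf by auto
  let ?s = "wupd 44 0 0 (wupd 48 0 (int x) (wupd 47 0 (int l) (wupd 46 0 (int y) s)))"
  let ?v = "\<lambda>z. g l z * wmem s buf (int ((y * Q + z) * Rs + x))"
  have bd': "\<bar>?v z\<bar> \<le> int b" if "z < Q" for z using bd(1)[OF that] unfolding y_def l_def x_def .
  have bs: "\<bar>\<Sum>z<k. ?v z\<bar> \<le> int Y" if "k \<le> Q" for k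
  proof -
    have "\<bar>\<Sum>z<k. ?v z\<bar> \<le> (\<Sum>z<k. \<bar>?v z\<bar>)" by (rule sum_abs)
    also have "\<dots> \<le> (\<Sum>z<k. int b)" using bd' that by (intro sum_mono) auto
    also have "\<dots> = int (k * b)" by (simp add: of_nat_mult)
    also have "\<dots> \<le> int (Q * b)" using that by (simp only: of_nat_le_iff) (rule mult_right_mono, auto)
    finally show ?thesis using bd(2) by simp
  qed
  have inner: "wp m (For 45 (WConst (int Q)) (Assign 44 (Padd (Var 44)
        (Pmul (WLoad tab (Padd (Pmul (Var 47) (WConst (int Q))) (Var 45)))
          (WLoad buf (Padd (Pmul (Padd (Pmul (Var 46) (WConst (int Q))) (Var 45)) (Var 41)) (Var 48)))))))
     (\<lambda>t s'. t \<le> 60 * Q + 30 \<and> wmem s' 44 0 = (\<Sum>z<Q. ?v z) \<and> wmem s' 43 0 = int f \<and> wmem s' 32 = wmem s 32) ?s"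
  proof (rule wp_For[where N = Q and c = 30 and I = "\<lambda>k s'. wmem s' 44 0 = (\<Sum>z<k. ?v z)"], goal_cases)
    case (1 k s')
    then show ?case using Yb by (simp add: sz)
  next
    case 2
    then show ?case using Yb(4) by (rule wmax_Y)
  next
    case 3
    then show ?case by simp
  next
    case (4 k s')
    have fr: "wmem s' 46 0 = int y" "wmem s' 47 0 = int l" "wmem s' 48 0 = int x" "wmem s' 41 0 = int Rs" "wmem s' tab = wmem s tab" "wmem s' buf = wmem s buf"
      using 4(4) sc ne by auto
    have kY: "k \<le> Y" using 4(1) Yb by simp
    have w1: "word m (?v k) = Some (?v k)"
    proof (rule word_int)
      have "1 * b \<le> Q * b" using 4(1) by (intro mult_right_mono) auto
      then have "b \<le> Y" using bd(2) by linarith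
      then have "int b \<le> int Y" by simp
      then show "\<bar>?v k\<bar> \<le> int Y" using bd'[OF 4(1)] by linarith
    qed
    have w2: "word m ((\<Sum>z<k. ?v z) + ?v k) = Some ((\<Sum>z<k. ?v z) + ?v k)"
      by (rule word_int) (use bs[of "Suc k"] 4(1) in \<open>simp add: add.commute\<close>)
    show ?case using 4(2,3) fr kY le Yb g[OF l 4(1)] w1 w2 by (simp add: sz nf)
  next
    case (5 t s')
    then show ?case using sc by (simp)
  qed
  have store: "wp m (WStore 32 (Var 43) (Var 44)) (\<lambda>t' s''. t + t' \<le> 60 * Q + 40 \<and> wmem s'' 43 0 = int f \<and> wmem s'' 32 = (wmem s 32)(int f := (\<Sum>z<Q. ?v z))) s'"
    if "t \<le> 60 * Q + 30" "wmem s' 44 0 = (\<Sum>z<Q. ?v z)" "wmem s' 43 0 = int f" "wmem s' 32 = wmem s 32" for t s'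
    using that by (simp add: sz)
  show ?thesis unfolding transform_cell_def y_def[symmetric] l_def[symmetric] x_def[symmetric]
    apply (rule wp_Assign) using sc Yb le(1) apply (simp add: sz nf y_def[symmetric])
    apply (rule wp_Assign) using sc Yb le(2,4) apply (simp add: sz nf l_def[symmetric])
    apply (rule wp_Assign) using sc Yb le(3) apply (simp add: sz nf x_def[symmetric])
    apply (rule wp_Assign) apply (simp add: sz)
    apply (subst wp_Seq)
    apply (rule wp_mono[OF inner])
    apply (elim conjE)
    apply (rule wp_mono[OF store], assumption+)
    by auto
qed

text \<open>G bounds the coefficients and M the entries, so one level multiplies the bound on the
  entries by Q G. The terms and partial sums inside a cell obey the same bound.\<close>

lemma transform_level_wp:
  assumes tab: "tab \<in> {10,11,12}" and buf: "buf \<in> {30,31}"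
    and sc: "wmem s 41 0 = int (R ^ j)" "wmem s 42 0 = int (Q ^ Suc h' * R ^ j)"
    and RQ: "0 < R" "0 < Q" and Yb: "Q ^ Suc h' * R ^ j \<le> Y" "Q ^ h' * R ^ Suc j \<le> Y" "R ^ Suc j \<le> Y" "Q \<le> Y" "R \<le> Y" and TT: "Q ^ h' * R ^ Suc j \<le> TT"
    and g: "\<And>l z. l < R \<Longrightarrow> z < Q \<Longrightarrow> wmem s tab (int (l * Q + z)) = g l z \<and> \<bar>g l z\<bar> \<le> int G"
    and arr: "\<And>f. f < Q ^ Suc h' * R ^ j \<Longrightarrow> \<bar>wmem s buf (int f)\<bar> \<le> int M" and M: "Q * (G * M) \<le> Y"
  shows "wp m (transform_level R Q tab buf) (\<lambda>t s'. t \<le> TT * (60 * Q + 250) + 100 \<and> wmem s' 41 0 = int (R ^ Suc j) \<and> wmem s' 42 0 = int (Q ^ h' * R ^ Suc j) \<and>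
     (\<forall>f<Q ^ h' * R ^ Suc j. wmem s' buf (int f) = (\<Sum>z<Q. g (f mod R ^ Suc j div R ^ j) z * wmem s buf (int ((f div R ^ Suc j * Q + z) * R ^ j + f mod R ^ j))) \<and>
        \<bar>wmem s' buf (int f)\<bar> \<le> int (Q * G * M))) s"
proof -
  let ?n = "Q ^ h' * R ^ Suc j"
  let ?s = "wupd 49 0 (int (R ^ Suc j)) (wupd 42 0 (int ?n) s)"
  let ?V = "\<lambda>f. \<Sum>z<Q. g (f mod R ^ Suc j div R ^ j) z * wmem s buf (int ((f div R ^ Suc j * Q + z) * R ^ j + f mod R ^ j))"
  have ne: "buf \<noteq> n'" "tab \<noteq> n'" if "n' \<in> {32,41,42,43,44,45,46,47,48,49}" for n' using tab buf that by auto
  have Rj: "0 < R ^ j" "R ^ j \<le> R ^ Suc j" using RQ by auto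
  have RR: "R ^ j * R = R ^ Suc j" by simp
  have tm: "\<bar>g (f mod R ^ Suc j div R ^ j) z * wmem s buf (int ((f div R ^ Suc j * Q + z) * R ^ j + f mod R ^ j))\<bar> \<le> int (G * M)"
    if f: "f < ?n" and z: "z < Q" for f z
  proof -
    have l: "f mod R ^ Suc j div R ^ j < R" using RQ by (simp add: less_mult_imp_div_less)
    have y: "f div R ^ Suc j < Q ^ h'" using f by (simp add: less_mult_imp_div_less)
    have yz: "f div R ^ Suc j * Q + z < Q ^ h' * Q" using mult_add_less[OF y z] .
    have "(f div R ^ Suc j * Q + z) * R ^ j + f mod R ^ j < Q ^ h' * Q * R ^ j" using Rj by (intro mult_add_less[OF yz]) auto
    then have "\<bar>wmem s buf (int ((f div R ^ Suc j * Q + z) * R ^ j + f mod R ^ j))\<bar> \<le> int M" by (intro arr) (simp add: mult.commute)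
    moreover have "\<bar>g (f mod R ^ Suc j div R ^ j) z\<bar> \<le> int G" using g[OF l z] by blast
    ultimately show ?thesis unfolding abs_mult of_nat_mult by (intro mult_mono) auto
  qed
  have loop1: "wp m (For 43 (Var 42) (transform_cell Q tab buf)) (\<lambda>t s'. t \<le> TT * (60 * Q + 130) + 22 \<and> (\<forall>f<?n. wmem s' 32 (int f) = ?V f)) ?s"
  proof (rule wp_For[where N = ?n and c = "60 * Q + 100" and I = "\<lambda>k s'. \<forall>f<k. wmem s' 32 (int f) = ?V f"], goal_cases)
    case (1 k s')
    then show ?case by (simp add: sz)
  next
    case 2
    show ?case by (rule wmax_Y[OF Yb(2)])
  next
    case 3
    then show ?case by simp
  next
    case (4 k s')
    have fr: "wmem s' 41 0 = int (R ^ j)" "wmem s' 49 0 = int (R ^ j * R)" "wmem s' tab = wmem s tab" "wmem s' buf = wmem s buf"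
      using 4(4) sc ne by (auto simp: mult.commute)
    have kY: "k \<le> Y" using 4(1) Yb(2) by linarith
    have c: "wp m (transform_cell Q tab buf) (\<lambda>t s''. t \<le> 60 * Q + 100 \<and> wmem s'' 43 0 = int k \<and> wmem s'' 32 = (wmem s' 32)(int k := ?V k)) s'"
    proof (rule transform_cell_wp[OF tab buf 4(3) fr(1,2), where g = g and b = "G * M", unfolded RR fr(4)])
      show "R ^ j \<le> Y" using Rj Yb by linarith
      show "wmem s' tab (int (l * Q + z)) = g l z" if "l < R" "z < Q" for l z using g[OF that] fr(3) by simp
      show "\<bar>g (k mod R ^ Suc j div R ^ j) z * wmem s buf (int ((k div R ^ Suc j * Q + z) * R ^ j + k mod R ^ j))\<bar> \<le> int (G * M)" if "z < Q" for z
        by (rule tm[OF 4(1) that])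
    qed (use kY Yb M RQ in auto)
    show ?case by (rule wp_mono[OF c]) (use 4(2) in \<open>auto simp: less_Suc_eq\<close>)
  next
    case (5 t s')
    have "t \<le> ?n * (60 * Q + 122) + 22" using 5(3) by (simp add: ac_simps)
    also have "\<dots> \<le> TT * (60 * Q + 130) + 22" using TT by (intro add_right_mono mult_mono) auto
    finally show ?case using 5(1) by blast
  qed
  have loop2: "wp m (For 43 (Var 42) (WStore buf (Var 43) (WLoad 32 (Var 43)))) (\<lambda>t s''. t \<le> TT * 40 + 22 \<and> (\<forall>f<?n. wmem s'' buf (int f) = ?V f)) s'"
    if s': "wmem s' 42 0 = int ?n" "\<forall>f<?n. wmem s' 32 (int f) = ?V f" for s'
  proof (rule wp_For[where N = ?n and c = 10 and I = "\<lambda>k s''. \<forall>f<k. wmem s'' buf (int f) = ?V f"], goal_cases)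
    case (1 k s'')
    then show ?case using s' ne by (simp add: sz)
  next
    case 2
    show ?case by (rule wmax_Y[OF Yb(2)])
  next
    case 3
    then show ?case by simp
  next
    case (4 k s'')
    have "wmem s'' 32 (int k) = ?V k" using 4(1,4) s' ne by simp
    then show ?case using 4(2,3) ne by (auto simp: sz less_Suc_eq)
  next
    case (5 t s'')
    have "t \<le> ?n * 32 + 22" using 5(3) by (simp add: ac_simps)
    also have "\<dots> \<le> TT * 40 + 22" using TT by (intro add_right_mono mult_mono) auto
    finally show ?case using 5(1) by blast
  qed
  have Vb: "\<bar>?V f\<bar> \<le> int (Q * G * M)" if "f < ?n" for f
  proof -
    have "\<bar>?V f\<bar> \<le> (\<Sum>z<Q. \<bar>g (f mod R ^ Suc j div R ^ j) z * wmem s buf (int ((f div R ^ Suc j * Q + z) * R ^ j + f mod R ^ j))\<bar>)" by (rule sum_abs)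
    also have "\<dots> \<le> (\<Sum>z<Q. int (G * M))" by (intro sum_mono tm[OF that]) auto
    also have "\<dots> = int (Q * G * M)" by (simp add: of_nat_mult)
    finally show ?thesis .
  qed
  have e1: "Q ^ Suc h' * R ^ j div Q * R = ?n" using RQ by (simp add: mult.assoc)
  have e2: "R ^ j * R = R ^ Suc j" by simp
  have main: "wp m (Seq (For 43 (Var 42) (transform_cell Q tab buf))
    (Seq (For 43 (Var 42) (WStore buf (Var 43) (WLoad 32 (Var 43)))) (Assign 41 (Var 49)))) (\<lambda>t s'. t \<le> TT * (60 * Q + 190) + 60 \<and> wmem s' 41 0 = int (R ^ Suc j) \<and> wmem s' 42 0 = int ?n \<and>
     (\<forall>f<?n. wmem s' buf (int f) = ?V f \<and> \<bar>wmem s' buf (int f)\<bar> \<le> int (Q * G * M))) ?s"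
    unfolding wp_Seq[of m "For _ _ _"]
  proof (rule wp_frame[OF loop1], elim conjE)
    fix t1 :: nat and s1 :: state
    assume a1: "t1 \<le> TT * (60 * Q + 130) + 22" "\<forall>f<?n. wmem s1 32 (int f) = ?V f"
      and f1: "\<And>a. a \<notin> wmods (For 43 (Var 42) (transform_cell Q tab buf)) \<Longrightarrow> wmem s1 a = wmem ?s a"
    have s1: "wmem s1 42 0 = int ?n" "wmem s1 49 0 = int (R ^ Suc j)" using f1 by auto
    show "wp m (For 43 (Var 42) (WStore buf (Var 43) (WLoad 32 (Var 43)))) (\<lambda>t s'. wp m (Assign 41 (Var 49)) (\<lambda>t' s''.
       t1 + (t + t') \<le> TT * (60 * Q + 190) + 60 \<and> wmem s'' 41 0 = int (R ^ Suc j) \<and> wmem s'' 42 0 = int ?n \<and>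
     (\<forall>f<?n. wmem s'' buf (int f) = ?V f \<and> \<bar>wmem s'' buf (int f)\<bar> \<le> int (Q * G * M))) s') s1"
    proof (rule wp_frame[OF loop2[OF s1(1) a1(2)]], elim conjE)
      fix t2 :: nat and s2 :: state
      assume a2: "t2 \<le> TT * 40 + 22" "\<forall>f<?n. wmem s2 buf (int f) = ?V f"
        and f2: "\<And>a. a \<notin> wmods (For 43 (Var 42) (WStore buf (Var 43) (WLoad 32 (Var 43)))) \<Longrightarrow> wmem s2 a = wmem s1 a"
      have s2: "wmem s2 42 0 = int ?n" "wmem s2 49 0 = int (R ^ Suc j)" using f2[of 42] f2[of 49] s1 ne by auto
      have "t1 + (t2 + 4) \<le> TT * (60 * Q + 190) + 60" using a1(1) a2(1) by (simp add: algebra_simps)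
      moreover have "\<forall>f<?n. wmem s2 buf (int f) = ?V f \<and> \<bar>wmem s2 buf (int f)\<bar> \<le> int (Q * G * M)" using a2(2) Vb by simp
      ultimately show "wp m (Assign 41 (Var 49)) (\<lambda>t' s''.
       t1 + (t2 + t') \<le> TT * (60 * Q + 190) + 60 \<and> wmem s'' 41 0 = int (R ^ Suc j) \<and> wmem s'' 42 0 = int ?n \<and>
     (\<forall>f<?n. wmem s'' buf (int f) = ?V f \<and> \<bar>wmem s'' buf (int f)\<bar> \<le> int (Q * G * M))) s2"
        using s2 ne[of 41] Vb by (simp add: sz)
    qed
  qed
  have d: "Q ^ Suc h' * R ^ j div Q \<le> Y" using Yb(1) by (meson div_le_dividend le_trans)
  show ?thesis unfolding transform_level_def
    apply (rule wp_Assign) using sc Yb d apply (simp add: sz nf del: power_Suc) apply (unfold e1)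
    apply (rule wp_Assign) using sc Yb Rj(2) apply (simp add: sz nf e2 del: power_Suc)
    apply (rule wp_mono[OF main])
    using sc by (auto simp: algebra_simps)
qed

end

section \<open>Fast matrix multiplication on the machine\<close>

context bounded_machine begin

text \<open>One number TT bounds the lengths Q^(h - j) R^j of all levels, hence the cost of order h
  TT for fixed Q. The entries grow to at most (Q G)^h M, which has to fit into a word.\<close>

lemma transform_wp:
  assumes tab: "tab \<in> {10,11,12}" and buf: "buf \<in> {30,31}" and sv: "sv \<in> {22,23}"
    and sc: "wmem s sv 0 = int (Q ^ h)" "wmem s 21 0 = int h"
    and RQ: "0 < R" "0 < Q" and TT: "\<And>j. j \<le> h \<Longrightarrow> Q ^ (h - j) * R ^ j \<le> TT" and Yb: "TT \<le> Y" "Q \<le> Y" "R \<le> Y" "h \<le> Y"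
    and g: "\<And>l z. l < R \<Longrightarrow> z < Q \<Longrightarrow> wmem s tab (int (l * Q + z)) = g l z \<and> \<bar>g l z\<bar> \<le> int G" and G: "1 \<le> G"
    and arr: "\<And>f. f < Q ^ h \<Longrightarrow> wmem s buf (int f) = c f \<and> \<bar>c f\<bar> \<le> int M" and M: "(Q * G) ^ h * M \<le> Y"
  shows "wp m (transform R Q tab buf sv) (\<lambda>t s'. t \<le> h * (TT * (60 * Q + 250) + 150) + 100 \<and>
     (\<forall>x<R ^ h. wmem s' buf (int x) = yates R Q g h c x \<and> \<bar>yates R Q g h c x\<bar> \<le> int ((Q * G) ^ h * M))) s"
proof -
  let ?s = "wupd 42 0 (int (Q ^ h)) (wupd 41 0 1 s)"
  let ?b = "TT * (60 * Q + 250) + 100"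
  let ?I = "\<lambda>j s'. wmem s' 41 0 = int (R ^ j) \<and> wmem s' 42 0 = int (Q ^ (h - j) * R ^ j) \<and>
      (\<forall>f<Q ^ (h - j) * R ^ j. \<bar>wmem s' buf (int f)\<bar> \<le> int ((Q * G) ^ j * M)) \<and>
      (\<forall>x<R ^ j. \<forall>x'<R ^ (h - j). yates R Q g (h - j) (\<lambda>y. wmem s' buf (int (y * R ^ j + x))) x' = yates R Q g h c (x' * R ^ j + x))"
  have ne: "buf \<noteq> n'" "tab \<noteq> n'" "sv \<noteq> n'" if "n' \<in> {21,32,40,41,42,43,44,45,46,47,48,49}" for n' using tab buf sv that by auto
  have tb: "tab \<noteq> buf" using tab buf by auto
  have loop: "wp m (For 40 (Var 21) (transform_level R Q tab buf)) (\<lambda>t s'. t \<le> h * (?b + 22) + 22 \<and>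
     (\<forall>x<R ^ h. wmem s' buf (int x) = yates R Q g h c x \<and> \<bar>yates R Q g h c x\<bar> \<le> int ((Q * G) ^ h * M))) ?s"
  proof (rule wp_For[where N = h and c = ?b and I = ?I], goal_cases)
    case (1 k s')
    have "wmem s' 21 0 = int h" using 1(4)[of 21] ne sc(2) by simp
    then show ?case by (simp add: sz)
  next
    case 2
    show ?case by (rule wmax_Y[OF Yb(4)])
  next
    case 3
    have "yates R Q g h (\<lambda>y. wmem s buf (int y)) x' = yates R Q g h c x'" if "x' < R ^ h" for x'
      using arr that by (intro yates_cong) auto
    then show ?case using arr ne by simp
  next
    case (4 j s')
    obtain h' where h': "h - j = Suc h'" "h - Suc j = h'" using 4(1) by (metis Suc_diff_Suc)
    have I: "wmem s' 41 0 = int (R ^ j)" "wmem s' 42 0 = int (Q ^ Suc h' * R ^ j)"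
      "\<And>f. f < Q ^ Suc h' * R ^ j \<Longrightarrow> \<bar>wmem s' buf (int f)\<bar> \<le> int ((Q * G) ^ j * M)"
      "\<And>x x'. x < R ^ j \<Longrightarrow> x' < R ^ Suc h' \<Longrightarrow> yates R Q g (Suc h') (\<lambda>y. wmem s' buf (int (y * R ^ j + x))) x' = yates R Q g h c (x' * R ^ j + x)"
      using 4(2) unfolding h' by blast+
    have fr: "wmem s' tab = wmem s tab" using 4(4)[of tab] ne[of 40] ne tb by simp
    have T1: "Q ^ Suc h' * R ^ j \<le> TT" using TT[of j] 4(1) unfolding h' by simp
    have T2: "Q ^ h' * R ^ Suc j \<le> TT" using TT[of "Suc j"] 4(1) unfolding h' by simp
    have "1 * R ^ Suc j \<le> Q ^ h' * R ^ Suc j" using RQ by (intro mult_right_mono) auto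
    then have T3: "R ^ Suc j \<le> Y" using T2 Yb(1) by linarith
    have e: "Q * (G * ((Q * G) ^ j * M)) = (Q * G) ^ Suc j * M" "Q * G * ((Q * G) ^ j * M) = (Q * G) ^ Suc j * M" by simp_all
    have "(Q * G) ^ Suc j * M \<le> (Q * G) ^ h * M" using 4(1) RQ G by (intro mult_right_mono power_increasing) auto
    then have Ml: "Q * (G * ((Q * G) ^ j * M)) \<le> Y" unfolding e using M by linarith
    have lv: "wp m (transform_level R Q tab buf) (\<lambda>t s''. t \<le> ?b \<and> wmem s'' 41 0 = int (R ^ Suc j) \<and> wmem s'' 42 0 = int (Q ^ h' * R ^ Suc j) \<and>
     (\<forall>f<Q ^ h' * R ^ Suc j. wmem s'' buf (int f) = (\<Sum>z<Q. g (f mod R ^ Suc j div R ^ j) z * wmem s' buf (int ((f div R ^ Suc j * Q + z) * R ^ j + f mod R ^ j))) \<and>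
        \<bar>wmem s'' buf (int f)\<bar> \<le> int (Q * G * ((Q * G) ^ j * M)))) s'"
    proof (rule transform_level_wp[OF tab buf I(1,2) RQ _ _ T3 Yb(2,3) T2 _ I(3) Ml])
      show "Q ^ Suc h' * R ^ j \<le> Y" "Q ^ h' * R ^ Suc j \<le> Y" using T1 T2 Yb(1) by linarith+
      show "wmem s' tab (int (l * Q + z)) = g l z \<and> \<bar>g l z\<bar> \<le> int G" if "l < R" "z < Q" for l z unfolding fr by (rule g[OF that])
    qed
    show ?case
    proof (rule wp_frame[OF lv], elim conjE)
      fix t :: nat and s'' :: state
      assume a: "t \<le> ?b" "wmem s'' 41 0 = int (R ^ Suc j)" "wmem s'' 42 0 = int (Q ^ h' * R ^ Suc j)"
        "\<forall>f<Q ^ h' * R ^ Suc j. wmem s'' buf (int f) = (\<Sum>z<Q. g (f mod R ^ Suc j div R ^ j) z * wmem s' buf (int ((f div R ^ Suc j * Q + z) * R ^ j + f mod R ^ j))) \<and>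
        \<bar>wmem s'' buf (int f)\<bar> \<le> int (Q * G * ((Q * G) ^ j * M))"
        and fw: "\<And>a. a \<notin> wmods (transform_level R Q tab buf) \<Longrightarrow> wmem s'' a = wmem s' a"
      have i: "wmem s'' 40 0 = int j" using fw[of 40] ne[of 40] 4(3) by simp
      have ys: "yates R Q g h' (\<lambda>y. wmem s'' buf (int (y * R ^ Suc j + x))) x' = yates R Q g h c (x' * R ^ Suc j + x)" if "x < R ^ Suc j" "x' < R ^ h'" for x x'
        by (rule yates_step[where arr = "\<lambda>f. wmem s' buf (int f)", OF _ I(4) that]) (use a(4) in blast)+
      have "?I (Suc j) s''" unfolding h' using a(2,3,4) ys unfolding e by blast
      then show "t \<le> ?b \<and> wmem s'' 40 0 = int j \<and> ?I (Suc j) (wupd 40 0 (int (Suc j)) s'')" using a(1) i ne[of 40] by simp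
    qed
  next
    case (5 t s')
    have x: "wmem s' buf (int x) = yates R Q g h c x" if "x < R ^ h" for x
      using 5(1) that by (auto dest!: spec[of _ x])
    have b: "\<forall>f<R ^ h. \<bar>wmem s' buf (int f)\<bar> \<le> int ((Q * G) ^ h * M)" using 5(1) unfolding diff_self_eq_0 power_0 mult_1 by blast
    have "\<bar>yates R Q g h c x\<bar> \<le> int ((Q * G) ^ h * M)" if "x < R ^ h" for x using b[rule_format, OF that] unfolding x[OF that] .
    with x show ?case using 5(3) by (simp add: ac_simps)
  qed
  have "h * (?b + 22) \<le> h * (TT * (60 * Q + 250) + 150)" by (intro mult_left_mono) auto
  then have c: "7 + t \<le> h * (TT * (60 * Q + 250) + 150) + 100" if "t \<le> h * (?b + 22) + 22" for t using that by linarith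
  have ev: "weval m (wupd 41 0 1 s) (Var sv) = Some (int (Q ^ h))" using sc(1) ne[of 41] by (simp add: sz)
  show ?thesis unfolding transform_def
    apply (rule wp_Assign) apply (simp add: sz)
    apply (rule wp_Assign, rule ev)
    apply (rule wp_mono[OF loop])
    using c by auto
qed

end

context bilinear_algorithm begin

text \<open>
  Word arrays: 10 to 12 tables of coefficients; 20 to 24 the scalars \<open>d ^ h\<close>, \<open>h\<close>, \<open>r ^ h\<close>, \<open>q ^ h\<close> and \<open>D ^ h\<close>;
  27 and 28 row and column of a position; 30 and 31 the vectors to be transformed, 32 their scratch space.
\<close>

definition tables :: com where
  "tables = Seq (store_list 10 0 (map (\<lambda>k. \<alpha> (k div q) (k mod q)) [0..<r * q]))
    (Seq (store_list 11 0 (map (\<lambda>k. \<beta> (k div q) (k mod q)) [0..<r * q]))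
    (store_list 12 0 (map (\<lambda>k. \<gamma> (k div r) (k mod r)) [0..<q * r])))"

text \<open>The machine has no logarithm or power: h is the first exponent with d^h \<ge> n, and the
  other powers are multiplied up along the way.\<close>

definition sizes :: com where
  "sizes = Seq (Assign 20 (WConst 1)) (Seq (Assign 21 (WConst 0)) (Seq (Assign 22 (WConst 1)) (Seq (Assign 23 (WConst 1)) (Seq (Assign 24 (WConst 1))
    (While (WLess (Var 20) (Var 0))
      (Seq (Assign 20 (Pmul (Var 20) (WConst (int d))))
      (Seq (Assign 21 (Padd (Var 21) (WConst 1)))
      (Seq (Assign 22 (Pmul (Var 22) (WConst (int r))))
      (Seq (Assign 23 (Pmul (Var 23) (WConst (int q))))
      (Assign 24 (Pmul (Var 24) (WConst (int (nat D))))))))))))))"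

abbreviation inside :: bexp where
  "inside \<equiv> Conj (WLess (WLoad 27 (Var 29)) (Var 0)) (WLess (WLoad 28 (Var 29)) (Var 0))"

abbreviation entry :: wexp where
  "entry \<equiv> Padd (Pmul (WLoad 27 (Var 29)) (Var 0)) (WLoad 28 (Var 29))"

text \<open>The coordinates stored for \<open>f div q\<close> are extended by one digit. Cell 0
  reads itself and is therefore preset by \<open>load\<close>. Outside the given matrix the padding
  is 0.\<close>

definition load_cell :: com where
  "load_cell =
    Seq (WStore 27 (Var 29) (Padd (Pmul (WLoad 27 (Pdiv (Var 29) (WConst (int q)))) (WConst (int d))) (Pdiv (WMod (Var 29) (WConst (int q))) (WConst (int d)))))
    (Seq (WStore 28 (Var 29) (Padd (Pmul (WLoad 28 (Pdiv (Var 29) (WConst (int q)))) (WConst (int d))) (WMod (WMod (Var 29) (WConst (int q))) (WConst (int d)))))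
    (Cond inside (Seq (WStore 30 (Var 29) (WLoad 1 entry)) (WStore 31 (Var 29) (WLoad 2 entry)))
      (Seq (WStore 30 (Var 29) (WConst 0)) (WStore 31 (Var 29) (WConst 0)))))"

definition load :: com where
  "load = Seq (Assign 27 (WConst 0)) (Seq (Assign 28 (WConst 0)) (For 29 (Var 23) load_cell))"

definition pointwise :: com where
  "pointwise = For 29 (Var 22) (WStore 30 (Var 29) (Pmul (WLoad 30 (Var 29)) (WLoad 31 (Var 29))))"

text \<open>The last transform yields D^h times the product, so the division is exact; positions in
  the padding are skipped.\<close>

definition emit :: com where
  "emit = For 29 (Var 23) (Cond inside (WStore 3 entry (Pdiv (WLoad 30 (Var 29)) (Var 24))) Skip)"

definition multiply :: com where
  "multiply = Seq tables (Seq sizes (Seq load (Seq (transform r q 10 30 23) (Seq (transform r q 11 31 23)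
    (Seq pointwise (Seq (transform q r 12 30 22) emit))))))"

lemma mods_multiply:
  "wmods tables \<subseteq> {10,11,12}" "wmods sizes = {20,21,22,23,24}" "wmods load = {27,28,29,30,31}"
  "wmods load_cell = {27,28,30,31}" "nmods load_cell = {}" "wmods pointwise = {29,30}" "wmods emit = {3,29}"
  using mods_store_list unfolding tables_def by (force, auto simp: sizes_def load_def load_cell_def pointwise_def emit_def)

lemma ri_0: "ri h 0 = 0" "ci h 0 = 0"
  by (induction h) auto

end

definition padded :: "nat \<Rightarrow> (nat \<Rightarrow> nat \<Rightarrow> int) \<Rightarrow> nat \<Rightarrow> nat \<Rightarrow> int" where
  "padded n A i j = (if i < n \<and> j < n then A i j else 0)"

lemma mat_prod_padded: "n \<le> N \<Longrightarrow> i < n \<Longrightarrow> j < n \<Longrightarrow> mat_prod N (padded n A) (padded n B) i j = mat_prod n A B i j"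
  unfolding mat_prod_def padded_def by (rule sum.mono_neutral_cong_right) auto

text \<open>Z exceeds every constant that is raised to the power h. The loop for h makes about log n
  rounds, so Z^h is polynomial in n; the condition on Z^k asks for this in every round that can
  occur.\<close>

locale bilinear_machine = bilinear_algorithm + bounded_machine +
  fixes G Z n :: nat
  assumes G: "1 \<le> G" "\<And>l z. l < r \<Longrightarrow> z < q \<Longrightarrow> \<bar>\<alpha> l z\<bar> \<le> int G \<and> \<bar>\<beta> l z\<bar> \<le> int G \<and> \<bar>\<gamma> z l\<bar> \<le> int G"
    and Z: "r * q * q * G ^ 3 * nat D \<le> Z" "Z \<le> Y" "\<And>k. k = 0 \<or> d ^ (k - 1) < n \<Longrightarrow> Z ^ k \<le> Y" and n: "1 \<le> n" "n \<le> Y"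
begin

lemma small: "2 \<le> d" "d \<le> q" "q \<le> r" "1 \<le> q" "1 \<le> nat D" "r * q \<le> Z" "r \<le> Z" "q \<le> Z" "d \<le> Z" "G \<le> Z" "nat D \<le> Z" "q * G \<le> Z" "q * G * (q * G) \<le> Z" "r * G * (q * G * (q * G)) \<le> Z"
proof -
  have p: "a \<le> Z" if "a * b \<le> Z" "1 \<le> b" for a b using mult_le_mono2[OF that(2), of a] that(1) by linarith
  have p': "b \<le> Z" if "a * b \<le> Z" "1 \<le> a" for a b using mult_le_mono1[OF that(2), of b] that(1) by linarith
  show b: "2 \<le> d" "d \<le> q" "q \<le> r" "1 \<le> q" "1 \<le> nat D" using d2 r_ge D0 q_pos by auto
  have r1: "1 \<le> r" "1 \<le> d" using b by linarith+
  have Z1: "(r * G * (q * G * (q * G))) * nat D \<le> Z" using Z(1) by (simp add: power3_eq_cube ac_simps)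
  show z1: "r * G * (q * G * (q * G)) \<le> Z" by (rule p[OF Z1 b(5)])
  show "nat D \<le> Z" using p'[OF Z1] r1 G(1) b(4) by simp
  show z2: "q * G * (q * G) \<le> Z" using p'[OF z1] r1 G(1) by simp
  show z3: "q * G \<le> Z" using p[OF z2] b(4) G(1) by simp
  show z4: "G \<le> Z" using p'[OF z3 b(4)] .
  show "q \<le> Z" using p[OF z3 G(1)] .
  then show "d \<le> Z" using b by linarith
  have "(r * q) * (G * (q * G * G)) \<le> Z" using z1 by (simp add: ac_simps)
  then show z5: "r * q \<le> Z" using p[of "r * q" "G * (q * G * G)"] b(4) G(1) by simp
  show "r \<le> Z" using p[OF z5 b(4)] .
qed

lemma tables_wp:
  "wp m tables (\<lambda>t s'. t \<le> 9 * (r * q) + 3 \<and> (\<forall>l<r. \<forall>z<q. wmem s' 10 (int (l * q + z)) = \<alpha> l z \<and> wmem s' 11 (int (l * q + z)) = \<beta> l z \<and>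
     wmem s' 12 (int (z * r + l)) = \<gamma> z l)) s"
proof -
  have GY: "int G \<le> int Y" using small(10) Z(2) by simp
  have L: "r * q \<le> Y" "q * r \<le> Y" using small(6) Z(2) by (auto simp: mult.commute[of q])
  have r0: "0 < r" using small by linarith
  have dm: "k div q < r" "k mod q < q" if "k < r * q" for k using that small by (auto simp: less_mult_imp_div_less)
  have dm': "k div r < q" "k mod r < r" if "k < q * r" for k using that r0 by (simp_all add: less_mult_imp_div_less)
  have b1: "\<bar>x\<bar> \<le> int Y" if x: "x \<in> set (map (\<lambda>k. \<alpha> (k div q) (k mod q)) [0..<r * q])" for x
  proof -
    obtain k where k: "k < r * q" "x = \<alpha> (k div q) (k mod q)" using x by auto
    show ?thesis using G(2)[OF dm[OF k(1)]] GY unfolding k(2) by linarith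
  qed
  have b2: "\<bar>x\<bar> \<le> int Y" if x: "x \<in> set (map (\<lambda>k. \<beta> (k div q) (k mod q)) [0..<r * q])" for x
  proof -
    obtain k where k: "k < r * q" "x = \<beta> (k div q) (k mod q)" using x by auto
    show ?thesis using G(2)[OF dm[OF k(1)]] GY unfolding k(2) by linarith
  qed
  have b3: "\<bar>x\<bar> \<le> int Y" if x: "x \<in> set (map (\<lambda>k. \<gamma> (k div r) (k mod r)) [0..<q * r])" for x
  proof -
    obtain k where k: "k < q * r" "x = \<gamma> (k div r) (k mod r)" using x by auto
    show ?thesis using G(2)[OF dm'(2)[OF k(1)] dm'(1)[OF k(1)]] GY unfolding k(2) by linarith
  qed
  have l: "l * q + z < r * q" "z * r + l < q * r" if "l < r" "z < q" for l z using that by (auto intro: mult_add_less)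
  obtain t1 s1 where 1: "exec m (store_list 10 0 (map (\<lambda>k. \<alpha> (k div q) (k mod q)) [0..<r * q])) s t1 s1"
    "t1 \<le> 3 * (r * q) + 1" "\<forall>j<r * q. wmem s1 10 (int j) = \<alpha> (j div q) (j mod q)"
    using store_list_wp[of "map (\<lambda>k. \<alpha> (k div q) (k mod q)) [0..<r * q]" 0 10 s, OF b1] L unfolding wp_def by (auto simp: nth_upt)
  obtain t2 s2 where 2: "exec m (store_list 11 0 (map (\<lambda>k. \<beta> (k div q) (k mod q)) [0..<r * q])) s1 t2 s2"
    "t2 \<le> 3 * (r * q) + 1" "\<forall>j<r * q. wmem s2 11 (int j) = \<beta> (j div q) (j mod q)"
    using store_list_wp[of "map (\<lambda>k. \<beta> (k div q) (k mod q)) [0..<r * q]" 0 11 s1, OF b2] L unfolding wp_def by (auto simp: nth_upt)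
  obtain t3 s3 where 3: "exec m (store_list 12 0 (map (\<lambda>k. \<gamma> (k div r) (k mod r)) [0..<q * r])) s2 t3 s3"
    "t3 \<le> 3 * (r * q) + 1" "\<forall>j<q * r. wmem s3 12 (int j) = \<gamma> (j div r) (j mod r)"
    using store_list_wp[of "map (\<lambda>k. \<gamma> (k div r) (k mod r)) [0..<q * r]" 0 12 s2, OF b3] L unfolding wp_def by (auto simp: nth_upt mult.commute[of q])
  have f: "wmem s2 10 = wmem s1 10" "wmem s3 10 = wmem s2 10" "wmem s3 11 = wmem s2 11"
    using exec_frame[OF 2(1)] exec_frame[OF 3(1)] mods_store_list(1) by (metis insertE empty_iff subsetD numeral_eq_iff num.distinct num.inject)+
  have "wmem s3 10 (int (l * q + z)) = \<alpha> l z \<and> wmem s3 11 (int (l * q + z)) = \<beta> l z \<and> wmem s3 12 (int (z * r + l)) = \<gamma> z l" if "l < r" "z < q" for l z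
    using 1(3) 2(3) 3(3) l[OF that] that unfolding f by (simp add: mult_add_div_mod)
  moreover have "t1 + (t2 + t3) \<le> 9 * (r * q) + 3" using 1(2) 2(2) 3(2) by linarith
  ultimately show ?thesis unfolding tables_def wp_def using exec.Seq[OF 1(1) exec.Seq[OF 2(1) 3(1)]] by blast
qed

text \<open>Describes the exponents that the loop for h can reach. In particular d^k is at most d
  n.\<close>

definition fits :: "nat \<Rightarrow> bool" where
  "fits k \<longleftrightarrow> k = 0 \<or> d ^ (k - 1) < n"

lemma fits_powers:
  assumes "fits k"
  shows "a \<le> Z \<Longrightarrow> a ^ k \<le> Y" "k \<le> Y"
proof -
  have Zk: "Z ^ k \<le> Y" using Z(3) assms unfolding fits_def by blast
  show "a \<le> Z \<Longrightarrow> a ^ k \<le> Y" using power_mono[of a Z k] Zk by linarith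
  have "2 \<le> Z" using small by linarith
  then have "2 ^ k \<le> Z ^ k" by (rule power_mono) simp
  then show "k \<le> Y" using Zk less_exp[of k] by linarith
qed

abbreviation has_sizes :: "nat \<Rightarrow> state \<Rightarrow> bool" where
  "has_sizes k s \<equiv> wmem s 20 0 = int (d ^ k) \<and> wmem s 21 0 = int k \<and> wmem s 22 0 = int (r ^ k) \<and> wmem s 23 0 = int (q ^ k) \<and> wmem s 24 0 = int (nat D ^ k)"

lemma sizes_wp:
  assumes s: "wmem s 0 0 = int n"
  shows "wp m sizes (\<lambda>t s'. \<exists>h. fits h \<and> n \<le> d ^ h \<and> has_sizes h s' \<and> t \<le> 60 * (h + 1)) s"
proof -
  let ?s = "wupd 24 0 1 (wupd 23 0 1 (wupd 22 0 1 (wupd 21 0 0 (wupd 20 0 1 s))))"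
  let ?B = "(Seq (Assign 20 (Pmul (Var 20) (WConst (int d))))
      (Seq (Assign 21 (Padd (Var 21) (WConst 1)))
      (Seq (Assign 22 (Pmul (Var 22) (WConst (int r))))
      (Seq (Assign 23 (Pmul (Var 23) (WConst (int q))))
      (Assign 24 (Pmul (Var 24) (WConst (int (nat D)))))))))"
  have loop: "wp m (While (WLess (Var 20) (Var 0)) ?B) (\<lambda>t s'. \<exists>h. fits h \<and> n \<le> d ^ h \<and> has_sizes h s' \<and> t \<le> 50 * h + 20) ?s"
  proof (rule wp_While[where J = n and c = "\<lambda>_. 40" and I = "\<lambda>k s'. fits k \<and> has_sizes k s'"], goal_cases)
    case 1
    show ?case by (simp add: fits_def)
  next
    case (2 k s')
    have f0: "wmem s' 0 0 = int n" using 2(3)[of 0] s by simp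
    have ev: "beval m s' (WLess (Var 20) (Var 0)) = Some (d ^ k < n)" using 2(1) f0 by (simp add: sz)
    have step: "k < n \<and> wp m ?B (\<lambda>t s''. t \<le> 40 \<and> fits (Suc k) \<and> has_sizes (Suc k) s'') s'" if lt: "d ^ k < n"
    proof
      have "2 ^ k \<le> d ^ k" using d2 by (rule power_mono) simp
      then show "k < n" using lt less_exp[of k] by linarith
      have fit: "fits k" "fits (Suc k)" using 2(1) lt unfolding fits_def by auto
      have Y: "d ^ k \<le> Y" "r ^ k \<le> Y" "q ^ k \<le> Y" "nat D ^ k \<le> Y" "k \<le> Y" "d \<le> Y" "r \<le> Y" "q \<le> Y" "nat D \<le> Y"
        using fits_powers[OF fit(1)] small Z(2) by auto
      have Y': "d ^ Suc k \<le> Y" "r ^ Suc k \<le> Y" "q ^ Suc k \<le> Y" "nat D ^ Suc k \<le> Y"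
        by (rule fits_powers[OF fit(2)], rule small)+
      have e: "d ^ k * d = d ^ Suc k" "r ^ k * r = r ^ Suc k" "q ^ k * q = q ^ Suc k" "nat D ^ k * nat D = nat D ^ Suc k" by simp_all
      show "wp m ?B (\<lambda>t s''. t \<le> 40 \<and> fits (Suc k) \<and> has_sizes (Suc k) s'') s'"
        using 2(1) fit(2) Y Y' by (simp only: wp_Seq wp_WStore) (simp add: sz nf e del: power_Suc int_nat_eq)
    qed
    have fin: "\<exists>h. fits h \<and> n \<le> d ^ h \<and> has_sizes h s' \<and> t \<le> 50 * h + 20" if "\<not> d ^ k < n" "t \<le> (\<Sum>j<k. 40) + (k + 1) * (1 + bcost (WLess (Var 20) (Var 0)))" for t
      using that 2(1) by (intro exI[of _ k]) auto
    show ?case using ev step fin by (intro exI[of _ "d ^ k < n"]) blast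
  qed
  show ?thesis unfolding sizes_def
    apply (rule wp_Assign, simp add: sz)+
    apply (rule wp_mono[OF loop])
    by (elim exE conjE, rule exI, intro conjI, assumption+) simp
qed

end

text \<open>Turns a specification into an explicit execution with named final state, which is
  handier than nested preconditions for a sequence of eight phases.\<close>

lemma wp_result:
  "wp m p Q s \<Longrightarrow> \<exists>t s'. exec m p s t s' \<and> Q t s' \<and> (\<forall>a. a \<notin> wmods p \<longrightarrow> wmem s' a = wmem s a)"
  unfolding wp_def using exec_frame by meson

context notes [simp] = of_nat_add of_nat_mult of_nat_Suc begin

lemma multiply_cost:
  fixes T q r :: nat
  assumes qr: "q \<le> r" and T: "1 \<le> T" "q ^ h \<le> T"
    and t: "t1 \<le> 9 * (r * q) + 3" "t2 \<le> 60 * (h + 1)" "t3 \<le> 200 * q ^ h + 100" "t4 \<le> h * (T * (60 * q + 250) + 150) + 100"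
     "t5 \<le> h * (T * (60 * q + 250) + 150) + 100" "t6 \<le> 100 * T + 100" "t7 \<le> h * (T * (60 * r + 250) + 150) + 100" "t8 \<le> 100 * q ^ h + 100"
  shows "t1 + (t2 + (t3 + (t4 + (t5 + (t6 + (t7 + t8)))))) \<le> (9 * (r * q) + 180 * r + 3000) * ((h + 1) * T)"
proof -
  define U where "U = (h + 1) * T"
  have U0: "U = h * T + T" unfolding U_def by simp
  have "h * 1 \<le> h * T" using T(1) by (rule mult_le_mono2)
  then have u: "1 \<le> U" "h \<le> U" "T \<le> U" "q ^ h \<le> U" "h * T \<le> U" "h + 1 \<le> U" using T unfolding U0 by linarith+
  have tr: "h * (T * (60 * x + 250) + 150) + 100 \<le> (60 * r + 500) * U" if "x \<le> r" for x
  proof -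
    have "h * (T * (60 * x + 250) + 150) + 100 = (h * T) * (60 * x + 250) + 150 * h + 100" by (simp add: algebra_simps)
    also have "\<dots> \<le> U * (60 * r + 250) + 150 * U + 100 * U" using that u by (intro add_mono mult_mono) auto
    also have "\<dots> = (60 * r + 500) * U" by (simp add: algebra_simps)
    finally show ?thesis .
  qed
  define X W where "X = (9 * (r * q) + 3) * U" and "W = (60 * r + 500) * U"
  have "t1 \<le> (9 * (r * q) + 3) * 1" using t(1) by simp
  also have "\<dots> \<le> X" unfolding X_def using u(1) by (rule mult_le_mono2)
  finally have 1: "t1 \<le> X" .
  have 2: "t2 \<le> 60 * U" "t3 \<le> 300 * U" "t6 \<le> 200 * U" "t8 \<le> 200 * U" using t(2,3,6,8) u by simp_all
  have 3: "t4 \<le> W" "t5 \<le> W" "t7 \<le> W"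
    unfolding W_def by (rule order_trans[OF t(4) tr[OF qr]], rule order_trans[OF t(5) tr[OF qr]], rule order_trans[OF t(7) tr[OF order_refl]])
  have "t1 + (t2 + (t3 + (t4 + (t5 + (t6 + (t7 + t8)))))) \<le> X + 760 * U + 3 * W" using 1 2 3 by simp
  also have "\<dots> \<le> (9 * (r * q) + 180 * r + 3000) * U" unfolding X_def W_def by (simp add: algebra_simps)
  finally show ?thesis unfolding U_def .
qed

end

context bilinear_machine begin

lemma load_wp:
  assumes fit: "fits h" and hs: "has_sizes h s" and s0: "wmem s 0 0 = int n"
    and A: "holds_matrix n (wmem s 1) A" and B: "holds_matrix n (wmem s 2) B"
  shows "wp m load (\<lambda>t s'. t \<le> 200 * q ^ h + 100 \<and> (\<forall>f<q ^ h. wmem s' 27 (int f) = int (ri h f) \<and> wmem s' 28 (int f) = int (ci h f) \<and>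
     wmem s' 30 (int f) = padded n A (ri h f) (ci h f) \<and> wmem s' 31 (int f) = padded n B (ri h f) (ci h f))) s"
proof -
  let ?s = "wupd 28 0 0 (wupd 27 0 0 s)"
  have Y: "q ^ h \<le> Y" "d ^ h \<le> Y" "d \<le> Y" "q \<le> Y" using fits_powers[OF fit] small Z(2) by auto
  let ?P = "\<lambda>f s'. wmem s' 27 (int f) = int (ri h f) \<and> wmem s' 28 (int f) = int (ci h f) \<and>
     wmem s' 30 (int f) = padded n A (ri h f) (ci h f) \<and> wmem s' 31 (int f) = padded n B (ri h f) (ci h f)"
  have loop: "wp m (For 29 (Var 23) load_cell) (\<lambda>t s'. t \<le> 200 * q ^ h + 50 \<and> (\<forall>f<q ^ h. ?P f s')) ?s"
  proof (rule wp_For[where N = "q ^ h" and c = 150 and I = "\<lambda>k s'. wmem s' 27 0 = 0 \<and> wmem s' 28 0 = 0 \<and> (\<forall>f<k. ?P f s')"], goal_cases)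
    case (1 k s')
    have "wmem s' 23 0 = int (q ^ h)" using 1(4)[of 23] hs by (simp add: mods_multiply)
    then show ?case by (simp add: sz)
  next
    case 2
    show ?case by (rule wmax_Y[OF Y(1)])
  next
    case 3
    show ?case by simp
  next
    case (4 k s')
    have fr: "wmem s' 0 0 = int n" "wmem s' 1 = wmem s 1" "wmem s' 2 = wmem s 2" using 4(4)[of 0] 4(4)[of 1] 4(4)[of 2] s0 by (simp_all add: mods_multiply)
    have kq: "k div q < q ^ h" "k \<le> Y" using 4(1) Y(1) div_le_dividend[of k q] by linarith+
    have rd: "wmem s' 27 (int (k div q)) = int (ri h (k div q)) \<and> wmem s' 28 (int (k div q)) = int (ci h (k div q))"
    proof (cases "k = 0")
      case True
      then show ?thesis using 4(2) by (simp add: ri_0)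
    next
      case False
      then have "k div q < k" using q_pos by simp
      then show ?thesis using 4(2) by blast
    qed
    have le: "ri h (k div q) \<le> Y" "ci h (k div q) \<le> Y" "ri h k \<le> Y" "ci h k \<le> Y"
      using ri_less[OF kq(1)] ri_less[OF 4(1)] Y(2) by linarith+
    have e: "ri h k = ri h (k div q) * d + k mod q div d" "ci h k = ci h (k div q) * d + k mod q mod d" by (rule ri_rec[OF 4(1)])+
    let ?s1 = "wupd 27 (int k) (int (ri h k)) s'"
    let ?s2 = "wupd 28 (int k) (int (ci h k)) ?s1"
    have ev1: "weval m s' (Padd (Pmul (WLoad 27 (Pdiv (Var 29) (WConst (int q)))) (WConst (int d))) (Pdiv (WMod (Var 29) (WConst (int q))) (WConst (int d)))) = Some (int (ri h k))"
      unfolding e using 4(3) rd Y kq le by (simp add: sz nf)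
    have ev2: "weval m ?s1 (Padd (Pmul (WLoad 28 (Pdiv (Var 29) (WConst (int q)))) (WConst (int d))) (WMod (WMod (Var 29) (WConst (int q))) (WConst (int d)))) = Some (int (ci h k))"
      unfolding e(2) using 4(3) rd Y kq le by (simp add: sz nf)
    have ev0: "weval m s' (Var 29) = Some (int k)" "weval m ?s1 (Var 29) = Some (int k)" using 4(3) by (simp_all add: sz)
    have evb: "beval m ?s2 inside = Some (ri h k < n \<and> ci h k < n)" using 4(3) fr by (simp add: sz)
    have eve: "weval m ?s2 entry = Some (int (ri h k * n + ci h k))" using 4(3) fr le n by (simp add: sz nf)
    have cond: "wp m (Cond inside (Seq (WStore 30 (Var 29) (WLoad 1 entry)) (WStore 31 (Var 29) (WLoad 2 entry)))
      (Seq (WStore 30 (Var 29) (WConst 0)) (WStore 31 (Var 29) (WConst 0)))) (\<lambda>t s''. t \<le> 60 \<and> wmem s'' 29 0 = int k \<and>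
         wmem s'' 27 = (wmem s' 27)(int k := int (ri h k)) \<and> wmem s'' 28 = (wmem s' 28)(int k := int (ci h k)) \<and>
         wmem s'' 30 = (wmem s' 30)(int k := padded n A (ri h k) (ci h k)) \<and> wmem s'' 31 = (wmem s' 31)(int k := padded n B (ri h k) (ci h k))) ?s2"
    proof (cases "ri h k < n \<and> ci h k < n")
      case True
      have AB: "wmem s' 1 (int (ri h k * n + ci h k)) = A (ri h k) (ci h k)" "wmem s' 2 (int (ri h k * n + ci h k)) = B (ri h k) (ci h k)"
        using A B True unfolding fr holds_matrix_def by blast+
      show ?thesis using True AB 4(3) fr le n by (simp add: sz nf padded_def)
    next
      case False
      then have ev: "beval m ?s2 inside = Some False" using evb by simp
      have "padded n A (ri h k) (ci h k) = 0" "padded n B (ri h k) (ci h k) = 0" using False by (auto simp: padded_def)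
      then show ?thesis unfolding wp_Cond ev using 4(3) by (simp add: sz)
    qed
    have cell: "wp m load_cell (\<lambda>t s''. t \<le> 150 \<and> wmem s'' 29 0 = int k \<and>
         wmem s'' 27 = (wmem s' 27)(int k := int (ri h k)) \<and> wmem s'' 28 = (wmem s' 28)(int k := int (ci h k)) \<and>
         wmem s'' 30 = (wmem s' 30)(int k := padded n A (ri h k) (ci h k)) \<and> wmem s'' 31 = (wmem s' 31)(int k := padded n B (ri h k) (ci h k))) s'"
      unfolding load_cell_def wp_Seq[of m "WStore 27 _ _"] wp_Seq[of m "WStore 28 _ _"] wp_WStore[of m 27] wp_WStore[of m 28]
      apply (rule exI[of _ "int k"], rule exI[of _ "int (ri h k)"], intro conjI, rule ev0, rule ev1)
      apply (rule exI[of _ "int k"], rule exI[of _ "int (ci h k)"], intro conjI, rule ev0, rule ev2)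
      by (rule wp_mono[OF cond]) simp
    show ?case
    proof (rule wp_mono[OF cell], elim conjE)
      fix t :: nat and s'' :: state
      assume a: "t \<le> 150" "wmem s'' 29 0 = int k" "wmem s'' 27 = (wmem s' 27)(int k := int (ri h k))" "wmem s'' 28 = (wmem s' 28)(int k := int (ci h k))"
        "wmem s'' 30 = (wmem s' 30)(int k := padded n A (ri h k) (ci h k))" "wmem s'' 31 = (wmem s' 31)(int k := padded n B (ri h k) (ci h k))"
      let ?t = "wupd 29 0 (int (Suc k)) s''"
      have "?P f ?t" if "f < Suc k" for f
        using that 4(2) by (cases "f = k") (simp_all add: a less_Suc_eq)
      moreover have "wmem ?t 27 0 = 0" "wmem ?t 28 0 = 0" using 4(2) by (simp_all add: a ri_0)
      ultimately show "t \<le> 150 \<and> wmem s'' 29 0 = int k \<and> wmem ?t 27 0 = 0 \<and> wmem ?t 28 0 = 0 \<and> (\<forall>f<Suc k. ?P f ?t)" using a(1,2) by blast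
    qed
  next
    case (5 t s')
    have "t \<le> 200 * q ^ h + 50" using 5(3) by simp
    then show ?case using 5(1) by blast
  qed
  show ?thesis unfolding load_def
    apply (rule wp_Assign, simp add: sz)
    apply (rule wp_Assign, simp add: sz)
    apply (rule wp_mono[OF loop])
    by simp
qed

lemma pointwise_wp:
  assumes fit: "fits h" and hs: "has_sizes h s"
    and ab: "\<And>x. x < r ^ h \<Longrightarrow> wmem s 30 (int x) = a x \<and> wmem s 31 (int x) = b x \<and> \<bar>a x * b x\<bar> \<le> int Y"
  shows "wp m pointwise (\<lambda>t s'. t \<le> 100 * r ^ h + 100 \<and> (\<forall>x<r ^ h. wmem s' 30 (int x) = a x * b x)) s"
  unfolding pointwise_def
\<comment> \<open>The products replace the left factors in place, so the invariant also says that
  the cells from k on are untouched.\<close>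
proof (rule wp_For[where N = "r ^ h" and c = 50 and I = "\<lambda>k s'. (\<forall>x<k. wmem s' 30 (int x) = a x * b x) \<and> (\<forall>x\<ge>k. wmem s' 30 (int x) = wmem s 30 (int x))"], goal_cases)
  case (1 k s')
  have "wmem s' 22 0 = int (r ^ h)" using 1(4)[of 22] hs by simp
  then show ?case by (simp add: sz)
next
  case 2
  show ?case by (rule wmax_Y, rule fits_powers[OF fit], rule small)
next
  case 3
  show ?case by simp
next
  case (4 k s')
  have v: "wmem s' 30 (int k) = a k" "wmem s' 31 (int k) = b k" "word m (a k * b k) = Some (a k * b k)"
    using 4(2) 4(4)[of 31] ab[OF 4(1)] word_int by auto
  show ?case using 4(2,3) v by (simp add: sz less_Suc_eq)
next
  case (5 t s')
  have "t \<le> 100 * r ^ h + 100" using 5(3) by simp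
  then show ?case using 5(1) by blast
qed

lemma emit_wp:
  assumes fit: "fits h" and hs: "has_sizes h s" and s0: "wmem s 0 0 = int n" and nh: "n \<le> d ^ h"
    and P: "\<And>f. f < q ^ h \<Longrightarrow> wmem s 27 (int f) = int (ri h f) \<and> wmem s 28 (int f) = int (ci h f) \<and>
      \<bar>wmem s 30 (int f)\<bar> \<le> int Y" "\<And>f. f < q ^ h \<Longrightarrow> ri h f < n \<Longrightarrow> ci h f < n \<Longrightarrow> wmem s 30 (int f) = int (nat D ^ h) * P (ri h f) (ci h f)"
  shows "wp m emit (\<lambda>t s'. t \<le> 100 * q ^ h + 100 \<and> holds_matrix n (wmem s' 3) P) s"
  unfolding emit_def
proof (rule wp_For[where N = "q ^ h" and c = 50 and
     I = "\<lambda>k s'. \<forall>i<n. \<forall>j<n. (\<exists>f<k. ri h f = i \<and> ci h f = j) \<longrightarrow> wmem s' 3 (int (i * n + j)) = P i j"], goal_cases)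
  case (1 k s')
  have "wmem s' 23 0 = int (q ^ h)" using 1(4)[of 23] hs by simp
  then show ?case by (simp add: sz)
next
  case 2
  show ?case by (rule wmax_Y, rule fits_powers[OF fit], rule small)
next
  case 3
  show ?case by simp
next
  case (4 k s')
  have fr: "wmem s' 0 0 = int n" "wmem s' 24 0 = int (nat D ^ h)" "wmem s' 30 = wmem s 30" "wmem s' 27 (int k) = int (ri h k)" "wmem s' 28 (int k) = int (ci h k)"
    using 4(4)[of 0] 4(4)[of 24] 4(4)[of 27] 4(4)[of 28] 4(4)[of 30] s0 hs P(1)[OF 4(1)] by simp_all
  have "d ^ h \<le> Y" by (rule fits_powers[OF fit], rule small)
  then have le: "ri h k \<le> Y" "ci h k \<le> Y" using ri_less[OF 4(1)] by linarith+
  have evb: "beval m s' inside = Some (ri h k < n \<and> ci h k < n)" using 4(3) fr by (simp add: sz)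
  show ?case
  proof (cases "ri h k < n \<and> ci h k < n")
    case True
    have D1: "1 \<le> int (nat D ^ h)" using small(5) by (metis of_nat_1 of_nat_le_iff one_le_power)
    have v: "wmem s 30 (int k) = int (nat D ^ h) * P (ri h k) (ci h k)" using P(2)[OF 4(1)] True by blast
    have dv: "wmem s 30 (int k) div int (nat D ^ h) = P (ri h k) (ci h k)" unfolding v using D1 by (intro nonzero_mult_div_cancel_left) linarith
    \<comment> \<open>The quotient is no larger in magnitude than the dividend and hence
      representable.\<close>
    have "1 * \<bar>P (ri h k) (ci h k)\<bar> \<le> int (nat D ^ h) * \<bar>P (ri h k) (ci h k)\<bar>" using D1 by (rule mult_right_mono) simp
    also have "\<dots> = \<bar>wmem s 30 (int k)\<bar>" unfolding v abs_mult by simp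
    finally have w: "word m (P (ri h k) (ci h k)) = Some (P (ri h k) (ci h k))" using P(1)[OF 4(1)] by (intro word_int) linarith
    have store: "wp m (WStore 3 entry (Pdiv (WLoad 30 (Var 29)) (Var 24))) (\<lambda>t s''. t \<le> 30 \<and> s'' = wupd 3 (int (ri h k * n + ci h k)) (P (ri h k) (ci h k)) s') s'"
      using 4(3) fr le n dv w by (simp add: sz nf)
    have inj: "i = ri h k \<and> j = ci h k" if "i < n" "j < n" "int (i * n + j) = int (ri h k * n + ci h k)" for i j
    proof -
      have "i * n + j = ri h k * n + ci h k" using that(3) by simp
      then show ?thesis using mult_add_div_mod[OF that(2), of i] mult_add_div_mod[of "ci h k" n "ri h k"] True by metis
    qed
    let ?t = "\<lambda>s''. wupd 29 0 (int (Suc k)) s''"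
    have post: "\<forall>i<n. \<forall>j<n. (\<exists>f<Suc k. ri h f = i \<and> ci h f = j) \<longrightarrow> wmem (wupd 29 0 (int (Suc k)) (wupd 3 (int (ri h k * n + ci h k)) (P (ri h k) (ci h k)) s')) 3 (int (i * n + j)) = P i j"
    proof (intro allI impI)
      fix i j assume ij: "i < n" "j < n" "\<exists>f<Suc k. ri h f = i \<and> ci h f = j"
      show "wmem (wupd 29 0 (int (Suc k)) (wupd 3 (int (ri h k * n + ci h k)) (P (ri h k) (ci h k)) s')) 3 (int (i * n + j)) = P i j"
      proof (cases "int (i * n + j) = int (ri h k * n + ci h k)")
        case True
        then show ?thesis using inj[OF ij(1,2) True] by simp
      next
        case False
        then have "\<exists>f<k. ri h f = i \<and> ci h f = j" using ij(3) less_Suc_eq by auto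
        then have "wmem s' 3 (int (i * n + j)) = P i j" using 4(2) ij(1,2) by blast
        then show ?thesis using False by simp
      qed
    qed
    have ev: "beval m s' inside = Some True" using evb True by simp
    show ?thesis unfolding wp_Cond ev
      apply (intro conjI impI; (simp only: option.distinct option.inject simp_thms)?)
      apply (rule wp_mono[OF store])
      using post 4(3) by simp
  next
    case False
    have "\<forall>i<n. \<forall>j<n. (\<exists>f<Suc k. ri h f = i \<and> ci h f = j) \<longrightarrow> wmem s' 3 (int (i * n + j)) = P i j"
      using 4(2) False less_Suc_eq by auto
    then show ?thesis using evb False 4(3) by simp
  qed
next
  case (5 t s')
  have "t \<le> 100 * q ^ h + 100" using 5(3) by simp
  moreover have "holds_matrix n (wmem s' 3) P" unfolding holds_matrix_def
  proof (intro allI impI)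
    fix i j assume ij: "i < n" "j < n"
    then have "\<exists>f<q ^ h. ri h f = i \<and> ci h f = j" using nh by (intro ri_surj) linarith+
    then show "wmem s' 3 (int (i * n + j)) = P i j" using 5(1) ij by blast
  qed
  ultimately show ?case by blast
qed

text \<open>Magnitudes are at most (q G)^h after each of the first two transforms, the square of
  this after the pointwise product, and (r G)^h times that square at the end. This explains the
  factor r q^2 G^3 in the lower bound on Z.\<close>

lemma multiply_wp:
  assumes s0: "wmem s 0 0 = int n" and A: "holds_matrix n (wmem s 1) A" and B: "holds_matrix n (wmem s 2) B"
    and AB: "\<And>i j. i < n \<Longrightarrow> j < n \<Longrightarrow> \<bar>A i j\<bar> \<le> 1 \<and> \<bar>B i j\<bar> \<le> 1"
  shows "wp m multiply (\<lambda>t s'. holds_matrix n (wmem s' 3) (mat_prod n A B) \<and> (\<exists>h. fits h \<and> t \<le> (9 * (r * q) + 180 * r + 3000) * ((h + 1) * r ^ h))) s"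
proof -
  obtain t1 s1 where 1: "exec m tables s t1 s1" "t1 \<le> 9 * (r * q) + 3"
    and tb1: "\<forall>l<r. \<forall>z<q. wmem s1 10 (int (l * q + z)) = \<alpha> l z \<and> wmem s1 11 (int (l * q + z)) = \<beta> l z \<and> wmem s1 12 (int (z * r + l)) = \<gamma> z l"
    and f1: "\<forall>a. a \<notin> wmods tables \<longrightarrow> wmem s1 a = wmem s a"
    using wp_result[OF tables_wp[of s]] by (elim exE conjE) (rule that; assumption)
  have i1: "wmem s1 0 = wmem s 0" "wmem s1 1 = wmem s 1" "wmem s1 2 = wmem s 2" using f1 mods_multiply(1) by auto
  obtain t2 s2 h where 2: "exec m sizes s1 t2 s2" and fit: "fits h" and nh: "n \<le> d ^ h" and hs2: "has_sizes h s2" and t2: "t2 \<le> 60 * (h + 1)"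
    and f2: "\<forall>a. a \<notin> wmods sizes \<longrightarrow> wmem s2 a = wmem s1 a"
    using wp_result[OF sizes_wp[of s1]] s0 i1 by auto
  have i2: "wmem s2 a = wmem s1 a" if "a \<in> {0,1,2,10,11,12}" for a using f2 that by (auto simp: mods_multiply)
  have z2: "wmem s2 0 0 = int n" "holds_matrix n (wmem s2 1) A" "holds_matrix n (wmem s2 2) B" using s0 A B i1 by (simp_all add: i2)
  obtain t3 s3 where 3: "exec m load s2 t3 s3" "t3 \<le> 200 * q ^ h + 100"
    and l3: "\<forall>f<q ^ h. wmem s3 27 (int f) = int (ri h f) \<and> wmem s3 28 (int f) = int (ci h f) \<and>
     wmem s3 30 (int f) = padded n A (ri h f) (ci h f) \<and> wmem s3 31 (int f) = padded n B (ri h f) (ci h f)"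
    and f3: "\<forall>a. a \<notin> wmods load \<longrightarrow> wmem s3 a = wmem s2 a"
    using wp_result[OF load_wp[OF fit hs2 z2]] by (elim exE conjE) (rule that; assumption)
  have i3: "wmem s3 a = wmem s2 a" if "a \<in> {0,10,11,12,20,21,22,23,24}" for a using f3 that by (auto simp: mods_multiply)
  have q1: "0 < q" "0 < r" using small by linarith+
  have Yb: "r ^ h \<le> Y" "q \<le> Y" "r \<le> Y" "h \<le> Y" using fits_powers[OF fit] small Z(2) by auto
  have TT1: "q ^ (h - j) * r ^ j \<le> r ^ h" if "j \<le> h" for j
  proof -
    have "q ^ (h - j) * r ^ j \<le> r ^ (h - j) * r ^ j" using small(3) by (intro mult_right_mono power_mono) auto
    then show ?thesis using that by (simp add: power_add[symmetric])
  qed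
  have TT2: "r ^ (h - j) * q ^ j \<le> r ^ h" if "j \<le> h" for j
  proof -
    have "r ^ (h - j) * q ^ j \<le> r ^ (h - j) * r ^ j" using small(3) by (intro mult_left_mono power_mono) auto
    then show ?thesis using that by (simp add: power_add[symmetric])
  qed
  have pad: "\<bar>padded n A i j\<bar> \<le> int 1" "\<bar>padded n B i j\<bar> \<le> int 1" for i j using AB unfolding padded_def by (auto simp: of_nat_Suc)
  have M1: "(q * G) ^ h * 1 \<le> Y" using fits_powers(1)[OF fit small(12)] by simp
  let ?a = "yates r q \<alpha> h (\<lambda>z. padded n A (ri h z) (ci h z))" and ?b = "yates r q \<beta> h (\<lambda>z. padded n B (ri h z) (ci h z))"
  have sc3: "wmem s3 23 0 = int (q ^ h)" "wmem s3 21 0 = int h" using hs2 by (simp_all add: i3)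
  have g3: "wmem s3 10 (int (l * q + z)) = \<alpha> l z \<and> \<bar>\<alpha> l z\<bar> \<le> int G" if "l < r" "z < q" for l z
    using tb1 G(2) that by (simp add: i3 i2)
  have tw3: "wp m (transform r q 10 30 23) (\<lambda>t s'. t \<le> h * (r ^ h * (60 * q + 250) + 150) + 100 \<and>
     (\<forall>x<r ^ h. wmem s' 30 (int x) = ?a x \<and> \<bar>?a x\<bar> \<le> int ((q * G) ^ h * 1))) s3"
    by (rule transform_wp[OF _ _ _ sc3 q1(2,1) TT1 Yb g3 G(1) _ M1]) (use l3 pad in auto)
  obtain t4 s4 where 4: "exec m (transform r q 10 30 23) s3 t4 s4" "t4 \<le> h * (r ^ h * (60 * q + 250) + 150) + 100"
    and a4: "\<forall>x<r ^ h. wmem s4 30 (int x) = ?a x \<and> \<bar>?a x\<bar> \<le> int ((q * G) ^ h * 1)"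
    and f4: "\<forall>a. a \<notin> wmods (transform r q 10 30 23) \<longrightarrow> wmem s4 a = wmem s3 a"
    using wp_result[OF tw3] by (elim exE conjE) (rule that; assumption)
  have i4: "wmem s4 a = wmem s3 a" if "a \<in> {0,10,11,12,20,21,22,23,24,27,28,31}" for a using f4 that by auto
  have sc4: "wmem s4 23 0 = int (q ^ h)" "wmem s4 21 0 = int h" using sc3 by (simp_all add: i4)
  have g4: "wmem s4 11 (int (l * q + z)) = \<beta> l z \<and> \<bar>\<beta> l z\<bar> \<le> int G" if "l < r" "z < q" for l z
    using tb1 G(2) that by (simp add: i4 i3 i2)
  have l4: "wmem s4 31 (int f) = padded n B (ri h f) (ci h f) \<and> \<bar>padded n B (ri h f) (ci h f)\<bar> \<le> int 1" if "f < q ^ h" for f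
    using l3 pad that by (simp add: i4)
  have tw4: "wp m (transform r q 11 31 23) (\<lambda>t s'. t \<le> h * (r ^ h * (60 * q + 250) + 150) + 100 \<and>
     (\<forall>x<r ^ h. wmem s' 31 (int x) = ?b x \<and> \<bar>?b x\<bar> \<le> int ((q * G) ^ h * 1))) s4"
    by (rule transform_wp[OF _ _ _ sc4 q1(2,1) TT1 Yb g4 G(1) l4 M1]) auto
  obtain t5 s5 where 5: "exec m (transform r q 11 31 23) s4 t5 s5" "t5 \<le> h * (r ^ h * (60 * q + 250) + 150) + 100"
    and a5: "\<forall>x<r ^ h. wmem s5 31 (int x) = ?b x \<and> \<bar>?b x\<bar> \<le> int ((q * G) ^ h * 1)"
    and f5: "\<forall>a. a \<notin> wmods (transform r q 11 31 23) \<longrightarrow> wmem s5 a = wmem s4 a"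
    using wp_result[OF tw4] by (elim exE conjE) (rule that; assumption)
  have i5: "wmem s5 a = wmem s4 a" if "a \<in> {0,10,11,12,20,21,22,23,24,27,28,30}" for a using f5 that by auto
  have hs5: "has_sizes h s5" using hs2 by (simp add: i5 i4 i3)
  let ?M = "(q * G * (q * G)) ^ h"
  have MY: "?M \<le> Y" by (rule fits_powers(1)[OF fit small(13)])
  have ab: "\<bar>?a x * ?b x\<bar> \<le> int ?M" if "x < r ^ h" for x
  proof -
    have "\<bar>?a x\<bar> * \<bar>?b x\<bar> \<le> int ((q * G) ^ h * 1) * int ((q * G) ^ h * 1)" using a4 a5 that by (intro mult_mono) auto
    then show ?thesis unfolding abs_mult power_mult_distrib[of "q * G"] by (simp add: of_nat_mult)
  qed
  have p5: "wmem s5 30 (int x) = ?a x \<and> wmem s5 31 (int x) = ?b x \<and> \<bar>?a x * ?b x\<bar> \<le> int Y" if "x < r ^ h" for x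
  proof -
    have "int ?M \<le> int Y" using MY by (simp only: of_nat_le_iff)
    then show ?thesis using ab[OF that] a4 a5 that by (simp add: i5)
  qed
  have pw: "wp m pointwise (\<lambda>t s'. t \<le> 100 * r ^ h + 100 \<and> (\<forall>x<r ^ h. wmem s' 30 (int x) = ?a x * ?b x)) s5"
    by (rule pointwise_wp[OF fit hs5 p5])
  obtain t6 s6 where 6: "exec m pointwise s5 t6 s6" "t6 \<le> 100 * r ^ h + 100" and a6: "\<forall>x<r ^ h. wmem s6 30 (int x) = ?a x * ?b x"
    and f6: "\<forall>a. a \<notin> wmods pointwise \<longrightarrow> wmem s6 a = wmem s5 a"
    using wp_result[OF pw] by (elim exE conjE) (rule that; assumption)
  have i6: "wmem s6 a = wmem s5 a" if "a \<in> {0,10,11,12,20,21,22,23,24,27,28}" for a using f6 that by (auto simp: mods_multiply)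
  have sc6: "wmem s6 22 0 = int (r ^ h)" "wmem s6 21 0 = int h" using hs5 by (simp_all add: i6)
  have g6: "wmem s6 12 (int (l * r + z)) = \<gamma> l z \<and> \<bar>\<gamma> l z\<bar> \<le> int G" if "l < q" "z < r" for l z
    using tb1 G(2) that by (simp add: i6 i5 i4 i3 i2)
  have l6: "wmem s6 30 (int x) = ?a x * ?b x \<and> \<bar>?a x * ?b x\<bar> \<le> int ?M" if "x < r ^ h" for x using a6 ab that by blast
  have M6: "(r * G) ^ h * ?M \<le> Y" using fits_powers(1)[OF fit small(14)] by (simp add: power_mult_distrib)
  let ?c = "yates q r \<gamma> h (\<lambda>x. ?a x * ?b x)"
  have tw6: "wp m (transform q r 12 30 22) (\<lambda>t s'. t \<le> h * (r ^ h * (60 * r + 250) + 150) + 100 \<and>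
     (\<forall>x<q ^ h. wmem s' 30 (int x) = ?c x \<and> \<bar>?c x\<bar> \<le> int ((r * G) ^ h * ?M))) s6"
    by (rule transform_wp[OF _ _ _ sc6 q1 TT2 Yb(1,3,2,4) g6 G(1) l6 M6]) auto
  obtain t7 s7 where 7: "exec m (transform q r 12 30 22) s6 t7 s7" "t7 \<le> h * (r ^ h * (60 * r + 250) + 150) + 100"
    and a7: "\<forall>x<q ^ h. wmem s7 30 (int x) = ?c x \<and> \<bar>?c x\<bar> \<le> int ((r * G) ^ h * ?M)"
    and f7: "\<forall>a. a \<notin> wmods (transform q r 12 30 22) \<longrightarrow> wmem s7 a = wmem s6 a"
    using wp_result[OF tw6] by (elim exE conjE) (rule that; assumption)
  have i7: "wmem s7 a = wmem s6 a" if "a \<in> {0,20,21,22,23,24,27,28}" for a using f7 that by auto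
  have hs7: "has_sizes h s7" using hs5 by (simp add: i7 i6)
  have n7: "wmem s7 0 0 = int n" using z2(1) by (simp add: i7 i6 i5 i4 i3)
  have P7: "wmem s7 27 (int f) = int (ri h f) \<and> wmem s7 28 (int f) = int (ci h f) \<and> \<bar>wmem s7 30 (int f)\<bar> \<le> int Y" if "f < q ^ h" for f
  proof -
    have "int ((r * G) ^ h * ?M) \<le> int Y" using M6 by (simp only: of_nat_le_iff)
    then have "\<bar>wmem s7 30 (int f)\<bar> \<le> int Y" using a7 that by fastforce
    then show ?thesis using l3 that by (simp add: i7 i6 i5 i4)
  qed
  have V7: "wmem s7 30 (int f) = int (nat D ^ h) * mat_prod n A B (ri h f) (ci h f)" if "f < q ^ h" "ri h f < n" "ci h f < n" for f
  proof -
    have "wmem s7 30 (int f) = ?c f" using a7 that(1) by blast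
    also have "\<dots> = D ^ h * mat_prod (d ^ h) (padded n A) (padded n B) (ri h f) (ci h f)" by (rule yates_matmul[OF that(1)])
    also have "\<dots> = int (nat D ^ h) * mat_prod n A B (ri h f) (ci h f)"
      using D0 by (simp add: mat_prod_padded[OF nh that(2,3)] of_nat_power)
    finally show ?thesis .
  qed
  have ew: "wp m emit (\<lambda>t s'. t \<le> 100 * q ^ h + 100 \<and> holds_matrix n (wmem s' 3) (mat_prod n A B)) s7"
    by (rule emit_wp[OF fit hs7 n7 nh P7 V7])
  obtain t8 s8 where 8: "exec m emit s7 t8 s8" "t8 \<le> 100 * q ^ h + 100" "holds_matrix n (wmem s8 3) (mat_prod n A B)"
    using wp_result[OF ew] by (elim exE conjE) (rule that; assumption)
  have T: "1 \<le> r ^ h" "q ^ h \<le> r ^ h" using q1 small(3) by (auto intro: power_mono)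
  have cost: "t1 + (t2 + (t3 + (t4 + (t5 + (t6 + (t7 + t8)))))) \<le> (9 * (r * q) + 180 * r + 3000) * ((h + 1) * r ^ h)"
    by (rule multiply_cost[OF small(3) T 1(2) t2 3(2) 4(2) 5(2) 6(2) 7(2) 8(2)])
  have ex: "exec m multiply s (t1 + (t2 + (t3 + (t4 + (t5 + (t6 + (t7 + t8))))))) s8"
    unfolding multiply_def by (rule exec.Seq[OF 1(1) exec.Seq[OF 2 exec.Seq[OF 3(1) exec.Seq[OF 4(1) exec.Seq[OF 5(1) exec.Seq[OF 6(1) exec.Seq[OF 7(1) 8(1)]]]]]]])
  have hc: "\<exists>h. fits h \<and> t1 + (t2 + (t3 + (t4 + (t5 + (t6 + (t7 + t8)))))) \<le> (9 * (r * q) + 180 * r + 3000) * ((h + 1) * r ^ h)" using fit cost by blast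
  show ?thesis unfolding wp_def by (rule exI, rule exI, rule conjI[OF ex conjI[OF 8(3) hc]])
qed

end

text \<open>The time is of order h r^h. From r \<le> d^\<tau> and d^h \<le> d n one gets r^h \<le>
  d^\<tau> n^\<tau>, where d is a constant, and h is logarithmic in n.\<close>

lemma (in bilinear_algorithm) bool_matmul_bilinear:
  assumes rt: "real r \<le> real d powr \<tau>" and \<tau>0: "0 \<le> \<tau>"
  shows "bool_matmul \<tau>"
proof -
  have "finite ((\<lambda>(l, z). nat \<bar>\<alpha> l z\<bar> + nat \<bar>\<beta> l z\<bar> + nat \<bar>\<gamma> z l\<bar>) ` ({..<r} \<times> {..<q}))" by simp
  then obtain N0 where N0: "\<forall>x\<in>(\<lambda>(l, z). nat \<bar>\<alpha> l z\<bar> + nat \<bar>\<beta> l z\<bar> + nat \<bar>\<gamma> z l\<bar>) ` ({..<r} \<times> {..<q}). x \<le> N0"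
    unfolding finite_nat_set_iff_bounded_le by blast
  define G where "G = Suc N0"
  have G1: "1 \<le> G" unfolding G_def by simp
  have G2: "\<bar>\<alpha> l z\<bar> \<le> int G \<and> \<bar>\<beta> l z\<bar> \<le> int G \<and> \<bar>\<gamma> z l\<bar> \<le> int G" if "l < r" "z < q" for l z
  proof -
    have "(\<lambda>(l, z). nat \<bar>\<alpha> l z\<bar> + nat \<bar>\<beta> l z\<bar> + nat \<bar>\<gamma> z l\<bar>) (l, z) \<le> N0"
      using N0 by (rule bspec) (rule imageI, use that in simp)
    then have "nat \<bar>\<alpha> l z\<bar> \<le> G" "nat \<bar>\<beta> l z\<bar> \<le> G" "nat \<bar>\<gamma> z l\<bar> \<le> G" unfolding G_def by simp_all
    then show ?thesis by (simp only: nat_le_iff)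
  qed
  define Z where "Z = r * q * q * G ^ 3 * nat D"
  \<comment> \<open>2 Z suffices for the powers of Z below; the 4 makes (n + 1)^a at least
    16.\<close>
  define a where "a = 2 * Z + 4"
  define C where "C = 9 * (r * q) + 180 * r + 3000"
  define K where "K = real C * ((2 + 1 / ln 2) * real d powr \<tau>)"
  have main: "\<exists>t s'. exec m multiply s t s' \<and> real t \<le> K * real n powr \<tau> * (1 + ln (real n)) ^ 1 \<and> holds_matrix n (wmem s' 3) (mat_prod n A B)"
    if n: "1 \<le> n" and AB: "\<forall>i<n. \<forall>j<n. \<bar>A i j\<bar> \<le> 1 \<and> \<bar>B i j\<bar> \<le> 1" and sup: "supports m (real (n + 1) ^ (a * 64)) 1"
      and s: "wmem s 0 0 = int n" "holds_matrix n (wmem s 1) A" "holds_matrix n (wmem s 2) B" for n A B m s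
  proof -
    define Y where "Y = (n + 1) ^ a"
    have n2: "2 \<le> n + 1" using n by simp
    have e2: "2 ^ k \<le> (n + 1) ^ k" for k using n2 by (rule power_mono) simp
    have pY: "(n + 1) ^ k \<le> Y" if "k \<le> a" for k unfolding Y_def using n2 that by (intro power_increasing) auto
    have YZ: "Z ^ k \<le> Y" if k: "k = 0 \<or> d ^ (k - 1) < n" for k
    proof (cases k)
      case 0
      then show ?thesis using pY[of 0] by simp
    next
      case (Suc j)
      have "2 ^ j \<le> d ^ j" using d2 by (rule power_mono) simp
      then have j: "2 ^ j \<le> n + 1" using k Suc by simp
      \<comment> \<open>The crude Z < 2^Z turns a constant with growing exponent into powers of 2
        and of 2^j \<le> n + 1 with the constant exponent Z.\<close>
      have "Z ^ k \<le> (2 ^ Z) ^ k" by (rule power_mono) (use less_exp[of Z] in simp_all)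
      also have "\<dots> = 2 ^ Z * (2 ^ j) ^ Z" unfolding Suc by (simp add: power_mult[symmetric] power_add[symmetric] mult.commute)
      also have "\<dots> \<le> (n + 1) ^ Z * (n + 1) ^ Z" using e2 j n by (intro mult_mono power_mono) auto
      also have "\<dots> = (n + 1) ^ (2 * Z)" by (simp add: power_add[symmetric] mult_2)
      also have "\<dots> \<le> Y" by (rule pY) (simp add: a_def)
      finally show ?thesis .
    qed
    have "Z \<le> 2 ^ Z" using less_exp[of Z] by simp
    also have "\<dots> \<le> (n + 1) ^ Z" by (rule e2)
    also have "\<dots> \<le> Y" by (rule pY) (simp add: a_def)
    finally have ZY: "Z \<le> Y" .
    have nY: "n \<le> Y" using pY[of 1] by (simp add: a_def)
    have Y16: "16 \<le> Y" using e2[of 4] pY[of 4] by (simp add: a_def)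
    have "real Y ^ 64 = real (n + 1) ^ (a * 64)" unfolding Y_def of_nat_power power_mult ..
    then have wm: "real Y ^ 64 \<le> wmax m" using sup unfolding supports_def by simp
    interpret bilinear_machine d r \<alpha> \<beta> \<gamma> D m Y G Z n
      by unfold_locales (use G1 G2 Y16 wm ZY YZ n nY in \<open>auto simp: Z_def\<close>)
    from multiply_wp[OF s] AB obtain t s' h where ex: "exec m multiply s t s'" "holds_matrix n (wmem s' 3) (mat_prod n A B)"
      and fit: "fits h" and t: "t \<le> C * ((h + 1) * r ^ h)" unfolding wp_def C_def by blast
    have n1: "1 \<le> real n" using n by simp
    then have ln0: "0 \<le> ln (real n)" by simp
    have l2: "0 < ln (2::real)" by simp
    have dh: "d ^ h \<le> d * n \<and> real h * ln 2 \<le> ln 2 + ln (real n)"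
    proof (cases h)
      case 0
      then show ?thesis using d2 n ln0 l2 by simp
    next
      case (Suc j)
      have lt: "d ^ j < n" using fit Suc unfolding fits_def by simp
      then have "d ^ h \<le> d * n" unfolding Suc power_Suc by (intro mult_le_mono2) simp
      moreover have "2 ^ j \<le> d ^ j" using d2 by (rule power_mono) simp
      then have "2 ^ j \<le> n" using lt by linarith
      then have "(2::real) ^ j \<le> real n" by (metis of_nat_le_iff of_nat_numeral of_nat_power)
      then have "ln ((2::real) ^ j) \<le> ln (real n)" using n1 by (subst ln_le_cancel_iff) auto
      then have "real j * ln 2 \<le> ln (real n)" by (simp add: ln_realpow)
      ultimately show ?thesis unfolding Suc by (simp add: of_nat_Suc distrib_right)
    qed
    have "real h \<le> (ln 2 + ln (real n)) / ln 2" using dh l2 by (simp add: pos_le_divide_eq)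
    also have "\<dots> = 1 + (1 / ln 2) * ln (real n)" using l2 by (simp add: add_divide_distrib)
    finally have "real (h + 1) \<le> 2 + (1 / ln 2) * ln (real n)" by (simp add: of_nat_add)
    also have "\<dots> \<le> (2 + 1 / ln 2) * (1 + ln (real n))"
    proof -
      have gen: "2 + c * L \<le> (2 + c) * (1 + L)" if "0 \<le> c" "0 \<le> L" for c L :: real using that by (simp add: algebra_simps)
      show ?thesis by (rule gen) (use ln0 l2 in simp_all)
    qed
    finally have h1: "real (h + 1) \<le> (2 + 1 / ln 2) * (1 + ln (real n))" .
    have d0: "0 < real d" using d2 by simp
    have "real (r ^ h) \<le> (real d powr \<tau>) ^ h" unfolding of_nat_power using rt by (rule power_mono) simp
    also have "\<dots> = (real d powr \<tau>) powr real h" using d0 by (subst powr_realpow) auto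
    also have "\<dots> = (real d powr real h) powr \<tau>" by (simp add: powr_powr mult.commute)
    also have "\<dots> = real (d ^ h) powr \<tau>" using d0 by (simp add: powr_realpow of_nat_power)
    also have "\<dots> \<le> real (d * n) powr \<tau>" by (rule powr_mono2[OF \<tau>0 of_nat_0_le_iff]) (use dh in \<open>simp only: of_nat_le_iff\<close>)
    also have "\<dots> = real d powr \<tau> * real n powr \<tau>" by (simp add: of_nat_mult powr_mult)
    finally have r1: "real (r ^ h) \<le> real d powr \<tau> * real n powr \<tau>" .
    have "real t \<le> real (C * ((h + 1) * r ^ h))" using t by (simp only: of_nat_le_iff)
    also have "\<dots> = real C * (real (h + 1) * real (r ^ h))" unfolding of_nat_mult ..
    also have "\<dots> \<le> real C * (((2 + 1 / ln 2) * (1 + ln (real n))) * (real d powr \<tau> * real n powr \<tau>))"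
      using h1 r1 ln0 l2 by (intro mult_left_mono mult_mono) auto
    also have "\<dots> = K * real n powr \<tau> * (1 + ln (real n)) ^ 1" unfolding K_def by (simp add: ac_simps)
    finally show ?thesis using ex by blast
  qed
  show ?thesis unfolding bool_matmul_def
    by (rule exI[of _ multiply], rule exI[of _ "a * 64"], rule exI[of _ K], rule exI[of _ 1], intro allI impI) (rule main)
qed

text \<open>A constant in the bound on r would enter the time with exponent h. Therefore d is taken
  so large that 2 K \<le> d^e, where e is the gap between \<tau> and \<omega> + \<delta>; the factor
  2 counts the two products per instruction.\<close>

lemma bool_matmul_near_omega:
  assumes \<delta>: "0 < \<delta>"
  shows "bool_matmul (\<omega> + \<delta>)"
proof -
  obtain \<tau> where \<tau>: "\<tau> \<in> exponents" "\<tau> < \<omega> + \<delta>" using exponent_near_omega[OF \<delta>] by blast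
  obtain K where K: "\<And>n. 1 \<le> n \<Longrightarrow> \<exists>prog out. slp_multiplies n prog out \<and> real (length prog) \<le> K * real n powr \<tau>"
    using \<tau>(1) unfolding exponents_def by blast
  define e where "e = \<omega> + \<delta> - \<tau>"
  have e: "0 < e" using \<tau>(2) unfolding e_def by simp
  define M where "M = max (2 * K) 1"
  define d where "d = max 2 (nat \<lceil>M powr (1 / e)\<rceil>)"
  have d: "2 \<le> d" "M powr (1 / e) \<le> real d" unfolding d_def by (simp, linarith)
  have "M = (M powr (1 / e)) powr e" using e unfolding M_def by (simp add: powr_powr)
  also have "\<dots> \<le> real d powr e" using d(2) e by (intro powr_mono2) auto
  finally have Md: "2 * K \<le> real d powr e" unfolding M_def by simp
  obtain p out where p: "slp_multiplies d p out" "real (length p) \<le> K * real d powr \<tau>" using K[of d] d by auto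
  obtain \<alpha> \<beta> \<gamma> D where D: "0 < D" and bil: "\<And>(A :: nat \<Rightarrow> nat \<Rightarrow> int) B i j. i < d \<Longrightarrow> j < d \<Longrightarrow>
      (\<Sum>l<2 * length p. \<gamma> (i * d + j) l * ((\<Sum>z<d * d. \<alpha> l z * A (z div d) (z mod d)) * (\<Sum>z<d * d. \<beta> l z * B (z div d) (z mod d)))) =
      D * mat_prod d A B i j"
    using slp_integer_bilinear[OF p(1)] by blast
  \<comment> \<open>Products of weight 0 raise the number to at least d^2; it stays below
    d^(\<omega> + \<delta>) because \<omega> \<ge> 2.\<close>
  define r where "r = max (2 * length p) (d * d)"
  define \<gamma>' where "\<gamma>' z l = (if l < 2 * length p then \<gamma> z l else 0)" for z l
  have "2 * real (length p) \<le> (2 * K) * real d powr \<tau>" using p(2) by simp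
  also have "\<dots> \<le> real d powr e * real d powr \<tau>" using Md by (rule mult_right_mono) simp
  also have "\<dots> = real d powr (\<omega> + \<delta>)" unfolding powr_add[symmetric] e_def by simp
  finally have r1: "real (2 * length p) \<le> real d powr (\<omega> + \<delta>)" by (simp add: of_nat_mult)
  have "real (d * d) = real d powr 2" using d(1) by (simp add: of_nat_mult powr_numeral power2_eq_square)
  also have "\<dots> \<le> real d powr (\<omega> + \<delta>)" using d(1) omega_bounds(1) \<delta> by (intro powr_mono) auto
  finally have rt: "real r \<le> real d powr (\<omega> + \<delta>)" using r1 unfolding r_def by (simp add: max_def)
  interpret bilinear_algorithm d r \<alpha> \<beta> \<gamma>' D
  proof
    show "2 \<le> d" "0 < D" "d * d \<le> r" using d D unfolding r_def by auto
    fix A B :: "nat \<Rightarrow> nat \<Rightarrow> int" and i j assume ij: "i < d" "j < d"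
    have "(\<Sum>l<r. \<gamma>' (i * d + j) l * ((\<Sum>z<d * d. \<alpha> l z * A (z div d) (z mod d)) * (\<Sum>z<d * d. \<beta> l z * B (z div d) (z mod d)))) =
      (\<Sum>l<2 * length p. \<gamma> (i * d + j) l * ((\<Sum>z<d * d. \<alpha> l z * A (z div d) (z mod d)) * (\<Sum>z<d * d. \<beta> l z * B (z div d) (z mod d))))"
      by (rule sum.mono_neutral_cong_right) (auto simp: \<gamma>'_def r_def)
    then show "(\<Sum>l<r. \<gamma>' (i * d + j) l * ((\<Sum>z<d * d. \<alpha> l z * A (z div d) (z mod d)) * (\<Sum>z<d * d. \<beta> l z * B (z div d) (z mod d)))) =
      D * mat_prod d A B i j" unfolding bil[OF ij] .
  qed
  show ?thesis using bool_matmul_bilinear[OF rt] omega_bounds(1) \<delta> by simp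
qed

theorem theorem9:
  "(\<forall>\<delta>>0. approx_min_plus_in_soft_O (\<lambda>n \<epsilon>. real n powr ((\<omega> + 3) / 2 + \<delta>) * \<epsilon> powr (-1))) \<and>
   (matmul_in_soft_O \<omega> \<longrightarrow>
      approx_min_plus_in_soft_O (\<lambda>n \<epsilon>. real n powr ((\<omega> + 3) / 2) * \<epsilon> powr (-1)))"
proof (intro conjI allI impI)
  fix \<delta> :: real assume \<delta>: "0 < \<delta>"
  show "approx_min_plus_in_soft_O (\<lambda>n \<epsilon>. real n powr ((\<omega> + 3) / 2 + \<delta>) * \<epsilon> powr (-1))"
  \<comment> \<open>The infimum \<omega> need not be attained, so the product is taken at exponent
    \<omega> + \<delta>. Only half of this \<delta> enters (\<tau> + 3) / 2, while the bound \<tau>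
    itself uses \<omega> \<le> 3.\<close>
  proof (rule approx_from_bool_matmul[OF bool_matmul_near_omega[OF \<delta>]])
    show "2 \<le> \<omega> + \<delta>" using \<delta> omega_bounds by linarith
    show "\<omega> + \<delta> \<le> (\<omega> + 3) / 2 + \<delta>" using omega_bounds by (simp add: field_simps)
    show "(\<omega> + \<delta> + 3) / 2 \<le> (\<omega> + 3) / 2 + \<delta>" using \<delta> by (simp add: add_divide_distrib)
  qed
next
  assume "matmul_in_soft_O \<omega>"
  then show "approx_min_plus_in_soft_O (\<lambda>n \<epsilon>. real n powr ((\<omega> + 3) / 2) * \<epsilon> powr (-1))"
  proof (rule approx_from_bool_matmul[OF matmul_bool_matmul])
    show "\<omega> \<le> (\<omega> + 3) / 2" using omega_bounds by (simp add: field_simps)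
  qed (use omega_bounds in simp_all)
qed

end
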